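(* Let $\mathcal{I}$ be the finite set of isomorphism classes of complete genus $2$ interval exchanges, viewed as a directed graph with an edge from $\tau$ to $\tau'$ whenever $\tau\searrow\tau'$, and write $\sigma\searrow\!\!\!\searrow\tau$ if there is a directed path from $\sigma$ to $\tau$. Let $$\mathcal{I}_S=\{\tau\in\mathcal{I} : \sigma\searrow\!\!\!\searrow\tau\text{ for every }\sigma\in\mathcal{I}\}$$ be the sink of $\mathcal{I}$, and let $X_S=\coprod_{\tau\in\mathcal{I}_S}\mathcal{ML}(\tau,\mathbb{R})$, with the Lebesgue measure on each $\mathcal{ML}(\tau,\mathbb{R})$. Then the exchange $\tau_0=\frac{1\,2\,3\,4\,2\,3\,4}{5\,6\,7\,5\,6\,7\,1}$ lies in $\mathcal{I}_S$ (in particular $\mathcal{I}_S\neq\emptyset$), and the splitting transformation on $X_S$ is normal: for every finite splitting sequence $\sigma_1\searrow\sigma_2\searrow\cdots\searrow\sigma_n$ contained in $\mathcal{I}_S$, for almost every $(\tau,w)\in X_S$ the sequence $\sigma_1,\dots,\sigma_n$ occurs infinitely often (as a block of consecutive terms) in the splitting sequence of $(\tau,w)$.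
   Context: An (abstract) interval exchange $\tau$ consists of a thickened base interval (horizontal, with a left and a right end) with finitely many bands attached along disjoint subintervals of its top and bottom sides so that the resulting surface with boundary is orientable. Combinatorially it is a pair of words, written $\frac{\text{top word}}{\text{bottom word}}$, listing from left to right the bands attached on the top and on the bottom; every band label occurs exactly twice in total. A band is orientation preserving if it joins top to bottom, and orientation reversing if both ends are on the same side. Isomorphism means equality up to relabelling bands and, possibly, interchanging top and bottom (left and right are preserved). $\mathcal{ML}(\tau,\mathbb{R})$ is the space of weights: assignments of a real $w_e\ge0$ to every band $e$ such that the total weight attached along the top (counted with multiplicity) equals that along the bottom. $\tau$ is recurrent if some $w\in\mathcal{ML}(\tau,\mathbb{R})$ has all $w_e>0$. The complementary regions of $\tau$ correspond to the boundary components of the banded surface; their ideal vertices are the gaps between adjacent band ends on the top or on the bottom (the left and right ends of the base interval are smooth and give no ideal vertex). $\tau$ is complete if it is recurrent and every complementary region is an ideal triangle (exactly three ideal vertices); it is genus $2$ if capping each boundary component with a disc gives a closed genus $2$ surface. Such $\tau$ has $7$ bands, and $\mathcal{ML}(\tau,\mathbb{R})$ is a $6$-dimensional cone, given Lebesgue measure. Splitting: let $t$ and $b$ be the rightmost bands on the top and bottom. If $w_t>w_b$, then $(\tau,w)$ splits to $(\tau',w')$, where the critical end of $b$ (the last letter of the bottom word) is removed and reinserted adjacent to the other (non-critical) end of $t$: immediately to its right if $t$ is orientation preserving, immediately to its left if $t$ is orientation reversing; $w'_t=w_t-w_b$ and all other weights are unchanged. If $w_b>w_t$ one does the same with the roles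 of top and bottom exchanged. If $w_t=w_b$ then the bands are amalgamated and the result is not complete. Write $\tau\searrow\tau'$ if $(\tau,w)$ splits to $(\tau',w')$ for some $w$. The splitting transformation sends $(\tau,w)$ to $(\tau',w')$; it is defined after deleting the measure-zero set of $(\tau,w)$ for which the case $w_t=w_b$ occurs at some stage of repeated splitting. The splitting sequence of $(\tau,w)$ is the resulting infinite sequence $\tau=\tau_1\searrow\tau_2\searrow\cdots$ in $\mathcal{I}$. $X_S$ is closed under this transformation. *)

theory Defs
  imports "HOL-Analysis.Analysis"
begin

section \<open>Interval exchanges\<close>

text \<open>A pair consisting of the top word and the bottom word, both read from left to right.\<close>

type_synonym exchange = "nat list \<times> nat list"

definition bands :: "exchange \<Rightarrow> nat set" where
  "bands \<tau> = set (fst \<tau>) \<union> set (snd \<tau>)"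

definition interval_exchange :: "exchange \<Rightarrow> bool" where
  "interval_exchange \<tau> \<longleftrightarrow> (\<forall>e\<in>bands \<tau>. count_list (fst \<tau> @ snd \<tau>) e = 2)"

definition relabel :: "(nat \<Rightarrow> nat) \<Rightarrow> exchange \<Rightarrow> exchange" where
  "relabel f \<tau> = (map f (fst \<tau>), map f (snd \<tau>))"

definition isomorphic_exchanges :: "(exchange \<times> exchange) set" where
  "isomorphic_exchanges = {(\<tau>, \<tau>'). interval_exchange \<tau> \<and> interval_exchange \<tau>' \<and>
     (\<exists>f. inj_on f (bands \<tau>) \<and> (\<tau>' = relabel f \<tau> \<or> \<tau>' = prod.swap (relabel f \<tau>)))}"

definition iso_class :: "exchange \<Rightarrow> exchange set" where
  "iso_class \<tau> = isomorphic_exchanges `` {\<tau>}"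

text \<open>Weights are extensional functions on the bands, so that distinct elements of \<open>weights \<tau>\<close> really
  are distinct assignments of weights to the bands of \<open>\<tau>\<close>.\<close>

definition weights :: "exchange \<Rightarrow> (nat \<Rightarrow> real) set" where
  "weights \<tau> = {w \<in> bands \<tau> \<rightarrow>\<^sub>E {0..}. sum_list (map w (fst \<tau>)) = sum_list (map w (snd \<tau>))}"

definition recurrent :: "exchange \<Rightarrow> bool" where
  "recurrent \<tau> \<longleftrightarrow> (\<exists>w\<in>weights \<tau>. \<forall>e\<in>bands \<tau>. w e > 0)"


section \<open>Complementary regions and genus\<close>

text \<open>
  The thickened base interval is a disc. Going once around its boundary clockwise from the top
  left corner, one meets the band ends in the order \<open>ends \<tau>\<close>. The gap with number \<open>i\<close> is the arc
  between the end at position \<open>i\<close> and the cyclically next one. The gaps \<open>length (fst \<tau>) - 1\<close> and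
  \<open>length (ends \<tau>) - 1\<close> run around the right and the left end of the base interval, and are smooth;
  all other gaps are ideal vertices.
\<close>

definition ends :: "exchange \<Rightarrow> nat list" where
  "ends \<tau> = fst \<tau> @ rev (snd \<tau>)"

definition other_end :: "exchange \<Rightarrow> nat \<Rightarrow> nat" where
  "other_end \<tau> i = (THE j. j < length (ends \<tau>) \<and> j \<noteq> i \<and> ends \<tau> ! j = ends \<tau> ! i)"

text \<open>
  As the banded surface is orientable, the bands are untwisted: traversing gap \<open>i\<close> clockwise, one
  arrives at the near side of the end \<open>i + 1\<close> of some band, follows the side of this band, and
  leaves its other end, at position \<open>j\<close> say, along the gap \<open>j\<close>, again clockwise.
  The boundary components are thus the cycles of the following permutation of the gaps.
\<close>

definition next_gap :: "exchange \<Rightarrow> nat \<Rightarrow> nat" where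
  "next_gap \<tau> i = other_end \<tau> (Suc i mod length (ends \<tau>))"

text \<open>Each complementary region is given by the set of gaps on its boundary. (The exchange without
  any bands, whose boundary component contains no gap, is of no interest here.)\<close>

definition complementary_regions :: "exchange \<Rightarrow> nat set set" where
  "complementary_regions \<tau> =
     (\<lambda>i. range (\<lambda>k. (next_gap \<tau> ^^ k) i)) ` {..<length (ends \<tau>)}"

definition ideal_vertices :: "exchange \<Rightarrow> nat set \<Rightarrow> nat set" where
  "ideal_vertices \<tau> R = {i\<in>R. Suc i \<noteq> length (fst \<tau>) \<and> Suc i \<noteq> length (ends \<tau>)}"

definition complete_exchange :: "exchange \<Rightarrow> bool" where
  "complete_exchange \<tau> \<longleftrightarrow> interval_exchange \<tau> \<and> recurrent \<tau> \<and>
     (\<forall>R\<in>complementary_regions \<tau>. card (ideal_vertices \<tau> R) = 3)"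

text \<open>The banded surface is connected, and has Euler characteristic \<open>1\<close> minus the number of bands;
  each disc that is glued in adds \<open>1\<close>.\<close>

definition capped_euler_char :: "exchange \<Rightarrow> int" where
  "capped_euler_char \<tau> = 1 - int (card (bands \<tau>)) + int (card (complementary_regions \<tau>))"

definition has_genus :: "exchange \<Rightarrow> nat \<Rightarrow> bool" where
  "has_genus \<tau> g \<longleftrightarrow> capped_euler_char \<tau> = 2 - 2 * int g"


section \<open>Splitting\<close>

text \<open>Insertion of \<open>b\<close> immediately to the right, or left, of the first occurrence of \<open>t\<close>.\<close>

fun insert_right :: "nat \<Rightarrow> nat \<Rightarrow> nat list \<Rightarrow> nat list" where
  "insert_right t b [] = []"
| "insert_right t b (x # xs) = (if x = t then x # b # xs else x # insert_right t b xs)"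

fun insert_left :: "nat \<Rightarrow> nat \<Rightarrow> nat list \<Rightarrow> nat list" where
  "insert_left t b [] = []"
| "insert_left t b (x # xs) = (if x = t then b # x # xs else x # insert_left t b xs)"

text \<open>The case in which the rightmost top band \<open>t\<close> has the larger weight. It preserves orientation
  iff it also occurs in the bottom word. Otherwise its non-critical end is the first of the two
  occurrences of \<open>t\<close> in the top word.\<close>

definition split_top :: "exchange \<times> (nat \<Rightarrow> real) \<Rightarrow> exchange \<times> (nat \<Rightarrow> real)" where
  "split_top = (\<lambda>((T, B), w). let t = last T; b = last B in
     (if t \<in> set B then (T, insert_right t b (butlast B))
      else (insert_left t b T, butlast B),
      w(t := w t - w b)))"

text \<open>The value \<open>None\<close> stands for the case of equal weights, where the bands are amalgamated.\<close>

definition split_step :: "exchange \<times> (nat \<Rightarrow> real) \<Rightarrow> (exchange \<times> (nat \<Rightarrow> real)) option" where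
  "split_step = (\<lambda>((T, B), w).
     if w (last T) > w (last B) then Some (split_top ((T, B), w))
     else if w (last B) > w (last T) then Some (apfst prod.swap (split_top ((B, T), w)))
     else None)"

text \<open>The splitting sequence (numbered from \<open>0\<close>); it is \<open>None\<close> after a case of equal weights.\<close>

definition splitting_sequence :: "exchange \<Rightarrow> (nat \<Rightarrow> real) \<Rightarrow> nat \<Rightarrow> exchange set option" where
  "splitting_sequence \<tau> w k =
     map_option (iso_class \<circ> fst) (((\<lambda>s. Option.bind s split_step) ^^ k) (Some (\<tau>, w)))"


section \<open>The graph of complete genus 2 exchanges and its sink\<close>

definition genus2_classes :: "exchange set set" where
  "genus2_classes = {\<tau>. complete_exchange \<tau> \<and> has_genus \<tau> 2} // isomorphic_exchanges"

definition splits_to :: "exchange set \<Rightarrow> exchange set \<Rightarrow> bool" where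
  "splits_to C C' \<longleftrightarrow> (\<exists>\<tau>\<in>C. \<exists>w\<in>weights \<tau>. \<exists>\<tau>'\<in>C'. \<exists>w'. split_step (\<tau>, w) = Some (\<tau>', w'))"

definition splitting_graph :: "(exchange set \<times> exchange set) set" where
  "splitting_graph = {(C, C'). C \<in> genus2_classes \<and> C' \<in> genus2_classes \<and> splits_to C C'}"

definition genus2_sink :: "exchange set set" where
  "genus2_sink = {C \<in> genus2_classes. \<forall>D\<in>genus2_classes. (D, C) \<in> splitting_graph\<^sup>*}"


section \<open>Lebesgue measure on the spaces of weights\<close>

text \<open>
  The equation defining \<open>weights \<tau>\<close> reads \<open>(\<Sum>e\<in>bands \<tau>. defect \<tau> e * w e) = 0\<close>. If some defect is
  nonzero (as for complete genus 2 exchanges, with 7 bands), \<open>weights \<tau>\<close> is a cone in the hyperplane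
  orthogonal to \<open>unit_normal \<tau>\<close>. The Lebesgue measure of a subset \<open>A\<close> of this hyperplane, with
  its Euclidean structure, is the Lebesgue measure of the slab \<open>A + [0, 1] \<cdot> unit_normal \<tau>\<close> in
  the space of all functions on the bands, i.e. Lebesgue measure on the hyperplane is the image of
  Lebesgue measure on the slab of thickness \<open>1\<close> under orthogonal projection. (If all defects
  vanish, the hyperplane, the slab and the whole space coincide and the projection is the identity.)
\<close>

definition defect :: "exchange \<Rightarrow> nat \<Rightarrow> real" where
  "defect \<tau> e = real (count_list (fst \<tau>) e) - real (count_list (snd \<tau>) e)"

definition unit_normal :: "exchange \<Rightarrow> nat \<Rightarrow> real" where
  "unit_normal \<tau> e = defect \<tau> e / sqrt (\<Sum>d\<in>bands \<tau>. (defect \<tau> d)\<^sup>2)"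

definition height :: "exchange \<Rightarrow> (nat \<Rightarrow> real) \<Rightarrow> real" where
  "height \<tau> v = (\<Sum>e\<in>bands \<tau>. unit_normal \<tau> e * v e)"

definition hyperplane_proj :: "exchange \<Rightarrow> (nat \<Rightarrow> real) \<Rightarrow> (nat \<Rightarrow> real)" where
  "hyperplane_proj \<tau> v = (\<lambda>e\<in>bands \<tau>. v e - height \<tau> v * unit_normal \<tau> e)"

definition lebesgue_hyperplane :: "exchange \<Rightarrow> (nat \<Rightarrow> real) measure" where
  "lebesgue_hyperplane \<tau> =
     distr (restrict_space (\<Pi>\<^sub>M e\<in>bands \<tau>. lborel) {v. 0 \<le> height \<tau> v \<and> height \<tau> v \<le> 1})
       (\<Pi>\<^sub>M e\<in>bands \<tau>. lborel) (hyperplane_proj \<tau>)"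

definition lebesgue_weights :: "exchange \<Rightarrow> (nat \<Rightarrow> real) measure" where
  "lebesgue_weights \<tau> = restrict_space (lebesgue_hyperplane \<tau>) (weights \<tau>)"

lemma finite_bands [simp]: "finite (bands \<tau>)"
  by (simp add: bands_def)

lemma measurable_height [measurable]:
  "height \<tau> \<in> borel_measurable (\<Pi>\<^sub>M e\<in>bands \<tau>. lborel)"
  unfolding height_def by measurable

lemma measurable_hyperplane_proj [measurable]:
  "hyperplane_proj \<tau> \<in> (\<Pi>\<^sub>M e\<in>bands \<tau>. lborel) \<rightarrow>\<^sub>M (\<Pi>\<^sub>M e\<in>bands \<tau>. lborel)"
  unfolding hyperplane_proj_def by measurable

lemma emeasure_lebesgue_hyperplane:
  assumes "A \<in> sets (\<Pi>\<^sub>M e\<in>bands \<tau>. lborel)"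
  shows "emeasure (lebesgue_hyperplane \<tau>) A = emeasure (\<Pi>\<^sub>M e\<in>bands \<tau>. lborel)
     {v \<in> space (\<Pi>\<^sub>M e\<in>bands \<tau>. lborel). 0 \<le> height \<tau> v \<and> height \<tau> v \<le> 1 \<and> hyperplane_proj \<tau> v \<in> A}"
proof -
  let ?L = "\<Pi>\<^sub>M e\<in>bands \<tau>. (lborel :: real measure)"
  let ?S = "{v. 0 \<le> height \<tau> v \<and> height \<tau> v \<le> 1}"
  have S: "?S \<inter> space ?L \<in> sets ?L"
  proof -
    have "{v \<in> space ?L. 0 \<le> height \<tau> v \<and> height \<tau> v \<le> 1} \<in> sets ?L"
      by measurable
    moreover have "{v \<in> space ?L. 0 \<le> height \<tau> v \<and> height \<tau> v \<le> 1} = ?S \<inter> space ?L"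
      by blast
    ultimately show ?thesis
      by metis
  qed
  have m: "hyperplane_proj \<tau> \<in> restrict_space ?L ?S \<rightarrow>\<^sub>M ?L"
    by (intro measurable_restrict_space1) measurable
  have "emeasure (lebesgue_hyperplane \<tau>) A =
      emeasure (restrict_space ?L ?S) (hyperplane_proj \<tau> -` A \<inter> space (restrict_space ?L ?S))"
    unfolding lebesgue_hyperplane_def using m assms by (rule emeasure_distr)
  also have "\<dots> = emeasure ?L (hyperplane_proj \<tau> -` A \<inter> space (restrict_space ?L ?S))"
    using S by (intro emeasure_restrict_space) (auto simp: space_restrict_space)
  also have "hyperplane_proj \<tau> -` A \<inter> space (restrict_space ?L ?S) =
      {v \<in> space ?L. 0 \<le> height \<tau> v \<and> height \<tau> v \<le> 1 \<and> hyperplane_proj \<tau> v \<in> A}"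
    by (auto simp: space_restrict_space)
  finally show ?thesis .
qed

lemma space_lebesgue_weights: "space (lebesgue_weights \<tau>) = weights \<tau>"
  by (auto simp: lebesgue_weights_def lebesgue_hyperplane_def space_restrict_space space_PiM
      weights_def PiE_def)


section \<open>The measure on a disjoint union\<close>

definition coproduct_measure :: "'i set \<Rightarrow> ('i \<Rightarrow> 'a measure) \<Rightarrow> ('i \<times> 'a) measure" where
  "coproduct_measure I M = measure_of (SIGMA i:I. space (M i))
     {A. A \<subseteq> (SIGMA i:I. space (M i)) \<and> (\<forall>i\<in>I. Pair i -` A \<in> sets (M i))}
     (\<lambda>A. \<integral>\<^sup>+ i. emeasure (M i) (Pair i -` A) \<partial>count_space I)"

lemma sigma_algebra_coproduct:
  "sigma_algebra (SIGMA i:I. space (M i))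
     {A. A \<subseteq> (SIGMA i:I. space (M i)) \<and> (\<forall>i\<in>I. Pair i -` A \<in> sets (M i))}"
proof (rule sigma_algebra_iff2[THEN iffD2], intro conjI ballI allI impI, goal_cases)
  case (3 A)
  have "Pair i -` ((SIGMA i:I. space (M i)) - A) = space (M i) - Pair i -` A" if "i \<in> I" for i
    using that by auto
  with 3 show ?case by auto
next
  case (4 A)
  have "Pair i -` (\<Union>n. A n) = (\<Union>n. Pair i -` A n)" for i
    by auto
  with 4 show ?case by auto
qed auto

lemma space_coproduct_measure: "space (coproduct_measure I M) = (SIGMA i:I. space (M i))"
  unfolding coproduct_measure_def by (rule space_measure_of) auto

lemma sets_coproduct_measure: "sets (coproduct_measure I M) =
    {A. A \<subseteq> (SIGMA i:I. space (M i)) \<and> (\<forall>i\<in>I. Pair i -` A \<in> sets (M i))}"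
  unfolding coproduct_measure_def
  by (rule sigma_algebra.sets_measure_of_eq[OF sigma_algebra_coproduct])

lemma emeasure_coproduct_measure:
  assumes "A \<in> sets (coproduct_measure I M)"
  shows "emeasure (coproduct_measure I M) A = (\<integral>\<^sup>+ i. emeasure (M i) (Pair i -` A) \<partial>count_space I)"
proof (rule emeasure_measure_of[OF coproduct_measure_def])
  show "countably_additive (sets (coproduct_measure I M))
     (\<lambda>A. \<integral>\<^sup>+ i. emeasure (M i) (Pair i -` A) \<partial>count_space I)"
    unfolding countably_additive_def
  proof (intro allI impI)
    fix A :: "nat \<Rightarrow> ('a \<times> 'b) set"
    assume A: "range A \<subseteq> sets (coproduct_measure I M)" "disjoint_family A"
    have "(\<Sum>n. \<integral>\<^sup>+ i. emeasure (M i) (Pair i -` A n) \<partial>count_space I) =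
        (\<integral>\<^sup>+ i. (\<Sum>n. emeasure (M i) (Pair i -` A n)) \<partial>count_space I)"
      by (rule nn_integral_suminf[symmetric]) simp
    also have "\<dots> = (\<integral>\<^sup>+ i. emeasure (M i) (Pair i -` (\<Union>n. A n)) \<partial>count_space I)"
    proof (rule nn_integral_cong)
      fix i assume i: "i \<in> space (count_space I)"
      have "(\<Sum>n. emeasure (M i) (Pair i -` A n)) = emeasure (M i) (\<Union>n. Pair i -` A n)"
      proof (rule suminf_emeasure)
        show "range (\<lambda>n. Pair i -` A n) \<subseteq> sets (M i)"
          using A(1) i by (auto simp: sets_coproduct_measure)
        show "disjoint_family (\<lambda>n. Pair i -` A n)"
          using A(2) unfolding disjoint_family_on_def by blast
      qed
      also have "(\<Union>n. Pair i -` A n) = Pair i -` (\<Union>n. A n)"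
        by auto
      finally show "(\<Sum>n. emeasure (M i) (Pair i -` A n)) = emeasure (M i) (Pair i -` (\<Union>n. A n))" .
    qed
    finally show "(\<Sum>n. \<integral>\<^sup>+ i. emeasure (M i) (Pair i -` A n) \<partial>count_space I) =
        (\<integral>\<^sup>+ i. emeasure (M i) (Pair i -` (\<Union>n. A n)) \<partial>count_space I)" .
  qed
qed (use assms in \<open>auto simp: positive_def\<close>)

lemma AE_coproduct_measure:
  "(AE x in coproduct_measure I M. P x) \<longleftrightarrow> (\<forall>i\<in>I. AE y in M i. P (i, y))"
proof safe
  fix i assume "AE x in coproduct_measure I M. P x" and i: "i \<in> I"
  from this(1) obtain N where N: "{x \<in> space (coproduct_measure I M). \<not> P x} \<subseteq> N"
    "emeasure (coproduct_measure I M) N = 0" "N \<in> sets (coproduct_measure I M)"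
    by (rule AE_E)
  have "(\<integral>\<^sup>+ i. emeasure (M i) (Pair i -` N) \<partial>count_space I) = 0"
    using N(2) emeasure_coproduct_measure[OF N(3)] by simp
  then have "emeasure (M i) (Pair i -` N) = 0"
    using i by (subst (asm) nn_integral_0_iff_AE) (auto simp: AE_count_space)
  moreover have "Pair i -` N \<in> sets (M i)"
    using N(3) i by (auto simp: sets_coproduct_measure)
  moreover have "{y \<in> space (M i). \<not> P (i, y)} \<subseteq> Pair i -` N"
    using N(1) i by (auto simp: space_coproduct_measure)
  ultimately show "AE y in M i. P (i, y)"
    by (intro AE_I)
next
  assume "\<forall>i\<in>I. AE y in M i. P (i, y)"
  then have "\<forall>i\<in>I. \<exists>N. {y \<in> space (M i). \<not> P (i, y)} \<subseteq> N \<and> emeasure (M i) N = 0 \<and> N \<in> sets (M i)"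
    by (auto elim!: AE_E)
  then obtain N where N: "\<And>i. i \<in> I \<Longrightarrow> {y \<in> space (M i). \<not> P (i, y)} \<subseteq> N i"
    "\<And>i. i \<in> I \<Longrightarrow> emeasure (M i) (N i) = 0" "\<And>i. i \<in> I \<Longrightarrow> N i \<in> sets (M i)"
    by metis
  have slice: "Pair i -` (SIGMA i:I. N i) = N i" if "i \<in> I" for i
    using that by auto
  have meas: "(SIGMA i:I. N i) \<in> sets (coproduct_measure I M)"
    using N(3) sets.sets_into_space by (fastforce simp: sets_coproduct_measure slice)
  show "AE x in coproduct_measure I M. P x"
  proof (rule AE_I)
    show "{x \<in> space (coproduct_measure I M). \<not> P x} \<subseteq> (SIGMA i:I. N i)"
      using N(1) by (auto simp: space_coproduct_measure)
    have "(\<integral>\<^sup>+ i. emeasure (M i) (Pair i -` (SIGMA i:I. N i)) \<partial>count_space I) =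
        (\<integral>\<^sup>+ i. 0 \<partial>count_space I)"
      by (intro nn_integral_cong) (simp add: slice N(2))
    then show "emeasure (coproduct_measure I M) (SIGMA i:I. N i) = 0"
      using emeasure_coproduct_measure[OF meas] by simp
  qed (rule meas)
qed

text \<open>The argument \<open>rep\<close> chooses an exchange from each isomorphism class, so that the points of
  \<open>X_S\<close> are the pairs \<open>(C, w)\<close> with \<open>C\<close> in the sink and \<open>w \<in> weights (rep C)\<close>. Different choices lead to
  canonically isomorphic measure spaces up to automorphisms of exchanges, which do not affect the
  splitting sequences in the set of isomorphism classes.\<close>

definition X_S :: "(exchange set \<Rightarrow> exchange) \<Rightarrow> (exchange set \<times> (nat \<Rightarrow> real)) measure" where
  "X_S rep = coproduct_measure genus2_sink (\<lambda>C. lebesgue_weights (rep C))"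

end

theory Submission
  imports Defs
begin

text \<open>
  Normality is proved by an argument in the style of Kerckhoff. A functional \<open>c\<close> with positive
  coefficients on the bands cuts off a region \<open>{w. c \<cdot> w \<le> 1}\<close> of the cone of weights, and splitting
  divides it into the regions of the successors, where the functional is obtained from \<open>c\<close> by adding the
  coefficient of the winner to that of the loser. The volume of a region is, up to a constant factor, an
  explicit expression in \<open>c\<close>. Call \<open>c\<close> balanced if its coefficients are comparable (in the sense of
  \<open>hat\<close>, which accounts for the bands that cannot have positive weight alone). Any finite path can be
  followed on a definite proportion of the volume if \<open>c\<close> is balanced. In general the volume
  estimates show that, on a definite proportion of the weights, some small coefficient becomes large
  before the large ones have grown by more than a constant factor, because every band takes
  part in some comparison along a suitable path; so, inductively, \<open>c\<close> becomes balanced on a definite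
  proportion. The volume of the set of weights whose sequence never meets a given block is thus at most
  \<open>1 - \<theta>\<close> times that of the region, and by iteration it vanishes.

  What remains to be known about genus 2 is that \<open>base_exchange\<close> can be reached from every complete
  exchange, and that all bands are compared along some path from it. Complete genus 2
  exchanges are enumerated by gluing the \<open>14\<close> band ends in pairs, where chains of gaps on a common
  complementary region with more than three ideal vertices are excluded.
\<close>

section \<open>Moves\<close>

text \<open>The obstacle is that the balance equation makes the cone of weights non-simplicial: its
  extreme rays are the single bands with one end on each side, and the pairs of a top-top band and a
  bottom-bottom band. A volume is therefore not just the reciprocal of a product of coefficients,
  and a loose band with a tiny coefficient can still be expensive because all of its possible
  partners are. Sizes are measured by \<open>hat\<close> for this reason, and volumes are known only
  through \<open>hat_vol\<close>, up to a factor depending on the number of bands. Each comparison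
  of two volumes costs this factor twice; the argument makes two such comparisons, which accounts
  for the fourth power in \<open>growth\<close>. No probability space of splitting sequences is
  built. A constant \<open>a\<close> with \<psi> \<le> a * volume plays the role of the probability
  of avoiding the block, and a better constant at the states to be reached is averaged over the
  successors, one move at a time.\<close>

text \<open>A move is a splitting without weights; the argument \<open>True\<close> says that the top band wins.\<close>

definition side :: "bool \<Rightarrow> exchange \<Rightarrow> nat set" where
  "side s \<tau> = (if s then set (fst \<tau>) - set (snd \<tau>) else set (snd \<tau>) - set (fst \<tau>))"

definition win :: "bool \<Rightarrow> exchange \<Rightarrow> nat" where
  "win s \<tau> = last (if s then fst \<tau> else snd \<tau>)"

abbreviation lose :: "bool \<Rightarrow> exchange \<Rightarrow> nat" where
  "lose s \<tau> \<equiv> win (\<not> s) \<tau>"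

definition move_top :: "exchange \<Rightarrow> exchange" where
  "move_top \<tau> = (if last (fst \<tau>) \<in> set (snd \<tau>)
     then (fst \<tau>, insert_right (last (fst \<tau>)) (last (snd \<tau>)) (butlast (snd \<tau>)))
     else (insert_left (last (fst \<tau>)) (last (snd \<tau>)) (fst \<tau>), butlast (snd \<tau>)))"

definition move :: "bool \<Rightarrow> exchange \<Rightarrow> exchange" where
  "move s \<tau> = (if s then move_top \<tau> else prod.swap (move_top (prod.swap \<tau>)))"

definition split_weight :: "bool \<Rightarrow> exchange \<Rightarrow> (nat \<Rightarrow> real) \<Rightarrow> nat \<Rightarrow> real" where
  "split_weight s \<tau> w = w(win s \<tau> := w (win s \<tau>) - w (lose s \<tau>))"

text \<open>The last conjunct excludes the case in which the two competing bands are the only loose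
  ones. By balance they would then have equal weights throughout the cone, so that no split could
  occur. It also provides a third loose band whose coordinate can be eliminated when volumes are
  computed.\<close>

definition unequal_ends :: "exchange \<Rightarrow> bool" where
  "unequal_ends \<tau> \<longleftrightarrow> interval_exchange \<tau> \<and> side True \<tau> \<noteq> {} \<and> side False \<tau> \<noteq> {} \<and>
     win True \<tau> \<noteq> win False \<tau> \<and> \<not> (side True \<tau> = {win True \<tau>} \<and> side False \<tau> = {win False \<tau>})"

text \<open>In the excluded situation the loser alone has to balance all loose bands on the winner's
  side, the winner among them, and so it cannot be the lighter one. By
  \<open>feasible_if_greater\<close> and \<open>feasible_obtain\<close> this is the only
  restriction.\<close>

definition feasible :: "bool \<Rightarrow> exchange \<Rightarrow> bool" where
  "feasible s \<tau> \<longleftrightarrow> \<not> (win s \<tau> \<in> side s \<tau> \<and> side (\<not> s) \<tau> = {lose s \<tau>})"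

lemma swap_simps [simp]:
  "side s (prod.swap \<tau>) = side (\<not> s) \<tau>" "win s (prod.swap \<tau>) = win (\<not> s) \<tau>"
  "move s (prod.swap \<tau>) = prod.swap (move (\<not> s) \<tau>)" "bands (prod.swap \<tau>) = bands \<tau>"
  "split_weight s (prod.swap \<tau>) = split_weight (\<not> s) \<tau>"
  "feasible s (prod.swap \<tau>) = feasible (\<not> s) \<tau>"
  "defect (prod.swap \<tau>) e = - defect \<tau> e"
  by (auto simp: side_def win_def move_def bands_def split_weight_def fun_eq_iff feasible_def defect_def)

lemma interval_exchange_swap [simp]: "interval_exchange (prod.swap \<tau>) = interval_exchange \<tau>"
  by (simp add: interval_exchange_def bands_def add.commute Un_commute)

lemma unequal_ends_swap [simp]: "unequal_ends (prod.swap \<tau>) = unequal_ends \<tau>"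
  by (auto simp: unequal_ends_def)

lemma weights_swap [simp]: "weights (prod.swap \<tau>) = weights \<tau>"
  by (auto simp: weights_def)

lemma side_disjoint: "side True \<tau> \<inter> side False \<tau> = {}" "e \<in> side s \<tau> \<Longrightarrow> e \<notin> side (\<not> s) \<tau>"
  by (auto simp: side_def split: if_splits)

lemma side_subset: "side s \<tau> \<subseteq> bands \<tau>"
  by (auto simp: side_def bands_def)

lemma finite_side [simp]: "finite (side s \<tau>)"
  by (rule finite_subset[OF side_subset]) simp

section \<open>Effect of a move on the words and on the loose bands\<close>

lemma set_insert_right: "t \<in> set xs \<Longrightarrow> set (insert_right t b xs) = insert b (set xs)"
  by (induction xs) auto

lemma set_insert_left: "t \<in> set xs \<Longrightarrow> set (insert_left t b xs) = insert b (set xs)"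
  by (induction xs) auto

lemma mset_insert_right: "t \<in> set xs \<Longrightarrow> mset (insert_right t b xs) = add_mset b (mset xs)"
  by (induction xs) auto

lemma mset_insert_left: "t \<in> set xs \<Longrightarrow> mset (insert_left t b xs) = add_mset b (mset xs)"
  by (induction xs) auto

lemma last_insert_left: "xs \<noteq> [] \<Longrightarrow> last (insert_left t b xs) = last xs"
proof (induction xs)
  case (Cons x xs)
  then show ?case by (cases xs) auto
qed simp

lemma butlast_last_append: "xs \<noteq> [] \<Longrightarrow> mset xs = add_mset (last xs) (mset (butlast xs))"
  by (metis add_mset_add_single append_butlast_last_id mset_append mset_single_iff_right mset.simps(1) mset.simps(2))

lemma unequal_ends_nonempty: "unequal_ends \<tau> \<Longrightarrow> fst \<tau> \<noteq> [] \<and> snd \<tau> \<noteq> []"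
  by (auto simp: unequal_ends_def side_def)

lemma win_in_bands: "unequal_ends \<tau> \<Longrightarrow> win s \<tau> \<in> bands \<tau>"
  using unequal_ends_nonempty[of \<tau>] by (auto simp: win_def bands_def)

lemma win_not_side: "unequal_ends \<tau> \<Longrightarrow> win s \<tau> \<notin> side (\<not> s) \<tau>"
  using unequal_ends_nonempty[of \<tau>] by (auto simp: win_def side_def split: if_splits)

lemma win_neq_lose: "unequal_ends \<tau> \<Longrightarrow> win s \<tau> \<noteq> lose s \<tau>"
  by (cases s) (auto simp: unequal_ends_def)

lemma in_butlast: "x \<in> set xs \<Longrightarrow> x \<noteq> last xs \<Longrightarrow> x \<in> set (butlast xs)"
  by (induction xs) auto

lemma mset_move:
  assumes "unequal_ends \<tau>"
  shows "mset (fst (move s \<tau>) @ snd (move s \<tau>)) = mset (fst \<tau> @ snd \<tau>)"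
proof -
  have top: "mset (fst (move_top \<tau>) @ snd (move_top \<tau>)) = mset (fst \<tau> @ snd \<tau>)"
    if u: "unequal_ends \<tau>" for \<tau>
  proof -
    have ne: "fst \<tau> \<noteq> []" "snd \<tau> \<noteq> []" "last (fst \<tau>) \<noteq> last (snd \<tau>)"
      using unequal_ends_nonempty[OF u] win_neq_lose[OF u, of True] by (auto simp: win_def)
    then show ?thesis
      using butlast_last_append[OF ne(2)]
      by (auto simp: move_top_def mset_insert_right mset_insert_left in_butlast)
  qed
  show ?thesis
    using top[OF assms] top[of "prod.swap \<tau>"] assms
    by (cases s) (auto simp: move_def add.commute union_commute)
qed

lemma bands_move [simp]: "unequal_ends \<tau> \<Longrightarrow> bands (move s \<tau>) = bands \<tau>"
  using arg_cong[OF mset_move, of \<tau> set_mset s] by (simp add: bands_def)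

lemma interval_exchange_move: "unequal_ends \<tau> \<Longrightarrow> interval_exchange (move s \<tau>)"
  using mset_move[of \<tau> s] bands_move[of \<tau> s]
  by (simp add: interval_exchange_def unequal_ends_def flip: count_mset del: bands_move mset_append count_list_append)

lemma count_twice:
  assumes "interval_exchange \<tau>" "e \<in> bands \<tau>"
  shows "count_list (fst \<tau>) e + count_list (snd \<tau>) e = 2"
  using assms by (auto simp: interval_exchange_def)

text \<open>If the winner has an end on each side, the end of the loser stays on the bottom and no
  side changes. If the winner is top-top, the end of the loser crosses over: a bottom-bottom band
  becomes two-sided, and a two-sided band becomes top-top.\<close>

lemma side_move_top:
  assumes u: "unequal_ends \<tau>"
  shows "side True (move_top \<tau>) = (if win True \<tau> \<in> side True \<tau> \<and> win False \<tau> \<notin> side False \<tau>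
      then insert (win False \<tau>) (side True \<tau>) else side True \<tau>)"
    and "side False (move_top \<tau>) =
      (if win True \<tau> \<in> side True \<tau> then side False \<tau> - {win False \<tau>} else side False \<tau>)"
proof -
  obtain T B where \<tau>: "\<tau> = (T, B)" by (cases \<tau>)
  define t b where "t = last T" and "b = last B"
  have ne: "T \<noteq> []" "B \<noteq> []" and tb: "t \<noteq> b"
    using unequal_ends_nonempty[OF u] win_neq_lose[OF u, of True] by (auto simp: win_def \<tau> t_def b_def)
  have tT: "t \<in> set T" and bB: "b \<in> set B"
    using ne by (auto simp: t_def b_def)
  have cb: "count_list T b + count_list B b = 2"
    using count_twice[of \<tau> b] u bB by (auto simp: unequal_ends_def bands_def \<tau>)
  have cbl: "count_list B b = count_list (butlast B) b + 1"
    using butlast_last_append[OF ne(2)] by (metis add.commute b_def count_add_mset count_mset plus_1_eq_Suc)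
  have set_but: "set B = insert b (set (butlast B))"
    using butlast_last_append[OF ne(2)] by (metis b_def set_mset_add_mset_insert set_mset_mset)
  \<comment> \<open>Of the two ends of \<open>b\<close> one is removed, and the other one decides on
    which side \<open>b\<close> remains.\<close>
  have b_but: "b \<in> set (butlast B) \<longleftrightarrow> b \<notin> set T"
    using cb cbl count_list_0_iff[of "butlast B" b] count_list_0_iff[of T b]
    by (cases "b \<in> set T"; cases "b \<in> set (butlast B)"; simp)
  have 1: "side True (move_top \<tau>) = (if t \<notin> set B \<and> b \<in> set T then insert b (set T - set B) else set T - set B)"
    "side False (move_top \<tau>) = (if t \<notin> set B then set B - set T - {b} else set B - set T)"
  proof -
    show "side True (move_top \<tau>) = (if t \<notin> set B \<and> b \<in> set T then insert b (set T - set B) else set T - set B)"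
    proof (cases "t \<in> set B")
      case True
      then have "t \<in> set (butlast B)" using tb by (simp add: b_def in_butlast)
      with True show ?thesis using set_but
        by (auto simp: move_top_def side_def \<tau> set_insert_right simp flip: t_def b_def)
    next
      case False
      then show ?thesis using set_but b_but tT
        by (auto simp: move_top_def side_def \<tau> set_insert_left simp flip: t_def b_def)
    qed
    show "side False (move_top \<tau>) = (if t \<notin> set B then set B - set T - {b} else set B - set T)"
    proof (cases "t \<in> set B")
      case True
      then have "t \<in> set (butlast B)" using tb by (simp add: b_def in_butlast)
      with True show ?thesis using set_but
        by (auto simp: move_top_def side_def \<tau> set_insert_right simp flip: t_def b_def)
    next
      case False
      then show ?thesis using set_but b_but tT
        by (auto simp: move_top_def side_def \<tau> set_insert_left simp flip: t_def b_def)
    qed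
  qed
  show "side True (move_top \<tau>) = (if win True \<tau> \<in> side True \<tau> \<and> win False \<tau> \<notin> side False \<tau>
      then insert (win False \<tau>) (side True \<tau>) else side True \<tau>)"
   and "side False (move_top \<tau>) =
      (if win True \<tau> \<in> side True \<tau> then side False \<tau> - {win False \<tau>} else side False \<tau>)"
    unfolding 1 using tT bB by (auto simp: side_def win_def \<tau> simp flip: t_def b_def)
qed

lemma side_move:
  assumes u: "unequal_ends \<tau>"
  shows "side s (move s \<tau>) = (if win s \<tau> \<in> side s \<tau> \<and> lose s \<tau> \<notin> side (\<not> s) \<tau>
      then insert (lose s \<tau>) (side s \<tau>) else side s \<tau>)"
    and "side (\<not> s) (move s \<tau>) =
      (if win s \<tau> \<in> side s \<tau> then side (\<not> s) \<tau> - {lose s \<tau>} else side (\<not> s) \<tau>)"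
  using side_move_top[OF u] side_move_top[of "prod.swap \<tau>"] u
  by (cases s; simp add: move_def)+

text \<open>The end that is moved never lands to the right of the critical end of the winner, which
  therefore goes on competing. A small winner thus stays in the competition after its move.\<close>

lemma win_move:
  assumes u: "unequal_ends \<tau>"
  shows "win s (move s \<tau>) = win s \<tau>"
proof -
  have "win True (move_top \<tau>) = win True \<tau>" if "unequal_ends \<tau>" for \<tau>
    using unequal_ends_nonempty[OF that] by (auto simp: move_top_def win_def last_insert_left)
  from this[OF u] this[of "prod.swap \<tau>"] u show ?thesis
    by (cases s) (auto simp: move_def)
qed

lemma split_step_eq:
  "split_step (\<tau>, w) = (if w (win True \<tau>) > w (win False \<tau>) then Some (move True \<tau>, split_weight True \<tau> w)
     else if w (win False \<tau>) > w (win True \<tau>) then Some (move False \<tau>, split_weight False \<tau> w) else None)"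
  by (cases \<tau>) (auto simp: split_step_def split_top_def win_def move_def move_top_def split_weight_def Let_def)

section \<open>The balance equation and the cone of weights under splitting\<close>

definition imbalance :: "exchange \<Rightarrow> (nat \<Rightarrow> real) \<Rightarrow> real" where
  "imbalance \<tau> w = sum_list (map w (fst \<tau>)) - sum_list (map w (snd \<tau>))"

lemma imbalance_swap: "imbalance (prod.swap \<tau>) w = - imbalance \<tau> w"
  by (simp add: imbalance_def)

lemma sum_list_eq_sum_count:
  fixes w :: "'a \<Rightarrow> real"
  assumes "finite A" "set xs \<subseteq> A"
  shows "sum_list (map w xs) = (\<Sum>e\<in>A. real (count_list xs e) * w e)"
  using assms(2)
proof (induction xs)
  case (Cons x xs)
  have "(\<Sum>e\<in>A. real (count_list (x # xs) e) * w e) =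
      (\<Sum>e\<in>A. (if x = e then w e else 0) + real (count_list xs e) * w e)"
    by (intro sum.cong) (auto simp: algebra_simps)
  with Cons assms(1) show ?case by (simp add: sum.distrib)
qed simp

lemma imbalance_eq: "imbalance \<tau> w = (\<Sum>e\<in>bands \<tau>. defect \<tau> e * w e)"
proof -
  have "imbalance \<tau> w = (\<Sum>e\<in>bands \<tau>. real (count_list (fst \<tau>) e) * w e) -
      (\<Sum>e\<in>bands \<tau>. real (count_list (snd \<tau>) e) * w e)"
    unfolding imbalance_def
    by (subst sum_list_eq_sum_count[of "bands \<tau>"] , simp, simp add: bands_def)+ simp
  then show ?thesis
    by (simp add: defect_def left_diff_distrib sum_subtractf)
qed

lemma defect_eq:
  assumes "interval_exchange \<tau>" "e \<in> bands \<tau>"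
  shows "defect \<tau> e = (if e \<in> side True \<tau> then 2 else if e \<in> side False \<tau> then -2 else 0)"
proof -
  have "e \<notin> set (fst \<tau>) \<longleftrightarrow> count_list (fst \<tau>) e = 0" "e \<notin> set (snd \<tau>) \<longleftrightarrow> count_list (snd \<tau>) e = 0"
    by (simp_all add: count_list_0_iff)
  with count_twice[OF assms] show ?thesis
    unfolding defect_def side_def by auto
qed

lemma sum_list_mset: "sum_list (map w xs) = (\<Sum>x\<in>#mset xs. w x)" for w :: "nat \<Rightarrow> real"
  by (induction xs) auto

text \<open>If the winner is two-sided, both totals drop by the weight of the loser. If it is
  top-top, the top loses this weight twice and regains it once, while the bottom loses it once. The
  identity concerns arbitrary functions, so whole hyperplanes correspond under splitting and not
  merely cones.\<close>

lemma imbalance_move: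
  assumes u: "unequal_ends \<tau>"
  shows "imbalance (move s \<tau>) (split_weight s \<tau> w) = imbalance \<tau> w"
proof -
  have top: "imbalance (move_top \<tau>) (split_weight True \<tau> w) = imbalance \<tau> w" if u: "unequal_ends \<tau>" for \<tau>
  proof -
    obtain T B where \<tau>: "\<tau> = (T, B)" by (cases \<tau>)
    define t b where "t = last T" and "b = last B"
    have ne: "T \<noteq> []" "B \<noteq> []" and tb: "t \<noteq> b"
      using unequal_ends_nonempty[OF u] win_neq_lose[OF u, of True] by (auto simp: win_def \<tau> t_def b_def)
    have tT: "t \<in> set T" and bB: "b \<in> set B"
      using ne by (auto simp: t_def b_def)
    define w' where "w' = split_weight True \<tau> w"
    have w': "w' = w(t := w t - w b)"
      by (simp add: w'_def split_weight_def win_def \<tau> t_def b_def)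
    have s: "sum_list (map w' xs) = sum_list (map w xs) - real (count_list xs t) * w b" for xs
      by (induction xs) (auto simp: w' algebra_simps)
    have ct: "count_list T t + count_list B t = 2"
      using count_twice[of \<tau> t] u tT by (auto simp: unequal_ends_def bands_def \<tau>)
    have but: "sum_list (map w B) = w b + sum_list (map w (butlast B))"
      using butlast_last_append[OF ne(2)] unfolding b_def sum_list_mset by simp
    have cbut: "count_list (butlast B) t = count_list B t"
      using butlast_last_append[OF ne(2)] tb by (metis b_def count_add_mset count_mset)
    have wb: "w' b = w b" using tb by (simp add: w')
    have "imbalance (move_top \<tau>) w' = imbalance \<tau> w"
    proof (cases "t \<in> set B")
      case True
      then have "t \<in> set (butlast B)" using tb by (simp add: b_def in_butlast)
      have "count_list T t = 1" "count_list B t = 1"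
        using ct True tT count_list_0_iff[of T t] count_list_0_iff[of B t] by linarith+
      moreover have "sum_list (map w' (insert_right t b (butlast B))) = w' b + sum_list (map w' (butlast B))"
        using \<open>t \<in> set (butlast B)\<close> unfolding sum_list_mset by (simp add: mset_insert_right)
      ultimately show ?thesis
        using True s[of T] s[of "butlast B"] by (simp add: imbalance_def move_top_def \<tau> but cbut wb flip: t_def b_def)
    next
      case False
      then have "count_list B t = 0" "count_list T t = 2"
        using ct count_list_0_iff[of B t] by linarith+
      moreover have "sum_list (map w' (insert_left t b T)) = w' b + sum_list (map w' T)"
        using tT unfolding sum_list_mset by (simp add: mset_insert_left)
      ultimately show ?thesis
        using False s[of T] s[of "butlast B"] by (simp add: imbalance_def move_top_def \<tau> but cbut wb flip: t_def b_def)
    qed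
    then show ?thesis by (simp add: w'_def)
  qed
  show ?thesis
    using top[OF u] top[of "prod.swap \<tau>"] u
    by (cases s) (auto simp: move_def imbalance_swap)
qed

lemma weights_iff: "w \<in> weights \<tau> \<longleftrightarrow> w \<in> bands \<tau> \<rightarrow>\<^sub>E {0..} \<and> imbalance \<tau> w = 0"
  by (auto simp: weights_def imbalance_def)

text \<open>The preimage of the cone of a successor is exactly the half cone where the winner is at
  least as heavy. Hence the two successors tile the cone and overlap only in the wall of equal
  weights.\<close>

lemma split_weight_weights_iff:
  assumes u: "unequal_ends \<tau>" and w: "w \<in> extensional (bands \<tau>)"
  shows "split_weight s \<tau> w \<in> weights (move s \<tau>) \<longleftrightarrow> w \<in> weights \<tau> \<and> w (lose s \<tau>) \<le> w (win s \<tau>)"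
proof -
  define t b where "t = win s \<tau>" and "b = lose s \<tau>"
  have tb: "t \<noteq> b" "t \<in> bands \<tau>" "b \<in> bands \<tau>"
    using win_in_bands[OF u] win_neq_lose[OF u, of s] by (auto simp: t_def b_def)
  define w' where "w' = split_weight s \<tau> w"
  have w': "w' = w(t := w t - w b)" by (simp add: w'_def split_weight_def t_def b_def)
  have "w' \<in> extensional (bands \<tau>)" using w tb by (auto simp: w' extensional_def)
  moreover have "(\<forall>e\<in>bands \<tau>. 0 \<le> w' e) \<longleftrightarrow> (\<forall>e\<in>bands \<tau>. 0 \<le> w e) \<and> w b \<le> w t"
  proof
    assume *: "\<forall>e\<in>bands \<tau>. 0 \<le> w' e"
    have "w b \<ge> 0" "w t - w b \<ge> 0" using bspec[OF *, of b] bspec[OF *, of t] tb by (auto simp: w')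
    moreover have "w e \<ge> 0" if "e \<in> bands \<tau>" "e \<noteq> t" for e using bspec[OF *, of e] that by (simp add: w')
    ultimately show "(\<forall>e\<in>bands \<tau>. 0 \<le> w e) \<and> w b \<le> w t" by force
  qed (simp add: w')
  ultimately have "w' \<in> bands \<tau> \<rightarrow>\<^sub>E {0..} \<longleftrightarrow> w \<in> bands \<tau> \<rightarrow>\<^sub>E {0..} \<and> w b \<le> w t"
    using w by (auto simp: PiE_iff)
  then show ?thesis
    by (auto simp: weights_iff imbalance_move[OF u] bands_move[OF u] w'_def t_def b_def)
qed

lemma sum_defect_zero:
  assumes "interval_exchange \<tau>"
  shows "imbalance \<tau> w = 2 * sum w (side True \<tau>) - 2 * sum w (side False \<tau>)"
proof -
  have "imbalance \<tau> w = (\<Sum>e\<in>bands \<tau>. (if e \<in> side True \<tau> then 2 * w e else 0) - (if e \<in> side False \<tau> then 2 * w e else 0))"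
    unfolding imbalance_eq by (intro sum.cong refl) (use side_disjoint(1)[of \<tau>] in \<open>auto simp: defect_eq[OF assms]\<close>)
  also have "\<dots> = 2 * sum w (side True \<tau>) - 2 * sum w (side False \<tau>)"
    by (simp add: sum_subtractf sum.If_cases Int_absorb1[OF side_subset] flip: sum_distrib_left)
  finally show ?thesis .
qed

lemma weights_side_sum:
  assumes "interval_exchange \<tau>" "w \<in> weights \<tau>"
  shows "sum w (side True \<tau>) = sum w (side False \<tau>)"
  using sum_defect_zero[OF assms(1), of w] assms(2) by (simp add: weights_iff)

lemma feasible_if_greater:
  assumes "interval_exchange \<tau>" "w \<in> weights \<tau>" "w (win s \<tau>) > w (lose s \<tau>)"
  shows "feasible s \<tau>"
proof (rule ccontr)
  assume "\<not> feasible s \<tau>"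
  then have s: "win s \<tau> \<in> side s \<tau>" "side (\<not> s) \<tau> = {lose s \<tau>}"
    by (auto simp: feasible_def)
  have "sum w (side s \<tau>) = sum w (side (\<not> s) \<tau>)"
    using weights_side_sum[OF assms(1,2)] by (cases s) auto
  then have "sum w (side s \<tau>) = w (lose s \<tau>)" using s by simp
  moreover have "w (win s \<tau>) \<le> sum w (side s \<tau>)"
    using s(1) assms(2) side_subset[of s \<tau>] by (intro member_le_sum) (auto simp: weights_def)
  ultimately show False using assms(3) by simp
qed

text \<open>An extreme ray serves as the witness: the winner alone if it is two-sided, and otherwise
  the winner together with a loose band on the other side that is not the loser.\<close>

lemma feasible_obtain:
  assumes u: "unequal_ends \<tau>" and f: "feasible s \<tau>"
  obtains w where "w \<in> weights \<tau>" "w (win s \<tau>) > w (lose s \<tau>)"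
proof -
  define t b where "t = win s \<tau>" and "b = lose s \<tau>"
  have ie: "interval_exchange \<tau>" using u by (simp add: unequal_ends_def)
  have tb: "t \<noteq> b" "t \<in> bands \<tau>" "b \<in> bands \<tau>" "t \<notin> side (\<not> s) \<tau>"
    using win_in_bands[OF u] win_neq_lose[OF u, of s] win_not_side[OF u, of s] by (auto simp: t_def b_def)
  show ?thesis
  proof (cases "t \<in> side s \<tau>")
    case False
    define w where "w = (\<lambda>e\<in>bands \<tau>. if e = t then 1 else 0 :: real)"
    have "t \<notin> side True \<tau>" "t \<notin> side False \<tau>" using False tb(4) by (cases s; auto)+
    then have "sum w (side True \<tau>) = 0" "sum w (side False \<tau>) = 0"
      using side_subset[of True \<tau>] side_subset[of False \<tau>] by (auto intro!: sum.neutral simp: w_def)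
    then have "w \<in> weights \<tau>"
      unfolding weights_iff sum_defect_zero[OF ie] by (auto simp: w_def)
    moreover have "w t > w b" using tb by (simp add: w_def)
    ultimately show ?thesis using that by (simp add: t_def b_def)
  next
    case True
    then obtain q where q: "q \<in> side (\<not> s) \<tau>" "q \<noteq> b"
    proof -
      have "side (\<not> s) \<tau> \<noteq> {}" "side (\<not> s) \<tau> \<noteq> {b}"
        using f u True by (cases s; simp add: feasible_def unequal_ends_def t_def b_def)+
      then show ?thesis using that by blast
    qed
    define w where "w = (\<lambda>e\<in>bands \<tau>. if e = t \<or> e = q then 1 else 0 :: real)"
    have "sum w (side s \<tau>) = sum w {t}"
      using True q side_disjoint(2)[of q "\<not> s" \<tau>] side_subset[of s \<tau>] by (intro sum.mono_neutral_right) (auto simp: w_def)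
    moreover have "sum w (side (\<not> s) \<tau>) = sum w {q}"
      using True q tb side_subset[of "\<not> s" \<tau>] by (intro sum.mono_neutral_right) (auto simp: w_def)
    moreover have "w t = 1" "w q = 1" using tb q side_subset[of "\<not> s" \<tau>] by (auto simp: w_def)
    ultimately have "sum w (side True \<tau>) = sum w (side False \<tau>)" by (cases s) auto
    then have "w \<in> weights \<tau>"
      unfolding weights_iff sum_defect_zero[OF ie] by (auto simp: w_def)
    moreover have "w t > w b" using tb q by (simp add: w_def)
    ultimately show ?thesis using that by (simp add: t_def b_def)
  qed
qed

fun feasible_path :: "exchange \<Rightarrow> bool list \<Rightarrow> bool" where
  "feasible_path \<tau> [] = True"
| "feasible_path \<tau> (s # ss) = (feasible s \<tau> \<and> feasible_path (move s \<tau>) ss)"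

fun competitors :: "exchange \<Rightarrow> bool list \<Rightarrow> nat set" where
  "competitors \<tau> [] = {}"
| "competitors \<tau> (s # ss) = {win s \<tau>, lose s \<tau>} \<union> competitors (move s \<tau>) ss"

section \<open>Volumes in the space of weights\<close>

abbreviation lb :: "nat set \<Rightarrow> (nat \<Rightarrow> real) measure" where
  "lb I \<equiv> \<Pi>\<^sub>M e\<in>I. lborel"

interpretation lborel_product: product_sigma_finite "\<lambda>_ :: nat. lborel :: real measure"
  by unfold_locales

lemma emeasure_lborel_translate:
  fixes A :: "real set" assumes "A \<in> sets borel"
  shows "emeasure lborel ((\<lambda>y. y + a) -` A) = emeasure lborel A"
proof -
  have "emeasure lborel A = emeasure (distr lborel borel ((+) a)) A"
    by (subst lborel_distr_plus) simp
  also have "\<dots> = emeasure lborel ((+) a -` A)"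
    using assms by (subst emeasure_distr) auto
  finally show ?thesis by (simp add: add.commute[of a] vimage_def)
qed

lemma distr_lb_translate:
  assumes "finite I"
  shows "distr (lb I) (lb I) (\<lambda>x. \<lambda>i\<in>I. x i + a i) = lb I"
proof (rule lborel_product.PiM_eqI[OF assms])
  fix A :: "nat \<Rightarrow> real set" assume A: "\<And>i. i \<in> I \<Longrightarrow> A i \<in> sets lborel"
  have "emeasure (distr (lb I) (lb I) (\<lambda>x. \<lambda>i\<in>I. x i + a i)) (Pi\<^sub>E I A) =
     emeasure (lb I) ((\<lambda>x. \<lambda>i\<in>I. x i + a i) -` Pi\<^sub>E I A \<inter> space (lb I))"
    using A assms by (intro emeasure_distr) (auto intro!: sets_PiM_I_finite)
  also have "(\<lambda>x. \<lambda>i\<in>I. x i + a i) -` Pi\<^sub>E I A \<inter> space (lb I) = Pi\<^sub>E I (\<lambda>i. (\<lambda>y. y + a i) -` A i)"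
    by (auto simp: space_PiM PiE_iff)
  also have "emeasure (lb I) \<dots> = (\<Prod>i\<in>I. emeasure lborel ((\<lambda>y. y + a i) -` A i))"
    using A assms by (intro lborel_product.emeasure_PiM) (auto intro!: measurable_sets_borel[of _ borel])
  also have "\<dots> = (\<Prod>i\<in>I. emeasure lborel (A i))"
    using A by (intro prod.cong refl emeasure_lborel_translate) auto
  finally show "emeasure (distr (lb I) (lb I) (\<lambda>x. \<lambda>i\<in>I. x i + a i)) (Pi\<^sub>E I A) = (\<Prod>i\<in>I. emeasure lborel (A i))" .
qed simp

lemma nn_integral_lb_translate:
  assumes "finite I" and [measurable]: "f \<in> borel_measurable (lb I)"
  shows "(\<integral>\<^sup>+x. f (\<lambda>i\<in>I. x i + a i) \<partial>lb I) = (\<integral>\<^sup>+x. f x \<partial>lb I)"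
proof -
  have "(\<integral>\<^sup>+x. f x \<partial>lb I) = (\<integral>\<^sup>+x. f x \<partial>distr (lb I) (lb I) (\<lambda>x. \<lambda>i\<in>I. x i + a i))"
    by (subst distr_lb_translate[OF assms(1)]) simp
  also have "\<dots> = (\<integral>\<^sup>+x. f (\<lambda>i\<in>I. x i + a i) \<partial>lb I)"
    by (intro nn_integral_distr) measurable
  finally show ?thesis ..
qed

text \<open>The coordinate \<open>e\<^sub>0\<close> is determined by the others through the balance equation.\<close>

definition fill :: "exchange \<Rightarrow> nat \<Rightarrow> (nat \<Rightarrow> real) \<Rightarrow> nat \<Rightarrow> real" where
  "fill \<tau> e\<^sub>0 x = x(e\<^sub>0 := - (\<Sum>e\<in>bands \<tau> - {e\<^sub>0}. defect \<tau> e * x e) / defect \<tau> e\<^sub>0)"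

lemma fill_eqI:
  assumes e0: "e\<^sub>0 \<in> bands \<tau>" "defect \<tau> e\<^sub>0 \<noteq> 0" and v: "imbalance \<tau> v = 0" "\<And>e. e \<noteq> e\<^sub>0 \<Longrightarrow> v e = x e"
  shows "fill \<tau> e\<^sub>0 x = v"
proof
  fix e
  have "imbalance \<tau> v = defect \<tau> e\<^sub>0 * v e\<^sub>0 + (\<Sum>e\<in>bands \<tau> - {e\<^sub>0}. defect \<tau> e * v e)"
    unfolding imbalance_eq using e0 by (simp add: sum.remove)
  also have "(\<Sum>e\<in>bands \<tau> - {e\<^sub>0}. defect \<tau> e * v e) = (\<Sum>e\<in>bands \<tau> - {e\<^sub>0}. defect \<tau> e * x e)"
    using v(2) by (intro sum.cong) auto
  finally have "v e\<^sub>0 = - (\<Sum>e\<in>bands \<tau> - {e\<^sub>0}. defect \<tau> e * x e) / defect \<tau> e\<^sub>0"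
    using v(1) e0 by (simp add: field_simps)
  then show "fill \<tau> e\<^sub>0 x e = v e"
    using v(2) by (simp add: fill_def)
qed

lemma imbalance_fill:
  assumes e0: "e\<^sub>0 \<in> bands \<tau>" "defect \<tau> e\<^sub>0 \<noteq> 0"
  shows "imbalance \<tau> (fill \<tau> e\<^sub>0 x) = 0"
proof -
  have "imbalance \<tau> (fill \<tau> e\<^sub>0 x) = defect \<tau> e\<^sub>0 * fill \<tau> e\<^sub>0 x e\<^sub>0 + (\<Sum>e\<in>bands \<tau> - {e\<^sub>0}. defect \<tau> e * fill \<tau> e\<^sub>0 x e)"
    unfolding imbalance_eq using e0 by (simp add: sum.remove)
  also have "(\<Sum>e\<in>bands \<tau> - {e\<^sub>0}. defect \<tau> e * fill \<tau> e\<^sub>0 x e) = (\<Sum>e\<in>bands \<tau> - {e\<^sub>0}. defect \<tau> e * x e)"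
    by (intro sum.cong) (auto simp: fill_def)
  also have "defect \<tau> e\<^sub>0 * fill \<tau> e\<^sub>0 x e\<^sub>0 = - (\<Sum>e\<in>bands \<tau> - {e\<^sub>0}. defect \<tau> e * x e)"
    using e0 by (simp add: fill_def)
  finally show ?thesis by simp
qed

lemma fill_other: "e \<noteq> e\<^sub>0 \<Longrightarrow> fill \<tau> e\<^sub>0 x e = x e"
  by (simp add: fill_def)

lemma measurable_fill [measurable]:
  assumes "e\<^sub>0 \<in> bands \<tau>"
  shows "fill \<tau> e\<^sub>0 \<in> lb (bands \<tau> - {e\<^sub>0}) \<rightarrow>\<^sub>M lb (bands \<tau>)"
proof -
  have "(\<lambda>x. - (\<Sum>e\<in>bands \<tau> - {e\<^sub>0}. defect \<tau> e * x e) / defect \<tau> e\<^sub>0) \<in> borel_measurable (lb (bands \<tau> - {e\<^sub>0}))"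
    by measurable
  then show ?thesis
    unfolding fill_def using assms by (intro measurable_fun_upd[where J = "bands \<tau> - {e\<^sub>0}"]) auto
qed

abbreviation loose :: "exchange \<Rightarrow> nat set" where
  "loose \<tau> \<equiv> side True \<tau> \<union> side False \<tau>"

definition slice :: "exchange \<Rightarrow> nat \<Rightarrow> (nat \<Rightarrow> real) set \<Rightarrow> (nat \<Rightarrow> real) set" where
  "slice \<tau> e\<^sub>0 A = fill \<tau> e\<^sub>0 -` A \<inter> space (lb (bands \<tau> - {e\<^sub>0}))"

lemma sets_slice [measurable]:
  assumes "e\<^sub>0 \<in> bands \<tau>" "A \<in> sets (lb (bands \<tau>))"
  shows "slice \<tau> e\<^sub>0 A \<in> sets (lb (bands \<tau> - {e\<^sub>0}))"
  unfolding slice_def using measurable_fill[OF assms(1)] assms(2) by (rule measurable_sets)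

lemma defect_loose:
  assumes "interval_exchange \<tau>" "e \<in> loose \<tau>"
  shows "e \<in> bands \<tau>" "(defect \<tau> e)\<^sup>2 = 4" "defect \<tau> e \<noteq> 0"
proof -
  show e: "e \<in> bands \<tau>" using assms(2) side_subset by blast
  show "(defect \<tau> e)\<^sup>2 = 4" using assms(2) by (auto simp: defect_eq[OF assms(1) e])
  then show "defect \<tau> e \<noteq> 0" by auto
qed

text \<open>Forgetting the coordinate \<open>e\<^sub>0\<close> changes area by the absolute value of
  the \<open>e\<^sub>0\<close> entry of the unit normal. All nonzero defects are 2 or -2 and belong
  to the loose bands, so the reciprocal of this entry has absolute value
  \<open>sqrt (card (loose \<tau>))\<close>, whichever loose band is eliminated.\<close>

lemma emeasure_lebesgue_hyperplane_slice:
  assumes ie: "interval_exchange \<tau>" and e0: "e\<^sub>0 \<in> loose \<tau>" and A[measurable]: "A \<in> sets (lb (bands \<tau>))"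
  shows "emeasure (lebesgue_hyperplane \<tau>) A =
    ennreal (sqrt (real (card (loose \<tau>)))) * emeasure (lb (bands \<tau> - {e\<^sub>0})) (slice \<tau> e\<^sub>0 A)"
proof -
  define E F where "E = bands \<tau>" and "F = bands \<tau> - {e\<^sub>0}"
  define u where "u = unit_normal \<tau>"
  define D where "D = sqrt (\<Sum>d\<in>bands \<tau>. (defect \<tau> d)\<^sup>2)"
  have e0b: "e\<^sub>0 \<in> bands \<tau>" "defect \<tau> e\<^sub>0 \<noteq> 0" "(defect \<tau> e\<^sub>0)\<^sup>2 = 4"
    using defect_loose[OF ie e0] by auto
  have E: "E = insert e\<^sub>0 F" "e\<^sub>0 \<notin> F" "finite F" "finite E"
    using e0b by (auto simp: E_def F_def)
  have "(\<Sum>d\<in>bands \<tau>. (defect \<tau> d)\<^sup>2) = (\<Sum>d\<in>bands \<tau>. if d \<in> loose \<tau> then 4 else 0)"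
    by (intro sum.cong refl) (auto simp: defect_eq[OF ie])
  also have "\<dots> = (\<Sum>d\<in>loose \<tau>. 4)"
    using side_subset[of True \<tau>] side_subset[of False \<tau>] by (intro sum.mono_neutral_cong_right) auto
  also have "\<dots> = 4 * real (card (loose \<tau>))" by simp
  finally have D2: "(\<Sum>d\<in>bands \<tau>. (defect \<tau> d)\<^sup>2) = 4 * real (card (loose \<tau>))" .
  have "card (loose \<tau>) > 0" using e0 by (auto simp: card_gt_0_iff)
  then have D: "D = 2 * sqrt (real (card (loose \<tau>)))" "D > 0"
    by (auto simp: D_def D2 real_sqrt_mult)
  have u: "u e = defect \<tau> e / D" for e by (simp add: u_def unit_normal_def D_def)
  have uD: "defect \<tau> e = D * u e" for e
    using less_imp_neq[OF D(2)] unfolding u by (simp only: times_divide_eq_right nonzero_mult_div_cancel_left not_sym not_False_eq_True)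
  have "\<bar>defect \<tau> e\<^sub>0\<bar> = 2"
    using e0b(3) by (metis abs_numeral numeral_power_eq_of_nat_cancel_iff power2_abs power2_eq_iff_nonneg abs_ge_zero
        zero_le_numeral real_sqrt_abs real_sqrt_four)
  then have u0: "u e\<^sub>0 \<noteq> 0" "\<bar>1 / u e\<^sub>0\<bar> = sqrt (real (card (loose \<tau>)))"
    using D by (auto simp: u)
  have uu: "(\<Sum>e\<in>E. u e * u e) = 1"
  proof -
    have "(\<Sum>e\<in>E. u e * u e) = (\<Sum>e\<in>E. (defect \<tau> e)\<^sup>2) / D\<^sup>2"
      unfolding sum_divide_distrib by (intro sum.cong) (auto simp: u power2_eq_square)
    also have "D\<^sup>2 = (\<Sum>e\<in>E. (defect \<tau> e)\<^sup>2)" by (simp add: D_def E_def sum_nonneg)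
    finally show ?thesis using D(2) by (simp add: D_def E_def)
  qed
  define S where "S = {v \<in> space (lb (bands \<tau>)). 0 \<le> height \<tau> v \<and> height \<tau> v \<le> 1 \<and> hyperplane_proj \<tau> v \<in> A}"
  have S[measurable]: "S \<in> sets (lb E)" unfolding S_def E_def by measurable
  define B where "B = slice \<tau> e\<^sub>0 A"
  have B[measurable]: "B \<in> sets (lb F)" unfolding B_def F_def using e0b A by measurable
  define g where "g x = (\<Sum>e\<in>F. u e * x e)" for x :: "nat \<Rightarrow> real"
  \<comment> \<open>The coordinate at \<open>e\<^sub>0\<close> is replaced by the height
    \<open>s\<close>. The point over \<open>x\<close> at height \<open>s\<close> projects to the
    point of the hyperplane over \<open>x\<close> translated by \<open>- s * u\<close>, so after
    Fubini the translation invariance of Lebesgue measure removes the dependence on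
    \<open>s\<close>.\<close>
  have key: "indicator S (x(e\<^sub>0 := - g x / u e\<^sub>0 + 1 / u e\<^sub>0 * s)) =
      (indicator {0..1} s * indicator B (\<lambda>e\<in>F. x e + (- s * u e)) :: ennreal)"
    if x: "x \<in> space (lb F)" for x s
  proof -
    define v where "v = x(e\<^sub>0 := - g x / u e\<^sub>0 + 1 / u e\<^sub>0 * s)"
    have v: "v \<in> space (lb (bands \<tau>))"
      using x e0b by (auto simp: v_def space_PiM PiE_iff F_def extensional_def)
    have h: "height \<tau> v = s"
    proof -
      have "height \<tau> v = u e\<^sub>0 * v e\<^sub>0 + (\<Sum>e\<in>F. u e * v e)"
        unfolding height_def F_def u_def[symmetric] using e0b by (simp add: sum.remove)
      also have "(\<Sum>e\<in>F. u e * v e) = g x"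
        unfolding g_def by (intro sum.cong) (auto simp: v_def F_def)
      finally have "height \<tau> v = u e\<^sub>0 * v e\<^sub>0 + g x" .
      also have "v e\<^sub>0 = (s - g x) / u e\<^sub>0" using u0(1) by (simp add: v_def diff_divide_distrib)
      finally show ?thesis using u0(1) by simp
    qed
    have "fill \<tau> e\<^sub>0 (\<lambda>e\<in>F. x e + (- s * u e)) = hyperplane_proj \<tau> v"
    proof (rule fill_eqI[OF e0b(1,2)])
      have "imbalance \<tau> (hyperplane_proj \<tau> v) = (\<Sum>e\<in>E. D * (u e * v e) - D * s * (u e * u e))"
        unfolding imbalance_eq E_def[symmetric]
        by (intro sum.cong) (auto simp: hyperplane_proj_def h uD algebra_simps E_def u_def[symmetric])
      also have "\<dots> = D * height \<tau> v - D * s * (\<Sum>e\<in>E. u e * u e)"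
        by (simp add: sum_subtractf height_def E_def u_def flip: sum_distrib_left)
      finally show "imbalance \<tau> (hyperplane_proj \<tau> v) = 0" by (simp add: h uu)
    next
      fix e assume "e \<noteq> e\<^sub>0"
      moreover have "hyperplane_proj \<tau> v e = (\<lambda>e\<in>bands \<tau>. v e - s * u e) e"
        by (simp add: hyperplane_proj_def h u_def)
      ultimately show "hyperplane_proj \<tau> v e = (\<lambda>e\<in>F. x e + (- s * u e)) e"
        by (auto simp: F_def v_def)
    qed
    then have "v \<in> S \<longleftrightarrow> s \<in> {0..1} \<and> (\<lambda>e\<in>F. x e + (- s * u e)) \<in> B"
      using v by (auto simp: S_def h B_def slice_def space_PiM F_def)
    then show ?thesis unfolding v_def[symmetric] by (auto simp: indicator_def)
  qed
  have "emeasure (lebesgue_hyperplane \<tau>) A = emeasure (lb E) S"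
    unfolding S_def E_def by (rule emeasure_lebesgue_hyperplane[OF A])
  also have "\<dots> = (\<integral>\<^sup>+v. indicator S v \<partial>lb (insert e\<^sub>0 F))"
    using S by (simp add: E(1))
  also have "\<dots> = (\<integral>\<^sup>+x. \<integral>\<^sup>+y. indicator S (x(e\<^sub>0 := y)) \<partial>lborel \<partial>lb F)"
    using E S by (intro lborel_product.product_nn_integral_insert) (auto simp: E(1)[symmetric])
  also have "\<dots> = (\<integral>\<^sup>+x. ennreal \<bar>1 / u e\<^sub>0\<bar> * (\<integral>\<^sup>+s. indicator {0..1} s * indicator B (\<lambda>e\<in>F. x e + (- s * u e)) \<partial>lborel) \<partial>lb F)"
  proof (rule nn_integral_cong)
    fix x assume x: "x \<in> space (lb F)"
    have "(\<lambda>y. x(e\<^sub>0 := y)) \<in> lborel \<rightarrow>\<^sub>M lb E"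
      unfolding E(1) using x by (intro measurable_fun_upd[where J = F]) auto
    then have [measurable]: "(\<lambda>y. indicator S (x(e\<^sub>0 := y)) :: ennreal) \<in> borel_measurable borel"
      using S by measurable
    have "(\<integral>\<^sup>+y. indicator S (x(e\<^sub>0 := y)) \<partial>lborel) =
        ennreal \<bar>1 / u e\<^sub>0\<bar> * (\<integral>\<^sup>+s. indicator S (x(e\<^sub>0 := - g x / u e\<^sub>0 + 1 / u e\<^sub>0 * s)) \<partial>lborel)"
      using u0 by (intro nn_integral_real_affine) auto
    then show "(\<integral>\<^sup>+y. indicator S (x(e\<^sub>0 := y)) \<partial>lborel) =
        ennreal \<bar>1 / u e\<^sub>0\<bar> * (\<integral>\<^sup>+s. indicator {0..1} s * indicator B (\<lambda>e\<in>F. x e + (- s * u e)) \<partial>lborel)"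
      by (simp only: key[OF x])
  qed
  also have "\<dots> = ennreal \<bar>1 / u e\<^sub>0\<bar> * (\<integral>\<^sup>+x. \<integral>\<^sup>+s. indicator {0..1} s * indicator B (\<lambda>e\<in>F. x e + (- s * u e)) \<partial>lborel \<partial>lb F)"
    by (intro nn_integral_cmult) measurable
  also have "(\<integral>\<^sup>+x. \<integral>\<^sup>+s. indicator {0..1} s * indicator B (\<lambda>e\<in>F. x e + (- s * u e)) \<partial>lborel \<partial>lb F) =
     (\<integral>\<^sup>+s. \<integral>\<^sup>+x. indicator {0..1} s * indicator B (\<lambda>e\<in>F. x e + (- s * u e)) \<partial>lb F \<partial>lborel)"
  proof (rule pair_sigma_finite.Fubini'[symmetric])
    show "pair_sigma_finite (lb F) (lborel :: real measure)"
      using E(3) by (simp add: pair_sigma_finite.intro lborel.sigma_finite_measure_axioms lborel_product.sigma_finite)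
  qed measurable
  also have "\<dots> = (\<integral>\<^sup>+s. indicator {0..1::real} s * emeasure (lb F) B \<partial>lborel)"
  proof (rule nn_integral_cong)
    fix s :: real
    have "(\<integral>\<^sup>+x. indicator {0..1} s * indicator B (\<lambda>e\<in>F. x e + (- s * u e)) \<partial>lb F) =
        indicator {0..1} s * (\<integral>\<^sup>+x. indicator B (\<lambda>e\<in>F. x e + (- s * u e)) \<partial>lb F)"
      by (intro nn_integral_cmult) measurable
    also have "(\<integral>\<^sup>+x. indicator B (\<lambda>e\<in>F. x e + (- s * u e)) \<partial>lb F) = (\<integral>\<^sup>+x. indicator B x \<partial>lb F)"
      using E(3) by (intro nn_integral_lb_translate) measurable
    also have "\<dots> = emeasure (lb F) B" by simp
    finally show "(\<integral>\<^sup>+x. indicator {0..1} s * indicator B (\<lambda>e\<in>F. x e + (- s * u e)) \<partial>lb F) =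
        indicator {0..1} s * emeasure (lb F) B" .
  qed
  also have "\<dots> = emeasure (lb F) B"
    by (simp add: nn_integral_multc)
  finally show ?thesis by (simp only: u0(2) B_def F_def)
qed

text \<open>The hyperplane measure without its factor \<open>sqrt (card (loose \<tau>))\<close>.
  That factor may change under a move, since the loser can enter or leave the loose bands, whereas
  \<open>area\<close> is preserved by splitting.\<close>

definition area :: "exchange \<Rightarrow> (nat \<Rightarrow> real) measure" where
  "area \<tau> = (let e\<^sub>0 = SOME e. e \<in> loose \<tau> in
     distr (lb (bands \<tau> - {e\<^sub>0})) (lb (bands \<tau>)) (fill \<tau> e\<^sub>0))"

lemma sets_area [simp, measurable_cong]: "sets (area \<tau>) = sets (lb (bands \<tau>))"
  and space_area: "space (area \<tau>) = bands \<tau> \<rightarrow>\<^sub>E UNIV"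
  by (auto simp: area_def Let_def space_PiM)

text \<open>Independence of the eliminated band: the hyperplane measure of the same set is computed
  with two choices, and the common positive factor is cancelled.\<close>

lemma emeasure_area:
  assumes ie: "interval_exchange \<tau>" and e0: "e\<^sub>0 \<in> loose \<tau>" and A: "A \<in> sets (lb (bands \<tau>))"
  shows "emeasure (area \<tau>) A = emeasure (lb (bands \<tau> - {e\<^sub>0})) (slice \<tau> e\<^sub>0 A)"
    and "emeasure (lebesgue_hyperplane \<tau>) A = ennreal (sqrt (real (card (loose \<tau>)))) * emeasure (area \<tau>) A"
proof -
  define e1 where "e1 = (SOME e. e \<in> loose \<tau>)"
  have e1: "e1 \<in> loose \<tau>" unfolding e1_def using e0 by (rule someI)
  have eq: "emeasure (area \<tau>) A = emeasure (lb (bands \<tau> - {e1})) (slice \<tau> e1 A)"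
    unfolding area_def Let_def e1_def[symmetric] slice_def
    using defect_loose[OF ie e1] A by (intro emeasure_distr) auto
  have "card (loose \<tau>) > 0" using e0 by (auto simp: card_gt_0_iff)
  moreover have "ennreal (sqrt (real (card (loose \<tau>)))) * emeasure (lb (bands \<tau> - {e\<^sub>0})) (slice \<tau> e\<^sub>0 A) =
      ennreal (sqrt (real (card (loose \<tau>)))) * emeasure (lb (bands \<tau> - {e1})) (slice \<tau> e1 A)"
    using emeasure_lebesgue_hyperplane_slice[OF ie e0 A] emeasure_lebesgue_hyperplane_slice[OF ie e1 A] by simp
  ultimately show "emeasure (area \<tau>) A = emeasure (lb (bands \<tau> - {e\<^sub>0})) (slice \<tau> e\<^sub>0 A)"
    unfolding eq by (auto simp: ennreal_mult_cancel_left)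
  show "emeasure (lebesgue_hyperplane \<tau>) A = ennreal (sqrt (real (card (loose \<tau>)))) * emeasure (area \<tau>) A"
    unfolding eq by (rule emeasure_lebesgue_hyperplane_slice[OF ie e1 A])
qed

section \<open>Invariance of volume under splitting\<close>

lemma emeasure_lb_insert:
  assumes "finite G" "t \<notin> G" "B \<in> sets (lb (insert t G))"
  shows "emeasure (lb (insert t G)) B = (\<integral>\<^sup>+x. \<integral>\<^sup>+y. indicator B (x(t := y)) \<partial>lborel \<partial>lb G)"
  using assms lborel_product.product_nn_integral_insert[of G t "indicator B"] by simp

lemma measurable_shear:
  assumes "t \<in> F" "b \<in> F"
  shows "(\<lambda>x. x(t := x t - x b)) \<in> lb F \<rightarrow>\<^sub>M lb F"
proof (rule measurable_fun_upd[where J = F])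
  show "(\<lambda>x. x t - x b) \<in> lb F \<rightarrow>\<^sub>M lborel" using assms by measurable
qed (use assms in auto)

text \<open>Fubini with the coordinate \<open>t\<close> innermost: on each line in this direction
  the shear is a translation by \<open>x b\<close>.\<close>

lemma emeasure_shear:
  assumes F: "finite F" "t \<in> F" "b \<in> F" "t \<noteq> b" and B[measurable]: "B \<in> sets (lb F)"
  shows "emeasure (lb F) ((\<lambda>x. x(t := x t - x b)) -` B \<inter> space (lb F)) = emeasure (lb F) B"
proof -
  define G where "G = F - {t}"
  have G: "F = insert t G" "t \<notin> G" "finite G" "b \<in> G" using F by (auto simp: G_def)
  have m: "(\<lambda>x. x(t := x t - x b)) -` B \<inter> space (lb F) \<in> sets (lb F)"
    using measurable_shear[OF F(2,3)] B by (rule measurable_sets)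
  have "emeasure (lb F) ((\<lambda>x. x(t := x t - x b)) -` B \<inter> space (lb F)) =
     (\<integral>\<^sup>+x. \<integral>\<^sup>+y. indicator ((\<lambda>x. x(t := x t - x b)) -` B \<inter> space (lb F)) (x(t := y)) \<partial>lborel \<partial>lb G)"
    using emeasure_lb_insert[OF G(3,2)] m by (simp flip: G(1))
  also have "\<dots> = (\<integral>\<^sup>+x. \<integral>\<^sup>+y. indicator B (x(t := y)) \<partial>lborel \<partial>lb G)"
  proof (rule nn_integral_cong)
    fix x assume x: "x \<in> space (lb G)"
    have "(\<lambda>y. x(t := y)) \<in> lborel \<rightarrow>\<^sub>M lb F"
      unfolding G(1) using x by (intro measurable_fun_upd[where J = G]) auto
    then have [measurable]: "(\<lambda>y. indicator B (x(t := y)) :: ennreal) \<in> borel_measurable borel"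
      by measurable
    have "(\<integral>\<^sup>+y. indicator B (x(t := y)) \<partial>lborel) = ennreal \<bar>1\<bar> * (\<integral>\<^sup>+y. indicator B (x(t := - x b + 1 * y)) \<partial>lborel)"
      by (intro nn_integral_real_affine) auto
    also have "(\<integral>\<^sup>+y. indicator B (x(t := - x b + 1 * y)) \<partial>lborel) =
        (\<integral>\<^sup>+y. indicator ((\<lambda>x. x(t := x t - x b)) -` B \<inter> space (lb F)) (x(t := y)) \<partial>lborel)"
      using x F(4) G by (intro nn_integral_cong) (auto simp: indicator_def space_PiM PiE_iff extensional_def)
    finally show "(\<integral>\<^sup>+y. indicator ((\<lambda>x. x(t := x t - x b)) -` B \<inter> space (lb F)) (x(t := y)) \<partial>lborel) =
       (\<integral>\<^sup>+y. indicator B (x(t := y)) \<partial>lborel)" by (simp only: abs_one ennreal_1 mult_1)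
  qed
  also have "\<dots> = emeasure (lb F) B"
    using emeasure_lb_insert[OF G(3,2)] B by (simp flip: G(1))
  finally show ?thesis .
qed

lemma emeasure_diagonal:
  assumes F: "finite F" "t \<in> F" "b \<in> F" "t \<noteq> b"
  shows "emeasure (lb F) {x \<in> space (lb F). x t = x b} = 0"
proof -
  define G where "G = F - {t}"
  have G: "F = insert t G" "t \<notin> G" "finite G" "b \<in> G" using F by (auto simp: G_def)
  have m: "{x \<in> space (lb F). x t = x b} \<in> sets (lb F)" using F by measurable
  have "emeasure (lb F) {x \<in> space (lb F). x t = x b} =
     (\<integral>\<^sup>+x. \<integral>\<^sup>+y. indicator {x \<in> space (lb F). x t = x b} (x(t := y)) \<partial>lborel \<partial>lb G)"
    using emeasure_lb_insert[OF G(3,2)] m by (simp flip: G(1))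
  also have "\<dots> = (\<integral>\<^sup>+x. \<integral>\<^sup>+y. indicator {x b} y \<partial>lborel \<partial>lb G)"
    using F(4) G by (intro nn_integral_cong) (auto simp: indicator_def space_PiM PiE_iff extensional_def)
  finally show ?thesis by simp
qed

text \<open>Eliminating this coordinate keeps both competing coordinates free, so that a split
  becomes a shear. Without such a band each side would consist of its own competitor alone, contrary
  to the last clause of \<open>unequal_ends\<close>.\<close>

lemma other_loose:
  assumes u: "unequal_ends \<tau>"
  obtains e\<^sub>0 where "e\<^sub>0 \<in> loose \<tau>" "e\<^sub>0 \<noteq> win s \<tau>" "e\<^sub>0 \<noteq> lose s \<tau>"
proof -
  have "\<exists>e\<^sub>0\<in>loose \<tau>. e\<^sub>0 \<noteq> win True \<tau> \<and> e\<^sub>0 \<noteq> win False \<tau>"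
  proof (rule ccontr)
    assume "\<not> ?thesis"
    then have *: "side True \<tau> \<subseteq> {win True \<tau>, win False \<tau>}" "side False \<tau> \<subseteq> {win True \<tau>, win False \<tau>}" by blast+
    then have "side True \<tau> \<subseteq> {win True \<tau>}" "side False \<tau> \<subseteq> {win False \<tau>}"
      using win_not_side[OF u, of True] win_not_side[OF u, of False] by auto
    with u show False unfolding unequal_ends_def by blast
  qed
  with that show ?thesis by (cases s) auto
qed

lemma loose_move:
  assumes "unequal_ends \<tau>" "e \<in> loose \<tau>" "e \<noteq> lose s \<tau>"
  shows "e \<in> loose (move s \<tau>)"
  using side_move[OF assms(1), of s] assms(2,3) by (cases s) (auto split: if_splits)

lemma measurable_split_weight:
  assumes u: "unequal_ends \<tau>"
  shows "split_weight s \<tau> \<in> lb (bands \<tau>) \<rightarrow>\<^sub>M lb (bands \<tau>)"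
  unfolding split_weight_def using win_in_bands[OF u] by (intro measurable_shear)

lemma emeasure_area_split:
  assumes u: "unequal_ends \<tau>" and A: "A \<in> sets (lb (bands \<tau>))"
  shows "emeasure (area \<tau>) {w \<in> space (area \<tau>). split_weight s \<tau> w \<in> A} = emeasure (area (move s \<tau>)) A"
proof -
  obtain e0 where e0: "e0 \<in> loose \<tau>" "e0 \<noteq> win s \<tau>" "e0 \<noteq> lose s \<tau>" using other_loose[OF u] by blast
  define F t b where "F = bands \<tau> - {e0}" and "t = win s \<tau>" and "b = lose s \<tau>"
  have F: "finite F" "t \<in> F" "b \<in> F" "t \<noteq> b"
    using e0 win_in_bands[OF u] win_neq_lose[OF u, of s] by (auto simp: F_def t_def b_def)
  have ie: "interval_exchange \<tau>" "interval_exchange (move s \<tau>)"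
    using u interval_exchange_move by (auto simp: unequal_ends_def)
  have e0': "e0 \<in> loose (move s \<tau>)" using loose_move[OF u e0(1,3)] .
  note d = defect_loose[OF ie(1) e0(1)] defect_loose[OF ie(2) e0']
  have sp: "space (area \<tau>) = space (lb (bands \<tau>))" by (simp add: space_area space_PiM)
  have A': "{w \<in> space (area \<tau>). split_weight s \<tau> w \<in> A} \<in> sets (lb (bands \<tau>))"
    using measurable_sets[OF measurable_split_weight[OF u] A, of s] by (simp add: sp vimage_def Int_def conj_commute)
  \<comment> \<open>Both functions agree off \<open>e0\<close>, and the right-hand one is balanced
    for the new exchange because the imbalance is invariant; the balance equation then determines
    the entry at \<open>e0\<close>.\<close>
  have eq: "fill (move s \<tau>) e0 (x(t := x t - x b)) = split_weight s \<tau> (fill \<tau> e0 x)" for x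
  proof (rule fill_eqI)
    show "imbalance (move s \<tau>) (split_weight s \<tau> (fill \<tau> e0 x)) = 0"
      unfolding imbalance_move[OF u] using d by (intro imbalance_fill)
  qed (use d e0 in \<open>auto simp: split_weight_def t_def b_def fill_other\<close>)
  have "slice \<tau> e0 {w \<in> space (area \<tau>). split_weight s \<tau> w \<in> A} =
     (\<lambda>x. x(t := x t - x b)) -` slice (move s \<tau>) e0 A \<inter> space (lb F)"
  proof -
    have "fill \<tau> e0 x \<in> space (area \<tau>)" if "x \<in> space (lb F)" for x
      using measurable_space[OF measurable_fill[OF d(1)]] that by (simp add: sp F_def)
    moreover have "x(t := x t - x b) \<in> space (lb F)" if "x \<in> space (lb F)" for x
      using measurable_space[OF measurable_shear[OF F(2,3)] that] .
    ultimately show ?thesis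
      unfolding slice_def bands_move[OF u] F_def[symmetric] by (auto simp: eq)
  qed
  then have "emeasure (area \<tau>) {w \<in> space (area \<tau>). split_weight s \<tau> w \<in> A} =
      emeasure (lb F) ((\<lambda>x. x(t := x t - x b)) -` slice (move s \<tau>) e0 A \<inter> space (lb F))"
    using emeasure_area(1)[OF ie(1) e0(1) A'] by (simp add: F_def)
  also have "\<dots> = emeasure (lb F) (slice (move s \<tau>) e0 A)"
    using F sets_slice[OF d(4), of A] A u by (intro emeasure_shear) (simp_all add: F_def)
  also have "\<dots> = emeasure (area (move s \<tau>)) A"
    using emeasure_area(1)[OF ie(2) e0', of A] A u by (simp add: F_def)
  finally show ?thesis .
qed

lemma emeasure_area_equal:
  assumes u: "unequal_ends \<tau>"
  shows "emeasure (area \<tau>) {w \<in> space (area \<tau>). w (win True \<tau>) = w (win False \<tau>)} = 0"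
proof -
  obtain e0 where e0: "e0 \<in> loose \<tau>" "e0 \<noteq> win True \<tau>" "e0 \<noteq> win False \<tau>"
    using other_loose[OF u, of True] by auto
  define F t b where "F = bands \<tau> - {e0}" and "t = win True \<tau>" and "b = win False \<tau>"
  have F: "finite F" "t \<in> F" "b \<in> F" "t \<noteq> b"
    using e0 win_in_bands[OF u] win_neq_lose[OF u, of True] by (auto simp: F_def t_def b_def)
  have ie: "interval_exchange \<tau>"
    using u by (auto simp: unequal_ends_def)
  have A: "{w \<in> space (area \<tau>). w t = w b} \<in> sets (lb (bands \<tau>))"
  proof -
    have "t \<in> bands \<tau>" "b \<in> bands \<tau>" using F by (auto simp: F_def)
    then have "{w \<in> space (lb (bands \<tau>)). w t = w b} \<in> sets (lb (bands \<tau>))" by measurable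
    then show ?thesis by (simp add: space_area space_PiM)
  qed
  have sp: "fill \<tau> e0 x \<in> space (area \<tau>)" if "x \<in> space (lb F)" for x
    using measurable_space[OF measurable_fill[of e0 \<tau>]] that defect_loose[OF ie e0(1)] by (simp add: space_area space_PiM F_def)
  have "slice \<tau> e0 {w \<in> space (area \<tau>). w t = w b} = {x \<in> space (lb F). x t = x b}"
    unfolding slice_def F_def[symmetric] using F sp by (auto simp: fill_other F_def)
  then have "emeasure (area \<tau>) {w \<in> space (area \<tau>). w t = w b} = 0"
    using emeasure_area(1)[OF ie e0(1) A] emeasure_diagonal[OF F] by (simp add: F_def)
  then show ?thesis by (simp add: t_def b_def)
qed

section \<open>Volumes of truncated cones\<close>

definition region :: "exchange \<Rightarrow> (nat \<Rightarrow> real) \<Rightarrow> (nat \<Rightarrow> real) set" where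
  "region \<tau> c = {w \<in> weights \<tau>. (\<Sum>e\<in>bands \<tau>. c e * w e) \<le> 1}"

definition vol :: "exchange \<Rightarrow> (nat \<Rightarrow> real) \<Rightarrow> real" where
  "vol \<tau> c = measure (area \<tau>) (region \<tau> c)"

text \<open>If \<open>w\<close> splits with winner on the side \<open>s\<close>, then the functional \<open>add_win s \<tau> c\<close> takes the same
  value at the split weight as \<open>c\<close> at \<open>w\<close>.\<close>

definition add_win :: "bool \<Rightarrow> exchange \<Rightarrow> (nat \<Rightarrow> real) \<Rightarrow> nat \<Rightarrow> real" where
  "add_win s \<tau> c = c(lose s \<tau> := c (lose s \<tau>) + c (win s \<tau>))"

text \<open>Up to a factor of at most \<open>2\<close>, the least value of the functional \<open>c\<close> on those extreme rays of
  \<open>weights \<tau>\<close> that give \<open>e\<close> a positive weight.\<close>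

definition hat :: "exchange \<Rightarrow> (nat \<Rightarrow> real) \<Rightarrow> nat \<Rightarrow> real" where
  "hat \<tau> c e = (if e \<in> side True \<tau> then max (c e) (Min (c ` side False \<tau>))
     else if e \<in> side False \<tau> then max (c e) (Min (c ` side True \<tau>)) else c e)"

text \<open>Up to a factor of 2, the cost of the cheapest pair of loose bands from opposite sides.
  It is also the \<open>hat\<close> value of the band that is best eliminated by the balance
  equation, which is why it reappears as a numerator in \<open>hat_vol\<close>.\<close>

definition mid :: "exchange \<Rightarrow> (nat \<Rightarrow> real) \<Rightarrow> real" where
  "mid \<tau> c = max (Min (c ` side True \<tau>)) (Min (c ` side False \<tau>))"

text \<open>The volume of \<open>region \<tau> c\<close> up to a constant factor.\<close>

definition hat_vol :: "exchange \<Rightarrow> (nat \<Rightarrow> real) \<Rightarrow> real" where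
  "hat_vol \<tau> c = mid \<tau> c / (\<Prod>e\<in>bands \<tau>. hat \<tau> c e)"

lemma hat_side: "e \<in> side s \<tau> \<Longrightarrow> hat \<tau> c e = max (c e) (Min (c ` side (\<not> s) \<tau>))"
  using side_disjoint(2)[of e s \<tau>] by (cases s) (auto simp: hat_def)

lemma mid_side: "mid \<tau> c = max (Min (c ` side s \<tau>)) (Min (c ` side (\<not> s) \<tau>))"
  by (cases s) (auto simp: mid_def max.commute)

lemma hat_ge: "c e \<le> hat \<tau> c e"
  by (auto simp: hat_def)

lemma sets_region [measurable]: "region \<tau> c \<in> sets (lb (bands \<tau>))" "weights \<tau> \<in> sets (lb (bands \<tau>))"
proof -
  have "{w \<in> space (lb (bands \<tau>)). (\<forall>e\<in>bands \<tau>. 0 \<le> w e) \<and> (\<Sum>e\<in>bands \<tau>. defect \<tau> e * w e) = 0} \<in> sets (lb (bands \<tau>))"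
    by measurable
  also have "{w \<in> space (lb (bands \<tau>)). (\<forall>e\<in>bands \<tau>. 0 \<le> w e) \<and> (\<Sum>e\<in>bands \<tau>. defect \<tau> e * w e) = 0} = weights \<tau>"
    by (auto simp: weights_iff imbalance_eq space_PiM PiE_iff)
  finally show w: "weights \<tau> \<in> sets (lb (bands \<tau>))" .
  have "{w \<in> space (lb (bands \<tau>)). (\<Sum>e\<in>bands \<tau>. c e * w e) \<le> 1} \<in> sets (lb (bands \<tau>))"
    by measurable
  then have "weights \<tau> \<inter> {w \<in> space (lb (bands \<tau>)). (\<Sum>e\<in>bands \<tau>. c e * w e) \<le> 1} \<in> sets (lb (bands \<tau>))"
    using w by blast
  also have "weights \<tau> \<inter> {w \<in> space (lb (bands \<tau>)). (\<Sum>e\<in>bands \<tau>. c e * w e) \<le> 1} = region \<tau> c"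
    by (auto simp: region_def weights_def space_PiM PiE_iff)
  finally show "region \<tau> c \<in> sets (lb (bands \<tau>))" .
qed

lemma emeasure_lb_box:
  assumes "finite F" "\<And>e. e \<in> F \<Longrightarrow> l e \<le> u e"
  shows "emeasure (lb F) (PiE F (\<lambda>e. {l e..u e})) = ennreal (\<Prod>e\<in>F. u e - l e)"
proof -
  have "emeasure (lb F) (PiE F (\<lambda>e. {l e..u e})) = (\<Prod>e\<in>F. emeasure lborel {l e..u e})"
    using assms by (intro lborel_product.emeasure_PiM) auto
  also have "\<dots> = (\<Prod>e\<in>F. ennreal (u e - l e))"
    using assms by (intro prod.cong) auto
  also have "\<dots> = ennreal (\<Prod>e\<in>F. u e - l e)"
    using assms by (intro prod_ennreal) auto
  finally show ?thesis .
qed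

lemma obtain_Min:
  assumes "finite S" "S \<noteq> {}"
  obtains a where "a \<in> S" "c a = Min (c ` S)"
proof -
  have "Min (c ` S) \<in> c ` S" using assms by (intro Min_in) auto
  then show ?thesis using that by (metis imageE)
qed

text \<open>The eliminated band \<open>a0\<close> is the cheapest one on the side with the smaller
  minimum; its \<open>hat\<close> value is \<open>mid\<close> and cancels the numerator of
  \<open>hat_vol\<close>. In the remaining coordinates the region lies in a box with edges
  \<open>n / hat\<close>, and it contains a box whose edges are at least \<open>1 / (6 * n)\<close>
  times \<open>1 / hat\<close>.\<close>

lemma vol_estimates:
  assumes u: "unequal_ends \<tau>" and c: "\<forall>e\<in>bands \<tau>. c e > 0"
  defines "n \<equiv> real (card (bands \<tau>))"
  shows "emeasure (area \<tau>) (region \<tau> c) \<le> ennreal (n ^ card (bands \<tau>) * hat_vol \<tau> c)"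
    and "emeasure (area \<tau>) (region \<tau> c) \<ge> ennreal (hat_vol \<tau> c / (6 * n) ^ card (bands \<tau>))"
proof -
  note c = bspec[OF c]
  have ie: "interval_exchange \<tau>" and ne: "side s \<tau> \<noteq> {}" for s
    using u by (auto simp: unequal_ends_def; cases s; simp)+
  obtain s where s: "Min (c ` side s \<tau>) \<le> Min (c ` side (\<not> s) \<tau>)"
  proof (cases "Min (c ` side True \<tau>) \<le> Min (c ` side False \<tau>)")
    case True then show ?thesis using that[of True] by simp
  next
    case False then show ?thesis using that[of False] by simp
  qed
  define m where "m = mid \<tau> c"
  have m: "m = Min (c ` side (\<not> s) \<tau>)" using s by (simp add: m_def mid_side[of _ _ s])
  obtain a0 where a0: "a0 \<in> side s \<tau>" "c a0 = Min (c ` side s \<tau>)"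
    using obtain_Min[OF finite_side ne] by blast
  obtain b0 where b0: "b0 \<in> side (\<not> s) \<tau>" "c b0 = m"
    using obtain_Min[OF finite_side ne] m by metis
  have m_le: "m \<le> c b" if "b \<in> side (\<not> s) \<tau>" for b using that m by simp
  have a0m: "c a0 \<le> m" using s a0 m by simp
  define F where "F = bands \<tau> - {a0}"
  have sub: "side s \<tau> \<subseteq> bands \<tau>" for s by (rule side_subset)
  have a0b: "a0 \<in> bands \<tau>" "a0 \<in> loose \<tau>" using a0(1) sub by (cases s; auto)+
  have b0b: "b0 \<in> bands \<tau>" "b0 \<in> F" using b0(1) sub a0(1) side_disjoint(2)[OF a0(1)] by (auto simp: F_def)
  have m0: "m > 0" using c[of b0] b0 sub by auto
  have hb: "hat \<tau> c b = c b" if "b \<in> side (\<not> s) \<tau>" for b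
    using hat_side[OF that, of c] m_le[OF that] a0 a0m by simp
  have ha: "hat \<tau> c a = max (c a) m" if "a \<in> side s \<tau>" for a
    using hat_side[OF that, of c] m by simp
  have hm: "hat \<tau> c e \<ge> m" if "e \<in> loose \<tau>" for e
    using that hb ha m_le by (cases s) fastforce+
  have ho: "hat \<tau> c e = c e" if "e \<notin> side s \<tau>" for e
  proof (cases "e \<in> side (\<not> s) \<tau>")
    case False
    then have "e \<notin> side True \<tau>" "e \<notin> side False \<tau>" using that by (cases s; simp)+
    then show ?thesis by (simp add: hat_def)
  qed (rule hb)
  have h0: "hat \<tau> c e > 0" if "e \<in> bands \<tau>" for e
    using c[OF that] hat_ge[of c e \<tau>] by linarith
  define h where "h = hat \<tau> c"
  have hv: "hat_vol \<tau> c = 1 / (\<Prod>e\<in>F. h e)"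
  proof -
    have "(\<Prod>e\<in>bands \<tau>. hat \<tau> c e) = h a0 * (\<Prod>e\<in>F. h e)"
      unfolding F_def h_def using a0b by (intro prod.remove) auto
    also have "h a0 = m" using ha[OF a0(1)] a0m by (simp add: h_def)
    finally show ?thesis using m0 by (simp add: hat_vol_def flip: m_def)
  qed
  have F: "finite F" "card (bands \<tau>) = Suc (card F)"
    using card_Suc_Diff1[of "bands \<tau>" a0] a0b by (simp_all add: F_def)
  have n: "n \<ge> 1" "n > 0" using F by (auto simp: n_def)
  have hF: "h e > 0" if "e \<in> F" for e using h0 that by (auto simp: h_def F_def)
  have prod0: "(\<Prod>e\<in>F. h e) > 0" using hF by (intro prod_pos) auto
  have area: "emeasure (area \<tau>) (region \<tau> c) = emeasure (lb F) (slice \<tau> a0 (region \<tau> c))"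
    unfolding F_def by (rule emeasure_area(1)[OF ie a0b(2)]) measurable
  have sumc: "sum w (side s \<tau>) = sum w (side (\<not> s) \<tau>)" if "w \<in> weights \<tau>" for w
    using weights_side_sum[OF ie that] by (cases s) auto
  show "emeasure (area \<tau>) (region \<tau> c) \<le> ennreal (n ^ card (bands \<tau>) * hat_vol \<tau> c)"
  proof -
    have "slice \<tau> a0 (region \<tau> c) \<subseteq> PiE F (\<lambda>e. {0..n / h e})"
    proof
      fix x assume x: "x \<in> slice \<tau> a0 (region \<tau> c)"
      define w where "w = fill \<tau> a0 x"
      have w: "w \<in> weights \<tau>" "(\<Sum>e\<in>bands \<tau>. c e * w e) \<le> 1"
        using x by (auto simp: slice_def region_def w_def)
      have w0: "w e \<ge> 0" if "e \<in> bands \<tau>" for e using w(1) that by (auto simp: weights_def)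
      have cw: "w e \<le> 1 / c e" if "e \<in> bands \<tau>" for e
      proof -
        have "c e * w e \<le> (\<Sum>e\<in>bands \<tau>. c e * w e)"
          using that w0 c by (intro member_le_sum) (auto simp: less_imp_le)
        then show ?thesis using w(2) c[OF that] by (simp add: field_simps)
      qed
      have up: "w e \<le> n / h e" if "e \<in> bands \<tau>" for e
      proof -
        have 1: "w e \<le> n / c e"
          using cw[OF that] n c[OF that] by (meson divide_right_mono less_imp_le order.trans)
        show ?thesis
        proof (cases "e \<in> side s \<tau>")
          case True
          \<comment> \<open>A loose band cannot outweigh the whole opposite side, where every
            coefficient is at least \<open>m\<close>. This accounts for the second argument of the
            maximum in \<open>hat\<close>.\<close>
          have "w e \<le> sum w (side s \<tau>)" using True w0 sub by (intro member_le_sum) auto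
          also have "\<dots> = sum w (side (\<not> s) \<tau>)" by (rule sumc[OF w(1)])
          also have "\<dots> \<le> (\<Sum>b\<in>side (\<not> s) \<tau>. 1 / m)"
          proof (rule sum_mono)
            fix b assume b: "b \<in> side (\<not> s) \<tau>"
            then have "w b \<le> 1 / c b" using cw sub by auto
            also have "\<dots> \<le> 1 / m" using m_le[OF b] m0 by (simp add: frac_le)
            finally show "w b \<le> 1 / m" .
          qed
          also have "\<dots> \<le> n / m"
            using m0 card_mono[OF _ sub, of "\<not> s"] by (simp add: n_def divide_right_mono)
          finally have "w e \<le> n / m" .
          with 1 show ?thesis by (simp add: h_def ha[OF True] max_def)
        next
          case False
          with 1 show ?thesis by (simp add: h_def ho)
        qed
      qed
      have "x e = w e" if "e \<in> F" for e using that by (simp add: w_def fill_other F_def)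
      then show "x \<in> PiE F (\<lambda>e. {0..n / h e})"
        using x w0 up by (auto simp: slice_def space_PiM PiE_iff F_def)
    qed
    then have "emeasure (lb F) (slice \<tau> a0 (region \<tau> c)) \<le> emeasure (lb F) (PiE F (\<lambda>e. {0..n / h e}))"
      using F by (intro emeasure_mono sets_PiM_I_finite) auto
    also have "\<dots> = ennreal (\<Prod>e\<in>F. n / h e - 0)"
      using F hF n by (intro emeasure_lb_box) (auto simp: less_imp_le)
    also have "(\<Prod>e\<in>F. n / h e - 0) = n ^ card F * hat_vol \<tau> c"
      by (simp add: prod_dividef hv)
    also have "\<dots> \<le> n ^ card (bands \<tau>) * hat_vol \<tau> c"
      using n prod0 by (intro mult_right_mono power_increasing) (auto simp: F hv less_imp_le)
    finally show ?thesis using area by (simp add: ennreal_leI order_trans)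
  qed
  show "emeasure (area \<tau>) (region \<tau> c) \<ge> ennreal (hat_vol \<tau> c / (6 * n) ^ card (bands \<tau>))"
  proof -
    \<comment> \<open>The functional will be bounded by \<open>3 * n * r\<close> from
      \<open>a0\<close>, \<open>2 * n * r\<close> from \<open>b0\<close> and \<open>n * r\<close>
      from all other bands, and these must add up to at most 1.\<close>
    define r where "r = 1 / (6 * n)"
    have r: "r > 0" "r \<le> 1" "6 * n * r = 1" using n by (auto simp: r_def field_simps)
    \<comment> \<open>The weight of \<open>b0\<close> is kept away from zero so that it outweighs
      all bands other than \<open>a0\<close> on the side of \<open>a0\<close>; the weight of
      \<open>a0\<close> that balance dictates is then nonnegative.\<close>
    define lo where "lo e = (if e = b0 then n * r / m else 0)" for e
    define hi where "hi e = (if e = b0 then 2 * n * r / m else r / h e)" for e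
    have lohi: "lo e \<le> hi e" if "e \<in> F" for e
      using r n m0 hF[OF that] by (auto simp: lo_def hi_def divide_right_mono)
    have "PiE F (\<lambda>e. {lo e..hi e}) \<subseteq> slice \<tau> a0 (region \<tau> c)"
    proof
      fix x assume x: "x \<in> PiE F (\<lambda>e. {lo e..hi e})"
      define w where "w = fill \<tau> a0 x"
      have wx: "w e = x e" if "e \<in> F" for e using that by (simp add: w_def fill_other F_def)
      have wF: "lo e \<le> w e" "w e \<le> hi e" if "e \<in> F" for e using x that by (auto simp: wx PiE_iff)
      have bal: "imbalance \<tau> w = 0"
        unfolding w_def using defect_loose[OF ie a0b(2)] by (intro imbalance_fill) auto
      have "sum w (side s \<tau>) = sum w (side (\<not> s) \<tau>)"
        using bal sum_defect_zero[OF ie, of w] by (cases s) auto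
      moreover have "sum w (side s \<tau>) = w a0 + sum w (side s \<tau> - {a0})"
        using a0 by (intro sum.remove) auto
      moreover have "sum w (side (\<not> s) \<tau>) = w b0 + sum w (side (\<not> s) \<tau> - {b0})"
        using b0 by (intro sum.remove) auto
      ultimately have wa0: "w a0 = w b0 + sum w (side (\<not> s) \<tau> - {b0}) - sum w (side s \<tau> - {a0})" by linarith
      have wb0: "n * r / m \<le> w b0" "w b0 \<le> 2 * n * r / m"
        using wF[OF b0b(2)] by (auto simp: lo_def hi_def)
      have small: "0 \<le> w e" "w e \<le> r / h e" if "e \<in> F" "e \<noteq> b0" for e
        using wF[OF that(1)] that(2) by (auto simp: lo_def hi_def)
      have rm: "0 \<le> w e" "w e \<le> r / m" if "e \<in> F" "e \<noteq> b0" "e \<in> loose \<tau>" for e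
      proof -
        show "0 \<le> w e" using small that by auto
        have "w e \<le> r / h e" using small that by auto
        also have "\<dots> \<le> r / m" using hm[OF that(3)] m0 r by (intro divide_left_mono) (auto simp: h_def)
        finally show "w e \<le> r / m" .
      qed
      have inF: "e \<in> F" "e \<noteq> b0" "e \<in> loose \<tau>" if "e \<in> side (\<not> s) \<tau> - {b0} \<or> e \<in> side s \<tau> - {a0}" for e
        using that side_disjoint(2)[OF a0(1)] side_disjoint(2)[OF b0(1)] sub[of s] sub[of "\<not> s"]
        by (auto simp: F_def; cases s; auto)+
      have sum_up: "sum w S \<le> n * r / m" "0 \<le> sum w S" if "S = side (\<not> s) \<tau> - {b0} \<or> S = side s \<tau> - {a0}" for S
      proof -
        have S: "S \<subseteq> bands \<tau>" "finite S" using that sub by (auto intro: finite_subset[OF _ finite_bands])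
        have "sum w S \<le> (\<Sum>e\<in>S. r / m)" using rm inF that by (intro sum_mono) blast
        also have "\<dots> = real (card S) * (r / m)" by simp
        also have "\<dots> \<le> n * (r / m)"
          using card_mono[OF _ S(1)] r m0 by (intro mult_right_mono) (auto simp: n_def)
        finally show "sum w S \<le> n * r / m" by simp
        show "0 \<le> sum w S" using rm inF that by (intro sum_nonneg) blast
      qed
      have a0w: "0 \<le> w a0" "w a0 \<le> 3 * n * r / m"
        using sum_up(1)[of "side s \<tau> - {a0}"] sum_up(2)[of "side s \<tau> - {a0}"]
          sum_up(1)[of "side (\<not> s) \<tau> - {b0}"] sum_up(2)[of "side (\<not> s) \<tau> - {b0}"] wb0
        unfolding wa0 by simp_all
      have pos: "0 \<le> w e" if "e \<in> bands \<tau>" for e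
        using that a0w(1) small(1) wb0(1) n r m0 by (cases "e = a0"; cases "e = b0") (auto simp: F_def intro: order_trans[OF _ wb0(1)])
      have "(\<Sum>e\<in>bands \<tau>. c e * w e) = c a0 * w a0 + (c b0 * w b0 + (\<Sum>e\<in>F - {b0}. c e * w e))"
        using a0b b0b F by (simp add: sum.remove[of "bands \<tau>" a0] sum.remove[of F b0] F_def[symmetric])
      also have "\<dots> \<le> 3 * n * r + (2 * n * r + (\<Sum>e\<in>F - {b0}. r))"
      proof (intro add_mono sum_mono)
        have "c a0 * w a0 \<le> m * (3 * n * r / m)" using a0m a0w m0 by (intro mult_mono) auto
        then show "c a0 * w a0 \<le> 3 * n * r" using m0 by simp
        have "c b0 * w b0 \<le> m * (2 * n * r / m)" using wb0 m0 b0 by (intro mult_mono) (auto intro: order_trans[OF _ wb0(1)] simp: n r)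
        then show "c b0 * w b0 \<le> 2 * n * r" using m0 by simp
        fix e assume e: "e \<in> F - {b0}"
        have "c e * w e \<le> h e * (r / h e)"
          using e small[of e] hat_ge[of c e \<tau>] hF[of e] by (intro mult_mono) (auto simp: h_def)
        then show "c e * w e \<le> r" using hF[of e] e by simp
      qed
      also have "(\<Sum>e\<in>F - {b0}. r) \<le> n * r"
        using r b0b F by (simp add: n_def mult_right_mono)
      finally have "(\<Sum>e\<in>bands \<tau>. c e * w e) \<le> 1" using r by simp
      moreover have "w \<in> extensional (bands \<tau>)"
        using x a0b by (auto simp: w_def fill_def extensional_def PiE_iff F_def)
      ultimately have "w \<in> region \<tau> c"
        using pos bal by (auto simp: region_def weights_iff PiE_iff)
      then show "x \<in> slice \<tau> a0 (region \<tau> c)"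
        using x by (auto simp: slice_def w_def space_PiM F_def PiE_iff)
    qed
    then have "emeasure (lb F) (PiE F (\<lambda>e. {lo e..hi e})) \<le> emeasure (lb F) (slice \<tau> a0 (region \<tau> c))"
      using a0b by (intro emeasure_mono) (simp_all add: F_def)
    then have 1: "ennreal (\<Prod>e\<in>F. hi e - lo e) \<le> emeasure (area \<tau>) (region \<tau> c)"
      using emeasure_lb_box[OF F(1) lohi] area by simp
    have "hat_vol \<tau> c / (6 * n) ^ card (bands \<tau>) = r ^ card (bands \<tau>) / (\<Prod>e\<in>F. h e)"
      by (simp add: hv r_def power_divide)
    also have "\<dots> \<le> r ^ card F / (\<Prod>e\<in>F. h e)"
      using r prod0 by (intro divide_right_mono power_decreasing) (auto simp: F)
    also have "\<dots> = (\<Prod>e\<in>F. r / h e)" by (simp add: prod_dividef)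
    also have "\<dots> \<le> (\<Prod>e\<in>F. hi e - lo e)"
    proof (intro prod_mono conjI)
      fix e assume e: "e \<in> F"
      show "0 \<le> r / h e" using hF[OF e] r by auto
      show "r / h e \<le> hi e - lo e"
      proof (cases "e = b0")
        case True
        have "r / h b0 = 1 * r / m" using hb[OF b0(1)] b0 by (simp add: h_def)
        also have "\<dots> \<le> n * r / m" using n r m0 by (intro divide_right_mono mult_right_mono) auto
        finally show ?thesis using True by (simp add: hi_def lo_def field_simps)
      qed (simp add: hi_def lo_def)
    qed
    finally have "ennreal (hat_vol \<tau> c / (6 * n) ^ card (bands \<tau>)) \<le> ennreal (\<Prod>e\<in>F. hi e - lo e)"
      by (rule ennreal_leI)
    with 1 show ?thesis by (rule order_trans[rotated])
  qed
qed

text \<open>One constant for both directions of the comparison: the upper constant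
  \<open>n ^ n\<close> is dominated by the inverse \<open>(6 * n) ^ n\<close> of the lower
  one.\<close>

definition distortion :: "nat \<Rightarrow> real" where
  "distortion n = (6 * real n) ^ n"

lemma hat_pos: "\<forall>e\<in>bands \<tau>. c e > 0 \<Longrightarrow> e \<in> bands \<tau> \<Longrightarrow> hat \<tau> c e > 0"
  using hat_ge[of c e \<tau>] by force

lemma card_bands_pos: "unequal_ends \<tau> \<Longrightarrow> card (bands \<tau>) > 0"
  using win_in_bands[of \<tau> True] by (auto simp: card_gt_0_iff)

lemma hat_vol_pos:
  assumes u: "unequal_ends \<tau>" and c: "\<forall>e\<in>bands \<tau>. c e > 0"
  shows "hat_vol \<tau> c > 0"
proof -
  have "side True \<tau> \<noteq> {}" using u by (simp add: unequal_ends_def)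
  then obtain a where "a \<in> side True \<tau>" "c a = Min (c ` side True \<tau>)"
    using obtain_Min[OF finite_side] by blast
  then have "mid \<tau> c > 0" using bspec[OF c, of a] side_subset[of True \<tau>] by (auto simp: mid_def less_max_iff_disj)
  moreover have "(\<Prod>e\<in>bands \<tau>. hat \<tau> c e) > 0" using hat_pos[OF c] by (intro prod_pos) blast
  ultimately show ?thesis by (simp add: hat_vol_def)
qed

lemma emeasure_region:
  assumes u: "unequal_ends \<tau>" and c: "\<forall>e\<in>bands \<tau>. c e > 0"
  shows "emeasure (area \<tau>) (region \<tau> c) = ennreal (vol \<tau> c)"
  using vol_estimates(1)[OF assms] unfolding vol_def
  by (intro emeasure_eq_ennreal_measure) (auto simp: top_unique)

lemma vol_bounds:
  assumes u: "unequal_ends \<tau>" and c: "\<forall>e\<in>bands \<tau>. c e > 0"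
  shows "vol \<tau> c \<le> distortion (card (bands \<tau>)) * hat_vol \<tau> c"
    and "hat_vol \<tau> c \<le> distortion (card (bands \<tau>)) * vol \<tau> c"
    and "vol \<tau> c > 0"
proof -
  define n where "n = card (bands \<tau>)"
  have n: "n > 0" using card_bands_pos[OF u] by (simp add: n_def)
  have p: "hat_vol \<tau> c > 0" by (rule hat_vol_pos[OF u c])
  have d: "distortion n > 0" using n by (simp add: distortion_def)
  have "vol \<tau> c \<le> real n ^ n * hat_vol \<tau> c"
    using vol_estimates(1)[OF u c] p unfolding emeasure_region[OF u c] n_def by (subst (asm) ennreal_le_iff) auto
  also have "\<dots> \<le> distortion n * hat_vol \<tau> c"
    using p unfolding distortion_def by (intro mult_right_mono power_mono) auto
  finally show "vol \<tau> c \<le> distortion (card (bands \<tau>)) * hat_vol \<tau> c" by (simp add: n_def)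
  have "hat_vol \<tau> c / distortion n \<le> vol \<tau> c"
    using vol_estimates(2)[OF u c] unfolding emeasure_region[OF u c] n_def distortion_def
    by (subst (asm) ennreal_le_iff) (auto simp: vol_def)
  then show "hat_vol \<tau> c \<le> distortion (card (bands \<tau>)) * vol \<tau> c"
    using d by (simp add: n_def field_simps)
  moreover have "hat_vol \<tau> c / distortion n > 0" using p d by simp
  ultimately show "vol \<tau> c > 0"
    using \<open>hat_vol \<tau> c / distortion n \<le> vol \<tau> c\<close> by linarith
qed

section \<open>Comparison of a region with the regions of its successors\<close>

lemma pairing_split:
  assumes u: "unequal_ends \<tau>"
  shows "(\<Sum>e\<in>bands \<tau>. add_win s \<tau> c e * split_weight s \<tau> w e) = (\<Sum>e\<in>bands \<tau>. c e * w e)"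
proof -
  define t b where "t = win s \<tau>" and "b = lose s \<tau>"
  have tb: "t \<in> bands \<tau>" "b \<in> bands \<tau> - {t}" "t \<noteq> b"
    using win_in_bands[OF u] win_neq_lose[OF u, of s] by (auto simp: t_def b_def)
  have s: "(\<Sum>e\<in>bands \<tau>. f e) = f t + (f b + (\<Sum>e\<in>bands \<tau> - {t} - {b}. f e))" for f :: "nat \<Rightarrow> real"
    using tb by (simp add: sum.remove[of "bands \<tau>" t] sum.remove[of "bands \<tau> - {t}" b])
  have "(\<Sum>e\<in>bands \<tau> - {t} - {b}. add_win s \<tau> c e * split_weight s \<tau> w e) = (\<Sum>e\<in>bands \<tau> - {t} - {b}. c e * w e)"
    by (intro sum.cong) (auto simp: add_win_def split_weight_def t_def b_def)
  then show ?thesis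
    unfolding s using tb(3) by (simp add: add_win_def split_weight_def algebra_simps flip: t_def b_def)
qed

lemma add_win_pos:
  assumes u: "unequal_ends \<tau>" and c: "\<forall>e\<in>bands \<tau>. c e > 0" and e: "e \<in> bands \<tau>"
  shows "add_win s \<tau> c e > 0" "add_win s \<tau> c e \<ge> c e"
  using bspec[OF c win_in_bands[OF u, of s]] bspec[OF c e] by (auto simp: add_win_def)

text \<open>By invariance the preimages of the two sets \<open>A s\<close> have the same volumes as
  these sets, and they lie in \<open>R\<close>. A weight in both preimages has equal competing
  weights, so their overlap is null.\<close>

lemma emeasure_area_children_ge:
  assumes u: "unequal_ends \<tau>" and R: "R \<in> sets (lb (bands \<tau>))"
    and A: "\<And>s. A s \<in> sets (lb (bands \<tau>))" "\<And>s. A s \<subseteq> weights (move s \<tau>)"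
    and sub: "\<And>s w. w \<in> weights \<tau> \<Longrightarrow> split_weight s \<tau> w \<in> A s \<Longrightarrow> w \<in> R"
  shows "(\<Sum>s\<in>UNIV. emeasure (area (move s \<tau>)) (A s)) \<le> emeasure (area \<tau>) R"
proof -
  define P where "P s = {w \<in> space (area \<tau>). split_weight s \<tau> w \<in> A s}" for s
  have sp: "space (area \<tau>) = space (lb (bands \<tau>))" by (simp add: space_area space_PiM)
  have P: "P s \<in> sets (area \<tau>)" for s
    using measurable_sets[OF measurable_split_weight[OF u] A(1), of s s]
    by (simp add: sp P_def vimage_def Int_def conj_commute)
  have eq: "emeasure (area \<tau>) (P s) = emeasure (area (move s \<tau>)) (A s)" for s
    unfolding P_def by (rule emeasure_area_split[OF u A(1)])
  have PW: "w \<in> weights \<tau>" "w (lose s \<tau>) \<le> w (win s \<tau>)" if "w \<in> P s" for w s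
    using that A(2)[of s] split_weight_weights_iff[OF u, of w s] by (auto simp: P_def space_area PiE_def)
  have PR: "P s \<subseteq> R" for s using PW sub by (auto simp: P_def)
  define N where "N = {w \<in> space (area \<tau>). w (win True \<tau>) = w (win False \<tau>)}"
  have N: "emeasure (area \<tau>) N = 0" unfolding N_def by (rule emeasure_area_equal[OF u])
  have Ns: "N \<in> sets (area \<tau>)"
  proof -
    have "{w \<in> space (lb (bands \<tau>)). w (win True \<tau>) = w (win False \<tau>)} \<in> sets (lb (bands \<tau>))"
      using win_in_bands[OF u] by measurable
    then show ?thesis by (simp add: N_def sp)
  qed
  have "P True \<inter> P False \<subseteq> N"
  proof
    fix w assume "w \<in> P True \<inter> P False"
    then show "w \<in> N" using PW(2)[of w True] PW(2)[of w False] by (auto simp: N_def P_def)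
  qed
  then have int: "emeasure (area \<tau>) (P True \<inter> P False) = 0"
    using N Ns by (metis emeasure_eq_0)
  have "(\<Sum>s\<in>UNIV. emeasure (area (move s \<tau>)) (A s)) = emeasure (area \<tau>) (P True) + emeasure (area \<tau>) (P False)"
    by (simp add: UNIV_bool eq)
  also have "\<dots> = emeasure (area \<tau>) (P True \<union> P False)"
  proof -
    have "emeasure (area \<tau>) (P False) = emeasure (area \<tau>) (P False - P True)"
      using emeasure_Diff_null_set[of "P True \<inter> P False" "area \<tau>" "P False"] int P
      by (simp add: null_sets_def Diff_Int_distrib Diff_Int)
    then show ?thesis
      using P plus_emeasure[of "P True" "area \<tau>" "P False - P True"] by auto
  qed
  also have "\<dots> \<le> emeasure (area \<tau>) R"
    using PR R by (intro emeasure_mono) auto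
  finally show ?thesis .
qed

text \<open>Off the null wall of equal weights every weight in \<open>B\<close> has a strict winner,
  whose move is feasible, and is carried into the corresponding set \<open>A s\<close>.\<close>

lemma emeasure_area_children_le:
  assumes u: "unequal_ends \<tau>" and B: "B \<in> sets (lb (bands \<tau>))" "B \<subseteq> weights \<tau>"
    and A: "\<And>s. feasible s \<tau> \<Longrightarrow> A s \<in> sets (lb (bands \<tau>))"
    and sub: "\<And>s w. w \<in> B \<Longrightarrow> w (win s \<tau>) > w (lose s \<tau>) \<Longrightarrow> split_weight s \<tau> w \<in> A s"
  shows "emeasure (area \<tau>) B \<le> (\<Sum>s | feasible s \<tau>. emeasure (area (move s \<tau>)) (A s))"
proof -
  define P where "P s = {w \<in> space (area \<tau>). split_weight s \<tau> w \<in> A s}" for s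
  have sp: "space (area \<tau>) = space (lb (bands \<tau>))" by (simp add: space_area space_PiM)
  have P: "P s \<in> sets (area \<tau>)" if "feasible s \<tau>" for s
    using measurable_sets[OF measurable_split_weight[OF u] A[OF that], of s]
    by (simp add: sp P_def vimage_def Int_def conj_commute)
  define N where "N = {w \<in> space (area \<tau>). w (win True \<tau>) = w (win False \<tau>)}"
  have N: "emeasure (area \<tau>) N = 0" unfolding N_def by (rule emeasure_area_equal[OF u])
  have Ns: "N \<in> sets (area \<tau>)"
  proof -
    have "{w \<in> space (lb (bands \<tau>)). w (win True \<tau>) = w (win False \<tau>)} \<in> sets (lb (bands \<tau>))"
      using win_in_bands[OF u] by measurable
    then show ?thesis by (simp add: N_def sp)
  qed
  have ie: "interval_exchange \<tau>" using u by (simp add: unequal_ends_def)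
  have "B \<subseteq> N \<union> (\<Union>s\<in>{s. feasible s \<tau>}. P s)"
  proof
    fix w assume w: "w \<in> B"
    have wsp: "w \<in> space (area \<tau>)" using w B(2) by (auto simp: space_area weights_def)
    show "w \<in> N \<union> (\<Union>s\<in>{s. feasible s \<tau>}. P s)"
    proof (cases "w (win True \<tau>) = w (win False \<tau>)")
      case True then show ?thesis using wsp by (simp add: N_def)
    next
      case False
      then obtain s where s: "w (win s \<tau>) > w (lose s \<tau>)"
        by (metis (full_types) linorder_neqE_linordered_idom)
      have "feasible s \<tau>" using feasible_if_greater[OF ie _ s] w B(2) by blast
      then show ?thesis using sub[OF w s] wsp by (auto simp: P_def)
    qed
  qed
  then have "emeasure (area \<tau>) B \<le> emeasure (area \<tau>) (N \<union> (\<Union>s\<in>{s. feasible s \<tau>}. P s))"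
    using P Ns by (intro emeasure_mono sets.Un sets.finite_UN) auto
  also have "\<dots> \<le> emeasure (area \<tau>) N + emeasure (area \<tau>) (\<Union>s\<in>{s. feasible s \<tau>}. P s)"
    using P Ns by (intro emeasure_subadditive sets.finite_UN) auto
  also have "\<dots> \<le> 0 + (\<Sum>s | feasible s \<tau>. emeasure (area \<tau>) (P s))"
    unfolding N using P by (intro add_mono emeasure_subadditive_finite) auto
  also have "\<dots> = (\<Sum>s | feasible s \<tau>. emeasure (area (move s \<tau>)) (A s))"
    using A by (simp add: P_def emeasure_area_split[OF u])
  finally show ?thesis .
qed

text \<open>Read as probabilities, the proportions of the successors add up to at most one. The same
  statement, applied to a raised functional, turns its volume into a comparison function in
  \<open>small_winners\<close>.\<close>

lemma vol_children:
  assumes u: "unequal_ends \<tau>" and c: "\<forall>e\<in>bands \<tau>. c e > 0"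
    and u': "\<And>s. s \<in> S \<Longrightarrow> unequal_ends (move s \<tau>)"
  shows "(\<Sum>s\<in>S. vol (move s \<tau>) (add_win s \<tau> c)) \<le> vol \<tau> c"
proof -
  have pos: "\<forall>e\<in>bands (move s \<tau>). add_win s \<tau> c e > 0" for s
    using add_win_pos(1)[OF u c] u by simp
  have "ennreal (\<Sum>s\<in>S. vol (move s \<tau>) (add_win s \<tau> c)) = (\<Sum>s\<in>S. ennreal (vol (move s \<tau>) (add_win s \<tau> c)))"
    by (intro sum_ennreal[symmetric]) (simp add: vol_def)
  also have "\<dots> = (\<Sum>s\<in>S. emeasure (area (move s \<tau>)) (region (move s \<tau>) (add_win s \<tau> c)))"
    using u' pos by (intro sum.cong refl emeasure_region[symmetric]) auto
  also have "\<dots> \<le> (\<Sum>s\<in>UNIV. emeasure (area (move s \<tau>)) (region (move s \<tau>) (add_win s \<tau> c)))"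
    by (intro sum_mono2) auto
  also have "\<dots> \<le> emeasure (area \<tau>) (region \<tau> c)"
  proof (rule emeasure_area_children_ge[OF u])
    show "region (move s \<tau>) (add_win s \<tau> c) \<in> sets (lb (bands \<tau>))" for s
      using sets_region(1)[of "move s \<tau>" "add_win s \<tau> c"] u by simp
    show "w \<in> region \<tau> c" if "w \<in> weights \<tau>" "split_weight s \<tau> w \<in> region (move s \<tau>) (add_win s \<tau> c)" for s w
      using that pairing_split[OF u, of s c w] u by (auto simp: region_def)
  qed (auto simp: region_def)
  also have "\<dots> = ennreal (vol \<tau> c)" by (rule emeasure_region[OF u c])
  finally show ?thesis by (subst (asm) ennreal_le_iff) (auto simp: vol_def)
qed

section \<open>Balanced functionals recur\<close>

text \<open>All exchanges share the labels \<open>E\<close>, so functionals are carried along paths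
  without relabelling. The assumption \<open>all_compete\<close> yields, for any proper set of large
  bands and from every state, a path on which a band outside this set has to compete; finiteness of
  \<open>X\<close> bounds the lengths of such paths.\<close>

locale splitting_system =
  fixes E :: "nat set" and X :: "exchange set"
  assumes finite_X: "finite X"
    and unequal: "\<And>\<tau>. \<tau> \<in> X \<Longrightarrow> unequal_ends \<tau>"
    and bands: "\<And>\<tau>. \<tau> \<in> X \<Longrightarrow> bands \<tau> = E"
    and move_X: "\<And>\<tau> s. \<tau> \<in> X \<Longrightarrow> feasible s \<tau> \<Longrightarrow> move s \<tau> \<in> X"
    and all_compete: "\<And>\<tau>. \<tau> \<in> X \<Longrightarrow> \<exists>ss. feasible_path \<tau> ss \<and> competitors \<tau> ss = E"
    and nonempty: "X \<noteq> {}"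
begin

definition pos :: "(nat \<Rightarrow> real) \<Rightarrow> bool" where
  "pos c \<longleftrightarrow> (\<forall>e\<in>E. c e > 0)"

lemma finite_E [simp]: "finite E"
  using nonempty bands by (metis ex_in_conv finite_bands)

lemma side_nonempty: "\<tau> \<in> X \<Longrightarrow> side s \<tau> \<noteq> {}"
  using unequal[of \<tau>] by (cases s) (auto simp: unequal_ends_def)

lemma side_E: "\<tau> \<in> X \<Longrightarrow> side s \<tau> \<subseteq> E"
  using side_subset[of s \<tau>] bands by blast

lemma win_E: "\<tau> \<in> X \<Longrightarrow> win s \<tau> \<in> E"
  using win_in_bands[OF unequal] bands by blast

lemma pos_add_win: "\<tau> \<in> X \<Longrightarrow> pos c \<Longrightarrow> pos (add_win s \<tau> c)"
  using add_win_pos(1)[OF unequal, of \<tau> c] bands unfolding pos_def by blast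

lemma add_win_ge: "\<tau> \<in> X \<Longrightarrow> pos c \<Longrightarrow> e \<in> E \<Longrightarrow> c e \<le> add_win s \<tau> c e"
  using add_win_pos(2)[OF unequal, of \<tau> c] bands unfolding pos_def by blast

lemma add_win_le:
  assumes "\<tau> \<in> X" "\<forall>e\<in>E. c e \<le> L" "e \<in> E" "0 \<le> L"
  shows "add_win s \<tau> c e \<le> 2 * L"
  using bspec[OF assms(2) win_E[OF assms(1), of s]] bspec[OF assms(2,3)] assms(4)
  by (auto simp: add_win_def)

lemma Min_image_mono:
  fixes c c' :: "nat \<Rightarrow> real"
  assumes "finite A" "finite B" "B \<noteq> {}" "\<And>e. e \<in> B \<Longrightarrow> \<exists>a\<in>A. c a \<le> c' e"
  shows "Min (c ` A) \<le> Min (c' ` B)"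
proof -
  obtain e where "e \<in> B" "c' e = Min (c' ` B)" using obtain_Min[OF assms(2,3)] by blast
  then obtain a where "a \<in> A" "c a \<le> Min (c' ` B)" using assms(4) by metis
  moreover have "Min (c ` A) \<le> c a" using \<open>a \<in> A\<close> assms(1) by simp
  ultimately show ?thesis by linarith
qed

context
  fixes \<tau> c s
  assumes \<tau>: "\<tau> \<in> X" and c: "pos c" and f: "feasible s \<tau>"
begin

lemma \<tau>': "move s \<tau> \<in> X"
  using move_X[OF \<tau> f] .

lemma Min_side_mono: "Min (c ` side r \<tau>) \<le> Min (add_win s \<tau> c ` side r (move s \<tau>))"
proof (rule Min_image_mono)
  fix e assume e: "e \<in> side r (move s \<tau>)"
  have ge: "e \<in> E \<Longrightarrow> c e \<le> add_win s \<tau> c e" for e using add_win_ge[OF \<tau> c] .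
  show "\<exists>a\<in>side r \<tau>. c a \<le> add_win s \<tau> c e"
  proof (cases "e \<in> side r \<tau>")
    case True
    then show ?thesis using ge side_E[OF \<tau>, of r] by blast
  next
    case False
    \<comment> \<open>Only the loser can newly enter a side, and it joins that of a loose winner.
      Its new coefficient exceeds that of the winner, which already belonged to this side.\<close>
    have r: "r = s \<and> win s \<tau> \<in> side s \<tau> \<and> e = lose s \<tau>"
    proof (cases "r = s")
      case True
      then show ?thesis using e False side_move(1)[OF unequal[OF \<tau>], of s] by (auto split: if_splits)
    next
      case neq: False
      then have "r = (\<not> s)" by auto
      then show ?thesis using e False side_move(2)[OF unequal[OF \<tau>], of s] by (auto split: if_splits)
    qed
    have "c (win s \<tau>) \<le> add_win s \<tau> c e"
      using r c win_E[OF \<tau>, of "\<not> s"] by (auto simp: add_win_def pos_def less_imp_le)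
    then show ?thesis using r by blast
  qed
qed (use side_nonempty[OF \<tau>'] in auto)

text \<open>The delicate case is a loser that ceases to be loose: the opposite minimum no longer
  counts for it, but this minimum is at most the coefficient of the winner, which has just been
  added.\<close>

lemma hat_mono:
  assumes e: "e \<in> E"
  shows "hat \<tau> c e \<le> hat (move s \<tau>) (add_win s \<tau> c) e"
proof -
  note sm = side_move[OF unequal[OF \<tau>], of s]
  have ge: "c e \<le> add_win s \<tau> c e" using add_win_ge[OF \<tau> c e] .
  have ge': "add_win s \<tau> c e \<le> hat (move s \<tau>) (add_win s \<tau> c) e" by (rule hat_ge)
  show ?thesis
  proof (cases "e \<in> loose \<tau>")
    case False
    then show ?thesis using ge ge' by (simp add: hat_def)
  next
    case True
    then obtain r where r: "e \<in> side r \<tau>" by (metis Un_iff)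
    show ?thesis
    proof (cases "e \<in> side r (move s \<tau>)")
      case True
      show ?thesis
        unfolding hat_side[OF r] hat_side[OF True] using ge Min_side_mono[of "\<not> r"] by (intro max.mono)
    next
      case False
      have r': "r = (\<not> s) \<and> win s \<tau> \<in> side s \<tau> \<and> e = lose s \<tau>"
      proof (cases "r = s")
        case True
        then show ?thesis using r False sm(1) by (auto split: if_splits)
      next
        case neq: False
        then have "r = (\<not> s)" by auto
        then show ?thesis using r False sm(2) by (auto split: if_splits)
      qed
      have "Min (c ` side (\<not> r) \<tau>) \<le> c (win s \<tau>)" using r' by simp
      moreover have "add_win s \<tau> c e = c e + c (win s \<tau>)" using r' by (simp add: add_win_def)
      moreover have "c e > 0" "c (win s \<tau>) > 0" using c e win_E[OF \<tau>] by (auto simp: pos_def)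
      ultimately show ?thesis
        unfolding hat_side[OF r] using ge' by linarith
    qed
  qed
qed

text \<open>A band that loses becomes at least as large as the band that beats it: this is how small
  bands become large.\<close>

lemma hat_lose: "hat \<tau> c (win s \<tau>) \<le> hat (move s \<tau>) (add_win s \<tau> c) (lose s \<tau>)"
proof -
  note sm = side_move[OF unequal[OF \<tau>], of s]
  define t b where "t = win s \<tau>" and "b = lose s \<tau>"
  have pos: "c t > 0" "c b > 0" using c win_E[OF \<tau>] by (auto simp: pos_def t_def b_def)
  have cb: "add_win s \<tau> c b = c b + c t" by (simp add: add_win_def t_def b_def)
  have ge': "add_win s \<tau> c b \<le> hat (move s \<tau>) (add_win s \<tau> c) b" by (rule hat_ge)
  have tn: "t \<notin> side (\<not> s) \<tau>" using win_not_side[OF unequal[OF \<tau>]] by (simp add: t_def)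
  show ?thesis
  proof (cases "t \<in> side s \<tau>")
    case False
    then have "t \<notin> side True \<tau>" "t \<notin> side False \<tau>" using tn by (cases s; simp)+
    then show ?thesis using ge' cb pos by (simp add: hat_def flip: t_def b_def)
  next
    case True
    note h = hat_side[OF True]
    show ?thesis
    proof (cases "b \<in> side (\<not> s) \<tau>")
      case False
      then have "b \<in> side s (move s \<tau>)" using sm(1) True by (simp add: t_def b_def)
      then have "hat (move s \<tau>) (add_win s \<tau> c) b = max (c b + c t) (Min (add_win s \<tau> c ` side (\<not> s) (move s \<tau>)))"
        using hat_side[of b s] cb by simp
      then show ?thesis using Min_side_mono[of "\<not> s"] pos h[of c]
        unfolding t_def[symmetric] b_def[symmetric] by linarith
    next
      case b: True
      have "Min (c ` side (\<not> s) \<tau>) \<le> c b" using b by simp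
      then show ?thesis using h ge' cb pos by (simp flip: t_def b_def)
    qed
  qed
qed

lemma mid_mono: "mid \<tau> c \<le> mid (move s \<tau>) (add_win s \<tau> c)"
  unfolding mid_def using Min_side_mono by (intro max.mono)

end

lemma hat_le:
  assumes \<tau>: "\<tau> \<in> X" and L: "\<forall>e\<in>E. c e \<le> L" and e: "e \<in> E"
  shows "hat \<tau> c e \<le> L"
proof -
  have "Min (c ` side r \<tau>) \<le> L" for r
  proof -
    obtain a where "a \<in> side r \<tau>" "c a = Min (c ` side r \<tau>)"
      using obtain_Min[OF finite_side side_nonempty[OF \<tau>]] by blast
    moreover from this have "c a \<le> L" using L side_E[OF \<tau>, of r] by blast
    ultimately show ?thesis by simp
  qed
  then show ?thesis using L e by (auto simp: hat_def)
qed

text \<open>The \<open>hat\<close> value of a loose band bounds the minimum of the opposite side as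
  well, so a small loose band always has a small potential partner. Hence small loose bands are
  never confined to one side.\<close>

lemma small_side:
  assumes \<tau>: "\<tau> \<in> X" and u: "u \<in> side r \<tau>" "hat \<tau> c u < \<theta>"
  obtains q where "q \<in> side (\<not> r) \<tau>" "c q = Min (c ` side (\<not> r) \<tau>)" "hat \<tau> c q < \<theta>" "c q < \<theta>"
proof -
  obtain q where q: "q \<in> side (\<not> r) \<tau>" "c q = Min (c ` side (\<not> r) \<tau>)"
    using obtain_Min[OF finite_side side_nonempty[OF \<tau>]] by blast
  have cq: "c q < \<theta>" "c u < \<theta>" using u(2) q(2) unfolding hat_side[OF u(1)] by auto
  have "Min (c ` side r \<tau>) \<le> c u" using u(1) by simp
  then have "hat \<tau> c q < \<theta>" using hat_side[OF q(1), of c] cq by simp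
  with q cq that show ?thesis by blast
qed

text \<open>When two large bands compete, the small ones are not affected.\<close>

lemma hat_large_move:
  assumes \<tau>: "\<tau> \<in> X" and c: "pos c" and f: "feasible s \<tau>"
    and small: "\<And>e. e \<in> E - S \<Longrightarrow> hat \<tau> c e < \<theta>" and large: "\<And>e. e \<in> S \<Longrightarrow> \<theta> \<le> hat \<tau> c e"
    and S: "win s \<tau> \<in> S" "lose s \<tau> \<in> S" and e: "e \<in> E - S"
  shows "hat (move s \<tau>) (add_win s \<tau> c) e = hat \<tau> c e"
proof -
  note sm = side_move[OF unequal[OF \<tau>], of s]
  have el: "e \<noteq> lose s \<tau>" using S e by blast
  have same: "x \<in> side r (move s \<tau>) \<longleftrightarrow> x \<in> side r \<tau>" if "x \<noteq> lose s \<tau>" for x r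
    using sm that by (cases "r = s"; cases s; cases r) auto
  have ce: "add_win s \<tau> c x = c x" if "x \<noteq> lose s \<tau>" for x using that by (simp add: add_win_def)
  show ?thesis
  proof (cases "e \<in> loose \<tau>")
    case False
    then show ?thesis using same[OF el] ce[OF el] by (simp add: hat_def)
  next
    case True
    then obtain r where r: "e \<in> side r \<tau>" by (metis Un_iff)
    obtain q where q: "q \<in> side (\<not> r) \<tau>" "c q = Min (c ` side (\<not> r) \<tau>)" "hat \<tau> c q < \<theta>"
      using small_side[OF \<tau> r small[OF e]] by blast
    have "q \<notin> S" using q(3) large by force
    then have ql: "q \<noteq> lose s \<tau>" using S by blast
    have "Min (add_win s \<tau> c ` side (\<not> r) (move s \<tau>)) \<le> add_win s \<tau> c q"
      using q same[OF ql] by (intro Min_le) auto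
    then have "hat (move s \<tau>) (add_win s \<tau> c) e \<le> hat \<tau> c e"
      using same[OF el, of r] r by (simp add: hat_side[of e r] ce[OF el] ce[OF ql] q(2))
    then show ?thesis using hat_mono[OF \<tau> c f, of e] e by simp
  qed
qed

abbreviation n :: nat where "n \<equiv> card E"

lemma n_pos: "n > 0"
  using nonempty unequal card_bands_pos bands by (metis ex_in_conv)

lemma distortion_ge_1: "distortion n \<ge> 1"
  unfolding distortion_def using n_pos by (intro one_le_power) simp

lemma vol_bounds':
  assumes "\<tau> \<in> X" "pos c"
  shows "vol \<tau> c \<le> distortion n * hat_vol \<tau> c" "hat_vol \<tau> c \<le> distortion n * vol \<tau> c" "vol \<tau> c > 0"
    "hat_vol \<tau> c > 0"
  using vol_bounds[OF unequal[OF assms(1)], of c] hat_vol_pos[OF unequal[OF assms(1)], of c] assms bands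
  by (auto simp: pos_def)

lemma vol_children':
  assumes "\<tau> \<in> X" "pos c"
  shows "(\<Sum>s | feasible s \<tau>. vol (move s \<tau>) (add_win s \<tau> c)) \<le> vol \<tau> c"
  using assms bands move_X unequal by (intro vol_children) (auto simp: pos_def)

text \<open>By \<open>hat_large_move\<close> the factors of the small bands do not change, while
  those of the large bands were at least \<theta> and are at most \<open>2 * M\<close> afterwards.
  The square of \<open>distortion n\<close> pays for the passage from \<open>vol\<close> to
  \<open>hat_vol\<close> and back.\<close>

lemma vol_large_move:
  assumes \<tau>: "\<tau> \<in> X" and c: "pos c" and f: "feasible s \<tau>" and \<theta>: "0 < \<theta>"
    and small: "\<And>e. e \<in> E - S \<Longrightarrow> hat \<tau> c e < \<theta>" and large: "\<And>e. e \<in> S \<Longrightarrow> \<theta> \<le> hat \<tau> c e"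
    and S: "win s \<tau> \<in> S" "lose s \<tau> \<in> S" "S \<subseteq> E" and M: "\<forall>e\<in>E. c e \<le> M"
  shows "(\<theta> / (2 * M)) ^ n / (distortion n)\<^sup>2 * vol \<tau> c \<le> vol (move s \<tau>) (add_win s \<tau> c)"
proof -
  let ?\<tau>' = "move s \<tau>" and ?c' = "add_win s \<tau> c"
  note X' = move_X[OF \<tau> f] pos_add_win[OF \<tau> c, of s]
  have M0: "M > 0" using c M win_E[OF \<tau>, of s] unfolding pos_def by (meson less_le_trans)
  have c': "\<forall>e\<in>E. ?c' e \<le> 2 * M" using add_win_le[OF \<tau> M] M0 by auto
  define \<kappa> where "\<kappa> = \<theta> / (2 * M)"
  have \<kappa>0: "\<kappa> > 0" using \<theta> M0 by (simp add: \<kappa>_def)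
  have hp: "hat \<tau> c e > 0" "hat ?\<tau>' ?c' e > 0" if "e \<in> E" for e
    using hat_pos[of \<tau> c e] hat_pos[of ?\<tau>' ?c' e] \<tau> c X' bands that by (auto simp: pos_def)
  have \<kappa>1: "\<kappa> \<le> 1"
  proof -
    have "\<theta> \<le> hat \<tau> c (win s \<tau>)" using large S by blast
    also have "\<dots> \<le> M" using hat_le[OF \<tau> M] win_E[OF \<tau>] by blast
    finally show ?thesis using M0 by (simp add: \<kappa>_def)
  qed
  have h: "\<kappa> * hat ?\<tau>' ?c' e \<le> hat \<tau> c e" if "e \<in> E" for e
  proof (cases "e \<in> S")
    case True
    have "\<kappa> * hat ?\<tau>' ?c' e \<le> \<kappa> * (2 * M)"
      using hat_le[OF X'(1) c' that] \<kappa>0 by simp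
    also have "\<dots> = \<theta>" using M0 by (simp add: \<kappa>_def)
    finally show ?thesis using large[OF True] by simp
  next
    case False
    then have "hat ?\<tau>' ?c' e = hat \<tau> c e"
      using hat_large_move[OF \<tau> c f small large S(1,2)] that by blast
    then show ?thesis using \<kappa>1 hp(1)[OF that] by (simp add: mult_left_le_one_le \<kappa>0 less_imp_le)
  qed
  have "\<kappa> ^ n * (\<Prod>e\<in>E. hat ?\<tau>' ?c' e) = (\<Prod>e\<in>E. \<kappa> * hat ?\<tau>' ?c' e)"
    by (simp add: prod.distrib)
  also have "\<dots> \<le> (\<Prod>e\<in>E. hat \<tau> c e)"
    using h hp \<kappa>0 by (intro prod_mono) (auto simp: less_imp_le)
  finally have P: "\<kappa> ^ n * (\<Prod>e\<in>E. hat ?\<tau>' ?c' e) \<le> (\<Prod>e\<in>E. hat \<tau> c e)" .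
  have pp: "(\<Prod>e\<in>E. hat ?\<tau>' ?c' e) > 0" "(\<Prod>e\<in>E. hat \<tau> c e) > 0" using hp by (auto intro!: prod_pos)
  have "mid \<tau> c > 0"
    using vol_bounds'(4)[OF \<tau> c] pp by (simp add: hat_vol_def bands \<tau> zero_less_divide_iff)
  have "\<kappa> ^ n * hat_vol \<tau> c = \<kappa> ^ n * mid \<tau> c / (\<Prod>e\<in>E. hat \<tau> c e)"
    by (simp add: hat_vol_def bands \<tau>)
  also have "\<dots> \<le> \<kappa> ^ n * mid \<tau> c / (\<kappa> ^ n * (\<Prod>e\<in>E. hat ?\<tau>' ?c' e))"
    using P pp \<kappa>0 \<open>mid \<tau> c > 0\<close> by (intro divide_left_mono) auto
  also have "\<dots> = mid \<tau> c / (\<Prod>e\<in>E. hat ?\<tau>' ?c' e)" using \<kappa>0 by simp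
  also have "\<dots> \<le> hat_vol ?\<tau>' ?c'"
    using mid_mono[OF \<tau> c f] pp by (simp add: hat_vol_def bands X' divide_right_mono)
  finally have hv: "\<kappa> ^ n * hat_vol \<tau> c \<le> hat_vol ?\<tau>' ?c'" .
  have d: "distortion n > 0" using distortion_ge_1 by linarith
  have "\<kappa> ^ n * vol \<tau> c \<le> \<kappa> ^ n * (distortion n * hat_vol \<tau> c)"
    using vol_bounds'(1)[OF \<tau> c] \<kappa>0 by simp
  also have "\<dots> \<le> distortion n * hat_vol ?\<tau>' ?c'"
    using hv d by (simp add: mult.left_commute)
  also have "\<dots> \<le> distortion n * (distortion n * vol ?\<tau>' ?c')"
    using vol_bounds'(2)[OF X'] d by simp
  finally have "\<kappa> ^ n * vol \<tau> c \<le> vol ?\<tau>' ?c' * (distortion n)\<^sup>2"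
    by (simp add: power2_eq_square mult_ac)
  then have "\<kappa> ^ n * vol \<tau> c / (distortion n)\<^sup>2 \<le> vol ?\<tau>' ?c'"
    using d by (simp add: pos_divide_le_eq)
  then show ?thesis unfolding \<kappa>_def by simp
qed

text \<open>The constant \<open>a\<close> is an upper bound for a conditional probability, uniform
  over all states: the share of a region that \<psi> measures.\<close>

definition bounded_by :: "real \<Rightarrow> (exchange \<Rightarrow> (nat \<Rightarrow> real) \<Rightarrow> real) \<Rightarrow> bool" where
  "bounded_by a \<psi> \<longleftrightarrow> (\<forall>\<tau>\<in>X. \<forall>c. pos c \<longrightarrow> \<psi> \<tau> c \<le> a * vol \<tau> c)"

text \<open>The regions of the successors of \<open>\<tau>\<close> partition \<open>region \<tau> c\<close>, so \<open>\<psi> \<tau> c\<close> stands for the volume of the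
  part of \<open>region \<tau> c\<close> in some set of weights that is preserved by splitting.\<close>

definition subharmonic :: "(exchange \<Rightarrow> (nat \<Rightarrow> real) \<Rightarrow> real) \<Rightarrow> bool" where
  "subharmonic \<psi> \<longleftrightarrow> (\<forall>\<tau>\<in>X. \<forall>c. pos c \<longrightarrow>
     \<psi> \<tau> c \<le> (\<Sum>s | feasible s \<tau>. \<psi> (move s \<tau>) (add_win s \<tau> c)))"

text \<open>Averaging over the children with their volumes as weights: the improvement
  \<open>a - b\<close> counts on a proportion of at least \<open>k\<close>, and the general bound
  \<open>a\<close> is used on the rest.\<close>

lemma one_child_bound:
  assumes \<tau>: "\<tau> \<in> X" and c: "pos c" and f: "feasible s \<tau>"
    and \<psi>: "y \<le> (\<Sum>s | feasible s \<tau>. \<phi> s)" "\<And>s. feasible s \<tau> \<Longrightarrow> \<phi> s \<le> a * vol (move s \<tau>) (add_win s \<tau> c)"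
    and b: "\<phi> s \<le> b * vol (move s \<tau>) (add_win s \<tau> c)" "0 \<le> b" "b \<le> a"
    and k: "k * vol \<tau> c \<le> vol (move s \<tau>) (add_win s \<tau> c)"
  shows "y \<le> (a - (a - b) * k) * vol \<tau> c"
proof -
  let ?v = "\<lambda>s. vol (move s \<tau>) (add_win s \<tau> c)" and ?F = "{s. feasible s \<tau>}"
  have "y \<le> \<phi> s + (\<Sum>s\<in>?F - {s}. \<phi> s)"
    using \<psi>(1) f by (simp add: sum.remove[of ?F s])
  also have "\<dots> \<le> b * ?v s + (\<Sum>s\<in>?F - {s}. a * ?v s)"
    using b \<psi>(2) by (intro add_mono sum_mono) auto
  also have "\<dots> = a * (\<Sum>s\<in>?F. ?v s) - (a - b) * ?v s"
    using f by (simp add: sum.remove[of ?F s] sum_distrib_left algebra_simps)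
  also have "\<dots> \<le> a * vol \<tau> c - (a - b) * (k * vol \<tau> c)"
    using vol_children'[OF \<tau> c] b k by (intro diff_mono mult_left_mono) auto
  finally show ?thesis by (simp add: algebra_simps)
qed

end

context splitting_system begin

section \<open>Raising the large coefficients\<close>

definition bump :: "nat set \<Rightarrow> real \<Rightarrow> (nat \<Rightarrow> real) \<Rightarrow> nat \<Rightarrow> real" where
  "bump S x c e = (if e \<in> S then c e + x else c e)"

lemma pos_bump: "pos c \<Longrightarrow> 0 \<le> x \<Longrightarrow> pos (bump S x c)"
  by (auto simp: pos_def bump_def add_pos_nonneg)

lemma add_win_bump: "win s \<tau> \<notin> S \<Longrightarrow> add_win s \<tau> (bump S x c) = bump S x (add_win s \<tau> c)"
  by (auto simp: add_win_def bump_def fun_eq_iff)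

lemma mid_le_hat: "e \<in> loose \<tau> \<Longrightarrow> mid \<tau> c \<le> hat \<tau> c e"
proof -
  assume "e \<in> loose \<tau>"
  then obtain r where r: "e \<in> side r \<tau>" by (metis Un_iff)
  have "Min (c ` side r \<tau>) \<le> c e" using r by simp
  then show ?thesis unfolding hat_side[OF r] mid_side[of _ _ r] by (intro max.mono) auto
qed

lemma hat_eq_mid:
  assumes "\<tau> \<in> X"
  obtains a where "a \<in> loose \<tau>" "hat \<tau> c a = mid \<tau> c"
proof -
  obtain r where r: "Min (c ` side r \<tau>) \<le> Min (c ` side (\<not> r) \<tau>)"
  proof (cases "Min (c ` side True \<tau>) \<le> Min (c ` side False \<tau>)")
    case True then show ?thesis using that[of True] by simp
  next
    case False then show ?thesis using that[of False] by simp
  qed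
  obtain a where a: "a \<in> side r \<tau>" "c a = Min (c ` side r \<tau>)"
    using obtain_Min[OF finite_side side_nonempty[OF assms]] by blast
  have "hat \<tau> c a = mid \<tau> c" using r a(2) by (simp add: hat_side[OF a(1)] mid_side[of _ _ r])
  moreover have "a \<in> loose \<tau>" using a by (cases r) auto
  ultimately show ?thesis using that by blast
qed

text \<open>The exponent in the comparison is the codimension of the face of \<open>weights \<tau>\<close> on which the
  bands in \<open>S\<close> have weight zero. It is one less than the cardinality of \<open>S\<close> iff \<open>S\<close> contains all
  loose bands.\<close>

lemma hat_vol_bump:
  assumes \<tau>: "\<tau> \<in> X" and c: "pos c" and SE: "S \<subseteq> E" and x: "0 < x"
    and small: "\<And>e. e \<in> E - S \<Longrightarrow> hat \<tau> c e < \<theta>" and large: "\<And>e. e \<in> S \<Longrightarrow> \<theta> \<le> hat \<tau> c e"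
  obtains R where "R \<subseteq> S" "card R = (if loose \<tau> \<subseteq> S then card S - 1 else card S)"
    "hat_vol \<tau> c = hat_vol \<tau> (bump S x c) * (\<Prod>e\<in>R. 1 + x / hat \<tau> c e)"
    "\<And>e. e \<in> S \<Longrightarrow> x \<le> c e \<Longrightarrow> \<exists>e\<in>R. x \<le> hat \<tau> c e"
proof -
  let ?h = "hat \<tau> c" and ?d = "bump S x c"
  have hp: "?h e > 0" if "e \<in> E" for e using hat_pos[of \<tau> c] that c \<tau> bands by (auto simp: pos_def)
  have finS: "finite S" using SE by (rule finite_subset) simp
  have E: "(\<Prod>e\<in>E. f e) = (\<Prod>e\<in>E - S. f e) * (\<Prod>e\<in>S. f e)" for f :: "nat \<Rightarrow> real"
    using SE by (simp add: prod.subset_diff)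
  have key: "(\<Prod>e\<in>R. ?h e + x) = (\<Prod>e\<in>R. ?h e) * (\<Prod>e\<in>R. 1 + x / ?h e)" if "R \<subseteq> S" for R
  proof -
    have "?h e + x = ?h e * (1 + x / ?h e)" if "e \<in> R" for e
      using hp[of e] that \<open>R \<subseteq> S\<close> SE by (auto simp: distrib_left)
    then have "(\<Prod>e\<in>R. ?h e + x) = (\<Prod>e\<in>R. ?h e * (1 + x / ?h e))" by (intro prod.cong) auto
    then show ?thesis by (simp add: prod.distrib)
  qed
  have pp: "(\<Prod>e\<in>R. ?h e) > 0" "(\<Prod>e\<in>R. ?h e + x) > 0" if "R \<subseteq> E" for R
    using that hp x by (auto intro!: prod_pos add_pos_pos)
  show ?thesis
  proof (cases "loose \<tau> \<subseteq> S")
    case False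
    then obtain u r where u: "u \<in> side r \<tau>" "u \<in> E - S" using side_E[OF \<tau>] by (metis UnE subsetI DiffI subsetD)
    obtain q where q: "q \<in> side (\<not> r) \<tau>" "?h q < \<theta>"
      using small_side[OF \<tau> u(1) small[OF u(2)]] by blast
    have q': "q \<in> E - S" using q large[of q] side_E[OF \<tau>, of "\<not> r"] by force
    \<comment> \<open>A small loose band exists here, and smallness passes to the opposite side. So
      on either side the minimum is attained at a band outside \<open>S\<close>, which is not
      raised.\<close>
    have ex: "\<exists>u\<in>side k \<tau>. u \<in> E - S" for k
      using u q(1) q' by (cases "k = r"; cases k; cases r) auto
    have m: "\<exists>v\<in>side k \<tau> - S. c v = Min (c ` side k \<tau>) \<and> c v < \<theta>" for k
    proof -
      obtain v where v: "v \<in> side (\<not> k) \<tau>" "v \<in> E - S" using ex by blast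
      show ?thesis
        using small_side[OF \<tau> v(1) small[OF v(2)]] large by (metis DiffI linorder_not_less not_not)
    qed
    have Min_d: "Min (?d ` side k \<tau>) = Min (c ` side k \<tau>)" for k
    proof (rule antisym)
      obtain v where v: "v \<in> side k \<tau> - S" "c v = Min (c ` side k \<tau>)" using m by blast
      have "Min (?d ` side k \<tau>) \<le> ?d v" using v by simp
      then show "Min (?d ` side k \<tau>) \<le> Min (c ` side k \<tau>)" using v by (simp add: bump_def)
      show "Min (c ` side k \<tau>) \<le> Min (?d ` side k \<tau>)"
        using x by (intro Min_image_mono finite_side side_nonempty[OF \<tau>]) (auto simp: bump_def intro!: bexI)
    qed
    \<comment> \<open>The minima are below \<theta> and do not change, so for a band in
      \<open>S\<close> the \<open>hat\<close> value is just its coefficient, which grows by exactly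
      \<open>x\<close>.\<close>
    have hd: "hat \<tau> ?d e = (if e \<in> S then ?h e + x else ?h e)" if "e \<in> E" for e
    proof (cases "e \<in> loose \<tau>")
      case False
      then show ?thesis by (simp add: hat_def bump_def)
    next
      case True
      then obtain k where k: "e \<in> side k \<tau>" by (metis Un_iff)
      have "Min (c ` side (\<not> k) \<tau>) < \<theta>" using m[of "\<not> k"] by force
      then show ?thesis
        using large[of e] x unfolding hat_side[OF k] Min_d bump_def by auto
    qed
    have md: "mid \<tau> ?d = mid \<tau> c" by (simp add: mid_def Min_d)
    have "(\<Prod>e\<in>E. hat \<tau> ?d e) = (\<Prod>e\<in>E - S. ?h e) * (\<Prod>e\<in>S. ?h e + x)"
      unfolding E using hd SE by (intro arg_cong2[where f = "(*)"] prod.cong) auto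
    also have "\<dots> = (\<Prod>e\<in>E. ?h e) * (\<Prod>e\<in>S. 1 + x / ?h e)"
      unfolding key[OF order_refl] E[of ?h] by simp
    finally have P: "(\<Prod>e\<in>E. hat \<tau> ?d e) = (\<Prod>e\<in>E. ?h e) * (\<Prod>e\<in>S. 1 + x / ?h e)" .
    have "(\<Prod>e\<in>S. 1 + x / ?h e) \<noteq> 0"
      using hp SE x by (intro less_imp_neq[symmetric] prod_pos) (auto intro!: add_pos_pos)
    then have "hat_vol \<tau> c = hat_vol \<tau> ?d * (\<Prod>e\<in>S. 1 + x / ?h e)"
      by (simp add: hat_vol_def bands[OF \<tau>] md P)
    moreover have "\<exists>e\<in>S. x \<le> ?h e" if "e \<in> S" "x \<le> c e" for e
      using that hat_ge[of c e \<tau>] by (meson order_trans)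
    ultimately show ?thesis
      using that[of S] False by (metis order_refl)
  next
    case True
    have Min_d: "Min (?d ` side k \<tau>) = Min (c ` side k \<tau>) + x" for k
    proof -
      have "?d ` side k \<tau> = (\<lambda>e. c e + x) ` side k \<tau>"
        using True by (intro image_cong refl) (cases k; auto simp: bump_def)
      then have "Min (?d ` side k \<tau>) = Min ((\<lambda>y. y + x) ` c ` side k \<tau>)" by (simp add: image_image)
      also have "\<dots> = Min (c ` side k \<tau>) + x"
        using mono_Min_commute[of "\<lambda>y. y + x" "c ` side k \<tau>"] side_nonempty[OF \<tau>] by (simp add: mono_def)
      finally show ?thesis .
    qed
    have hd: "hat \<tau> ?d e = (if e \<in> S then ?h e + x else ?h e)" if "e \<in> E" for e
    proof (cases "e \<in> loose \<tau>")
      case False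
      then show ?thesis by (simp add: hat_def bump_def)
    next
      case e: True
      then obtain k where k: "e \<in> side k \<tau>" by (metis Un_iff)
      show ?thesis
        using e True unfolding hat_side[OF k] Min_d bump_def by auto
    qed
    \<comment> \<open>Here the numerator of \<open>hat_vol\<close> grows along with the denominator.
      It cancels the factor of one band \<open>a\<close> whose \<open>hat\<close> value is
      \<open>mid\<close>, and this is the drop of the exponent by one.\<close>
    have md: "mid \<tau> ?d = mid \<tau> c + x" by (simp add: mid_def Min_d)
    obtain a where a: "a \<in> loose \<tau>" "?h a = mid \<tau> c" using hat_eq_mid[OF \<tau>] by blast
    have aS: "a \<in> S" using a True by blast
    define R where "R = S - {a}"
    have R: "R \<subseteq> S" "card R = card S - 1" using aS by (auto simp: R_def)
    have P1: "(\<Prod>e\<in>E. ?h e) = (\<Prod>e\<in>E - S. ?h e) * (mid \<tau> c * (\<Prod>e\<in>R. ?h e))"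
      unfolding E R_def using aS finS a by (simp add: prod.remove[of S a])
    have "(\<Prod>e\<in>E. hat \<tau> ?d e) = (\<Prod>e\<in>E - S. ?h e) * (\<Prod>e\<in>S. ?h e + x)"
      unfolding E using hd SE by (intro arg_cong2[where f = "(*)"] prod.cong) auto
    also have "(\<Prod>e\<in>S. ?h e + x) = (mid \<tau> c + x) * (\<Prod>e\<in>R. ?h e + x)"
      unfolding R_def using aS finS a by (simp add: prod.remove[of S a])
    also have "(\<Prod>e\<in>R. ?h e + x) = (\<Prod>e\<in>R. ?h e) * (\<Prod>e\<in>R. 1 + x / ?h e)"
      by (rule key[OF R(1)])
    finally have P: "(\<Prod>e\<in>E. hat \<tau> ?d e) =
      (\<Prod>e\<in>E - S. ?h e) * ((mid \<tau> c + x) * ((\<Prod>e\<in>R. ?h e) * (\<Prod>e\<in>R. 1 + x / ?h e)))" .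
    have "(\<Prod>e\<in>R. 1 + x / ?h e) \<noteq> 0"
      using hp SE x R by (intro less_imp_neq[symmetric] prod_pos) (auto intro!: add_pos_pos)
    moreover have "mid \<tau> c > 0" using hp[of a] a aS SE by auto
    moreover have "(\<Prod>e\<in>E - S. ?h e) > 0" "(\<Prod>e\<in>R. ?h e) > 0" using pp[of R] pp[of "E - S"] R SE by auto
    moreover have cancel: "m / (b * (m * p)) = y / (b * (y * (p * q))) * q"
      if "m \<noteq> 0" "y \<noteq> 0" "q \<noteq> 0" for b m p y q :: real
      using that by simp
    ultimately have "hat_vol \<tau> c = hat_vol \<tau> ?d * (\<Prod>e\<in>R. 1 + x / ?h e)"
      using x unfolding hat_vol_def bands[OF \<tau>] md P P1 by simp
    moreover have "\<exists>e\<in>R. x \<le> ?h e" if e: "e \<in> S" "x \<le> c e" for e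
    proof (cases "e = a")
      case False
      then show ?thesis using e hat_ge[of c e \<tau>] by (intro bexI[of _ e]) (auto simp: R_def)
    next
      case eq: True
      obtain r where r: "a \<in> side r \<tau>" using a by (metis Un_iff)
      \<comment> \<open>If the large coefficient is that of the cancelled band \<open>a\<close>, any
        loose band on the other side can replace it: its \<open>hat\<close> value is at least
        \<open>mid\<close>, hence at least that of \<open>a\<close>.\<close>
      obtain a1 where a1: "a1 \<in> side (\<not> r) \<tau>" using side_nonempty[OF \<tau>] by blast
      have "a1 \<noteq> a" "a1 \<in> loose \<tau>" using r a1 side_disjoint(2)[OF r] by (auto; cases r; auto)+
      moreover have "x \<le> ?h a" using e eq hat_ge[of c a \<tau>] by simp
      moreover have "a1 \<in> R" using calculation True by (auto simp: R_def)
      ultimately show ?thesis using mid_le_hat[of a1 \<tau> c] a(2) by (intro bexI[of _ a1]) auto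
    qed
    ultimately show ?thesis using that[of R] R True by auto
  qed
qed

lemma competitors_move:
  assumes "\<tau> \<in> X"
  shows "win s (move s \<tau>) = win s \<tau>"
  using win_move[OF unequal[OF assms]] .

text \<open>A loose winner lies outside \<open>S\<close> and stays loose; with a two-sided winner
  the sides do not change at all. Hence the exponent in \<open>hat_vol_bump\<close> is constant as
  long as only bands outside \<open>S\<close> win.\<close>

lemma loose_subset_move:
  assumes \<tau>: "\<tau> \<in> X" and w: "win s \<tau> \<notin> S"
  shows "loose (move s \<tau>) \<subseteq> S \<longleftrightarrow> loose \<tau> \<subseteq> S"
proof -
  note sm = side_move[OF unequal[OF \<tau>], of s]
  show ?thesis
  proof (cases "win s \<tau> \<in> side s \<tau>")
    case True
    then have "win s \<tau> \<in> side s (move s \<tau>)" using sm(1) by auto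
    with True w have "\<not> loose (move s \<tau>) \<subseteq> S" "\<not> loose \<tau> \<subseteq> S" by (cases s; auto)+
    then show ?thesis by blast
  next
    case False
    then have "loose (move s \<tau>) = loose \<tau>" using sm by (cases s) auto
    then show ?thesis by simp
  qed
qed

text \<open>Chosen such that \<open>T = growth K\<close> satisfies \<open>4 * distortion n ^ 4 * (2
  * K) ^ (k - 1) * T ^ (k - 1) \<le> T ^ k\<close> for \<open>K \<ge> 1\<close> and
  \<open>0 < k \<le> n\<close>. The factor 4 is a loss of 2 in one factor of a product, times
  another 2 that turns the final bound into one half.\<close>

definition growth :: "real \<Rightarrow> real" where
  "growth K = 4 * distortion n ^ 4 * (2 * K) ^ n"

text \<open>As long as only small bands win, raising the large coefficients by \<open>x\<close> commutes with splitting.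
  The volume of the raised region controls the set of weights for which a coefficient grows by the
  factor \<open>growth K\<close> before a small band becomes large.\<close>

lemma small_winners:
  fixes M \<theta> :: real and S :: "nat set"
  defines "T \<equiv> growth (M / \<theta>)"
  assumes \<tau>0: "\<tau>\<^sub>0 \<in> X" and c0: "pos c\<^sub>0" and SE: "S \<subseteq> E" "S \<noteq> {}" and \<theta>: "0 < \<theta>" "\<theta> \<le> M"
    and M: "\<forall>e\<in>E. c\<^sub>0 e \<le> M"
    and small0: "\<And>e. e \<in> E - S \<Longrightarrow> hat \<tau>\<^sub>0 c\<^sub>0 e < \<theta>" and large0: "\<And>e. e \<in> S \<Longrightarrow> \<theta> \<le> hat \<tau>\<^sub>0 c\<^sub>0 e"
    and comp0: "\<not> {win True \<tau>\<^sub>0, win False \<tau>\<^sub>0} \<subseteq> S"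
    and \<psi>: "subharmonic \<psi>" "bounded_by a \<psi>" and ab: "0 \<le> b" "b \<le> a"
    and b: "\<And>\<tau> c. \<tau> \<in> X \<Longrightarrow> pos c \<Longrightarrow> \<forall>e\<in>E. c e \<le> 2 * (T * M) \<Longrightarrow>
       card S < card {e \<in> E. \<theta> \<le> hat \<tau> c e} \<Longrightarrow> \<psi> \<tau> c \<le> b * vol \<tau> c"
  shows "\<psi> \<tau>\<^sub>0 c\<^sub>0 \<le> (a + b) / 2 * vol \<tau>\<^sub>0 c\<^sub>0"
proof -
  define K where "K = M / \<theta>"
  have K: "K \<ge> 1" "M = K * \<theta>" "M > 0" using \<theta> by (auto simp: K_def)
  have d1: "distortion n \<ge> 1" by (rule distortion_ge_1)
  have T: "T = 4 * distortion n ^ 4 * (2 * K) ^ n" by (simp add: T_def growth_def K_def)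
  note SE = SE(1) and S_ne = SE(2)
  have T1: "T \<ge> 1"
  proof -
    have "1 \<le> distortion n ^ 4 * (2 * K) ^ n"
      using K d1 by (intro mult_ge1_I one_le_power) auto
    then show ?thesis unfolding T by linarith
  qed
  define x where "x = T * M"
  have x: "x > 0" "x / \<theta> = T * K" "x / M = T" using T1 K \<theta> by (auto simp: x_def)
  have "1 * M \<le> T * M" using T1 K(3) by (intro mult_right_mono) auto
  then have M_le_x: "M \<le> x" by (simp add: x_def)
  define fl where "fl \<longleftrightarrow> loose \<tau>\<^sub>0 \<subseteq> S"
  define k where "k = (if fl then card S - 1 else card S)"
  have finS: "finite S" using SE by (rule finite_subset) simp
  \<comment> \<open>At a failure one of the \<open>k\<close> factors \<open>1 + x / hat\<close> is
    at most 2, and the other \<open>k - 1\<close> are at most \<open>2 * T * K\<close>. The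
    distortion enters twice, for the passage between \<open>vol\<close> and
    \<open>hat_vol\<close>.\<close>
  define Dc where "Dc = (distortion n)\<^sup>2 * (2 * (2 * T * K) ^ (k - 1))"
  have Dc0: "Dc > 0" using d1 T1 K by (simp add: Dc_def)
  obtain cmin where cmin: "cmin > 0" "\<And>e. e \<in> E \<Longrightarrow> cmin \<le> c\<^sub>0 e"
  proof -
    have "E \<noteq> {}" using n_pos by auto
    then have "Min (c\<^sub>0 ` E) > 0" using c0 by (simp add: pos_def)
    then show ?thesis using that by simp
  qed
  \<comment> \<open>The raised volume is the comparison function: by \<open>vol_children'\<close>
    its sum over the children is at most its value, and at a failure it dominates
    \<open>vol \<tau> c\<close> up to the factor \<open>Dc\<close>. The number \<open>N\<close>
    bounds the moves that are left, since every move adds at least \<open>cmin\<close> to the sum of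
    the coefficients, and a sum of at least \<open>n * x\<close> forces some coefficient up to
    \<open>x\<close>.\<close>
  have main: "\<psi> \<tau> c \<le> b * vol \<tau> c + (a - b) * Dc * vol \<tau> (bump S x c)"
    if "\<tau> \<in> X" "pos c" "\<And>e. e \<in> S \<Longrightarrow> \<theta> \<le> hat \<tau> c e" "\<And>e. e \<in> E - S \<Longrightarrow> hat \<tau> c e < \<theta>"
      "loose \<tau> \<subseteq> S \<longleftrightarrow> fl" "\<not> {win True \<tau>, win False \<tau>} \<subseteq> S" "\<And>e. e \<in> E \<Longrightarrow> cmin \<le> c e"
      "real n * x - (\<Sum>e\<in>E. c e) \<le> real N * cmin" for N \<tau> c
    using that
  proof (induction N arbitrary: \<tau> c)
    have fail: "\<psi> \<tau> c \<le> b * vol \<tau> c + (a - b) * Dc * vol \<tau> (bump S x c)"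
      if \<tau>: "\<tau> \<in> X" and c: "pos c" and large: "\<And>e. e \<in> S \<Longrightarrow> \<theta> \<le> hat \<tau> c e"
        and small: "\<And>e. e \<in> E - S \<Longrightarrow> hat \<tau> c e < \<theta>"
        and fl: "loose \<tau> \<subseteq> S \<longleftrightarrow> fl" and big: "e \<in> E" "x \<le> c e" for \<tau> c e
    proof -
      \<comment> \<open>A coefficient that has reached \<open>x\<close> must belong to
        \<open>S\<close>, because \<theta> \<le> M \<le> x while the bands outside \<open>S\<close>
        are still below \<theta>.\<close>
      have "\<theta> \<le> hat \<tau> c e" using hat_ge[of c e \<tau>] big \<theta> M_le_x by linarith
      then have eS: "e \<in> S" using small[of e] big by force
      obtain R where R: "R \<subseteq> S" "card R = (if loose \<tau> \<subseteq> S then card S - 1 else card S)"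
        "hat_vol \<tau> c = hat_vol \<tau> (bump S x c) * (\<Prod>e\<in>R. 1 + x / hat \<tau> c e)"
        "\<And>e. e \<in> S \<Longrightarrow> x \<le> c e \<Longrightarrow> \<exists>e\<in>R. x \<le> hat \<tau> c e"
        using hat_vol_bump[OF \<tau> c SE x(1) small large] by blast
      obtain f where f: "f \<in> R" "x \<le> hat \<tau> c f" using R(4) eS big by blast
      have kR: "card R = k" using R(2) fl by (simp add: k_def)
      have finR: "finite R" using R(1) finS by (rule finite_subset)
      have h: "\<theta> \<le> hat \<tau> c e" if "e \<in> R" for e using large that R by blast
      have h0: "0 \<le> 1 + x / hat \<tau> c e" if "e \<in> R" for e
        using h[OF that] x \<theta> by simp
      have "(\<Prod>e\<in>R. 1 + x / hat \<tau> c e) = (1 + x / hat \<tau> c f) * (\<Prod>e\<in>R - {f}. 1 + x / hat \<tau> c e)"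
        using f finR by (simp add: prod.remove)
      also have "\<dots> \<le> 2 * (\<Prod>e\<in>R - {f}. 2 * T * K)"
      proof (intro mult_mono prod_mono conjI prod_nonneg)
        show "1 + x / hat \<tau> c f \<le> 2" using f x by (simp add: divide_le_eq_1)
        fix e assume e: "e \<in> R - {f}"
        then have he: "\<theta> \<le> hat \<tau> c e" using h by blast
        have "x / hat \<tau> c e \<le> x / \<theta>" using he \<theta> x by (intro divide_left_mono) auto
        moreover have "1 \<le> T * K" using T1 K by (intro mult_ge1_I) auto
        ultimately show "1 + x / hat \<tau> c e \<le> 2 * T * K" using x by simp
      qed (use h0 in auto)
      also have "\<dots> = 2 * (2 * T * K) ^ (k - 1)" using f finR kR by simp
      finally have prod: "(\<Prod>e\<in>R. 1 + x / hat \<tau> c e) \<le> 2 * (2 * T * K) ^ (k - 1)" .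
      have pb: "pos (bump S x c)" using pos_bump[OF c] x by simp
      have "vol \<tau> c \<le> distortion n * hat_vol \<tau> c" by (rule vol_bounds'(1)[OF \<tau> c])
      also have "\<dots> \<le> distortion n * (hat_vol \<tau> (bump S x c) * (2 * (2 * T * K) ^ (k - 1)))"
        unfolding R(3) using prod d1 vol_bounds'(4)[OF \<tau> pb] by (intro mult_left_mono) auto
      also have "\<dots> \<le> distortion n * ((distortion n * vol \<tau> (bump S x c)) * (2 * (2 * T * K) ^ (k - 1)))"
        using vol_bounds'(2)[OF \<tau> pb] d1 T1 K by (intro mult_left_mono mult_right_mono) auto
      also have "\<dots> = Dc * vol \<tau> (bump S x c)" by (simp add: Dc_def power2_eq_square mult_ac)
      finally have v: "vol \<tau> c \<le> Dc * vol \<tau> (bump S x c)" .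
      have "\<psi> \<tau> c \<le> a * vol \<tau> c" using \<psi>(2) \<tau> c by (auto simp: bounded_by_def)
      also have "\<dots> = b * vol \<tau> c + (a - b) * vol \<tau> c" by (simp add: algebra_simps)
      also have "\<dots> \<le> b * vol \<tau> c + (a - b) * (Dc * vol \<tau> (bump S x c))"
        using v ab by (intro add_left_mono mult_left_mono) auto
      finally show ?thesis by (simp add: mult_ac)
    qed
    {
      case (0 \<tau> c)
      have "\<exists>e\<in>E. x \<le> c e"
      proof (rule ccontr)
        assume "\<not> ?thesis"
        then have "(\<Sum>e\<in>E. c e) < (\<Sum>e\<in>E. x)" using n_pos by (intro sum_strict_mono) auto
        then show False using 0 by simp
      qed
      then show ?case using fail[OF 0(1-5)] by blast
    next
      case (Suc N \<tau> c)
      note \<tau> = Suc.prems(1) and c = Suc.prems(2) and large = Suc.prems(3) and small = Suc.prems(4)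
      show ?case
      proof (cases "\<exists>e\<in>E. x \<le> c e")
        case True
        then show ?thesis using fail[OF Suc.prems(1-5)] by blast
      next
        case False
        then have cx: "\<forall>e\<in>E. c e \<le> x" by force
        define d where "d = bump S x c"
        have d: "pos d" using pos_bump[OF c] x by (simp add: d_def)
        have child: "\<psi> (move s \<tau>) (add_win s \<tau> c) \<le>
            b * vol (move s \<tau>) (add_win s \<tau> c) + (a - b) * Dc * vol (move s \<tau>) (add_win s \<tau> d)"
          if f: "feasible s \<tau>" for s
        proof -
          let ?\<tau> = "move s \<tau>" and ?c = "add_win s \<tau> c"
          have \<tau>': "?\<tau> \<in> X" "pos ?c" using move_X[OF \<tau> f] pos_add_win[OF \<tau> c] by auto
          have ge: "hat \<tau> c e \<le> hat ?\<tau> ?c e" if "e \<in> E" for e by (rule hat_mono[OF \<tau> c f that])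
          have large': "\<theta> \<le> hat ?\<tau> ?c e" if "e \<in> S" for e
            using ge[of e] large[OF that] that SE by force
          have nonneg: "(a - b) * Dc * vol ?\<tau> (add_win s \<tau> d) \<ge> 0"
            using ab Dc0 by (auto simp: vol_def)
          \<comment> \<open>A success: one more band has become large. All coefficients were at most
            \<open>x\<close> before the move, whence the bound \<open>2 * (T * M)\<close> in the
            hypothesis on \<open>b\<close>.\<close>
          have win: "\<psi> ?\<tau> ?c \<le> b * vol ?\<tau> ?c" if u: "u \<in> E - S" "\<theta> \<le> hat ?\<tau> ?c u" for u
          proof (rule b[OF \<tau>'])
            show "\<forall>e\<in>E. ?c e \<le> 2 * (T * M)"
              using add_win_le[OF \<tau> cx _ less_imp_le[OF x(1)]] by (simp add: x_def)
            have "insert u S \<subseteq> {e \<in> E. \<theta> \<le> hat ?\<tau> ?c e}" using large' u SE by auto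
            then have "card (insert u S) \<le> card {e \<in> E. \<theta> \<le> hat ?\<tau> ?c e}" by (intro card_mono) auto
            then show "card S < card {e \<in> E. \<theta> \<le> hat ?\<tau> ?c e}" using u finS by simp
          qed
          show ?thesis
          proof (cases "\<exists>u\<in>E - S. \<theta> \<le> hat ?\<tau> ?c u")
            case True
            then show ?thesis using win nonneg by force
          next
            case False
            \<comment> \<open>A large winner would face a loser outside \<open>S\<close>, since the
              competitors are not both in \<open>S\<close>, and would make it large by
              \<open>hat_lose\<close>.\<close>
            have wS: "win s \<tau> \<notin> S"
            proof
              assume w: "win s \<tau> \<in> S"
              then have l: "lose s \<tau> \<in> E - S" using Suc.prems(6) win_E[OF \<tau>] by (cases s) auto
              have "\<theta> \<le> hat ?\<tau> ?c (lose s \<tau>)" using hat_lose[OF \<tau> c f] large[OF w] by linarith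
              with l False show False by blast
            qed
            have "\<psi> ?\<tau> ?c \<le> b * vol ?\<tau> ?c + (a - b) * Dc * vol ?\<tau> (bump S x ?c)"
            proof (rule Suc.IH[OF \<tau>' large'])
              show "hat ?\<tau> ?c e < \<theta>" if "e \<in> E - S" for e using False that by force
              show "loose ?\<tau> \<subseteq> S \<longleftrightarrow> fl" using loose_subset_move[OF \<tau> wS] Suc.prems(5) by simp
              show "\<not> {win True ?\<tau>, win False ?\<tau>} \<subseteq> S"
                using competitors_move[OF \<tau>, of s] wS by (cases s) auto
              show "cmin \<le> ?c e" if "e \<in> E" for e
                using Suc.prems(7)[OF that] add_win_ge[OF \<tau> c that, of s] by linarith
              have "(\<Sum>e\<in>E. ?c e) = (\<Sum>e\<in>E. c e + (if e = lose s \<tau> then c (win s \<tau>) else 0))"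
                by (intro sum.cong) (auto simp: add_win_def)
              also have "\<dots> = (\<Sum>e\<in>E. c e) + c (win s \<tau>)"
                using win_E[OF \<tau>] by (simp add: sum.distrib)
              finally show "real n * x - (\<Sum>e\<in>E. ?c e) \<le> real N * cmin"
                using Suc.prems(8) Suc.prems(7)[OF win_E[OF \<tau>, of s]] by (simp add: algebra_simps)
            qed
            then show ?thesis by (simp add: d_def add_win_bump[OF wS])
          qed
        qed
        have "\<psi> \<tau> c \<le> (\<Sum>s | feasible s \<tau>. \<psi> (move s \<tau>) (add_win s \<tau> c))"
          using \<psi>(1) \<tau> c by (auto simp: subharmonic_def)
        also have "\<dots> \<le> (\<Sum>s | feasible s \<tau>. b * vol (move s \<tau>) (add_win s \<tau> c) +
            (a - b) * Dc * vol (move s \<tau>) (add_win s \<tau> d))"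
          using child by (intro sum_mono) auto
        also have "\<dots> = b * (\<Sum>s | feasible s \<tau>. vol (move s \<tau>) (add_win s \<tau> c)) +
            (a - b) * Dc * (\<Sum>s | feasible s \<tau>. vol (move s \<tau>) (add_win s \<tau> d))"
          by (simp add: sum.distrib sum_distrib_left)
        also have "\<dots> \<le> b * vol \<tau> c + (a - b) * Dc * vol \<tau> d"
          using ab Dc0 vol_children'[OF \<tau> c] vol_children'[OF \<tau> d] by (intro add_mono mult_left_mono) auto
        finally show ?thesis by (simp add: d_def)
      qed
    }
  qed
  obtain R where R: "R \<subseteq> S" "card R = (if loose \<tau>\<^sub>0 \<subseteq> S then card S - 1 else card S)"
    "hat_vol \<tau>\<^sub>0 c\<^sub>0 = hat_vol \<tau>\<^sub>0 (bump S x c\<^sub>0) * (\<Prod>e\<in>R. 1 + x / hat \<tau>\<^sub>0 c\<^sub>0 e)"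
    "\<And>e. e \<in> S \<Longrightarrow> x \<le> c\<^sub>0 e \<Longrightarrow> \<exists>e\<in>R. x \<le> hat \<tau>\<^sub>0 c\<^sub>0 e"
    using hat_vol_bump[OF \<tau>0 c0 SE x(1) small0 large0] by blast
  \<comment> \<open>If \<open>S\<close> contains all loose bands, it has at least one from each
    side, so subtracting one still leaves a positive exponent.\<close>
  have k0: "k > 0"
  proof (cases fl)
    case True
    then have "card (side True \<tau>\<^sub>0 \<union> side False \<tau>\<^sub>0) \<le> card S" using finS by (intro card_mono) (auto simp: fl_def)
    moreover have "card (side True \<tau>\<^sub>0 \<union> side False \<tau>\<^sub>0) = card (side True \<tau>\<^sub>0) + card (side False \<tau>\<^sub>0)"
      by (rule card_Un_disjoint[OF finite_side finite_side side_disjoint(1)])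
    moreover have "card (side r \<tau>\<^sub>0) > 0" for r
      using side_nonempty[OF \<tau>0, of r] by (simp add: card_gt_0_iff)
    from this[of True] this[of False] have "card (side True \<tau>\<^sub>0) > 0" "card (side False \<tau>\<^sub>0) > 0" .
    ultimately show ?thesis using True by (simp add: k_def)
  next
    case False
    then show ?thesis using S_ne finS by (simp add: k_def card_gt_0_iff)
  qed
  show ?thesis
  proof -
    have kR: "card R = k" using R(2) by (simp add: k_def fl_def)
    have kn: "k \<le> n" using card_mono[OF finite_E SE] by (auto simp: k_def)
    have "T ^ k = (\<Prod>e\<in>R. T)" using kR by simp
    also have "\<dots> \<le> (\<Prod>e\<in>R. 1 + x / hat \<tau>\<^sub>0 c\<^sub>0 e)"
    proof (intro prod_mono conjI)
      fix e assume e: "e \<in> R"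
      have "hat \<tau>\<^sub>0 c\<^sub>0 e \<le> M" using hat_le[OF \<tau>0 M] e R SE by blast
      moreover have "\<theta> \<le> hat \<tau>\<^sub>0 c\<^sub>0 e" using large0 e R by blast
      ultimately have "x / M \<le> x / hat \<tau>\<^sub>0 c\<^sub>0 e" using \<theta> x by (intro divide_left_mono) auto
      then show "T \<le> 1 + x / hat \<tau>\<^sub>0 c\<^sub>0 e" using x by simp
    qed (use T1 in auto)
    finally have prod: "T ^ k \<le> (\<Prod>e\<in>R. 1 + x / hat \<tau>\<^sub>0 c\<^sub>0 e)" .
    have pb: "pos (bump S x c\<^sub>0)" using pos_bump[OF c0] x by simp
    have "T ^ k * vol \<tau>\<^sub>0 (bump S x c\<^sub>0) \<le> T ^ k * (distortion n * hat_vol \<tau>\<^sub>0 (bump S x c\<^sub>0))"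
      using vol_bounds'(1)[OF \<tau>0 pb] T1 by (intro mult_left_mono) auto
    also have "\<dots> = distortion n * (hat_vol \<tau>\<^sub>0 (bump S x c\<^sub>0) * T ^ k)" by simp
    also have "\<dots> \<le> distortion n * hat_vol \<tau>\<^sub>0 c\<^sub>0"
      unfolding R(3) using prod vol_bounds'(4)[OF \<tau>0 pb] d1 by (intro mult_left_mono) auto
    also have "\<dots> \<le> distortion n * (distortion n * vol \<tau>\<^sub>0 c\<^sub>0)"
      using vol_bounds'(2)[OF \<tau>0 c0] d1 by (intro mult_left_mono) auto
    finally have v: "T ^ k * vol \<tau>\<^sub>0 (bump S x c\<^sub>0) \<le> (distortion n)\<^sup>2 * vol \<tau>\<^sub>0 c\<^sub>0"
      by (simp add: power2_eq_square mult_ac)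
    \<comment> \<open>The decisive count of exponents: at the start each of the \<open>k\<close>
      factors is at least \<open>T\<close>, whereas a failure gives back only \<open>k - 1\<close>
      powers of \<open>T\<close>.\<close>
    have "2 * Dc * (distortion n)\<^sup>2 \<le> T ^ k"
    proof -
      have "2 * Dc * (distortion n)\<^sup>2 = 4 * distortion n ^ 4 * (2 * K) ^ (k - 1) * T ^ (k - 1)"
        by (simp add: Dc_def power_mult_distrib power2_eq_square power4_eq_xxxx mult_ac)
      also have "\<dots> \<le> 4 * distortion n ^ 4 * (2 * K) ^ n * T ^ (k - 1)"
        using K kn d1 T1 by (intro mult_right_mono mult_left_mono power_increasing) auto
      also have "\<dots> = T ^ k" unfolding T[symmetric] using k0 by (cases k) auto
      finally show ?thesis .
    qed
    then have "2 * Dc * (distortion n)\<^sup>2 * vol \<tau>\<^sub>0 (bump S x c\<^sub>0) \<le> T ^ k * vol \<tau>\<^sub>0 (bump S x c\<^sub>0)"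
      by (intro mult_right_mono) (auto simp: vol_def)
    also note v
    finally have "(distortion n)\<^sup>2 * (2 * Dc * vol \<tau>\<^sub>0 (bump S x c\<^sub>0)) \<le> (distortion n)\<^sup>2 * vol \<tau>\<^sub>0 c\<^sub>0"
      by (simp add: mult_ac)
    then have half: "Dc * vol \<tau>\<^sub>0 (bump S x c\<^sub>0) \<le> vol \<tau>\<^sub>0 c\<^sub>0 / 2"
      using d1 by (subst (asm) mult_le_cancel_left_pos) auto
    obtain N :: nat where N: "(real n * x - (\<Sum>e\<in>E. c\<^sub>0 e)) / cmin \<le> real N" using real_arch_simple by blast
    have "\<psi> \<tau>\<^sub>0 c\<^sub>0 \<le> b * vol \<tau>\<^sub>0 c\<^sub>0 + (a - b) * Dc * vol \<tau>\<^sub>0 (bump S x c\<^sub>0)"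
      using N cmin by (intro main[OF \<tau>0 c0 large0 small0 _ comp0, of N]) (auto simp: fl_def pos_divide_le_eq)
    also have "\<dots> \<le> b * vol \<tau>\<^sub>0 c\<^sub>0 + (a - b) * (vol \<tau>\<^sub>0 c\<^sub>0 / 2)"
      using half ab by (auto simp: mult.assoc intro!: mult_left_mono)
    finally show ?thesis by (simp add: field_simps)
  qed
qed

end

context splitting_system begin

section \<open>Balance is reached with positive probability\<close>

lemma bounded_byD: "bounded_by a \<psi> \<Longrightarrow> \<tau> \<in> X \<Longrightarrow> pos c \<Longrightarrow> \<psi> \<tau> c \<le> a * vol \<tau> c"
  by (auto simp: bounded_by_def)

lemma subharmonicD:
  "subharmonic \<psi> \<Longrightarrow> \<tau> \<in> X \<Longrightarrow> pos c \<Longrightarrow> \<psi> \<tau> c \<le> (\<Sum>s | feasible s \<tau>. \<psi> (move s \<tau>) (add_win s \<tau> c))"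
  by (auto simp: subharmonic_def)

text \<open>As long as both competitors are in \<open>S\<close>, the path is followed for one more
  move, which costs a factor \<kappa> and leaves the small bands alone. Since some band outside
  \<open>S\<close> competes along the path, a state to which \<open>start\<close> applies is met
  before the path ends. The bound \<open>L\<close> on the coefficients doubles with each
  move.\<close>

lemma large_competitors_path:
  assumes \<psi>: "subharmonic \<psi>" "bounded_by a \<psi>" and ab: "0 \<le> b" "b \<le> a"
    and \<theta>: "0 < \<theta>" and SE: "S \<subseteq> E"
    and start: "\<And>\<tau> c. \<tau> \<in> X \<Longrightarrow> pos c \<Longrightarrow> \<forall>e\<in>E. c e \<le> M \<Longrightarrow> (\<And>e. e \<in> E - S \<Longrightarrow> hat \<tau> c e < \<theta>) \<Longrightarrow>
       (\<And>e. e \<in> S \<Longrightarrow> \<theta> \<le> hat \<tau> c e) \<Longrightarrow> \<not> {win True \<tau>, win False \<tau>} \<subseteq> S \<Longrightarrow> \<psi> \<tau> c \<le> b * vol \<tau> c"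
  defines "\<kappa> \<equiv> (\<theta> / (2 * M)) ^ n / (distortion n)\<^sup>2"
  assumes "\<tau> \<in> X" "pos c" "feasible_path \<tau> ss" "\<not> competitors \<tau> ss \<subseteq> S"
    "\<forall>e\<in>E. c e \<le> L" "2 ^ length ss * L \<le> M" "0 < L" "\<theta> \<le> M"
    "\<And>e. e \<in> E - S \<Longrightarrow> hat \<tau> c e < \<theta>" "\<And>e. e \<in> S \<Longrightarrow> \<theta> \<le> hat \<tau> c e"
  shows "\<psi> \<tau> c \<le> (a - (a - b) * \<kappa> ^ length ss) * vol \<tau> c"
  using assms(9-)
proof (induction ss arbitrary: \<tau> c L)
  case (Cons s ss)
  note \<tau> = Cons.prems(1) and c = Cons.prems(2) and L = Cons.prems(5-7) and \<theta>M = Cons.prems(8)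
    and small = Cons.prems(9) and large = Cons.prems(10)
  have f: "feasible s \<tau>" using Cons.prems(3) by simp
  have "L \<le> 2 ^ length (s # ss) * L"
    using L(3) one_le_power[of "2::real" "length (s # ss)"] by (simp only: mult_le_cancel_right1) auto
  then have LM: "L \<le> M" using L(2) by linarith
  then have M: "\<forall>e\<in>E. c e \<le> M" "M > 0" using L by force+
  have \<kappa>: "0 \<le> \<kappa>" "\<kappa> \<le> 1"
  proof -
    show "0 \<le> \<kappa>" using \<theta> M by (simp add: \<kappa>_def)
    have "(\<theta> / (2 * M)) ^ n \<le> 1" using \<theta> \<theta>M M by (intro power_le_one) auto
    moreover have "1 \<le> (distortion n)\<^sup>2" using distortion_ge_1 by (intro one_le_power)
    ultimately show "\<kappa> \<le> 1" by (simp add: \<kappa>_def divide_le_eq)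
  qed
  show ?case
  proof (cases "{win True \<tau>, win False \<tau>} \<subseteq> S")
    case False
    have "\<psi> \<tau> c \<le> b * vol \<tau> c" using start[OF \<tau> c M(1) small large False] .
    also have "\<dots> \<le> (a - (a - b) * \<kappa> ^ length (s # ss)) * vol \<tau> c"
    proof (rule mult_right_mono)
      have "(a - b) * \<kappa> ^ length (s # ss) \<le> (a - b) * 1"
        using ab \<kappa> by (intro mult_left_mono power_le_one) auto
      then show "b \<le> a - (a - b) * \<kappa> ^ length (s # ss)" by simp
    qed (simp add: vol_def)
    finally show ?thesis .
  next
    case True
    then have wS: "win s \<tau> \<in> S" "lose s \<tau> \<in> S" by (cases s; auto)+
    let ?\<tau> = "move s \<tau>" and ?c = "add_win s \<tau> c"
    have \<tau>': "?\<tau> \<in> X" "pos ?c" using move_X[OF \<tau> f] pos_add_win[OF \<tau> c] by auto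
    have step: "\<kappa> * vol \<tau> c \<le> vol ?\<tau> ?c"
      unfolding \<kappa>_def using vol_large_move[OF \<tau> c f \<theta> small large wS SE M(1)] .
    have IH: "\<psi> ?\<tau> ?c \<le> (a - (a - b) * \<kappa> ^ length ss) * vol ?\<tau> ?c"
    proof (rule Cons.IH[OF \<tau>'])
      show "\<not> competitors ?\<tau> ss \<subseteq> S" using Cons.prems(4) wS by auto
      show "\<forall>e\<in>E. ?c e \<le> 2 * L" using add_win_le[OF \<tau> L(1)] L(3) by simp
      show "hat ?\<tau> ?c e < \<theta>" if "e \<in> E - S" for e
        using hat_large_move[OF \<tau> c f small large wS that] small[OF that] by simp
      show "\<theta> \<le> hat ?\<tau> ?c e" if "e \<in> S" for e
        using hat_mono[OF \<tau> c f, of e] large[OF that] that SE by force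
    qed (use Cons.prems L \<theta>M in auto)
    have "(a - b) * \<kappa> ^ length ss \<le> (a - b) * 1"
      using ab \<kappa> by (intro mult_left_mono power_le_one) auto
    moreover have "0 \<le> (a - b) * \<kappa> ^ length ss" using ab \<kappa> by simp
    ultimately have "0 \<le> a - (a - b) * \<kappa> ^ length ss" "a - (a - b) * \<kappa> ^ length ss \<le> a"
      using ab by simp_all
    then have "\<psi> \<tau> c \<le> (a - (a - (a - (a - b) * \<kappa> ^ length ss)) * \<kappa>) * vol \<tau> c"
      using one_child_bound[OF \<tau> c f subharmonicD[OF \<psi>(1) \<tau> c] _ IH _ _ step, of a]
        bounded_byD[OF \<psi>(2)] move_X[OF \<tau>] pos_add_win[OF \<tau> c] by blast
    then show ?thesis by (simp add: algebra_simps)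
  qed
qed simp

text \<open>The scale \<open>L\<close> bounds all coefficients, and at least \<open>j\<close> bands
  are comparable with it up to the factor \<open>K\<close>. For \<open>j = card E\<close> every band
  is, which is the notion of a balanced functional in the overview.\<close>

definition balanced :: "nat \<Rightarrow> real \<Rightarrow> exchange \<Rightarrow> (nat \<Rightarrow> real) \<Rightarrow> bool" where
  "balanced j K \<tau> c \<longleftrightarrow> (\<exists>L>0. (\<forall>e\<in>E. c e \<le> L) \<and> j \<le> card {e \<in> E. L / K \<le> hat \<tau> c e})"

text \<open>Starting at a state in \<open>P\<close>, the probability to reach \<open>Q\<close> is at least \<open>\<eta>\<close>, expressed by the
  maximum principle for subharmonic functions.\<close>

definition reaches :: "real \<Rightarrow> (exchange \<Rightarrow> (nat \<Rightarrow> real) \<Rightarrow> bool) \<Rightarrow> (exchange \<Rightarrow> (nat \<Rightarrow> real) \<Rightarrow> bool) \<Rightarrow> bool" where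
  "reaches \<eta> P Q \<longleftrightarrow> (\<forall>\<psi> a b. subharmonic \<psi> \<longrightarrow> bounded_by a \<psi> \<longrightarrow> 0 \<le> b \<longrightarrow> b \<le> a \<longrightarrow>
     (\<forall>\<tau>\<in>X. \<forall>c. pos c \<longrightarrow> Q \<tau> c \<longrightarrow> \<psi> \<tau> c \<le> b * vol \<tau> c) \<longrightarrow>
     (\<forall>\<tau>\<in>X. \<forall>c. pos c \<longrightarrow> P \<tau> c \<longrightarrow> \<psi> \<tau> c \<le> (a - \<eta> * (a - b)) * vol \<tau> c))"

lemma reachesD:
  assumes "reaches \<eta> P Q" "subharmonic \<psi>" "bounded_by a \<psi>" "0 \<le> b" "b \<le> a"
    "\<And>\<tau> c. \<tau> \<in> X \<Longrightarrow> pos c \<Longrightarrow> Q \<tau> c \<Longrightarrow> \<psi> \<tau> c \<le> b * vol \<tau> c" "\<tau> \<in> X" "pos c" "P \<tau> c"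
  shows "\<psi> \<tau> c \<le> (a - \<eta> * (a - b)) * vol \<tau> c"
  using assms unfolding reaches_def by blast

text \<open>The improved bound that the second statement gives on \<open>Q\<close> takes the place
  of \<open>b\<close> in the first one.\<close>

lemma reaches_trans:
  assumes 1: "reaches \<eta> P Q" and 2: "reaches \<eta>' Q R" and \<eta>': "0 \<le> \<eta>'" "\<eta>' \<le> 1"
  shows "reaches (\<eta> * \<eta>') P R"
  unfolding reaches_def
proof (intro allI impI ballI)
  fix \<psi> a b \<tau> c
  assume \<psi>: "subharmonic \<psi>" "bounded_by a \<psi>" and ab: "0 \<le> b" "b \<le> a"
    and R: "\<forall>\<tau>\<in>X. \<forall>c. pos c \<longrightarrow> R \<tau> c \<longrightarrow> \<psi> \<tau> c \<le> b * vol \<tau> c" and x: "\<tau> \<in> X" "pos c" "P \<tau> c"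
  have "\<eta>' * (a - b) \<le> 1 * (a - b)" using \<eta>' ab by (intro mult_right_mono) auto
  moreover have "0 \<le> \<eta>' * (a - b)" using \<eta>' ab by simp
  ultimately have "\<psi> \<tau> c \<le> (a - \<eta> * (a - (a - \<eta>' * (a - b)))) * vol \<tau> c"
    using ab R by (intro reachesD[OF 1 \<psi> _ _ _ x] reachesD[OF 2 \<psi> ab]) auto
  then show "\<psi> \<tau> c \<le> (a - \<eta> * \<eta>' * (a - b)) * vol \<tau> c" by (simp add: mult.assoc)
qed

lemma competing_paths:
  obtains N where "\<And>\<tau>. \<tau> \<in> X \<Longrightarrow> \<exists>ss. feasible_path \<tau> ss \<and> competitors \<tau> ss = E \<and> length ss \<le> N"
proof -
  obtain p where p: "\<And>\<tau>. \<tau> \<in> X \<Longrightarrow> feasible_path \<tau> (p \<tau>) \<and> competitors \<tau> (p \<tau>) = E"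
    using all_compete by metis
  have "length (p \<tau>) \<le> Max ((length \<circ> p) ` X)" if "\<tau> \<in> X" for \<tau>
    using that finite_X by (auto intro!: Max_ge)
  with p that show ?thesis by blast
qed

text \<open>Let \<open>S\<close> be the set of bands that are large already. Following a path on
  which all bands compete leads, with probability at least \<open>\<kappa> ^ N\<close>, to a state
  whose competitors are not both in \<open>S\<close>; from there \<open>small_winners\<close>
  enlarges the set of large bands with probability one half.\<close>

lemma balanced_step:
  assumes j: "1 \<le> j" "j < n" and K: "1 \<le> K"
  obtains K' \<eta> :: real where "1 \<le> K'" "0 < \<eta>" "\<eta> \<le> 1" "reaches \<eta> (balanced j K) (balanced (Suc j) K')"
proof -
  obtain N where N: "\<And>\<tau>. \<tau> \<in> X \<Longrightarrow> \<exists>ss. feasible_path \<tau> ss \<and> competitors \<tau> ss = E \<and> length ss \<le> N"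
    using competing_paths by blast
  \<comment> \<open>Coefficients at most double in a move, so along a path of length at most
    \<open>N\<close> they stay below \<open>2 ^ N * L\<close>; this is the ratio of that bound to
    the threshold \<open>L / K\<close>.\<close>
  define K2 where "K2 = 2 ^ N * K"
  define T where "T = growth K2"
  \<comment> \<open>After a success the coefficients are bounded by \<open>2 * T * M\<close> with
    \<open>M = 2 ^ N * L\<close>, while the threshold is still \<open>L / K\<close>.\<close>
  define K' where "K' = 2 * T * K2"
  define \<kappa> where "\<kappa> = (1 / (2 * K2)) ^ n / (distortion n)\<^sup>2"
  define \<eta> where "\<eta> = \<kappa> ^ N / 2"
  have K2: "K \<le> K2" "1 \<le> K2"
  proof -
    have "1 * K \<le> 2 ^ N * K" using K by (intro mult_right_mono one_le_power) auto
    then show "K \<le> K2" by (simp add: K2_def)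
    then show "1 \<le> K2" using K by linarith
  qed
  have d: "1 \<le> distortion n" by (rule distortion_ge_1)
  have T: "1 \<le> T"
  proof -
    have "1 \<le> distortion n ^ 4 * (2 * K2) ^ n" using K2 d by (intro mult_ge1_I one_le_power) auto
    then show ?thesis unfolding T_def growth_def by linarith
  qed
  have K': "K \<le> K'" "1 \<le> K'"
  proof -
    have "1 * K2 \<le> (2 * T) * K2" using K2 T by (intro mult_right_mono) auto
    then have "K2 \<le> K'" by (simp add: K'_def)
    then show "K \<le> K'" "1 \<le> K'" using K2 by linarith+
  qed
  have \<kappa>: "0 < \<kappa>" "\<kappa> \<le> 1"
  proof -
    show "0 < \<kappa>" using K2 d by (simp add: \<kappa>_def)
    have "(1 / (2 * K2)) ^ n \<le> 1" using K2 by (intro power_le_one) auto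
    moreover have "1 \<le> (distortion n)\<^sup>2" using d by (intro one_le_power)
    ultimately show "\<kappa> \<le> 1" by (simp add: \<kappa>_def divide_le_eq)
  qed
  have \<eta>: "0 < \<eta>" "\<eta> \<le> 1"
    using \<kappa> power_le_one[of \<kappa> N] by (auto simp: \<eta>_def)
  show ?thesis
  proof (rule that[OF K'(2) \<eta>], unfold reaches_def, intro allI impI ballI)
    fix \<psi> a b \<tau> c
    assume \<psi>: "subharmonic \<psi>" "bounded_by a \<psi>" and ab: "0 \<le> b" "b \<le> (a::real)"
      and bal: "\<forall>\<tau>\<in>X. \<forall>c. pos c \<longrightarrow> balanced (Suc j) K' \<tau> c \<longrightarrow> \<psi> \<tau> c \<le> b * vol \<tau> c"
      and \<tau>: "\<tau> \<in> X" and c: "pos c" and "balanced j K \<tau> c"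
    then obtain L where L: "0 < L" "\<forall>e\<in>E. c e \<le> L" "j \<le> card {e \<in> E. L / K \<le> hat \<tau> c e}"
      by (auto simp: balanced_def)
    define \<theta> where "\<theta> = L / K"
    define S where "S = {e \<in> E. \<theta> \<le> hat \<tau> c e}"
    have S: "S \<subseteq> E" "j \<le> card S" "S \<noteq> {}"
    proof -
      show "j \<le> card S" using L(3) by (simp add: S_def \<theta>_def)
      then show "S \<noteq> {}" using j by auto
    qed (simp add: S_def)
    have \<theta>: "0 < \<theta>" using L K by (simp add: \<theta>_def)
    have le1: "b \<le> a - \<eta> * (a - b)"
      using mult_right_mono[OF \<eta>(2), of "a - b"] ab by simp
    show "\<psi> \<tau> c \<le> (a - \<eta> * (a - b)) * vol \<tau> c"
    proof (cases "Suc j \<le> card S")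
      case True
      have "L / K' \<le> L / K" using L K' K by (intro divide_left_mono) auto
      then have "S \<subseteq> {e \<in> E. L / K' \<le> hat \<tau> c e}" by (auto simp: S_def \<theta>_def)
      then have "card S \<le> card {e \<in> E. L / K' \<le> hat \<tau> c e}" by (intro card_mono) auto
      then have "balanced (Suc j) K' \<tau> c" using L True unfolding balanced_def by (intro exI[of _ L]) auto
      then have "\<psi> \<tau> c \<le> b * vol \<tau> c" using bal \<tau> c by blast
      also have "\<dots> \<le> (a - \<eta> * (a - b)) * vol \<tau> c"
        using le1 by (intro mult_right_mono) (simp_all add: vol_def)
      finally show ?thesis .
    next
      case False
      then have cS: "card S = j" using S by simp
      define M where "M = 2 ^ N * L"
      have M: "M / \<theta> = K2" "\<theta> / (2 * M) = 1 / (2 * K2)" "L \<le> M" "\<theta> \<le> M"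
      proof -
        show 1: "M / \<theta> = K2" using L K by (simp add: M_def \<theta>_def K2_def)
        then have "M = K2 * \<theta>" using \<theta> by (simp add: divide_eq_eq)
        then show "\<theta> / (2 * M) = 1 / (2 * K2)" "\<theta> \<le> M" using \<theta> K2 by simp_all
        have "1 * L \<le> 2 ^ N * L" using L by (intro mult_right_mono one_le_power) auto
        then show "L \<le> M" by (simp add: M_def)
      qed
      obtain ss where ss: "feasible_path \<tau> ss" "competitors \<tau> ss = E" "length ss \<le> N" using N[OF \<tau>] by blast
      have nS: "\<not> competitors \<tau> ss \<subseteq> S" using ss(2) cS j S(1) by auto
      have start: "\<psi> \<tau> c \<le> (a + b) / 2 * vol \<tau> c"
        if "\<tau> \<in> X" "pos c" "\<forall>e\<in>E. c e \<le> M" "\<And>e. e \<in> E - S \<Longrightarrow> hat \<tau> c e < \<theta>"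
          "\<And>e. e \<in> S \<Longrightarrow> \<theta> \<le> hat \<tau> c e" "\<not> {win True \<tau>, win False \<tau>} \<subseteq> S" for \<tau> c
      proof (rule small_winners[OF that(1,2) S(1,3) \<theta> M(4) that(3-6) \<psi> ab])
        fix \<tau> c
        assume \<tau>: "\<tau> \<in> X" "pos c" and cM: "\<forall>e\<in>E. c e \<le> 2 * (growth (M / \<theta>) * M)"
          and card: "card S < card {e \<in> E. \<theta> \<le> hat \<tau> c e}"
        have gT: "growth (M / \<theta>) = T" by (simp add: M(1) T_def)
        have MK: "M = K2 * \<theta>" using M(1) \<theta> by (simp add: divide_eq_eq)
        have e: "2 * (growth (M / \<theta>) * M) = 2 * (T * (K2 * \<theta>))"
          unfolding gT by (simp only: MK)
        have "2 * (growth (M / \<theta>) * M) / K' = \<theta>"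
          unfolding e K'_def using T K2 by simp
        moreover have "2 * (growth (M / \<theta>) * M) > 0"
          unfolding e using T K2 \<theta> by simp
        ultimately have "balanced (Suc j) K' \<tau> c"
          using cM card cS unfolding balanced_def by (intro exI[of _ "2 * (growth (M / \<theta>) * M)"]) auto
        then show "\<psi> \<tau> c \<le> b * vol \<tau> c" using bal \<tau> by blast
      qed
      have "\<psi> \<tau> c \<le> (a - (a - (a + b) / 2) * ((\<theta> / (2 * M)) ^ n / (distortion n)\<^sup>2) ^ length ss) * vol \<tau> c"
      proof (rule large_competitors_path[OF \<psi> _ _ \<theta> S(1) start \<tau> c ss(1) nS L(2) _ L(1) M(4)])
        show "2 ^ length ss * L \<le> M"
          unfolding M_def using ss(3) L by (intro mult_right_mono power_increasing) auto
      qed (use ab in \<open>auto simp: S_def\<close>)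
      also have "\<dots> = (a - (a - b) / 2 * \<kappa> ^ length ss) * vol \<tau> c"
        unfolding M(2) \<kappa>_def[symmetric] by (simp add: field_simps)
      also have "\<dots> \<le> (a - \<eta> * (a - b)) * vol \<tau> c"
      proof (rule mult_right_mono)
        have "\<kappa> ^ N \<le> \<kappa> ^ length ss" using \<kappa> ss(3) by (intro power_decreasing) auto
        then have "(a - b) / 2 * \<kappa> ^ N \<le> (a - b) / 2 * \<kappa> ^ length ss" using ab by (intro mult_left_mono) auto
        then show "a - (a - b) / 2 * \<kappa> ^ length ss \<le> a - \<eta> * (a - b)" by (simp add: \<eta>_def field_simps)
      qed (simp add: vol_def)
      finally show ?thesis .
    qed
  qed
qed

text \<open>The largest coefficient is taken as the scale, with which its own band is
  comparable.\<close>

lemma balanced_1: "\<tau> \<in> X \<Longrightarrow> pos c \<Longrightarrow> balanced 1 1 \<tau> c"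
proof -
  assume "\<tau> \<in> X" and c: "pos c"
  have ne: "E \<noteq> {}" using n_pos by auto
  obtain e where e: "e \<in> E" "c e = Max (c ` E)"
    using Max_in[of "c ` E"] ne by (metis finite_E finite_imageI imageE image_is_empty)
  have "e \<in> {e \<in> E. Max (c ` E) / 1 \<le> hat \<tau> c e}" using e hat_ge[of c e \<tau>] by simp
  then have "card {e \<in> E. Max (c ` E) / 1 \<le> hat \<tau> c e} > 0" by (subst card_gt_0_iff) auto
  moreover have "Max (c ` E) > 0" using c e by (auto simp: pos_def)
  ultimately show ?thesis unfolding balanced_def by (intro exI[of _ "Max (c ` E)"]) auto
qed

lemma reach_balanced:
  assumes "1 \<le> j" "j \<le> n"
  shows "\<exists>K \<eta>. 1 \<le> K \<and> 0 < \<eta> \<and> \<eta> \<le> 1 \<and> reaches \<eta> (\<lambda>_ _. True) (balanced j K)"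
  using assms
proof (induction j rule: dec_induct)
  case base
  have "reaches 1 (\<lambda>_ _. True) (balanced 1 1)"
    unfolding reaches_def
  proof (intro allI impI ballI)
    fix \<psi> a b \<tau> c
    assume "\<forall>\<tau>\<in>X. \<forall>c. pos c \<longrightarrow> balanced 1 1 \<tau> c \<longrightarrow> \<psi> \<tau> c \<le> b * vol \<tau> c" "\<tau> \<in> X" "pos c"
    then have "\<psi> \<tau> c \<le> b * vol \<tau> c" using balanced_1 by blast
    then show "\<psi> \<tau> c \<le> (a - 1 * (a - b)) * vol \<tau> c" by simp
  qed
  then show ?case by (intro exI[of _ 1]) simp
next
  case (step j)
  then obtain K \<eta> where K: "1 \<le> K" "0 < \<eta>" "\<eta> \<le> 1" "reaches \<eta> (\<lambda>_ _. True) (balanced j K)"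
    by auto
  obtain K' \<eta>' where K': "1 \<le> K'" "0 < \<eta>'" "\<eta>' \<le> 1" "reaches \<eta>' (balanced j K) (balanced (Suc j) K')"
    using balanced_step[OF step.hyps(1) _ K(1)] step.prems by (metis Suc_le_lessD)
  have "reaches (\<eta> * \<eta>') (\<lambda>_ _. True) (balanced (Suc j) K')"
    using reaches_trans[OF K(4) K'(4)] K'(2,3) by simp
  moreover have "0 < \<eta> * \<eta>'" "\<eta> * \<eta>' \<le> 1" using K K' by (auto simp: mult_le_one)
  ultimately show ?case using K'(1) by blast
qed

text \<open>A bound \<open>a\<close> improves to \<open>a * (1 - \<delta>)\<close> at balanced
  states, which are reached with probability \<eta> from everywhere, and hence to
  \<open>a * (1 - \<eta> * \<delta>)\<close> everywhere. As \<delta> does not depend on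
  \<open>a\<close>, this can be iterated and the bounds decay geometrically.\<close>

theorem subharmonic_vanishes:
  assumes \<psi>: "subharmonic \<psi>" "bounded_by 1 \<psi>"
    and gain: "\<And>K. 1 \<le> K \<Longrightarrow> \<exists>\<delta>>0. \<delta> \<le> 1 \<and> (\<forall>a \<tau> c. 0 \<le> a \<longrightarrow> bounded_by a \<psi> \<longrightarrow> \<tau> \<in> X \<longrightarrow> pos c \<longrightarrow>
        balanced n K \<tau> c \<longrightarrow> \<psi> \<tau> c \<le> a * (1 - \<delta>) * vol \<tau> c)"
    and "\<tau> \<in> X" "pos c"
  shows "\<psi> \<tau> c \<le> 0"
proof -
  obtain K \<eta> where K: "1 \<le> K" "0 < \<eta>" "\<eta> \<le> 1" and reach: "reaches \<eta> (\<lambda>_ _. True) (balanced n K)"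
    using reach_balanced[of n] n_pos by auto
  obtain \<delta> where \<delta>: "0 < \<delta>" "\<delta> \<le> 1" "\<And>a \<tau> c. 0 \<le> a \<Longrightarrow> bounded_by a \<psi> \<Longrightarrow> \<tau> \<in> X \<Longrightarrow> pos c \<Longrightarrow>
        balanced n K \<tau> c \<Longrightarrow> \<psi> \<tau> c \<le> a * (1 - \<delta>) * vol \<tau> c"
    using gain[OF K(1)] by blast
  define r where "r = 1 - \<eta> * \<delta>"
  have r: "0 \<le> r" "r < 1" using K \<delta> mult_le_one[of \<eta> \<delta>] by (auto simp: r_def)
  have "bounded_by (r ^ k) \<psi>" for k
  proof (induction k)
    case 0 then show ?case using \<psi>(2) by simp
  next
    case (Suc k)
    have 1: "0 \<le> r ^ k" using r by simp
    have 2: "0 \<le> r ^ k * (1 - \<delta>)" "r ^ k * (1 - \<delta>) \<le> r ^ k"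
      using 1 \<delta> by (auto intro: mult_left_le)
    show ?case
      unfolding bounded_by_def
    proof (intro ballI allI impI)
      fix \<tau> c assume x: "\<tau> \<in> X" "pos c"
      have "\<psi> \<tau> c \<le> (r ^ k - \<eta> * (r ^ k - r ^ k * (1 - \<delta>))) * vol \<tau> c"
        using \<delta>(3)[OF 1 Suc] by (intro reachesD[OF reach \<psi>(1) Suc 2 _ x]) auto
      also have "r ^ k - \<eta> * (r ^ k - r ^ k * (1 - \<delta>)) = r ^ Suc k" by (simp add: r_def algebra_simps)
      finally show "\<psi> \<tau> c \<le> r ^ Suc k * vol \<tau> c" .
    qed
  qed
  then have le: "\<psi> \<tau> c \<le> r ^ k * vol \<tau> c" for k
    using assms(4,5) by (auto simp: bounded_by_def)
  have "(\<lambda>k. r ^ k * vol \<tau> c) \<longlonglongrightarrow> 0 * vol \<tau> c"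
    using r by (intro tendsto_mult LIMSEQ_power_zero) auto
  then show ?thesis using le by (intro LIMSEQ_le_const[of "\<lambda>k. r ^ k * vol \<tau> c"]) auto
qed

end

section \<open>Weights whose splitting sequence avoids a block\<close>

fun classes :: "exchange \<Rightarrow> bool list \<Rightarrow> exchange set list" where
  "classes \<tau> [] = [iso_class \<tau>]"
| "classes \<tau> (s # ss) = iso_class \<tau> # classes (move s \<tau>) ss"

fun cylinder :: "exchange \<Rightarrow> bool list \<Rightarrow> (nat \<Rightarrow> real) set" where
  "cylinder \<tau> [] = weights \<tau>"
| "cylinder \<tau> (s # ss) = {w \<in> weights \<tau>. w (lose s \<tau>) < w (win s \<tau>) \<and> split_weight s \<tau> w \<in> cylinder (move s \<tau>) ss}"

definition occurs :: "exchange set list \<Rightarrow> exchange \<Rightarrow> (nat \<Rightarrow> real) \<Rightarrow> nat \<Rightarrow> bool" where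
  "occurs \<sigma>s \<tau> w k \<longleftrightarrow> (\<forall>i<length \<sigma>s. splitting_sequence \<tau> w (k + i) = Some (\<sigma>s ! i))"

lemma splitting_sequence_0 [simp]: "splitting_sequence \<tau> w 0 = Some (iso_class \<tau>)"
  by (simp add: splitting_sequence_def)

lemma splitting_sequence_Suc:
  "splitting_sequence \<tau> w (Suc k) = (case split_step (\<tau>, w) of None \<Rightarrow> None | Some (\<tau>', w') \<Rightarrow> splitting_sequence \<tau>' w' k)"
proof -
  have "((\<lambda>s. Option.bind s split_step) ^^ k) None = None" by (induction k) auto
  then show ?thesis
    by (auto simp: splitting_sequence_def funpow_swap1[symmetric] funpow.simps(2)[of k] comp_def funpow_Suc_right simp del: funpow.simps split: option.splits)
qed

lemma splitting_sequence_greater: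
  "w (lose s \<tau>) < w (win s \<tau>) \<Longrightarrow> splitting_sequence \<tau> w (Suc k) = splitting_sequence (move s \<tau>) (split_weight s \<tau> w) k"
  by (cases s) (auto simp: splitting_sequence_Suc split_step_eq)

lemma splitting_sequence_equal:
  "w (win True \<tau>) = w (win False \<tau>) \<Longrightarrow> splitting_sequence \<tau> w (Suc k) = None"
  by (auto simp: splitting_sequence_Suc split_step_eq)

lemma occurs_greater:
  "w (lose s \<tau>) < w (win s \<tau>) \<Longrightarrow> occurs \<sigma>s \<tau> w (Suc k) = occurs \<sigma>s (move s \<tau>) (split_weight s \<tau> w) k"
  by (simp add: occurs_def splitting_sequence_greater)

lemma cylinder_classes:
  assumes "w \<in> cylinder \<tau> ss" "i < length (classes \<tau> ss)"
  shows "splitting_sequence \<tau> w i = Some (classes \<tau> ss ! i)"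
  using assms
proof (induction ss arbitrary: \<tau> w i)
  case (Cons s ss)
  show ?case
  proof (cases i)
    case (Suc k)
    then show ?thesis
      using Cons.prems Cons.IH[of "split_weight s \<tau> w" "move s \<tau>" k]
        splitting_sequence_greater[of w s \<tau> k] by simp
  qed simp
qed simp

lemma occurs_cylinder:
  assumes "w \<in> cylinder \<tau> ss" "drop m (classes \<tau> ss) = \<sigma>s"
  shows "occurs \<sigma>s \<tau> w m"
  unfolding occurs_def
proof (intro allI impI)
  fix i assume "i < length \<sigma>s"
  then show "splitting_sequence \<tau> w (m + i) = Some (\<sigma>s ! i)"
    using assms(2) cylinder_classes[OF assms(1), of "m + i"] by auto
qed

context splitting_system begin

section \<open>Measurability of events in the splitting sequence\<close>

lemma sets_weights_X: "\<tau> \<in> X \<Longrightarrow> weights \<tau> \<in> sets (lb E)"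
  using sets_region(2)[of \<tau>] bands by simp

lemma sets_split_preimage:
  assumes \<tau>: "\<tau> \<in> X" and A: "A \<in> sets (lb E)"
  shows "{w \<in> weights \<tau>. w (lose s \<tau>) < w (win s \<tau>) \<and> split_weight s \<tau> w \<in> A} \<in> sets (lb E)"
proof -
  have 1: "split_weight s \<tau> -` A \<inter> space (lb E) \<in> sets (lb E)"
    using measurable_sets[OF measurable_split_weight[OF unequal[OF \<tau>]]] A bands[OF \<tau>] by simp
  have 2: "{w \<in> space (lb E). w (lose s \<tau>) < w (win s \<tau>)} \<in> sets (lb E)"
    using win_E[OF \<tau>] by measurable
  have "weights \<tau> \<subseteq> space (lb E)" using sets_weights_X[OF \<tau>] by (rule sets.sets_into_space)
  then have "{w \<in> weights \<tau>. w (lose s \<tau>) < w (win s \<tau>) \<and> split_weight s \<tau> w \<in> A} =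
     weights \<tau> \<inter> (split_weight s \<tau> -` A \<inter> space (lb E)) \<inter> {w \<in> space (lb E). w (lose s \<tau>) < w (win s \<tau>)}"
    by auto
  then show ?thesis using 1 2 sets_weights_X[OF \<tau>] by (simp only: sets.Int)
qed

lemma sets_cylinder: "\<tau> \<in> X \<Longrightarrow> feasible_path \<tau> ss \<Longrightarrow> cylinder \<tau> ss \<in> sets (lb E)"
proof (induction ss arbitrary: \<tau>)
  case (Cons s ss)
  then show ?case using sets_split_preimage[OF Cons.prems(1)] move_X by simp
qed (simp add: sets_weights_X)

lemma sets_splitting_sequence:
  "\<tau> \<in> X \<Longrightarrow> {w \<in> weights \<tau>. splitting_sequence \<tau> w k = Some C} \<in> sets (lb E)"
proof (induction k arbitrary: \<tau>)
  case 0
  then show ?case by (cases "iso_class \<tau> = C") (auto simp: sets_weights_X)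
next
  case (Suc k)
  let ?B = "\<lambda>s. {w \<in> weights \<tau>. w (lose s \<tau>) < w (win s \<tau>) \<and>
      split_weight s \<tau> w \<in> {w \<in> weights (move s \<tau>). splitting_sequence (move s \<tau>) w k = Some C}}"
  have ie: "interval_exchange \<tau>" using unequal[OF Suc.prems] by (simp add: unequal_ends_def)
  have "{w \<in> weights \<tau>. splitting_sequence \<tau> w (Suc k) = Some C} = (\<Union>s\<in>{s. feasible s \<tau>}. ?B s)"
  proof (intro equalityI subsetI)
    fix w assume w: "w \<in> {w \<in> weights \<tau>. splitting_sequence \<tau> w (Suc k) = Some C}"
    have "w (win True \<tau>) \<noteq> w (win False \<tau>)" using w splitting_sequence_equal[of w \<tau> k] by auto
    then obtain s where s: "w (lose s \<tau>) < w (win s \<tau>)"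
      by (metis (full_types) linorder_neqE_linordered_idom)
    have "feasible s \<tau>" using feasible_if_greater[OF ie _ s] w by blast
    moreover have "split_weight s \<tau> w \<in> weights (move s \<tau>)"
      using split_weight_weights_iff[OF unequal[OF Suc.prems], of w s] w s by (auto simp: weights_def PiE_def)
    ultimately show "w \<in> (\<Union>s\<in>{s. feasible s \<tau>}. ?B s)"
      using w s splitting_sequence_greater[OF s, of k] by auto
  qed (auto simp: splitting_sequence_greater)
  also have "\<dots> \<in> sets (lb E)"
    using sets_split_preimage[OF Suc.prems Suc.IH] move_X[OF Suc.prems] by (intro sets.finite_UN) auto
  finally show ?case .
qed

section \<open>Volume of the weights that avoid a block\<close>

definition never :: "exchange set list \<Rightarrow> exchange \<Rightarrow> (nat \<Rightarrow> real) set" where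
  "never \<sigma>s \<tau> = {w \<in> weights \<tau>. \<forall>k. \<not> occurs \<sigma>s \<tau> w k}"

lemma sets_occurs:
  assumes "\<tau> \<in> X"
  shows "{w \<in> weights \<tau>. occurs \<sigma>s \<tau> w k} \<in> sets (lb E)"
proof -
  let ?M = "\<lambda>i. {w \<in> weights \<tau>. splitting_sequence \<tau> w (k + i) = Some (\<sigma>s ! i)}"
  have "{w \<in> weights \<tau>. occurs \<sigma>s \<tau> w k} = weights \<tau> - (\<Union>i\<in>{..<length \<sigma>s}. weights \<tau> - ?M i)"
    by (auto simp: occurs_def)
  also have "\<dots> \<in> sets (lb E)"
    using sets_weights_X[OF assms] sets_splitting_sequence[OF assms]
    by (intro sets.Diff sets.finite_UN) simp_all
  finally show ?thesis .
qed

lemma sets_never: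
  assumes "\<tau> \<in> X"
  shows "never \<sigma>s \<tau> \<in> sets (lb E)"
proof -
  have "never \<sigma>s \<tau> = weights \<tau> - (\<Union>k. {w \<in> weights \<tau>. occurs \<sigma>s \<tau> w k})"
    by (auto simp: never_def)
  then show ?thesis using sets_weights_X[OF assms] sets_occurs[OF assms] by (auto intro!: sets.Diff sets.countable_UN)
qed

lemma sets_region_X: "\<tau> \<in> X \<Longrightarrow> region \<tau> c \<in> sets (lb E)"
  using sets_region(1)[of \<tau> c] bands by simp

lemma emeasure_Int_region:
  assumes \<tau>: "\<tau> \<in> X" and c: "pos c" and A: "A \<in> sets (lb E)"
  shows "emeasure (area \<tau>) (A \<inter> region \<tau> c) = ennreal (measure (area \<tau>) (A \<inter> region \<tau> c))"
    and "measure (area \<tau>) (A \<inter> region \<tau> c) \<le> vol \<tau> c"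
proof -
  have r: "emeasure (area \<tau>) (region \<tau> c) = ennreal (vol \<tau> c)"
    using emeasure_region[OF unequal[OF \<tau>], of c] c bands[OF \<tau>] by (simp add: pos_def)
  have "emeasure (area \<tau>) (A \<inter> region \<tau> c) \<le> emeasure (area \<tau>) (region \<tau> c)"
    using sets_region_X[OF \<tau>] bands[OF \<tau>] by (intro emeasure_mono) auto
  then have le: "emeasure (area \<tau>) (A \<inter> region \<tau> c) \<le> ennreal (vol \<tau> c)" by (simp add: r)
  then have "emeasure (area \<tau>) (A \<inter> region \<tau> c) \<noteq> \<infinity>" by (auto simp: top_unique)
  then show 1: "emeasure (area \<tau>) (A \<inter> region \<tau> c) = ennreal (measure (area \<tau>) (A \<inter> region \<tau> c))"
    by (intro emeasure_eq_ennreal_measure) auto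
  show "measure (area \<tau>) (A \<inter> region \<tau> c) \<le> vol \<tau> c"
    using le unfolding 1 by (subst (asm) ennreal_le_iff) (auto simp: vol_def)
qed

text \<open>The sets \<open>A s\<close> may differ from child to child. With \<open>never\<close> in
  all children this gives subharmonicity; in \<open>path_gain\<close> a cylinder is removed in one
  child only.\<close>

lemma measure_children_le:
  assumes \<tau>: "\<tau> \<in> X" and c: "pos c" and B: "B \<in> sets (lb E)"
    and A: "\<And>s. feasible s \<tau> \<Longrightarrow> A s \<in> sets (lb E)"
    and sub: "\<And>s w. w \<in> B \<Longrightarrow> w \<in> weights \<tau> \<Longrightarrow> w (win s \<tau>) > w (lose s \<tau>) \<Longrightarrow> feasible s \<tau> \<Longrightarrow>
       split_weight s \<tau> w \<in> weights (move s \<tau>) \<Longrightarrow> split_weight s \<tau> w \<in> A s"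
  shows "measure (area \<tau>) (B \<inter> region \<tau> c) \<le>
    (\<Sum>s | feasible s \<tau>. measure (area (move s \<tau>)) (A s \<inter> region (move s \<tau>) (add_win s \<tau> c)))"
proof -
  have u: "unequal_ends \<tau>" by (rule unequal[OF \<tau>])
  have ie: "interval_exchange \<tau>" using u by (simp add: unequal_ends_def)
  have "ennreal (measure (area \<tau>) (B \<inter> region \<tau> c)) = emeasure (area \<tau>) (B \<inter> region \<tau> c)"
    by (rule emeasure_Int_region(1)[OF \<tau> c B, symmetric])
  also have "\<dots> \<le> (\<Sum>s | feasible s \<tau>. emeasure (area (move s \<tau>)) (A s \<inter> region (move s \<tau>) (add_win s \<tau> c)))"
  proof (rule emeasure_area_children_le[OF u])
    show "B \<inter> region \<tau> c \<in> sets (lb (bands \<tau>))" using B sets_region_X[OF \<tau>] bands[OF \<tau>] by simp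
    show "A s \<inter> region (move s \<tau>) (add_win s \<tau> c) \<in> sets (lb (bands \<tau>))" if "feasible s \<tau>" for s
      using A[OF that] sets_region_X[OF move_X[OF \<tau> that]] bands[OF \<tau>] by simp
    show "split_weight s \<tau> w \<in> A s \<inter> region (move s \<tau>) (add_win s \<tau> c)"
      if w: "w \<in> B \<inter> region \<tau> c" and s: "w (lose s \<tau>) < w (win s \<tau>)" for s w
    proof -
      have ww: "w \<in> weights \<tau>" using w by (auto simp: region_def)
      have "split_weight s \<tau> w \<in> weights (move s \<tau>)"
        using split_weight_weights_iff[OF u, of w s] ww s by (auto simp: weights_def PiE_def)
      moreover have "feasible s \<tau>" by (rule feasible_if_greater[OF ie ww s])
      ultimately show ?thesis
        using sub[of w s] w ww s pairing_split[OF u, of s c w] u by (auto simp: region_def)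
    qed
  qed (auto simp: region_def)
  also have "\<dots> = (\<Sum>s | feasible s \<tau>. ennreal (measure (area (move s \<tau>)) (A s \<inter> region (move s \<tau>) (add_win s \<tau> c))))"
    using A move_X[OF \<tau>] pos_add_win[OF \<tau> c] by (intro sum.cong refl emeasure_Int_region(1)) auto
  also have "\<dots> = ennreal (\<Sum>s | feasible s \<tau>. measure (area (move s \<tau>)) (A s \<inter> region (move s \<tau>) (add_win s \<tau> c)))"
    by (intro sum_ennreal) simp
  finally show ?thesis by (subst (asm) ennreal_le_iff) (auto intro: sum_nonneg)
qed

lemma never_split:
  assumes "w \<in> never \<sigma>s \<tau>" "w (lose s \<tau>) < w (win s \<tau>)" "split_weight s \<tau> w \<in> weights (move s \<tau>)"
  shows "split_weight s \<tau> w \<in> never \<sigma>s (move s \<tau>)"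
proof -
  have "\<not> occurs \<sigma>s (move s \<tau>) (split_weight s \<tau> w) k" for k
    using assms(1) occurs_greater[OF assms(2), of \<sigma>s k] by (auto simp: never_def)
  then show ?thesis using assms(3) by (simp add: never_def)
qed

text \<open>Children off the path are estimated by the bound \<open>a\<close>, the child on the path
  by the induction hypothesis, so that the gain is a proportion of \<open>a\<close> itself. All of
  \<open>E\<close> counts as large here, and \<open>vol_large_move\<close> therefore applies to
  every move.\<close>

lemma path_gain:
  assumes a: "0 \<le> a" "bounded_by a (\<lambda>\<tau> c. measure (area \<tau>) (never \<sigma>s \<tau> \<inter> region \<tau> c))"
    and \<theta>: "0 < \<theta>" "\<theta> \<le> M"
  defines "\<kappa> \<equiv> (\<theta> / (2 * M)) ^ n / (distortion n)\<^sup>2"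
  assumes "\<tau> \<in> X" "pos c" "feasible_path \<tau> ss" "0 < L" "\<forall>e\<in>E. c e \<le> L" "2 ^ length ss * L \<le> M"
    "\<And>e. e \<in> E \<Longrightarrow> \<theta> \<le> hat \<tau> c e"
  shows "measure (area \<tau>) ((never \<sigma>s \<tau> - cylinder \<tau> ss) \<inter> region \<tau> c) \<le> a * (1 - \<kappa> ^ length ss) * vol \<tau> c"
  using assms(6-)
proof (induction ss arbitrary: \<tau> c L)
  case Nil
  \<comment> \<open>The cylinder of the empty path is the whole cone, so nothing is left.\<close>
  have "(never \<sigma>s \<tau> - cylinder \<tau> []) \<inter> region \<tau> c = {}" by (auto simp: never_def)
  then have m0: "measure (area \<tau>) ((never \<sigma>s \<tau> - cylinder \<tau> []) \<inter> region \<tau> c) = 0"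
    by (simp only: measure_empty)
  show ?case unfolding m0 by simp
next
  case (Cons s ss)
  note \<tau> = Cons.prems(1) and c = Cons.prems(2) and L = Cons.prems(4-6) and large = Cons.prems(7)
  have f: "feasible s \<tau>" "feasible_path (move s \<tau>) ss" using Cons.prems(3) by auto
  let ?\<tau> = "move s \<tau>" and ?c = "add_win s \<tau> c"
  have \<tau>': "?\<tau> \<in> X" "pos ?c" using move_X[OF \<tau> f(1)] pos_add_win[OF \<tau> c] by auto
  have "1 * L \<le> 2 ^ length (s # ss) * L"
    using L(1) by (intro mult_right_mono one_le_power) auto
  then have LM: "L \<le> M" using L(3) by linarith
  then have M: "\<forall>e\<in>E. c e \<le> M" "M > 0" using L by force+
  have \<kappa>: "0 \<le> \<kappa>" "\<kappa> \<le> 1"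
  proof -
    show "0 \<le> \<kappa>" using \<theta> M by (simp add: \<kappa>_def)
    have "(\<theta> / (2 * M)) ^ n \<le> 1" using \<theta> M by (intro power_le_one) auto
    moreover have "1 \<le> (distortion n)\<^sup>2" using distortion_ge_1 by (intro one_le_power)
    ultimately show "\<kappa> \<le> 1" by (simp add: \<kappa>_def divide_le_eq)
  qed
  have step: "\<kappa> * vol \<tau> c \<le> vol ?\<tau> ?c"
    unfolding \<kappa>_def using vol_large_move[OF \<tau> c f(1) \<theta>(1), of E M] large win_E[OF \<tau>] M(1) by auto
  have IH: "measure (area ?\<tau>) ((never \<sigma>s ?\<tau> - cylinder ?\<tau> ss) \<inter> region ?\<tau> ?c) \<le> a * (1 - \<kappa> ^ length ss) * vol ?\<tau> ?c"
  proof (rule Cons.IH[OF \<tau>' f(2), of "2 * L"])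
    show "\<forall>e\<in>E. ?c e \<le> 2 * L" using add_win_le[OF \<tau> L(2)] L(1) by simp
    show "\<theta> \<le> hat ?\<tau> ?c e" if "e \<in> E" for e
      using hat_mono[OF \<tau> c f(1) that] large[OF that] by linarith
  qed (use L in auto)
  \<comment> \<open>The rest of the cylinder is removed only in the child that lies on the
    path.\<close>
  define A where "A r = (if r = s then never \<sigma>s ?\<tau> - cylinder ?\<tau> ss else never \<sigma>s (move r \<tau>))" for r
  have A: "A r \<in> sets (lb E)" if "feasible r \<tau>" for r
    using sets_never[OF move_X[OF \<tau> that], of \<sigma>s] sets_never[OF \<tau>'(1), of \<sigma>s] sets_cylinder[OF \<tau>'(1) f(2)]
    by (cases "r = s") (simp_all add: A_def sets.Diff)
  have B: "never \<sigma>s \<tau> - cylinder \<tau> (s # ss) \<in> sets (lb E)"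
    using sets_never[OF \<tau>] sets_cylinder[OF \<tau> Cons.prems(3)] by (rule sets.Diff)
  have "measure (area \<tau>) ((never \<sigma>s \<tau> - cylinder \<tau> (s # ss)) \<inter> region \<tau> c) \<le>
     (\<Sum>r | feasible r \<tau>. measure (area (move r \<tau>)) (A r \<inter> region (move r \<tau>) (add_win r \<tau> c)))"
  proof (rule measure_children_le[OF \<tau> c B A])
    fix r w
    assume w: "w \<in> never \<sigma>s \<tau> - cylinder \<tau> (s # ss)" "w \<in> weights \<tau>" "w (lose r \<tau>) < w (win r \<tau>)"
      "split_weight r \<tau> w \<in> weights (move r \<tau>)"
    have "split_weight r \<tau> w \<in> never \<sigma>s (move r \<tau>)" using never_split[of w] w by blast
    then show "split_weight r \<tau> w \<in> A r" using w by (auto simp: A_def)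
  qed
  moreover have "measure (area (move r \<tau>)) (A r \<inter> region (move r \<tau>) (add_win r \<tau> c)) \<le>
      a * vol (move r \<tau>) (add_win r \<tau> c)" if "feasible r \<tau>" for r
  proof (cases "r = s")
    case True
    have "a * (1 - \<kappa> ^ length ss) * vol ?\<tau> ?c \<le> a * 1 * vol ?\<tau> ?c"
      using a(1) \<kappa> by (intro mult_right_mono mult_left_mono) (auto simp: vol_def)
    then show ?thesis using True IH by (simp add: A_def)
  next
    case False
    then show ?thesis
      using bounded_byD[OF a(2) move_X[OF \<tau> that] pos_add_win[OF \<tau> c]] by (simp add: A_def)
  qed
  moreover have "measure (area ?\<tau>) (A s \<inter> region ?\<tau> ?c) \<le> a * (1 - \<kappa> ^ length ss) * vol ?\<tau> ?c"
    using IH by (simp add: A_def)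
  moreover have "0 \<le> a * (1 - \<kappa> ^ length ss)" "a * (1 - \<kappa> ^ length ss) \<le> a"
    using a(1) \<kappa> by (auto simp: power_le_one mult_left_le)
  ultimately have "measure (area \<tau>) ((never \<sigma>s \<tau> - cylinder \<tau> (s # ss)) \<inter> region \<tau> c) \<le>
     (a - (a - a * (1 - \<kappa> ^ length ss)) * \<kappa>) * vol \<tau> c"
    using step by (intro one_child_bound[OF \<tau> c f(1), where \<phi> = "\<lambda>r. measure (area (move r \<tau>)) (A r \<inter> region (move r \<tau>) (add_win r \<tau> c))"]) auto
  then show ?case by (simp add: algebra_simps)
qed

context
  fixes \<sigma>s
  assumes paths: "\<And>\<tau>. \<tau> \<in> X \<Longrightarrow> \<exists>ss m. feasible_path \<tau> ss \<and> drop m (classes \<tau> ss) = \<sigma>s"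
begin

text \<open>A path that ends with the block has a cylinder disjoint from \<open>never\<close>, so
  \<open>path_gain\<close> provides the gain \<delta> = \<open>\<kappa> ^ N\<close> at balanced
  states, where \<open>N\<close> bounds the lengths of the chosen paths. The regions of the constant
  functionals \<open>1 / (i + 1)\<close> exhaust the cone.\<close>

lemma never_null:
  assumes \<tau>: "\<tau> \<in> X"
  shows "emeasure (area \<tau>) (never \<sigma>s \<tau>) = 0"
proof -
  let ?\<psi> = "\<lambda>\<tau> c. measure (area \<tau>) (never \<sigma>s \<tau> \<inter> region \<tau> c)"
  obtain p m where p: "\<And>\<tau>. \<tau> \<in> X \<Longrightarrow> feasible_path \<tau> (p \<tau>) \<and> drop (m \<tau>) (classes \<tau> (p \<tau>)) = \<sigma>s"
    using paths by metis
  define N where "N = Max ((length \<circ> p) ` X)"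
  have N: "length (p \<tau>) \<le> N" if "\<tau> \<in> X" for \<tau>
    unfolding N_def using that finite_X by (auto intro!: Max_ge)
  have sub: "subharmonic ?\<psi>"
    unfolding subharmonic_def
  proof (intro ballI allI impI)
    fix \<tau> c assume \<tau>: "\<tau> \<in> X" and c: "pos c"
    show "?\<psi> \<tau> c \<le> (\<Sum>s | feasible s \<tau>. ?\<psi> (move s \<tau>) (add_win s \<tau> c))"
    proof (rule measure_children_le[OF \<tau> c sets_never[OF \<tau>]])
      show "never \<sigma>s (move s \<tau>) \<in> sets (lb E)" if "feasible s \<tau>" for s
        by (rule sets_never[OF move_X[OF \<tau> that]])
      show "split_weight s \<tau> w \<in> never \<sigma>s (move s \<tau>)"
        if "w \<in> never \<sigma>s \<tau>" "w (lose s \<tau>) < w (win s \<tau>)" "split_weight s \<tau> w \<in> weights (move s \<tau>)" for s w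
        using that by (rule never_split)
    qed
  qed
  have bd: "bounded_by 1 ?\<psi>"
    unfolding bounded_by_def
  proof (intro ballI allI impI)
    fix \<tau> c assume "\<tau> \<in> X" "pos c"
    then show "?\<psi> \<tau> c \<le> 1 * vol \<tau> c" using emeasure_Int_region(2)[OF _ _ sets_never] by simp
  qed
  have zero: "?\<psi> \<tau> c \<le> 0" if c: "pos c" for c
  proof (rule subharmonic_vanishes[OF sub bd _ \<tau> c])
    fix K :: real assume K: "1 \<le> K"
    define \<kappa> where "\<kappa> = (1 / (2 * (2 ^ N * K))) ^ n / (distortion n)\<^sup>2"
    have NK: "1 \<le> 2 ^ N * K" using K by (intro mult_ge1_I one_le_power) auto
    have \<kappa>: "0 < \<kappa>" "\<kappa> \<le> 1"
    proof -
      show "0 < \<kappa>" using NK distortion_ge_1 by (simp add: \<kappa>_def)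
      have "(1 / (2 * (2 ^ N * K))) ^ n \<le> 1" using NK by (intro power_le_one) auto
      moreover have "1 \<le> (distortion n)\<^sup>2" using distortion_ge_1 by (intro one_le_power)
      ultimately show "\<kappa> \<le> 1" by (simp add: \<kappa>_def divide_le_eq)
    qed
    show "\<exists>\<delta>>0. \<delta> \<le> 1 \<and> (\<forall>a \<tau> c. 0 \<le> a \<longrightarrow> bounded_by a ?\<psi> \<longrightarrow> \<tau> \<in> X \<longrightarrow> pos c \<longrightarrow>
        balanced n K \<tau> c \<longrightarrow> ?\<psi> \<tau> c \<le> a * (1 - \<delta>) * vol \<tau> c)"
    proof (rule exI[of _ "\<kappa> ^ N"], intro conjI allI impI)
      show "0 < \<kappa> ^ N" "\<kappa> ^ N \<le> 1" using \<kappa> by (auto simp: power_le_one)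
      fix a \<tau> c
      assume a: "0 \<le> a" "bounded_by a ?\<psi>" and \<tau>: "\<tau> \<in> X" and c: "pos c" and "balanced n K \<tau> c"
      then obtain L where L: "0 < L" "\<forall>e\<in>E. c e \<le> L" "n \<le> card {e \<in> E. L / K \<le> hat \<tau> c e}"
        by (auto simp: balanced_def)
      have "{e \<in> E. L / K \<le> hat \<tau> c e} = E"
        using L(3) by (intro card_seteq) auto
      then have large: "L / K \<le> hat \<tau> c e" if "e \<in> E" for e using that by blast
      define M where "M = 2 ^ N * L"
      have "1 * L \<le> 2 ^ N * L" using L by (intro mult_right_mono one_le_power) auto
      moreover have "L / K \<le> L" using L K by (simp add: divide_le_eq mult_left_le)
      ultimately have M: "L / K \<le> M" by (simp add: M_def)
      have \<kappa>_eq: "(L / K / (2 * M)) ^ n / (distortion n)\<^sup>2 = \<kappa>"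
        using L K by (simp add: M_def \<kappa>_def field_simps)
      have "never \<sigma>s \<tau> \<inter> cylinder \<tau> (p \<tau>) = {}"
        using occurs_cylinder[of _ \<tau> "p \<tau>" "m \<tau>" \<sigma>s] p[OF \<tau>] by (auto simp: never_def)
      then have "?\<psi> \<tau> c = measure (area \<tau>) ((never \<sigma>s \<tau> - cylinder \<tau> (p \<tau>)) \<inter> region \<tau> c)"
        by (intro arg_cong[where f = "measure (area \<tau>)"]) blast
      also have "\<dots> \<le> a * (1 - \<kappa> ^ length (p \<tau>)) * vol \<tau> c"
        unfolding \<kappa>_eq[symmetric]
      proof (rule path_gain[OF a _ M \<tau> c _ L(1,2)])
        show "2 ^ length (p \<tau>) * L \<le> M"
          unfolding M_def using N[OF \<tau>] L by (intro mult_right_mono power_increasing) auto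
      qed (use L K large p[OF \<tau>] in auto)
      also have "\<dots> \<le> a * (1 - \<kappa> ^ N) * vol \<tau> c"
        using a \<kappa> N[OF \<tau>] by (intro mult_right_mono mult_left_mono diff_left_mono power_decreasing) (auto simp: vol_def)
      finally show "?\<psi> \<tau> c \<le> a * (1 - \<kappa> ^ N) * vol \<tau> c" .
    qed
  qed
  define R where "R i = region \<tau> (\<lambda>_. 1 / real (Suc i))" for i
  have pos: "pos (\<lambda>_. 1 / real (Suc i))" for i by (simp add: pos_def)
  have "never \<sigma>s \<tau> \<subseteq> (\<Union>i. never \<sigma>s \<tau> \<inter> R i)"
  proof
    fix w assume w: "w \<in> never \<sigma>s \<tau>"
    obtain i where "(\<Sum>e\<in>bands \<tau>. w e) \<le> real i" using real_arch_simple by blast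
    then have "(\<Sum>e\<in>bands \<tau>. w e) \<le> real (Suc i)" by simp
    then have "(\<Sum>e\<in>bands \<tau>. w e) / real (Suc i) \<le> 1" by (simp add: divide_le_eq)
    then have "(\<Sum>e\<in>bands \<tau>. 1 / real (Suc i) * w e) \<le> 1"
      by (simp only: sum_divide_distrib mult_1 times_divide_eq_left)
    then have "w \<in> R i" using w by (simp add: R_def region_def never_def)
    then show "w \<in> (\<Union>i. never \<sigma>s \<tau> \<inter> R i)" using w by blast
  qed
  moreover have "never \<sigma>s \<tau> \<inter> R i \<in> null_sets (area \<tau>)" for i
  proof -
    have "measure (area \<tau>) (never \<sigma>s \<tau> \<inter> R i) = 0"
      unfolding R_def using zero[OF pos[of i]] measure_nonneg by (rule antisym)
    then have "emeasure (area \<tau>) (never \<sigma>s \<tau> \<inter> R i) = 0"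
      using emeasure_Int_region(1)[OF \<tau> pos[of i] sets_never[OF \<tau>, of \<sigma>s]] by (simp only: R_def ennreal_0)
    moreover have "never \<sigma>s \<tau> \<inter> R i \<in> sets (area \<tau>)"
      using sets.Int[OF sets_never[OF \<tau>] sets_region_X[OF \<tau>]] bands[OF \<tau>] by (simp add: R_def)
    ultimately show ?thesis by (rule null_setsI)
  qed
  ultimately have "never \<sigma>s \<tau> \<in> null_sets (area \<tau>)"
    using sets_never[OF \<tau>, of \<sigma>s] bands[OF \<tau>]
    by (intro null_sets_subset[OF null_sets_UN[of "\<lambda>i. never \<sigma>s \<tau> \<inter> R i" "area \<tau>"], of "never \<sigma>s \<tau>"]) simp_all
  then show ?thesis by (rule null_setsD1)
qed

text \<open>Avoiding the block from time \<open>Suc m\<close> on is avoiding it from time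
  \<open>m\<close> on after one split, and volume does not increase in passing back from the
  successors.\<close>

lemma eventually_never_null:
  assumes "\<tau> \<in> X"
  shows "{w \<in> weights \<tau>. \<forall>k\<ge>m. \<not> occurs \<sigma>s \<tau> w k} \<in> null_sets (area \<tau>)"
  using assms
proof (induction m arbitrary: \<tau>)
  case 0
  then show ?case
    using never_null[OF 0] sets_never[OF 0, of \<sigma>s] bands[OF 0] by (simp add: never_def null_sets_def)
next
  case (Suc m)
  let ?N = "\<lambda>\<tau> m. {w \<in> weights \<tau>. \<forall>k\<ge>m. \<not> occurs \<sigma>s \<tau> w k}"
  have u: "unequal_ends \<tau>" by (rule unequal[OF Suc.prems])
  have eq: "?N \<tau> (Suc m) = weights \<tau> - (\<Union>k\<in>{Suc m..}. {w \<in> weights \<tau>. occurs \<sigma>s \<tau> w k})" by auto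
  have meas: "?N \<tau> (Suc m) \<in> sets (lb E)"
    unfolding eq using sets_weights_X[OF Suc.prems] sets_occurs[OF Suc.prems]
    by (intro sets.Diff sets.countable_UN'[OF _ image_subsetI]) auto
  have "emeasure (area \<tau>) (?N \<tau> (Suc m)) \<le> (\<Sum>s | feasible s \<tau>. emeasure (area (move s \<tau>)) (?N (move s \<tau>) m))"
  proof (rule emeasure_area_children_le[OF u])
    show "?N (move s \<tau>) m \<in> sets (lb (bands \<tau>))" if "feasible s \<tau>" for s
      using null_setsD2[OF Suc.IH[OF move_X[OF Suc.prems that]]] unfolding sets_area bands_move[OF u] .
    show "split_weight s \<tau> w \<in> ?N (move s \<tau>) m"
      if w: "w \<in> ?N \<tau> (Suc m)" and s: "w (lose s \<tau>) < w (win s \<tau>)" for s w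
    proof -
      have "split_weight s \<tau> w \<in> weights (move s \<tau>)"
        using split_weight_weights_iff[OF u, of w s] w s by (auto simp: weights_def PiE_def)
      then show ?thesis using w occurs_greater[of w s \<tau>, OF s] by auto
    qed
    show "?N \<tau> (Suc m) \<in> sets (lb (bands \<tau>))" using meas unfolding bands[OF Suc.prems] .
  qed blast
  also have "\<dots> = 0" using null_setsD1[OF Suc.IH[OF move_X[OF Suc.prems]]] by (intro sum.neutral) simp
  finally have "emeasure (area \<tau>) (?N \<tau> (Suc m)) = 0" by (rule le_zero_eq[THEN iffD1])
  moreover have "?N \<tau> (Suc m) \<in> sets (area \<tau>)" using meas unfolding sets_area bands[OF Suc.prems] .
  ultimately show ?case by (rule null_setsI)
qed

text \<open>Finitely many occurrences have a last one, which leaves countably many null sets. They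
  are null in the hyperplane as well, whose measure is a constant multiple of
  \<open>area\<close>.\<close>

theorem AE_occurs_infinitely_often:
  assumes \<tau>: "\<tau> \<in> X"
  shows "AE w in lebesgue_weights \<tau>. infinite {k. occurs \<sigma>s \<tau> w k}"
proof -
  let ?N = "\<lambda>m. {w \<in> weights \<tau>. \<forall>k\<ge>m. \<not> occurs \<sigma>s \<tau> w k}"
  have ie: "interval_exchange \<tau>"
    using unequal[OF \<tau>] by (simp add: unequal_ends_def)
  obtain e where "e \<in> side True \<tau>" using side_nonempty[OF \<tau>, of True] by (metis ex_in_conv)
  then have e: "e \<in> loose \<tau>" by simp
  have sets_h: "sets (lebesgue_hyperplane \<tau>) = sets (lb E)"
    by (simp add: lebesgue_hyperplane_def bands[OF \<tau>])
  have null: "?N m \<in> null_sets (lebesgue_hyperplane \<tau>)" for m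
  proof (rule null_setsI)
    have N: "?N m \<in> null_sets (area \<tau>)" by (rule eventually_never_null[OF \<tau>])
    then have s: "?N m \<in> sets (lb (bands \<tau>))" unfolding sets_area[symmetric] by (rule null_setsD2)
    then show "?N m \<in> sets (lebesgue_hyperplane \<tau>)" by (simp only: sets_h bands[OF \<tau>])
    show "emeasure (lebesgue_hyperplane \<tau>) (?N m) = 0"
      unfolding emeasure_area(2)[OF ie e s] null_setsD1[OF N] by simp
  qed
  have "AE w in lebesgue_hyperplane \<tau>. w \<in> weights \<tau> \<longrightarrow> infinite {k. occurs \<sigma>s \<tau> w k}"
  proof (rule AE_I'[OF null_sets_UN[of ?N]])
    show "{w \<in> space (lebesgue_hyperplane \<tau>). \<not> (w \<in> weights \<tau> \<longrightarrow> infinite {k. occurs \<sigma>s \<tau> w k})} \<subseteq> (\<Union>m. ?N m)"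
    proof
      fix w assume "w \<in> {w \<in> space (lebesgue_hyperplane \<tau>). \<not> (w \<in> weights \<tau> \<longrightarrow> infinite {k. occurs \<sigma>s \<tau> w k})}"
      then have w: "w \<in> weights \<tau>" "finite {k. occurs \<sigma>s \<tau> w k}" by auto
      from w(2) obtain m where "\<forall>k\<in>{k. occurs \<sigma>s \<tau> w k}. k < m" using finite_nat_set_iff_bounded by blast
      then have "w \<in> ?N m" using w(1) by force
      then show "w \<in> (\<Union>m. ?N m)" by blast
    qed
  qed (rule null)
  moreover have "weights \<tau> \<inter> space (lebesgue_hyperplane \<tau>) \<in> sets (lebesgue_hyperplane \<tau>)"
    using sets_weights_X[OF \<tau>] sets_h by (metis sets.Int_space_eq2)
  ultimately show ?thesis
    unfolding lebesgue_weights_def by (simp only: AE_restrict_space_iff)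
qed

end
end

section \<open>Enumeration by gluing the band ends\<close>

type_synonym chains = "(nat \<times> nat \<times> nat) list"

fun take_out :: "nat \<Rightarrow> chains \<Rightarrow> (nat \<times> nat \<times> chains) option" where
  "take_out j [] = None"
| "take_out j ((x, t, k) # r) = (if x = j then Some (t, k, r) else
     (case take_out j r of None \<Rightarrow> None | Some (t', k', r') \<Rightarrow> Some (t', k', (x, t, k) # r')))"

fun redirect :: "nat \<Rightarrow> nat \<Rightarrow> nat \<Rightarrow> chains \<Rightarrow> chains option" where
  "redirect i t k [] = None"
| "redirect i t k ((x, t', k') # r) = (if t' = i then (if k + k' \<le> 3 then Some ((x, t, k + k') # r) else None)
     else (case redirect i t k r of None \<Rightarrow> None | Some r' \<Rightarrow> Some ((x, t', k') # r')))"

text \<open>Applied when the ends \<open>i\<close> and \<open>j\<close> are glued: the chain that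
  leads to \<open>i\<close> is continued by the chain that begins after \<open>j\<close>. If both
  are the same chain, a region closes up and must have exactly three ideal vertices.\<close>

definition bypass :: "nat \<Rightarrow> nat \<Rightarrow> chains \<Rightarrow> chains option" where
  "bypass j i st = (case take_out j st of None \<Rightarrow> None | Some (t, k, r) \<Rightarrow>
     if t = i then (if k = 3 then Some r else None) else redirect i t k r)"

text \<open>A band has two sides: arriving at \<open>i\<close> one leaves after \<open>j\<close>,
  and arriving at \<open>j\<close> one leaves after \<open>i\<close>.\<close>

definition pair_up :: "nat \<Rightarrow> nat \<Rightarrow> chains \<Rightarrow> chains option" where
  "pair_up i j st = (case bypass j i st of None \<Rightarrow> None | Some st' \<Rightarrow> bypass i j st')"

text \<open>The target of the first chain is glued to each of the other ends in turn; a gluing is dropped as soon as a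
  region is closed up with the wrong number of ideal vertices or has too many of them.\<close>

fun gluings :: "nat \<Rightarrow> (nat \<times> nat) list \<Rightarrow> chains \<Rightarrow> (nat \<times> nat) list option list" where
  "gluings n ps [] = [Some ps]"
| "gluings 0 ps (e # r) = [None]"
| "gluings (Suc n) ps ((a, i, k) # r) = concat (map (\<lambda>(j, _, l). if j = i then [] else
     if (if j = a then k \<noteq> 3 else 3 < k + l) then [] else
     (case pair_up i j ((a, i, k) # r) of None \<Rightarrow> [] | Some st \<Rightarrow> gluings n ((i, j) # ps) st)) ((a, i, k) # r))"

section \<open>Weighted orbits of a finite permutation\<close>

definition orbit :: "('a \<Rightarrow> 'a) \<Rightarrow> 'a \<Rightarrow> 'a set" where
  "orbit N x = range (\<lambda>k. (N ^^ k) x)"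

text \<open>The points are chains of gaps, the orbits complementary regions, and \<kappa> counts the
  ideal vertices on a chain. Arbitrary natural weights make the condition stable under merging
  chains.\<close>

definition all_three :: "'a set \<Rightarrow> ('a \<Rightarrow> 'a) \<Rightarrow> ('a \<Rightarrow> nat) \<Rightarrow> bool" where
  "all_three I N \<kappa> \<longleftrightarrow> (\<forall>x\<in>I. sum \<kappa> (orbit N x) = 3)"

lemma orbit_refl: "x \<in> orbit N x"
  unfolding orbit_def by (rule range_eqI[of _ _ 0]) simp

lemma orbit_step: "y \<in> orbit N x \<Longrightarrow> N y \<in> orbit N x"
proof -
  assume "y \<in> orbit N x"
  then obtain k where "y = (N ^^ k) x" by (auto simp: orbit_def)
  then have "N y = (N ^^ Suc k) x" by simp
  then show ?thesis unfolding orbit_def by blast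
qed

lemma orbit_subset:
  assumes "x \<in> S" "\<And>y. y \<in> S \<Longrightarrow> N y \<in> S"
  shows "orbit N x \<subseteq> S"
proof -
  have "(N ^^ k) x \<in> S" for k by (induction k) (use assms in auto)
  then show ?thesis by (auto simp: orbit_def)
qed

lemma orbit_mono: "y \<in> orbit N x \<Longrightarrow> orbit N y \<subseteq> orbit N x"
  by (rule orbit_subset) (auto intro: orbit_step)

lemma orbit_cong:
  assumes "x \<in> I" "\<And>y. y \<in> I \<Longrightarrow> N y \<in> I" "\<And>y. y \<in> I \<Longrightarrow> N' y = N y"
  shows "orbit N' x = orbit N x"
proof -
  have "(N' ^^ k) x = (N ^^ k) x \<and> (N ^^ k) x \<in> I" for k
    by (induction k) (use assms in auto)
  then show ?thesis by (simp add: orbit_def)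
qed

lemma all_three_cong:
  assumes "\<And>y. y \<in> I \<Longrightarrow> N y \<in> I" "\<And>y. y \<in> I \<Longrightarrow> N' y = N y" "\<And>y. y \<in> I \<Longrightarrow> \<kappa>' y = \<kappa> y"
  shows "all_three I N' \<kappa>' \<longleftrightarrow> all_three I N \<kappa>"
proof -
  have "sum \<kappa>' (orbit N' x) = sum \<kappa> (orbit N x)" if "x \<in> I" for x
  proof -
    have "orbit N x \<subseteq> I" using that assms(1) by (rule orbit_subset)
    moreover have "orbit N' x = orbit N x" by (rule orbit_cong[OF that assms(1,2)])
    ultimately show ?thesis using assms(3) by (metis (mono_tags, lifting) subsetD sum.cong)
  qed
  then show ?thesis by (simp add: all_three_def)
qed

locale finite_permutation =
  fixes I :: "'a set" and N :: "'a \<Rightarrow> 'a"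
  assumes fin: "finite I" and inj: "inj_on N I" and closed: "x \<in> I \<Longrightarrow> N x \<in> I"
begin

lemma orbit_I: "x \<in> I \<Longrightarrow> orbit N x \<subseteq> I"
  using closed by (intro orbit_subset)

lemma funpow_I: "x \<in> I \<Longrightarrow> (N ^^ k) x \<in> I"
  using orbit_I by (auto simp: orbit_def)

lemma surj: "N ` I = I"
  using endo_inj_surj[OF fin _ inj] closed by blast

lemma funpow_cancel: "x \<in> I \<Longrightarrow> y \<in> I \<Longrightarrow> (N ^^ k) x = (N ^^ k) y \<Longrightarrow> x = y"
proof (induction k)
  case (Suc k)
  then show ?case using inj funpow_I[of _ k] by (auto dest: inj_onD)
qed simp

lemma period:
  assumes "x \<in> I"
  obtains m where "m > 0" "(N ^^ m) x = x"
proof -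
  have "\<not> inj (\<lambda>k. (N ^^ k) x)"
  proof
    assume "inj (\<lambda>k. (N ^^ k) x)"
    then have "infinite (range (\<lambda>k. (N ^^ k) x))" by (rule range_inj_infinite)
    moreover have "range (\<lambda>k. (N ^^ k) x) \<subseteq> I" using funpow_I[OF assms] by blast
    ultimately show False using fin finite_subset by blast
  qed
  then obtain a b where "(N ^^ a) x = (N ^^ b) x" "a < b"
    by (metis (mono_tags, lifting) injI linorder_neqE_nat)
  then have "(N ^^ a) ((N ^^ (b - a)) x) = (N ^^ a) x"
    by (metis funpow_add comp_apply le_add_diff_inverse less_imp_le)
  then have "(N ^^ (b - a)) x = x" using funpow_cancel[of "(N ^^ (b - a)) x" x a] funpow_I assms by blast
  with \<open>a < b\<close> that[of "b - a"] show ?thesis by simp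
qed

lemma orbit_step_back:
  assumes "x \<in> I"
  shows "x \<in> orbit N (N x)"
proof -
  obtain m where m: "m > 0" "(N ^^ m) x = x" using period[OF assms] by blast
  then have "(N ^^ (m - 1)) (N x) = x" by (metis Suc_pred' funpow_simps_right(2) comp_apply diff_Suc_1 gr0_conv_Suc)
  then show ?thesis unfolding orbit_def by (metis rangeI)
qed

lemma orbit_N: "x \<in> I \<Longrightarrow> orbit N (N x) = orbit N x"
  by (rule antisym[OF orbit_mono[OF orbit_step[OF orbit_refl]] orbit_mono[OF orbit_step_back]])

lemma orbit_eq: "x \<in> I \<Longrightarrow> y \<in> orbit N x \<Longrightarrow> orbit N y = orbit N x"
proof -
  assume x: "x \<in> I" and "y \<in> orbit N x"
  then obtain k where k: "y = (N ^^ k) x" by (auto simp: orbit_def)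
  have "orbit N ((N ^^ k) x) = orbit N x" for k
    by (induction k) (simp_all add: orbit_N funpow_I[OF x])
  with k show ?thesis by simp
qed

lemma all_three_fixed:
  assumes j: "j \<in> I" "N j = j"
  shows "all_three I N \<kappa> \<longleftrightarrow> \<kappa> j = 3 \<and> all_three (I - {j}) N \<kappa>"
proof -
  have "orbit N j \<subseteq> {j}" using j by (intro orbit_subset) auto
  then have "orbit N j = {j}" using orbit_refl[of j N] by blast
  then have "sum \<kappa> (orbit N j) = \<kappa> j" by simp
  then show ?thesis using j by (auto simp: all_three_def)
qed

lemma remove_fixed:
  assumes j: "j \<in> I" "N j = j"
  shows "finite_permutation (I - {j}) N"
proof
  show "N x \<in> I - {j}" if "x \<in> I - {j}" for x
    using that closed[of x] inj j by (auto dest: inj_onD)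
qed (use fin inj in \<open>auto intro: inj_on_subset\<close>)

context
  fixes j assumes j: "j \<in> I" "N j \<noteq> j"
begin

text \<open>The first return map of \<open>N\<close> to the complement of \<open>j\<close>.\<close>

definition skip :: "'a \<Rightarrow> 'a" where
  "skip x = (if N x = j then N j else N x)"

lemma remove_moved: "finite_permutation (I - {j}) skip"
proof
  show "skip x \<in> I - {j}" if "x \<in> I - {j}" for x
    using that closed[of x] closed[of j] j by (auto simp: skip_def)
  show "inj_on skip (I - {j})"
  proof (rule inj_onI)
    fix x y assume "x \<in> I - {j}" "y \<in> I - {j}" "skip x = skip y"
    then show "x = y" using j inj_onD[OF inj, of x y] inj_onD[OF inj, of j x] inj_onD[OF inj, of j y]
      by (auto simp: skip_def split: if_splits)
  qed
qed (use fin in auto)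

lemma orbit_skip:
  assumes x: "x \<in> I - {j}"
  shows "orbit skip x = orbit N x - {j}"
proof (rule antisym)
  interpret S: finite_permutation "I - {j}" skip by (rule remove_moved)
  have "N j \<in> orbit N x" if "N y = j" "y \<in> orbit N x" for y
    using orbit_step[OF orbit_step[OF that(2)]] that(1) by simp
  then have "orbit skip x \<subseteq> orbit N x"
    using orbit_refl[of x N] orbit_step[of _ N x] by (intro orbit_subset) (auto simp: skip_def)
  then show "orbit skip x \<subseteq> orbit N x - {j}" using S.orbit_I[OF x] by blast
  have "orbit N x \<subseteq> orbit skip x \<union> (if \<exists>a\<in>orbit skip x. N a = j then {j} else {})"
  proof (rule orbit_subset)
    fix y assume y: "y \<in> orbit skip x \<union> (if \<exists>a\<in>orbit skip x. N a = j then {j} else {})"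
    show "N y \<in> orbit skip x \<union> (if \<exists>a\<in>orbit skip x. N a = j then {j} else {})"
    proof (cases "y \<in> orbit skip x")
      case True
      then show ?thesis using orbit_step[OF True] by (cases "N y = j") (auto simp: skip_def)
    next
      case False
      then obtain a where a: "y = j" "a \<in> orbit skip x" "N a = j" using y by (auto split: if_splits)
      then have "N j \<in> orbit skip x" using orbit_step[OF a(2)] by (simp add: skip_def)
      then show ?thesis using a by simp
    qed
  qed (simp add: orbit_refl)
  then show "orbit N x - {j} \<subseteq> orbit skip x" by (auto split: if_splits)
qed

text \<open>The weight of \<open>j\<close> is handed to its only predecessor, which lies on the same
  orbit, so the totals do not change.\<close>

lemma sum_orbit_skip:
  fixes \<kappa> :: "'a \<Rightarrow> nat"
  assumes x: "x \<in> I - {j}"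
  shows "(\<Sum>y\<in>orbit skip x. \<kappa> y + (if N y = j then \<kappa> j else 0)) = sum \<kappa> (orbit N x)"
proof -
  have finO: "finite (orbit N x)" using orbit_I[of x] x fin by (auto intro: finite_subset)
  show ?thesis
  proof (cases "j \<in> orbit N x")
    case False
    then have "N y \<noteq> j" if "y \<in> orbit N x" for y using orbit_step[OF that] by auto
    then show ?thesis unfolding orbit_skip[OF x] using False by (intro sum.cong) auto
  next
    case True
    obtain a where a: "a \<in> I" "N a = j" using surj j by (metis imageE)
    have "a \<in> orbit N j" using orbit_step_back[OF a(1)] a(2) by simp
    then have aO: "a \<in> orbit N x" using orbit_eq[of x j] True x by auto
    have "(\<Sum>y\<in>orbit N x - {j}. \<kappa> y + (if N y = j then \<kappa> j else 0)) =
        (\<Sum>y\<in>orbit N x - {j}. \<kappa> y + (if y = a then \<kappa> j else 0))"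
    proof (intro sum.cong refl)
      fix y assume "y \<in> orbit N x - {j}"
      then have "y \<in> I" using orbit_I[of x] x by auto
      then have "N y = j \<longleftrightarrow> y = a" using a inj by (auto dest: inj_onD)
      then show "\<kappa> y + (if N y = j then \<kappa> j else 0) = \<kappa> y + (if y = a then \<kappa> j else 0)" by simp
    qed
    also have "\<dots> = sum \<kappa> (orbit N x - {j}) + \<kappa> j"
      using aO a j finO by (auto simp: sum.distrib)
    also have "\<dots> = sum \<kappa> (orbit N x)" using True finO by (simp add: sum.remove)
    finally show ?thesis by (simp add: orbit_skip[OF x])
  qed
qed

text \<open>No orbit is lost with \<open>j\<close>, since its orbit also contains the different
  point \<open>N j\<close>.\<close>

lemma all_three_moved:
  "all_three I N \<kappa> \<longleftrightarrow> all_three (I - {j}) skip (\<lambda>y. \<kappa> y + (if N y = j then \<kappa> j else 0))"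
proof -
  have "sum \<kappa> (orbit N j) = sum \<kappa> (orbit N (N j))" using orbit_N[OF j(1)] by simp
  moreover have "N j \<in> I - {j}" using closed j by simp
  ultimately have "(\<forall>x\<in>I. sum \<kappa> (orbit N x) = 3) \<longleftrightarrow> (\<forall>x\<in>I - {j}. sum \<kappa> (orbit N x) = 3)"
    using j(1) by (metis DiffD1 DiffI singletonD)
  also have "\<dots> \<longleftrightarrow> (\<forall>x\<in>I - {j}. (\<Sum>y\<in>orbit skip x. \<kappa> y + (if N y = j then \<kappa> j else 0)) = 3)"
    by (intro ball_cong refl) (simp only: sum_orbit_skip)
  finally show ?thesis unfolding all_three_def .
qed

end
end

section \<open>Chains of gaps on the complementary regions\<close>

definition target :: "chains \<Rightarrow> nat \<Rightarrow> nat" where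
  "target st x = fst (the (map_of st x))"

definition weight :: "chains \<Rightarrow> nat \<Rightarrow> nat" where
  "weight st x = snd (the (map_of st x))"

abbreviation chain_ends :: "chains \<Rightarrow> nat set" where
  "chain_ends st \<equiv> fst ` set st"

text \<open>A chain \<open>(x, t, k)\<close> is a sequence of consecutive gaps on one complementary region that is known
  already: it begins after the band end \<open>x\<close>, leads to the band end \<open>t\<close>, and contains \<open>k\<close> ideal
  vertices. If \<open>p\<close> maps each band end to the other end of its band, the chain is followed by the
  chain beginning after \<open>p t\<close>.\<close>

definition chain_system :: "(nat \<Rightarrow> nat) \<Rightarrow> chains \<Rightarrow> bool" where
  "chain_system p st \<longleftrightarrow> distinct (map fst st) \<and> (\<forall>x\<in>chain_ends st. p (p (target st x)) = target st x) \<and>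
     finite_permutation (chain_ends st) (\<lambda>x. p (target st x))"

definition triangular :: "(nat \<Rightarrow> nat) \<Rightarrow> chains \<Rightarrow> bool" where
  "triangular p st \<longleftrightarrow> all_three (chain_ends st) (\<lambda>x. p (target st x)) (weight st)"

lemma take_out_Some:
  assumes "distinct (map fst st)" "x \<in> chain_ends st"
  shows "\<exists>r. take_out x st = Some (target st x, weight st x, r) \<and> distinct (map fst r) \<and>
    chain_ends r = chain_ends st - {x} \<and> map_of r = (map_of st)(x := None)"
  using assms
proof (induction st)
  case (Cons e st)
  obtain y t k where e: "e = (y, t, k)" by (cases e)
  show ?case
  proof (cases "y = x")
    case True
    then have "map_of st x = None" using Cons.prems e by (auto simp: map_of_eq_None_iff)
    then show ?thesis using Cons.prems e True by (auto simp: target_def weight_def fun_eq_iff)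
  next
    case False
    then have x: "x \<in> chain_ends st" using Cons.prems e by auto
    obtain r where r: "take_out x st = Some (target st x, weight st x, r)" "distinct (map fst r)"
      "chain_ends r = chain_ends st - {x}" "map_of r = (map_of st)(x := None)"
      using Cons.IH[OF _ x] Cons.prems(1) by (simp only: distinct.simps list.map) blast
    have "target (e # st) x = target st x" "weight (e # st) x = weight st x"
      using False e by (auto simp: target_def weight_def)
    moreover have "y \<notin> chain_ends r" using r(3) Cons.prems e by auto
    ultimately show ?thesis using r False e by (auto simp: fun_eq_iff)
  qed
qed simp

lemma redirect_Some:
  assumes "distinct (map fst st)" "a \<in> chain_ends st" "target st a = i"
    "\<And>x. x \<in> chain_ends st \<Longrightarrow> target st x = i \<Longrightarrow> x = a"
  shows "if k + weight st a \<le> 3 then \<exists>r. redirect i t k st = Some r \<and> map fst r = map fst st \<and>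
      map_of r = (map_of st)(a \<mapsto> (t, k + weight st a)) else redirect i t k st = None"
  using assms
proof (induction st)
  case (Cons e st)
  obtain y s l where e: "e = (y, s, l)" by (cases e)
  have y: "target (e # st) y = s" "weight (e # st) y = l" using e by (auto simp: target_def weight_def)
  show ?case
  proof (cases "s = i")
    case True
    then have "y = a" using Cons.prems(4)[of y] y e by simp
    then show ?thesis using e True y by (auto simp: fun_eq_iff)
  next
    case False
    then have ya: "y \<noteq> a" using y Cons.prems(3) by auto
    have eq: "target (e # st) x = target st x" "weight (e # st) x = weight st x" if "x \<noteq> y" for x
      using that e by (auto simp: target_def weight_def)
    have yst: "y \<notin> chain_ends st" using Cons.prems(1) e by auto
    have "if k + weight st a \<le> 3 then \<exists>r. redirect i t k st = Some r \<and> map fst r = map fst st \<and>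
      map_of r = (map_of st)(a \<mapsto> (t, k + weight st a)) else redirect i t k st = None"
    proof (rule Cons.IH)
      show "distinct (map fst st)" using Cons.prems(1) by simp
      show "a \<in> chain_ends st" using Cons.prems(2) ya e by auto
      show "target st a = i" using Cons.prems(3) eq[of a] ya by simp
      show "x = a" if "x \<in> chain_ends st" "target st x = i" for x
        using Cons.prems(4)[of x] eq[of x] that yst by auto
    qed
    then show ?thesis using False ya e eq[of a] by (auto simp: fun_eq_iff)
  qed
qed simp

text \<open>Removing the chain that begins after \<open>j\<close> means dropping a fixed point or
  passing to the first return map. Weights are natural numbers, so a merged chain with more than
  three ideal vertices already refutes the triangle condition.\<close>

lemma bypass_correct:
  assumes st: "chain_system p st" and j: "j \<in> chain_ends st" and ij: "p i = j" "p j = i"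
  shows "triangular p st \<longleftrightarrow> (\<exists>st'. bypass j i st = Some st' \<and> triangular p st')"
    and "bypass j i st = Some st' \<Longrightarrow> chain_system p st' \<and> chain_ends st' = chain_ends st - {j}"
proof -
  define I N where "I = chain_ends st" and "N = (\<lambda>x. p (target st x))"
  interpret finite_permutation I N using st by (simp add: chain_system_def I_def N_def)
  have dist: "distinct (map fst st)" and inv: "\<And>x. x \<in> I \<Longrightarrow> p (p (target st x)) = target st x"
    using st by (auto simp: chain_system_def I_def)
  have jI: "j \<in> I" using j by (simp add: I_def)
  have N_j: "N x = j \<longleftrightarrow> target st x = i" if "x \<in> I" for x
  proof
    assume "N x = j"
    then have "p (target st x) = j" by (simp add: N_def)
    then show "target st x = i" using inv[OF that] ij(2) by simp
  next
    assume "target st x = i"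
    then show "N x = j" using ij(1) by (simp add: N_def)
  qed
  obtain r where r: "take_out j st = Some (target st j, weight st j, r)" "distinct (map fst r)"
    "chain_ends r = I - {j}" "map_of r = (map_of st)(j := None)"
    using take_out_Some[OF dist j] by (auto simp: I_def)
  have r_eq: "target r x = target st x" "weight r x = weight st x" if "x \<noteq> j" for x
    using that r(4) by (auto simp: target_def weight_def)
  have *: "(triangular p st \<longleftrightarrow> (\<exists>st'. bypass j i st = Some st' \<and> triangular p st')) \<and>
    (\<forall>st'. bypass j i st = Some st' \<longrightarrow> chain_system p st' \<and> chain_ends st' = I - {j})"
  proof (cases "target st j = i")
    case True
    then have Nj: "N j = j" using N_j[OF jI] by simp
    interpret R: finite_permutation "I - {j}" N by (rule remove_fixed[OF jI Nj])
    have byp: "bypass j i st = (if weight st j = 3 then Some r else None)"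
      by (simp add: bypass_def r(1) True)
    have "all_three (I - {j}) (\<lambda>x. p (target r x)) (weight r) = all_three (I - {j}) N (weight st)"
      using R.closed r_eq by (intro all_three_cong) (auto simp: N_def)
    then have tr: "triangular p st \<longleftrightarrow> weight st j = 3 \<and> triangular p r"
      using all_three_fixed[OF jI Nj, of "weight st"] by (simp add: triangular_def r(3) flip: I_def N_def)
    have "inj_on (\<lambda>x. p (target r x)) (I - {j}) = inj_on N (I - {j})"
      using r_eq by (intro inj_on_cong) (auto simp: N_def)
    then have "finite_permutation (I - {j}) (\<lambda>x. p (target r x))"
      using R.fin R.inj R.closed r_eq by unfold_locales (auto simp: N_def)
    then have "chain_system p r"
      using r inv r_eq by (auto simp: chain_system_def)
    with byp tr r(3) show ?thesis by auto
  next
    case False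
    then have Nj: "N j \<noteq> j" using N_j[OF jI] by simp
    interpret R: finite_permutation "I - {j}" "skip j" by (rule remove_moved[OF jI Nj])
    obtain a where a: "a \<in> I" "N a = j" using surj jI by (metis imageE)
    have aj: "a \<noteq> j" using a Nj by auto
    have ai: "target r a = i" "a \<in> chain_ends r" using N_j[OF a(1)] a aj r_eq r(3) by auto
    have uniq: "x = a" if "x \<in> chain_ends r" "target r x = i" for x
      using that r(3) r_eq[of x] N_j[of x] a inj by (auto dest: inj_onD)
    let ?k = "weight st j + weight r a"
    have red: "if ?k \<le> 3 then \<exists>r'. redirect i (target st j) (weight st j) r = Some r' \<and> map fst r' = map fst r \<and>
      map_of r' = (map_of r)(a \<mapsto> (target st j, ?k)) else redirect i (target st j) (weight st j) r = None"
      by (rule redirect_Some[OF r(2) ai(2,1) uniq])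
    have byp: "bypass j i st = redirect i (target st j) (weight st j) r"
      by (simp add: bypass_def r(1) False)
    let ?\<kappa> = "\<lambda>y. weight st y + (if N y = j then weight st j else 0)"
    have tr: "triangular p st \<longleftrightarrow> all_three (I - {j}) (skip j) ?\<kappa>"
      using all_three_moved[OF jI Nj, of "weight st"] by (simp add: triangular_def flip: I_def N_def)
    show ?thesis
    proof (cases "?k \<le> 3")
      case False
      have "\<not> all_three (I - {j}) (skip j) ?\<kappa>"
      proof
        assume "all_three (I - {j}) (skip j) ?\<kappa>"
        then have "sum ?\<kappa> (orbit (skip j) a) = 3" using a aj by (auto simp: all_three_def)
        moreover have "?\<kappa> a \<le> sum ?\<kappa> (orbit (skip j) a)"
          using R.orbit_I[of a] a aj R.fin orbit_refl[of a "skip j"] by (intro member_le_sum) (auto intro: finite_subset)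
        moreover have "?\<kappa> a = ?k" using a r_eq[OF aj] by simp
        ultimately show False using False by simp
      qed
      then show ?thesis using red False byp tr by auto
    next
      case True
      obtain r' where r': "redirect i (target st j) (weight st j) r = Some r'" "map fst r' = map fst r"
        "map_of r' = (map_of r)(a \<mapsto> (target st j, ?k))"
        using red True by auto
      have ends: "chain_ends r' = I - {j}" using arg_cong[OF r'(2), of set] r(3) by simp
      have t': "target r' x = (if x = a then target st j else target st x)"
        "weight r' x = (if x = a then ?k else weight st x)" if "x \<in> I - {j}" for x
        using that r_eq[of x] by (auto simp: target_def weight_def r'(3) r(4))
      have Na: "N x = j \<longleftrightarrow> x = a" if "x \<in> I" for x using a that inj by (auto dest: inj_onD)
      have s: "p (target r' x) = skip j x" if "x \<in> I - {j}" for x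
        using t'(1)[OF that] that Na[of x] skip_def[OF jI Nj, of x] by (auto simp: N_def)
      have w: "weight r' x = ?\<kappa> x" if "x \<in> I - {j}" for x
        using t'(2)[OF that] that Na[of x] r_eq[OF aj] by auto
      have "all_three (I - {j}) (\<lambda>x. p (target r' x)) (weight r') = all_three (I - {j}) (skip j) ?\<kappa>"
        using R.closed s w by (intro all_three_cong) auto
      then have "triangular p r' \<longleftrightarrow> all_three (I - {j}) (skip j) ?\<kappa>" by (simp add: triangular_def ends)
      then have "triangular p st \<longleftrightarrow> triangular p r'" using tr by blast
      moreover have "inj_on (\<lambda>x. p (target r' x)) (I - {j}) = inj_on (skip j) (I - {j})"
        using s by (intro inj_on_cong) auto
      then have "finite_permutation (I - {j}) (\<lambda>x. p (target r' x))"
        using R.fin R.inj R.closed s by unfold_locales auto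
      then have "chain_system p r'"
        using r(2) r'(2) inv t'(1) jI ends by (auto simp: chain_system_def)
      ultimately show ?thesis using byp r'(1) ends by auto
    qed
  qed
  then show "triangular p st \<longleftrightarrow> (\<exists>st'. bypass j i st = Some st' \<and> triangular p st')"
    and "bypass j i st = Some st' \<Longrightarrow> chain_system p st' \<and> chain_ends st' = chain_ends st - {j}"
    by (auto simp: I_def)
qed

lemma pair_up_correct:
  assumes st: "chain_system p st" and ij: "i \<in> chain_ends st" "j \<in> chain_ends st" "i \<noteq> j" "p i = j" "p j = i"
  shows "triangular p st \<longleftrightarrow> (\<exists>st'. pair_up i j st = Some st' \<and> triangular p st')"
    and "pair_up i j st = Some st' \<Longrightarrow> chain_system p st' \<and> chain_ends st' = chain_ends st - {i, j}"
proof -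
  note 1 = bypass_correct[OF st ij(2,4,5)]
  have 2: "chain_system p st1" "i \<in> chain_ends st1" "chain_ends st1 = chain_ends st - {j}"
    if "bypass j i st = Some st1" for st1 using 1(2)[OF that] ij by auto
  show "triangular p st \<longleftrightarrow> (\<exists>st'. pair_up i j st = Some st' \<and> triangular p st')"
  proof (cases "bypass j i st")
    case None
    then show ?thesis using 1(1) by (simp add: pair_up_def)
  next
    case (Some st1)
    then show ?thesis
      using 1(1) bypass_correct(1)[OF 2(1,2)[OF Some] ij(5,4)] by (simp add: pair_up_def)
  qed
  show "chain_system p st' \<and> chain_ends st' = chain_ends st - {i, j}" if pu: "pair_up i j st = Some st'"
  proof -
    obtain st1 where st1: "bypass j i st = Some st1" "bypass i j st1 = Some st'"
      using pu by (cases "bypass j i st") (auto simp: pair_up_def)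
    show ?thesis using bypass_correct(2)[OF 2(1,2)[OF st1(1)] ij(5,4) st1(2)] 2(3)[OF st1(1)] by auto
  qed
qed

text \<open>The branch that always glues \<open>i\<close> to \<open>p i\<close> survives, because
  its chains keep satisfying the triangle condition. The absence of \<open>None\<close> certifies
  that the depth bound \<open>n\<close> never cut off a branch.\<close>

lemma gluings_correct:
  assumes "None \<notin> set (gluings n ps st)" "chain_system p st" "triangular p st"
    "\<And>x. x \<in> chain_ends st \<Longrightarrow> p x \<in> chain_ends st \<and> p (p x) = x \<and> p x \<noteq> x"
    "\<And>i j. (i, j) \<in> set ps \<Longrightarrow> p i = j \<and> p j = i"
  shows "\<exists>ps'. Some ps' \<in> set (gluings n ps st) \<and> (\<forall>(i, j)\<in>set ps'. p i = j \<and> p j = i) \<and>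
    fst ` set ps' \<union> snd ` set ps' = fst ` set ps \<union> snd ` set ps \<union> chain_ends st"
  using assms
proof (induction n arbitrary: ps st)
  case 0
  have "st = []"
  proof (rule ccontr)
    assume "st \<noteq> []"
    then show False using 0(1) by (cases st) auto
  qed
  then show ?case using 0 by (intro exI[of _ ps]) auto
next
  case (Suc n)
  note 3 = Suc.IH Suc.prems
  show ?case
  proof (cases st)
    case Nil
    then show ?thesis using Suc.prems by (intro exI[of _ ps]) auto
  next
  case (Cons e r)
  obtain a i k where st: "st = (a, i, k) # r" using Cons by (cases e) auto
  let ?st = "(a, i, k) # r"
  note 3 = 3[unfolded st]
  interpret finite_permutation "chain_ends ?st" "\<lambda>x. p (target ?st x)"
    using 3(3) by (simp add: chain_system_def)
  define j where "j = p i"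
  have dist: "distinct (map fst ?st)" using 3(3) by (simp add: chain_system_def)
  have ai: "target ?st a = i" by (simp add: target_def)
  have a: "a \<in> chain_ends ?st" by simp
  have pji: "p j = i" using 3(3) a ai unfolding chain_system_def j_def by metis
  have jI: "j \<in> chain_ends ?st" using closed[OF a] ai by (simp add: j_def)
  have iI: "i \<in> chain_ends ?st" using 3(5)[OF jI] pji by simp
  have ij: "i \<noteq> j" using 3(5)[OF iI] by (simp add: j_def)
  note pu = pair_up_correct[OF 3(3) iI jI ij j_def[symmetric] pji]
  obtain st' where st': "pair_up i j ?st = Some st'" "triangular p st'"
    using pu(1) 3(4) by blast
  have c: "chain_system p st'" "chain_ends st' = chain_ends ?st - {i, j}" using pu(2)[OF st'(1)] by auto
  obtain t l where e: "(j, t, l) \<in> set ?st" using jI by force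
  have jl: "target ?st j = t" "weight ?st j = l"
    using map_of_is_SomeI[OF dist e] by (simp_all add: target_def weight_def)
  \<comment> \<open>The guard only anticipates a failure of \<open>bypass\<close>. As
    \<open>pair_up\<close> succeeds on the branch that follows \<open>p\<close>, this branch is not
    discarded.\<close>
  have guard: "\<not> (if j = a then k \<noteq> 3 else 3 < k + l)"
  proof -
    obtain st1 where st1: "bypass j i ?st = Some st1"
      using st'(1) by (cases "bypass j i ?st") (auto simp: pair_up_def)
    show ?thesis
    proof (cases "j = a")
      case True
      then show ?thesis using st1 by (auto simp: bypass_def split: if_splits)
    next
      case False
      obtain r' where r': "take_out j ?st = Some (t, l, r')"
        using take_out_Some[OF dist jI] unfolding jl by blast
      have "t \<noteq> i"
      proof
        assume "t = i"
        then have "p (target ?st j) = p (target ?st a)" using jl ai by simp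
        then show False using inj_onD[OF inj _ jI a] False by blast
      qed
      \<comment> \<open>Taking out the chain of \<open>j\<close> leaves the first chain at the head,
        and this is the one that leads to \<open>i\<close>; hence \<open>redirect\<close> tests
        precisely the sum \<open>k + l\<close>.\<close>
      moreover obtain r'' where "r' = (a, i, k) # r''"
        using r' False by (auto split: option.splits)
      ultimately show ?thesis using st1 r' False by (auto simp: bypass_def split: if_splits)
    qed
  qed
  define f where "f = (\<lambda>(j, _ :: nat, l). if j = i then [] else
     if (if j = a then k \<noteq> 3 else 3 < k + l) then [] else
     (case pair_up i j ?st of None \<Rightarrow> [] | Some st \<Rightarrow> gluings n ((i, j) # ps) st))"
  have G: "set (gluings (Suc n) ps ?st) = (\<Union>e\<in>set ?st. set (f e))"
    unfolding gluings.simps f_def[symmetric] by (simp only: set_concat set_map image_image)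
  have fe: "f (j, t, l) = gluings n ((i, j) # ps) st'"
    unfolding f_def prod.case using ij guard st'(1) by (simp only: if_False option.case) simp
  have sub: "set (gluings n ((i, j) # ps) st') \<subseteq> set (gluings (Suc n) ps ?st)"
    unfolding G fe[symmetric] by (rule UN_upper[OF e])
  have "None \<notin> set (gluings n ((i, j) # ps) st')"
    using 3(2) sub by blast
  moreover have "p x \<in> chain_ends st' \<and> p (p x) = x \<and> p x \<noteq> x" if "x \<in> chain_ends st'" for x
  proof -
    have x: "x \<in> chain_ends ?st" "x \<noteq> i" "x \<noteq> j" using that unfolding c(2) by blast+
    have p: "p x \<in> chain_ends ?st" "p (p x) = x" "p x \<noteq> x" using 3(5)[OF x(1)] by blast+
    have "p x \<noteq> i" using p(2) x(3) j_def by metis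
    moreover have "p x \<noteq> j" using p(2) x(2) pji by metis
    ultimately show ?thesis using p unfolding c(2) by blast
  qed
  moreover have "p x = y \<and> p y = x" if "(x, y) \<in> set ((i, j) # ps)" for x y
  proof (cases "(x, y) = (i, j)")
    case True
    then show ?thesis using pji j_def[symmetric] by simp
  next
    case False
    then have "(x, y) \<in> set ps" using that by auto
    then show ?thesis by (rule 3(6))
  qed
  ultimately have "\<exists>ps'. Some ps' \<in> set (gluings n ((i, j) # ps) st') \<and> (\<forall>(i, j)\<in>set ps'. p i = j \<and> p j = i) \<and>
    fst ` set ps' \<union> snd ` set ps' = fst ` set ((i, j) # ps) \<union> snd ` set ((i, j) # ps) \<union> chain_ends st'"
    by (rule Suc.IH[OF _ c(1) st'(2)])
  then have ex: "\<exists>ps'. Some ps' \<in> set (gluings (Suc n) ps ?st) \<and> (\<forall>(i, j)\<in>set ps'. p i = j \<and> p j = i) \<and>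
    fst ` set ps' \<union> snd ` set ps' = fst ` set ((i, j) # ps) \<union> snd ` set ((i, j) # ps) \<union> chain_ends st'"
    using sub by blast
  have "fst ` set ((i, j) # ps) \<union> snd ` set ((i, j) # ps) \<union> C = fst ` set ps \<union> snd ` set ps \<union> D"
    if "C = D - {i, j}" "i \<in> D" "j \<in> D" for C D
    using that by (simp only: list.set image_insert fst_conv snd_conv) blast
  from this[OF c(2) iI jI] ex show ?thesis unfolding st by (simp only:)
  qed
qed

section \<open>Executable search, tables and checks\<close>

definition gaps :: "nat list" where
  "gaps = [0, 1, 2, 3, 4, 5, 6, 7, 8, 9, 10, 11, 12, 13]"

text \<open>Before any gluing each gap is a chain of its own, from one of the 14 ends to the
  cyclically next. The gaps around the right and the left end of the base interval,
  \<open>lt - 1\<close> and 13, are smooth and count 0.\<close>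

definition start :: "nat \<Rightarrow> chains" where
  "start lt = map (\<lambda>i. (i, if i = 13 then 0 else i + 1, if i + 1 = lt \<or> i = 13 then 0 else 1)) gaps"

text \<open>Each band is named by the smaller of its two positions, in agreement with
  \<open>word_code\<close>. The default 0 is not reached at the positions covered by the
  gluing.\<close>

fun label :: "(nat \<times> nat) list \<Rightarrow> nat \<Rightarrow> nat" where
  "label [] x = 0"
| "label ((i, j) # ps) x = (if x = i \<or> x = j then (if i < j then i else j) else label ps x)"

text \<open>The tables are searched through tries since rewriting with linear search takes too long.\<close>

datatype trie = Empty | Node nat "nat option" trie trie

fun lookup :: "trie \<Rightarrow> nat list \<Rightarrow> nat option" where
  "lookup (Node x v c s) (y # ys) =
     (if x = y then (case ys of [] \<Rightarrow> v | _ # _ \<Rightarrow> lookup c ys) else lookup s (y # ys))"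
| "lookup _ _ = None"

fun update :: "nat list \<Rightarrow> nat \<Rightarrow> trie \<Rightarrow> trie" where
  "update [] d t = t"
| "update (y # ys) d Empty = Node y (case ys of [] \<Rightarrow> Some d | _ # _ \<Rightarrow> None) (update ys d Empty) Empty"
| "update (y # ys) d (Node x v c s) =
     (if x = y then Node x (case ys of [] \<Rightarrow> Some d | _ # _ \<Rightarrow> v) (update ys d c) s
      else Node x v c (update (y # ys) d s))"

fun trie_of :: "(nat list \<times> nat) list \<Rightarrow> trie" where
  "trie_of [] = Empty"
| "trie_of ((w, d) # ps) = update w d (trie_of ps)"

lemma lookup_Nil [simp]: "lookup t [] = None"
  by (cases t) auto

lemma lookup_update: "lookup (update w d t) v = (if w \<noteq> [] \<and> v = w then Some d else lookup t v)"
proof (induction w d t arbitrary: v rule: update.induct)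
  case (2 y ys d)
  then show ?case
    unfolding update.simps by (cases v; cases "tl v"; cases ys) (simp_all del: update.simps)
next
  case (3 y ys d x e c s)
  then show ?case by (cases v; cases "tl v"; cases ys; cases "x = y") simp_all
qed simp

lemma lookup_trie_of: "lookup (trie_of ps) w = (if w = [] then None else map_of ps w)"
  by (induction ps rule: trie_of.induct) (auto simp: lookup_update)

text \<open>The two tests ask for top-top and for bottom-bottom bands. If only one kind occurs,
  balance rules out recurrence and the gluing is ignored; otherwise its code has to be in the table.
  A branch that ran out of depth is rejected.\<close>

fun accept :: "nat \<Rightarrow> trie \<Rightarrow> (nat \<times> nat) list option \<Rightarrow> bool" where
  "accept lt t None = False"
| "accept lt t (Some ps) =
     (if list_ex (\<lambda>(i, j). i < lt \<and> j < lt) ps = list_ex (\<lambda>(i, j). lt \<le> i \<and> lt \<le> j) ps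
      then lookup t (map (label ps) gaps) \<noteq> None else True)"

definition first_position :: "nat list \<Rightarrow> nat \<Rightarrow> nat" where
  "first_position xs x = length (takeWhile (\<lambda>y. y \<noteq> x) xs)"

text \<open>A normal form under relabelling only: an exchange and its image under the interchange of
  top and bottom may have different codes, and both are tabulated.\<close>

definition word_code :: "exchange \<Rightarrow> nat list" where
  "word_code \<tau> = map (first_position (ends \<tau>)) (ends \<tau>)"

text \<open>\<open>codes_n\<close> lists the codes of the complete genus 2 exchanges with \<open>n\<close> band ends on the top. Each
  comes with the least number of moves that lead from it to \<open>base_exchange\<close>, or to its image under
  relabelling; the existence of such moves is then checked locally.\<close>

definition codes_3 :: "(nat list \<times> nat) list" where
  "codes_3 = [
    ([0,1,0,1,4,5,6,7,5,9,6,7,9,4], 16),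
    ([0,1,0,3,4,5,6,4,8,5,6,8,3,1], 24)]"

definition codes_4 :: "(nat list \<times> nat) list" where
  "codes_4 = [
    ([0,1,0,1,4,5,6,7,5,9,6,7,9,4], 15),
    ([0,1,0,3,1,3,6,7,8,6,10,7,8,10], 20),
    ([0,1,2,0,1,2,6,7,8,6,10,7,8,10], 19),
    ([0,1,2,0,2,5,6,7,5,1,10,6,7,10], 17),
    ([0,1,2,0,4,1,2,4,8,9,10,8,9,10], 3),
    ([0,1,2,0,4,5,1,2,5,9,10,9,4,10], 24),
    ([0,1,2,0,4,5,6,1,2,6,10,4,5,10], 24),
    ([0,1,2,0,4,5,6,1,2,6,10,4,10,5], 22),
    ([0,1,2,0,4,5,6,4,1,2,10,5,6,10], 15),
    ([0,1,2,0,4,5,6,4,2,9,5,6,9,1], 13),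
    ([0,1,2,0,4,5,6,4,5,6,10,1,2,10], 18),
    ([0,1,2,0,4,5,6,4,6,9,1,2,9,5], 16),
    ([0,1,2,0,4,5,6,4,8,1,2,8,5,6], 14),
    ([0,1,2,0,4,5,6,4,8,5,6,8,1,2], 11),
    ([0,1,2,0,4,5,6,5,8,1,2,8,4,6], 26),
    ([0,1,2,1,4,5,6,4,8,5,6,8,0,2], 23)]"

definition codes_5 :: "(nat list \<times> nat) list" where
  "codes_5 = [
    ([0,1,0,3,1,3,6,7,8,6,10,7,8,10], 18),
    ([0,1,0,3,4,1,4,7,8,9,7,3,8,9], 10),
    ([0,1,2,0,1,5,6,7,5,2,10,6,7,10], 16),
    ([0,1,2,0,2,5,6,7,5,9,6,7,9,1], 14),
    ([0,1,2,0,4,1,2,7,8,9,7,4,8,9], 9),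
    ([0,1,2,0,4,2,6,7,8,6,1,4,7,8], 8),
    ([0,1,2,0,4,5,1,2,5,9,10,4,9,10], 4),
    ([0,1,2,0,4,5,4,7,1,2,7,11,5,11], 25),
    ([0,1,2,0,4,5,4,7,5,7,10,1,2,10], 19),
    ([0,1,2,0,4,5,6,1,2,6,10,4,10,5], 5),
    ([0,1,2,0,4,5,6,4,5,9,1,2,9,6], 17),
    ([0,1,2,0,4,5,6,4,6,9,1,2,9,5], 18),
    ([0,1,2,0,4,5,6,7,1,2,7,4,5,6], 6),
    ([0,1,2,0,4,5,6,7,5,1,2,4,6,7], 7),
    ([0,1,2,0,4,5,6,7,5,6,7,4,1,2], 12),
    ([0,1,2,1,4,2,4,0,8,9,10,8,9,10], 3),
    ([0,1,2,1,4,5,6,7,5,6,7,4,0,2], 24),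
    ([0,1,2,3,0,1,3,7,8,9,7,2,8,9], 11),
    ([0,1,2,3,0,2,6,7,8,6,1,3,7,8], 9),
    ([0,1,2,3,0,3,6,7,1,9,6,2,7,9], 18),
    ([0,1,2,3,0,5,1,3,8,9,8,2,5,9], 25),
    ([0,1,2,3,0,5,2,7,8,7,1,3,5,8], 25),
    ([0,1,2,3,0,5,6,1,3,9,5,2,6,9], 16),
    ([0,1,2,3,0,5,6,1,3,9,5,6,9,2], 21),
    ([0,1,2,3,0,5,6,1,3,9,5,9,2,6], 19),
    ([0,1,2,3,0,5,6,2,8,5,1,3,6,8], 16),
    ([0,1,2,3,0,5,6,2,8,5,3,6,8,1], 14),
    ([0,1,2,3,0,5,6,2,8,5,6,8,1,3], 19),
    ([0,1,2,3,0,5,6,2,8,5,8,1,3,6], 17),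
    ([0,1,2,3,1,2,3,0,8,9,10,8,9,10], 2),
    ([0,1,2,3,1,5,2,3,5,9,10,9,0,10], 23),
    ([0,1,2,3,1,5,6,0,2,3,10,5,6,10], 14),
    ([0,1,2,3,1,5,6,0,3,9,5,6,9,2], 12),
    ([0,1,2,3,1,5,6,0,5,6,10,2,3,10], 17),
    ([0,1,2,3,1,5,6,0,6,9,2,3,9,5], 15),
    ([0,1,2,3,1,5,6,0,8,2,3,8,5,6], 13),
    ([0,1,2,3,1,5,6,0,8,5,6,8,2,3], 10),
    ([0,1,2,3,1,5,6,2,3,6,10,0,5,10], 23),
    ([0,1,2,3,1,5,6,2,3,6,10,0,10,5], 21),
    ([0,1,2,3,1,5,6,5,8,2,3,8,0,6], 25),
    ([0,1,2,3,2,5,6,1,8,5,6,8,0,3], 22)]"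

definition codes_6 :: "(nat list \<times> nat) list" where
  "codes_6 = [
    ([0,1,0,3,4,1,4,7,8,9,7,3,8,9], 10),
    ([0,1,0,3,4,5,1,5,8,9,3,8,4,9], 11),
    ([0,1,2,0,1,2,6,7,8,6,10,7,8,10], 17),
    ([0,1,2,0,2,5,6,7,8,6,7,8,5,1], 15),
    ([0,1,2,0,4,1,6,7,8,6,2,4,7,8], 8),
    ([0,1,2,0,4,5,1,2,8,9,4,8,5,9], 10),
    ([0,1,2,0,4,5,2,7,8,4,7,1,5,8], 9),
    ([0,1,2,0,4,5,4,7,1,2,7,11,5,11], 6),
    ([0,1,2,0,4,5,4,7,5,7,10,1,2,10], 21),
    ([0,1,2,0,4,5,6,1,2,6,10,4,5,10], 5),
    ([0,1,2,0,4,5,6,4,5,6,10,1,2,10], 20),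
    ([0,1,2,0,4,5,6,4,8,1,2,8,5,6], 7),
    ([0,1,2,0,4,5,6,5,8,1,2,8,4,6], 7),
    ([0,1,2,0,4,5,6,5,8,6,8,4,1,2], 13),
    ([0,1,2,0,4,5,6,7,4,6,1,2,5,7], 8),
    ([0,1,2,1,4,2,4,0,8,9,10,8,9,10], 1),
    ([0,1,2,1,4,5,2,5,8,9,8,4,0,9], 26),
    ([0,1,2,1,4,5,6,5,8,6,8,4,0,2], 25),
    ([0,1,2,3,0,1,6,7,2,9,6,3,7,9], 17),
    ([0,1,2,3,0,2,6,7,1,3,10,6,7,10], 17),
    ([0,1,2,3,0,3,6,7,2,9,6,7,9,1], 15),
    ([0,1,2,3,0,5,1,3,8,9,5,8,2,9], 13),
    ([0,1,2,3,0,5,2,7,8,5,7,1,3,8], 11),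
    ([0,1,2,3,0,5,3,7,8,1,5,7,2,8], 16),
    ([0,1,2,3,0,5,6,1,3,9,5,9,2,6], 14),
    ([0,1,2,3,0,5,6,2,8,5,8,1,3,6], 12),
    ([0,1,2,3,0,5,6,5,1,3,10,6,10,2], 22),
    ([0,1,2,3,0,5,6,5,2,9,6,9,1,3], 20),
    ([0,1,2,3,0,5,6,7,1,3,5,6,2,7], 15),
    ([0,1,2,3,0,5,6,7,2,5,6,1,3,7], 13),
    ([0,1,2,3,1,5,2,3,8,9,8,5,0,9], 25),
    ([0,1,2,3,1,5,3,7,8,7,2,5,0,8], 25),
    ([0,1,2,3,1,5,6,2,3,6,10,5,0,10], 24),
    ([0,1,2,3,1,5,6,5,0,2,3,11,6,11], 15),
    ([0,1,2,3,1,5,6,5,0,3,10,6,10,2], 13),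
    ([0,1,2,3,1,5,6,5,0,6,10,2,3,10], 18),
    ([0,1,2,3,1,5,6,5,0,9,2,3,9,6], 14),
    ([0,1,2,3,1,5,6,5,0,9,6,9,2,3], 11),
    ([0,1,2,3,1,5,6,7,2,3,7,5,0,6], 24),
    ([0,1,2,3,1,5,6,7,6,2,3,5,0,7], 25),
    ([0,1,2,3,2,5,3,5,1,9,10,9,0,10], 23),
    ([0,1,2,3,2,5,6,5,1,9,6,9,0,3], 23),
    ([0,1,2,3,4,0,1,4,8,9,2,8,3,9], 12),
    ([0,1,2,3,4,0,2,7,8,3,7,1,4,8], 10),
    ([0,1,2,3,4,0,3,7,8,1,4,7,2,8], 15),
    ([0,1,2,3,4,0,4,7,1,9,2,7,3,9], 19),
    ([0,1,2,3,4,0,6,1,4,9,2,6,3,9], 17),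
    ([0,1,2,3,4,0,6,1,4,9,2,6,9,3], 20),
    ([0,1,2,3,4,0,6,2,8,3,6,1,4,8], 17),
    ([0,1,2,3,4,0,6,2,8,3,6,4,8,1], 15),
    ([0,1,2,3,4,0,6,2,8,3,6,8,1,4], 18),
    ([0,1,2,3,4,0,6,3,8,1,4,6,2,8], 17),
    ([0,1,2,3,4,0,6,3,8,1,4,6,8,2], 22),
    ([0,1,2,3,4,1,2,4,8,9,8,3,0,9], 24),
    ([0,1,2,3,4,1,3,7,8,7,2,4,0,8], 24),
    ([0,1,2,3,4,1,6,2,4,9,0,3,6,9], 15),
    ([0,1,2,3,4,1,6,2,4,9,0,6,9,3], 20),
    ([0,1,2,3,4,1,6,2,4,9,0,9,3,6], 18),
    ([0,1,2,3,4,1,6,3,8,0,2,4,6,8], 15),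
    ([0,1,2,3,4,1,6,3,8,0,4,6,8,2], 13),
    ([0,1,2,3,4,1,6,3,8,0,6,8,2,4], 18),
    ([0,1,2,3,4,1,6,3,8,0,8,2,4,6], 16),
    ([0,1,2,3,4,2,3,4,1,9,10,9,0,10], 22),
    ([0,1,2,3,4,2,6,0,1,6,10,3,4,10], 16),
    ([0,1,2,3,4,2,6,0,3,4,10,1,6,10], 13),
    ([0,1,2,3,4,2,6,0,4,9,1,6,9,3], 11),
    ([0,1,2,3,4,2,6,0,6,9,3,4,9,1], 14),
    ([0,1,2,3,4,2,6,0,8,1,6,8,3,4], 9),
    ([0,1,2,3,4,2,6,0,8,3,4,8,1,6], 12),
    ([0,1,2,3,4,2,6,1,8,3,4,8,0,6], 24),
    ([0,1,2,3,4,2,6,3,4,6,10,0,1,10], 22),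
    ([0,1,2,3,4,2,6,3,4,6,10,0,10,1], 20),
    ([0,1,2,3,4,3,6,1,8,2,6,8,0,4], 21)]"

definition codes_7 :: "(nat list \<times> nat) list" where
  "codes_7 = [
    ([0,1,0,3,4,5,1,5,8,9,3,8,4,9], 11),
    ([0,1,0,3,4,5,6,1,6,9,3,4,9,5], 12),
    ([0,1,2,0,1,2,6,7,8,9,7,8,9,6], 18),
    ([0,1,2,0,2,5,6,7,6,9,7,9,5,1], 16),
    ([0,1,2,0,4,1,2,7,8,9,7,4,8,9], 9),
    ([0,1,2,0,4,5,1,7,8,4,7,2,5,8], 9),
    ([0,1,2,0,4,5,6,1,2,9,4,5,9,6], 11),
    ([0,1,2,0,4,5,6,2,8,4,5,8,1,6], 10),
    ([0,1,2,0,4,5,6,4,5,9,1,2,9,6], 8),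
    ([0,1,2,0,4,5,6,4,6,9,1,2,9,5], 9),
    ([0,1,2,0,4,5,6,5,8,1,2,8,4,6], 7),
    ([0,1,2,0,4,5,6,5,8,6,8,4,1,2], 15),
    ([0,1,2,0,4,5,6,7,1,2,7,4,5,6], 6),
    ([0,1,2,0,4,5,6,7,4,5,7,1,2,6], 9),
    ([0,1,2,0,4,5,6,7,5,6,7,4,1,2], 14),
    ([0,1,2,1,4,5,2,5,8,9,8,4,0,9], 23),
    ([0,1,2,1,4,5,6,2,6,9,4,0,5,9], 19),
    ([0,1,2,1,4,5,6,2,6,9,4,0,9,5], 18),
    ([0,1,2,1,4,5,6,5,8,6,8,4,0,2], 27),
    ([0,1,2,1,4,5,6,7,5,6,7,4,0,2], 26),
    ([0,1,2,3,0,1,3,7,8,2,10,7,8,10], 18),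
    ([0,1,2,3,0,2,6,7,6,1,3,11,7,11], 18),
    ([0,1,2,3,0,3,6,7,6,2,10,7,10,1], 16),
    ([0,1,2,3,0,5,1,7,8,2,5,7,3,8], 14),
    ([0,1,2,3,0,5,2,7,8,1,3,5,7,8], 16),
    ([0,1,2,3,0,5,6,1,3,9,5,6,9,2], 15),
    ([0,1,2,3,0,5,6,2,8,5,6,8,1,3], 13),
    ([0,1,2,3,0,5,6,3,8,5,1,6,8,2], 18),
    ([0,1,2,3,0,5,6,5,1,3,10,6,10,2], 16),
    ([0,1,2,3,0,5,6,5,2,9,6,9,1,3], 14),
    ([0,1,2,3,0,5,6,7,5,1,3,6,7,2], 17),
    ([0,1,2,3,0,5,6,7,5,2,6,7,1,3], 15),
    ([0,1,2,3,1,2,3,0,8,9,10,8,9,10], 0),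
    ([0,1,2,3,1,5,2,7,8,7,3,5,0,8], 23),
    ([0,1,2,3,1,5,6,0,2,3,10,5,6,10], 14),
    ([0,1,2,3,1,5,6,0,3,9,5,6,9,2], 12),
    ([0,1,2,3,1,5,6,0,5,6,10,2,3,10], 17),
    ([0,1,2,3,1,5,6,0,6,9,2,3,9,5], 15),
    ([0,1,2,3,1,5,6,0,8,2,3,8,5,6], 13),
    ([0,1,2,3,1,5,6,0,8,5,6,8,2,3], 10),
    ([0,1,2,3,1,5,6,2,3,9,5,0,6,9], 18),
    ([0,1,2,3,1,5,6,2,3,9,5,0,9,6], 17),
    ([0,1,2,3,1,5,6,3,8,5,0,2,6,8], 17),
    ([0,1,2,3,1,5,6,3,8,5,0,6,8,2], 15),
    ([0,1,2,3,1,5,6,3,8,5,0,8,2,6], 16),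
    ([0,1,2,3,1,5,6,5,0,2,3,11,6,11], 15),
    ([0,1,2,3,1,5,6,5,0,3,10,6,10,2], 13),
    ([0,1,2,3,1,5,6,5,0,6,10,2,3,10], 18),
    ([0,1,2,3,1,5,6,5,0,9,2,3,9,6], 14),
    ([0,1,2,3,1,5,6,5,0,9,6,9,2,3], 11),
    ([0,1,2,3,1,5,6,7,2,3,7,5,0,6], 18),
    ([0,1,2,3,1,5,6,7,5,0,2,3,6,7], 16),
    ([0,1,2,3,1,5,6,7,5,0,3,6,7,2], 14),
    ([0,1,2,3,1,5,6,7,5,0,6,7,2,3], 12),
    ([0,1,2,3,1,5,6,7,5,0,7,2,3,6], 15),
    ([0,1,2,3,2,5,3,5,1,9,10,9,0,10], 21),
    ([0,1,2,3,2,5,6,1,8,5,6,8,0,3], 22),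
    ([0,1,2,3,2,5,6,3,6,9,0,1,9,5], 18),
    ([0,1,2,3,2,5,6,3,6,9,0,5,1,9], 16),
    ([0,1,2,3,2,5,6,3,6,9,0,9,5,1], 16),
    ([0,1,2,3,2,5,6,5,1,9,6,9,0,3], 23),
    ([0,1,2,3,2,5,6,7,5,1,6,7,0,3], 24),
    ([0,1,2,3,4,0,1,7,2,9,3,7,4,9], 18),
    ([0,1,2,3,4,0,2,7,3,9,1,4,7,9], 18),
    ([0,1,2,3,4,0,3,7,1,4,10,2,7,10], 18),
    ([0,1,2,3,4,0,4,7,2,9,3,7,9,1], 16),
    ([0,1,2,3,4,0,6,1,4,9,6,2,9,3], 14),
    ([0,1,2,3,4,0,6,2,8,6,3,8,1,4], 12),
    ([0,1,2,3,4,0,6,3,8,6,1,4,8,2], 18),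
    ([0,1,2,3,4,0,6,4,8,1,6,2,8,3], 16),
    ([0,1,2,3,4,0,6,7,1,4,6,2,7,3], 15),
    ([0,1,2,3,4,0,6,7,2,6,3,7,1,4], 13),
    ([0,1,2,3,4,0,6,7,3,6,1,4,7,2], 19),
    ([0,1,2,3,4,1,6,2,4,9,6,0,3,9], 17),
    ([0,1,2,3,4,1,6,2,4,9,6,0,9,3], 20),
    ([0,1,2,3,4,1,6,3,8,6,0,2,4,8], 17),
    ([0,1,2,3,4,1,6,3,8,6,0,4,8,2], 15),
    ([0,1,2,3,4,1,6,3,8,6,0,8,2,4], 18),
    ([0,1,2,3,4,1,6,4,8,2,6,0,3,8], 17),
    ([0,1,2,3,4,1,6,4,8,2,6,0,8,3], 22),
    ([0,1,2,3,4,1,6,7,2,4,6,0,3,7], 16),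
    ([0,1,2,3,4,1,6,7,2,4,6,0,7,3], 21),
    ([0,1,2,3,4,1,6,7,3,6,0,2,4,7], 16),
    ([0,1,2,3,4,1,6,7,3,6,0,4,7,2], 14),
    ([0,1,2,3,4,1,6,7,3,6,0,7,2,4], 19),
    ([0,1,2,3,4,2,6,0,1,9,3,4,9,6], 14),
    ([0,1,2,3,4,2,6,0,3,4,10,6,1,10], 13),
    ([0,1,2,3,4,2,6,0,4,9,6,1,9,3], 11),
    ([0,1,2,3,4,2,6,0,6,1,10,3,4,10], 16),
    ([0,1,2,3,4,2,6,0,8,3,4,8,6,1], 12),
    ([0,1,2,3,4,2,6,0,8,6,1,8,3,4], 9),
    ([0,1,2,3,4,2,6,1,8,3,4,8,0,6], 19),
    ([0,1,2,3,4,2,6,3,4,9,0,1,9,6], 17),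
    ([0,1,2,3,4,2,6,3,4,9,0,6,1,9], 15),
    ([0,1,2,3,4,2,6,3,4,9,0,9,6,1], 15),
    ([0,1,2,3,4,2,6,4,8,0,1,8,3,6], 16),
    ([0,1,2,3,4,2,6,4,8,0,3,6,1,8], 15),
    ([0,1,2,3,4,2,6,4,8,0,6,1,8,3], 13),
    ([0,1,2,3,4,2,6,4,8,0,8,3,6,1], 14),
    ([0,1,2,3,4,2,6,7,0,1,7,3,4,6], 15),
    ([0,1,2,3,4,2,6,7,0,3,4,6,1,7], 14),
    ([0,1,2,3,4,2,6,7,0,4,6,1,7,3], 12),
    ([0,1,2,3,4,2,6,7,0,6,1,7,3,4], 10),
    ([0,1,2,3,4,2,6,7,0,7,3,4,6,1], 13),
    ([0,1,2,3,4,2,6,7,3,4,7,0,1,6], 18),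
    ([0,1,2,3,4,2,6,7,3,4,7,0,6,1], 16),
    ([0,1,2,3,4,3,6,1,8,6,2,8,0,4], 21),
    ([0,1,2,3,4,3,6,4,6,2,10,0,1,10], 22),
    ([0,1,2,3,4,3,6,4,6,2,10,0,10,1], 20),
    ([0,1,2,3,4,3,6,7,1,6,2,7,0,4], 22),
    ([0,1,2,3,4,5,0,1,5,9,2,3,9,4], 13),
    ([0,1,2,3,4,5,0,2,8,3,4,8,1,5], 11),
    ([0,1,2,3,4,5,0,3,8,4,1,5,8,2], 17),
    ([0,1,2,3,4,5,0,4,8,1,5,2,8,3], 15),
    ([0,1,2,3,4,5,1,2,5,9,3,0,4,9], 16),
    ([0,1,2,3,4,5,1,2,5,9,3,0,9,4], 19),
    ([0,1,2,3,4,5,1,3,8,4,0,2,5,8], 16),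
    ([0,1,2,3,4,5,1,3,8,4,0,5,8,2], 14),
    ([0,1,2,3,4,5,1,3,8,4,0,8,2,5], 17),
    ([0,1,2,3,4,5,1,4,8,2,5,0,3,8], 16),
    ([0,1,2,3,4,5,1,4,8,2,5,0,8,3], 21),
    ([0,1,2,3,4,5,2,3,5,9,0,1,9,4], 19),
    ([0,1,2,3,4,5,2,3,5,9,0,4,1,9], 14),
    ([0,1,2,3,4,5,2,3,5,9,0,9,4,1], 17),
    ([0,1,2,3,4,5,2,4,8,0,1,8,3,5], 17),
    ([0,1,2,3,4,5,2,4,8,0,3,5,1,8], 14),
    ([0,1,2,3,4,5,2,4,8,0,5,1,8,3], 12),
    ([0,1,2,3,4,5,2,4,8,0,8,3,5,1], 15),
    ([0,1,2,3,4,5,3,0,1,2,10,4,5,10], 15),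
    ([0,1,2,3,4,5,3,0,2,9,4,5,9,1], 13),
    ([0,1,2,3,4,5,3,0,4,5,10,1,2,10], 12),
    ([0,1,2,3,4,5,3,0,5,9,1,2,9,4], 10),
    ([0,1,2,3,4,5,3,0,8,1,2,8,4,5], 8),
    ([0,1,2,3,4,5,3,0,8,4,5,8,1,2], 11),
    ([0,1,2,3,4,5,3,1,8,4,5,8,0,2], 23),
    ([0,1,2,3,4,5,3,4,5,2,10,0,1,10], 21),
    ([0,1,2,3,4,5,3,4,5,2,10,0,10,1], 19),
    ([0,1,2,3,4,5,4,1,8,2,3,8,0,5], 20)]"

definition codes_8 :: "(nat list \<times> nat) list" where
  "codes_8 = [
    ([0,1,0,3,4,5,3,7,1,7,10,4,5,10], 23),
    ([0,1,0,3,4,5,6,1,6,9,3,4,9,5], 12),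
    ([0,1,2,0,1,2,6,7,8,7,10,8,10,6], 19),
    ([0,1,2,0,2,5,6,7,6,9,7,9,5,1], 18),
    ([0,1,2,0,2,5,6,7,8,6,7,8,5,1], 17),
    ([0,1,2,0,4,1,2,4,8,9,10,8,9,10], 10),
    ([0,1,2,0,4,5,1,2,8,9,4,8,5,9], 10),
    ([0,1,2,0,4,5,4,7,5,7,10,1,2,10], 12),
    ([0,1,2,0,4,5,6,1,8,4,5,8,2,6], 10),
    ([0,1,2,0,4,5,6,4,1,2,10,5,6,10], 22),
    ([0,1,2,0,4,5,6,4,2,9,5,6,9,1], 19),
    ([0,1,2,0,4,5,6,4,5,6,10,1,2,10], 11),
    ([0,1,2,0,4,5,6,4,6,9,1,2,9,5], 9),
    ([0,1,2,0,4,5,6,4,8,1,2,8,5,6], 7),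
    ([0,1,2,0,4,5,6,4,8,5,6,8,1,2], 15),
    ([0,1,2,1,4,5,6,2,6,9,4,0,5,9], 15),
    ([0,1,2,1,4,5,6,2,6,9,4,0,9,5], 18),
    ([0,1,2,1,4,5,6,4,8,5,6,8,0,2], 27),
    ([0,1,2,3,0,1,3,7,8,7,2,11,8,11], 19),
    ([0,1,2,3,0,2,6,7,1,3,10,6,7,10], 21),
    ([0,1,2,3,0,2,6,7,3,9,6,1,7,9], 20),
    ([0,1,2,3,0,2,6,7,6,1,3,11,7,11], 22),
    ([0,1,2,3,0,2,6,7,8,6,1,3,7,8], 19),
    ([0,1,2,3,0,3,6,7,2,9,6,7,9,1], 18),
    ([0,1,2,3,0,3,6,7,6,2,10,7,10,1], 19),
    ([0,1,2,3,0,3,6,7,8,6,2,7,8,1], 17),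
    ([0,1,2,3,0,5,1,3,8,9,2,5,8,9], 15),
    ([0,1,2,3,0,5,2,7,8,7,1,3,5,8], 17),
    ([0,1,2,3,0,5,6,1,8,5,2,6,8,3], 16),
    ([0,1,2,3,0,5,6,2,8,5,1,3,6,8], 18),
    ([0,1,2,3,1,5,2,3,8,9,8,5,0,9], 22),
    ([0,1,2,3,1,5,6,0,6,9,2,3,9,5], 21),
    ([0,1,2,3,1,5,6,2,8,5,0,3,6,8], 15),
    ([0,1,2,3,1,5,6,2,8,5,0,6,8,3], 13),
    ([0,1,2,3,1,5,6,2,8,5,0,8,3,6], 16),
    ([0,1,2,3,1,5,6,5,8,2,3,8,0,6], 19),
    ([0,1,2,3,2,5,6,0,3,9,5,1,6,9], 19),
    ([0,1,2,3,2,5,6,0,8,5,1,6,8,3], 25),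
    ([0,1,2,3,2,5,6,3,6,9,0,1,9,5], 18),
    ([0,1,2,3,2,5,6,3,6,9,0,5,1,9], 13),
    ([0,1,2,3,2,5,6,3,6,9,0,9,5,1], 16),
    ([0,1,2,3,4,0,1,4,8,2,10,3,8,10], 19),
    ([0,1,2,3,4,0,2,7,3,9,7,1,4,9], 20),
    ([0,1,2,3,4,0,2,7,8,3,7,1,4,8], 19),
    ([0,1,2,3,4,0,3,7,1,4,10,7,2,10], 21),
    ([0,1,2,3,4,0,3,7,4,9,1,7,2,9], 20),
    ([0,1,2,3,4,0,3,7,8,1,4,7,2,8], 19),
    ([0,1,2,3,4,0,4,7,2,9,7,3,9,1], 18),
    ([0,1,2,3,4,0,4,7,8,2,7,3,8,1], 17),
    ([0,1,2,3,4,0,6,1,8,2,6,3,8,4], 14),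
    ([0,1,2,3,4,0,6,2,8,3,6,1,4,8], 20),
    ([0,1,2,3,4,0,6,3,8,1,4,6,2,8], 16),
    ([0,1,2,3,4,1,6,2,8,3,6,0,4,8], 15),
    ([0,1,2,3,4,1,6,2,8,3,6,0,8,4], 20),
    ([0,1,2,3,4,1,6,3,8,2,4,6,0,8], 22),
    ([0,1,2,3,4,2,3,4,1,9,10,9,0,10], 20),
    ([0,1,2,3,4,2,6,0,1,6,10,3,4,10], 19),
    ([0,1,2,3,4,2,6,0,6,1,10,3,4,10], 22),
    ([0,1,2,3,4,2,6,0,8,3,4,8,1,6], 19),
    ([0,1,2,3,4,2,6,0,8,3,4,8,6,1], 17),
    ([0,1,2,3,4,2,6,3,8,0,1,8,4,6], 16),
    ([0,1,2,3,4,2,6,3,8,0,4,6,1,8], 13),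
    ([0,1,2,3,4,2,6,3,8,0,6,1,8,4], 11),
    ([0,1,2,3,4,2,6,3,8,0,8,4,6,1], 14),
    ([0,1,2,3,4,3,6,0,4,9,1,6,2,9], 19),
    ([0,1,2,3,4,3,6,0,8,1,6,2,8,4], 23),
    ([0,1,2,3,4,3,6,4,6,2,10,0,1,10], 20),
    ([0,1,2,3,4,3,6,4,6,2,10,0,10,1], 18),
    ([0,1,2,3,4,5,0,2,3,9,4,1,5,9], 20),
    ([0,1,2,3,4,5,0,3,4,9,1,5,2,9], 20),
    ([0,1,2,3,4,5,0,4,1,5,10,2,3,10], 20),
    ([0,1,2,3,4,5,0,5,2,9,3,4,9,1], 18),
    ([0,1,2,3,4,5,3,0,2,9,4,5,9,1], 17)]"

definition codes_9 :: "(nat list \<times> nat) list" where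
  "codes_9 = [
    ([0,1,0,3,4,5,3,7,1,7,10,4,5,10], 18),
    ([0,1,2,0,1,2,6,7,8,7,10,8,10,6], 21),
    ([0,1,2,0,1,2,6,7,8,9,7,8,9,6], 20),
    ([0,1,2,0,1,5,6,7,5,2,10,6,7,10], 22),
    ([0,1,2,0,2,5,6,7,5,9,6,7,9,1], 18),
    ([0,1,2,0,4,1,2,4,8,9,8,11,9,11], 11),
    ([0,1,2,0,4,5,1,2,5,9,10,4,9,10], 11),
    ([0,1,2,0,4,5,4,7,5,7,10,1,2,10], 10),
    ([0,1,2,0,4,5,6,1,2,9,4,5,9,6], 11),
    ([0,1,2,0,4,5,6,4,1,9,5,6,9,2], 16),
    ([0,1,2,0,4,5,6,4,5,9,1,2,9,6], 8),
    ([0,1,2,1,4,5,6,4,0,2,10,5,6,10], 20),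
    ([0,1,2,1,4,5,6,4,0,9,5,6,9,2], 28),
    ([0,1,2,3,0,1,3,7,8,2,10,7,8,10], 21),
    ([0,1,2,3,0,1,3,7,8,7,2,11,8,11], 22),
    ([0,1,2,3,0,1,3,7,8,9,7,2,8,9], 20),
    ([0,1,2,3,0,3,6,7,1,9,6,2,7,9], 18),
    ([0,1,2,3,0,5,1,3,8,9,8,2,5,9], 16),
    ([0,1,2,3,0,5,6,1,3,9,5,2,6,9], 17),
    ([0,1,2,3,1,5,2,3,5,9,10,9,0,10], 19),
    ([0,1,2,3,1,5,6,0,5,6,10,2,3,10], 21),
    ([0,1,2,3,1,5,6,2,3,9,5,0,6,9], 14),
    ([0,1,2,3,1,5,6,2,3,9,5,0,9,6], 17),
    ([0,1,2,3,1,5,6,5,0,6,10,2,3,10], 20),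
    ([0,1,2,3,1,5,6,5,0,9,2,3,9,6], 20),
    ([0,1,2,3,2,5,6,0,3,9,5,1,6,9], 26),
    ([0,1,2,3,4,0,1,4,8,2,10,8,3,10], 21),
    ([0,1,2,3,4,0,1,4,8,9,2,8,3,9], 20),
    ([0,1,2,3,4,0,4,7,1,9,2,7,3,9], 18),
    ([0,1,2,3,4,0,6,1,4,9,2,6,3,9], 15),
    ([0,1,2,3,4,1,6,2,4,9,3,6,0,9], 21),
    ([0,1,2,3,4,2,6,0,1,9,3,4,9,6], 20),
    ([0,1,2,3,4,2,6,0,6,9,3,4,9,1], 18),
    ([0,1,2,3,4,2,6,3,4,9,0,1,9,6], 17),
    ([0,1,2,3,4,2,6,3,4,9,0,6,1,9], 12),
    ([0,1,2,3,4,2,6,3,4,9,0,9,6,1], 15),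
    ([0,1,2,3,4,3,6,0,4,9,1,6,2,9], 24),
    ([0,1,2,3,4,5,0,1,5,2,10,3,4,10], 22),
    ([0,1,2,3,4,5,3,0,1,2,10,4,5,10], 21),
    ([0,1,2,3,4,5,3,4,5,2,10,0,1,10], 19),
    ([0,1,2,3,4,5,3,4,5,2,10,0,10,1], 17)]"

definition codes_10 :: "(nat list \<times> nat) list" where
  "codes_10 = [
    ([0,1,2,0,1,2,6,7,8,6,10,7,8,10], 21),
    ([0,1,2,0,2,5,6,7,5,1,10,6,7,10], 19),
    ([0,1,2,0,4,1,2,4,8,9,8,11,9,11], 13),
    ([0,1,2,0,4,1,2,4,8,9,10,8,9,10], 12),
    ([0,1,2,0,4,5,1,2,5,9,10,9,4,10], 12),
    ([0,1,2,0,4,5,6,1,2,6,10,4,5,10], 12),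
    ([0,1,2,0,4,5,6,4,1,2,10,5,6,10], 17),
    ([0,1,2,0,4,5,6,4,5,6,10,1,2,10], 9),
    ([0,1,2,1,4,5,6,4,0,2,10,5,6,10], 29),
    ([0,1,2,3,1,5,2,3,5,0,10,11,10,11], 18),
    ([0,1,2,3,1,5,6,2,3,6,10,5,0,10], 18),
    ([0,1,2,3,1,5,6,5,0,6,10,2,3,10], 21),
    ([0,1,2,3,4,2,6,0,1,6,10,3,4,10], 21),
    ([0,1,2,3,4,2,6,0,6,1,10,3,4,10], 19),
    ([0,1,2,3,4,2,6,3,4,6,10,0,1,10], 18),
    ([0,1,2,3,4,2,6,3,4,6,10,0,10,1], 16)]"

definition codes_11 :: "(nat list \<times> nat) list" where
  "codes_11 = [
    ([0,1,2,3,1,5,2,3,5,0,10,11,10,11], 19),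
    ([0,1,2,3,4,2,6,3,4,6,1,11,0,11], 17)]"

definition tables :: "(nat \<times> (nat list \<times> nat) list) list" where
  "tables = [(3, codes_3), (4, codes_4), (5, codes_5), (6, codes_6), (7, codes_7), (8, codes_8),
     (9, codes_9), (10, codes_10), (11, codes_11)]"

definition codes :: "nat \<Rightarrow> (nat list \<times> nat) list" where
  "codes lt = (case map_of tables lt of None \<Rightarrow> [] | Some ps \<Rightarrow> ps)"

definition code_rank :: "exchange \<Rightarrow> nat option" where
  "code_rank \<tau> = map_of (codes (length (fst \<tau>))) (word_code \<tau>)"

text \<open>The form in which ranks are evaluated; by \<open>rank_in_tables\<close> a successful
  lookup gives the value of \<open>code_rank\<close>.\<close>

definition rank_in :: "(nat \<times> trie) list \<Rightarrow> exchange \<Rightarrow> nat option" where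
  "rank_in ts \<tau> = (case map_of ts (length (fst \<tau>)) of None \<Rightarrow> None | Some t \<Rightarrow> lookup t (word_code \<tau>))"

lemma rank_in_tables:
  "rank_in (map (\<lambda>(lt, ps). (lt, trie_of ps)) tables) \<tau> = Some d \<Longrightarrow> code_rank \<tau> = Some d"
  by (auto simp: rank_in_def code_rank_def codes_def map_of_map lookup_trie_of split: option.splits if_splits)

definition decode :: "nat \<Rightarrow> nat list \<Rightarrow> exchange" where
  "decode lt w = (take lt w, rev (drop lt w))"

text \<open>An executable form of \<open>feasible\<close>: the winner is two-sided, or the loser's
  side has a loose band other than the loser.\<close>

definition feasible_code :: "bool \<Rightarrow> exchange \<Rightarrow> bool" where
  "feasible_code s \<tau> = (let A = (if s then fst \<tau> else snd \<tau>); B = (if s then snd \<tau> else fst \<tau>) in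
     win s \<tau> \<in> set B \<or> (\<exists>x\<in>set B. x \<notin> set A \<and> x \<noteq> win (\<not> s) \<tau>))"

fun pair_up_all :: "(nat \<times> nat) list \<Rightarrow> chains \<Rightarrow> bool" where
  "pair_up_all [] st = (st = [])"
| "pair_up_all ((i, j) # ps) st = (case pair_up i j st of None \<Rightarrow> False | Some st' \<Rightarrow> pair_up_all ps st')"

text \<open>In a code, a position that differs from its entry is the second end of a band, and the
  entry is the position of the first end.\<close>

definition partners :: "nat list \<Rightarrow> (nat \<times> nat) list" where
  "partners w = filter (\<lambda>(i, j). i \<noteq> j) (zip w gaps)"

text \<open>Certifies that an entry really is a complete genus 2 exchange. Recurrence follows from
  the presence of both kinds of loose bands, and the triangle condition from gluing the prescribed
  pairs with success.\<close>

definition static_check :: "nat \<Rightarrow> nat list \<Rightarrow> bool" where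
  "static_check lt w = (let (T, B) = decode lt w in
     length w = 14 \<and> word_code (T, B) = w \<and> list_all (\<lambda>e. count_list w e = 2) w \<and>
     (\<exists>e\<in>set T. e \<notin> set B) \<and> (\<exists>e\<in>set B. e \<notin> set T) \<and> last T \<noteq> last B \<and>
     pair_up_all (partners w) (start lt))"

definition successor_ranks :: "(exchange \<Rightarrow> nat option) \<Rightarrow> exchange \<Rightarrow> nat option list" where
  "successor_ranks rk \<tau> = map rk (map (\<lambda>s. move s \<tau>) (filter (\<lambda>s. feasible_code s \<tau>) [True, False]))"

definition smaller_rank :: "nat \<Rightarrow> nat option \<Rightarrow> bool" where
  "smaller_rank d r = (case r of None \<Rightarrow> False | Some d' \<Rightarrow> d' < d)"

abbreviation base_word :: "nat list" where
  "base_word \<equiv> [0,1,2,3,1,2,3,0,8,9,10,8,9,10]"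

text \<open>Here \<open>r\<close> belongs to the exchange with top and bottom interchanged and
  \<open>rs\<close> to the feasible successors. All of them must be tabulated, and some successor
  must have a smaller rank unless the entry is the base word.\<close>

definition check_ranks :: "nat \<Rightarrow> nat list \<Rightarrow> nat \<Rightarrow> nat option \<Rightarrow> nat option list \<Rightarrow> bool" where
  "check_ranks lt w d r rs \<longleftrightarrow> r \<noteq> None \<and> None \<notin> set rs \<and>
     (if d = 0 then lt = 7 \<and> w = base_word else list_ex (smaller_rank d) rs)"

fun dynamic_check :: "(exchange \<Rightarrow> nat option) \<Rightarrow> nat \<Rightarrow> nat list \<times> nat \<Rightarrow> bool" where
  "dynamic_check rk lt (w, d) =
     check_ranks lt w d (rk (prod.swap (decode lt w))) (successor_ranks rk (decode lt w))"

fun check_tables :: "(exchange \<Rightarrow> nat option) \<Rightarrow> (nat \<times> (nat list \<times> nat) list) list \<Rightarrow> bool" where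
  "check_tables rk [] = True"
| "check_tables rk ((lt, ps) # ts) \<longleftrightarrow> list_all (dynamic_check rk lt) ps \<and> check_tables rk ts"

lemma check_tablesD: "check_tables rk ts \<Longrightarrow> (lt, ps) \<in> set ts \<Longrightarrow> (w, d) \<in> set ps \<Longrightarrow> dynamic_check rk lt (w, d)"
  by (induction ts) (auto simp: list_all_iff simp del: dynamic_check.simps)

text \<open>The check asks only for successful lookups and the values found, so it passes to every
  lookup function that extends the given one.\<close>

lemma dynamic_check_mono:
  assumes "\<And>\<tau> d. rk \<tau> = Some d \<Longrightarrow> rk' \<tau> = Some d" "dynamic_check rk lt (w, d)"
  shows "dynamic_check rk' lt (w, d)"
proof -
  have not_None: "rk \<tau> \<noteq> None \<Longrightarrow> rk' \<tau> \<noteq> None" and smaller: "smaller_rank d (rk \<tau>) \<Longrightarrow> smaller_rank d (rk' \<tau>)" for \<tau>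
    using assms(1)[of \<tau>] by (auto simp: smaller_rank_def split: option.splits)
  define Y where "Y = (\<lambda>s. move s (decode lt w)) ` set (filter (\<lambda>s. feasible_code s (decode lt w)) [True, False])"
  have eq: "set (successor_ranks r (decode lt w)) = r ` Y" for r
    unfolding successor_ranks_def Y_def by (simp only: set_map)
  have mono: "P' \<and> Q' \<and> (if c then b else R')"
    if "P \<and> Q \<and> (if c then b else R)" "P \<Longrightarrow> P'" "Q \<Longrightarrow> Q'" "R \<Longrightarrow> R'" for P P' Q Q' R R' c b :: bool
    using that by simp
  have "rk (prod.swap (decode lt w)) \<noteq> None \<and> None \<notin> rk ` Y \<and>
      (if d = 0 then lt = 7 \<and> w = base_word else \<exists>r\<in>rk ` Y. smaller_rank d r)"
    using assms(2) unfolding dynamic_check.simps check_ranks_def list_ex_iff eq .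
  then have "rk' (prod.swap (decode lt w)) \<noteq> None \<and> None \<notin> rk' ` Y \<and>
      (if d = 0 then lt = 7 \<and> w = base_word else \<exists>r\<in>rk' ` Y. smaller_rank d r)"
  proof (rule mono)
    show "None \<notin> rk ` Y \<Longrightarrow> None \<notin> rk' ` Y" using not_None by (metis (no_types, lifting) imageE imageI)
    show "\<exists>r\<in>rk ` Y. smaller_rank d r \<Longrightarrow> \<exists>r\<in>rk' ` Y. smaller_rank d r" using smaller by blast
  qed (rule not_None)
  then show ?thesis unfolding dynamic_check.simps check_ranks_def list_ex_iff eq .
qed

text \<open>Depth 7 suffices for 14 ends because every step glues two of them.\<close>

lemma gluings_3: "list_all (accept 3 (trie_of codes_3)) (gluings 7 [] (start 3))"
  by code_simp

lemma static_3: "list_all (\<lambda>(w, d). static_check 3 w) codes_3"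
  by code_simp

lemma gluings_4: "list_all (accept 4 (trie_of codes_4)) (gluings 7 [] (start 4))"
  by code_simp

lemma static_4: "list_all (\<lambda>(w, d). static_check 4 w) codes_4"
  by code_simp

lemma gluings_5: "list_all (accept 5 (trie_of codes_5)) (gluings 7 [] (start 5))"
  by code_simp

lemma static_5: "list_all (\<lambda>(w, d). static_check 5 w) codes_5"
  by code_simp

lemma gluings_6: "list_all (accept 6 (trie_of codes_6)) (gluings 7 [] (start 6))"
  by code_simp

lemma static_6: "list_all (\<lambda>(w, d). static_check 6 w) codes_6"
  by code_simp

lemma gluings_7: "list_all (accept 7 (trie_of codes_7)) (gluings 7 [] (start 7))"
  by code_simp

lemma static_7: "list_all (\<lambda>(w, d). static_check 7 w) codes_7"
  by code_simp

lemma gluings_8: "list_all (accept 8 (trie_of codes_8)) (gluings 7 [] (start 8))"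
  by code_simp

lemma static_8: "list_all (\<lambda>(w, d). static_check 8 w) codes_8"
  by code_simp

lemma gluings_9: "list_all (accept 9 (trie_of codes_9)) (gluings 7 [] (start 9))"
  by code_simp

lemma static_9: "list_all (\<lambda>(w, d). static_check 9 w) codes_9"
  by code_simp

lemma gluings_10: "list_all (accept 10 (trie_of codes_10)) (gluings 7 [] (start 10))"
  by code_simp

lemma static_10: "list_all (\<lambda>(w, d). static_check 10 w) codes_10"
  by code_simp

lemma gluings_11: "list_all (accept 11 (trie_of codes_11)) (gluings 7 [] (start 11))"
  by code_simp

lemma static_11: "list_all (\<lambda>(w, d). static_check 11 w) codes_11"
  by code_simp

lemma check_all: "check_tables (rank_in (map (\<lambda>(lt, ps). (lt, trie_of ps)) tables)) tables"
  by code_simp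

text \<open>A band joining the only two top ends would close up the gap between them to a region
  with a single ideal vertex.\<close>

lemma no_start_2: "pair_up 0 1 (start 2) = None"
  by code_simp

lemma no_start_12: "pair_up 12 13 (start 12) = None"
  by code_simp

lemma codes_cases: "codes lt \<noteq> [] \<Longrightarrow> (lt, codes lt) \<in> set tables"
  by (auto simp: codes_def split: option.splits dest: map_of_SomeD)

lemma codes_range: "codes lt \<noteq> [] \<Longrightarrow> lt \<in> {3, 4, 5, 6, 7, 8, 9, 10, 11}"
  using codes_cases by (fastforce simp: tables_def)

lemma codes_simps:
  "codes 3 = codes_3" "codes 4 = codes_4" "codes 5 = codes_5" "codes 6 = codes_6" "codes 7 = codes_7"
  "codes 8 = codes_8" "codes 9 = codes_9" "codes 10 = codes_10" "codes 11 = codes_11"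
  by (simp_all add: codes_def tables_def)

lemma gluings_codes:
  "lt \<in> {3, 4, 5, 6, 7, 8, 9, 10, 11} \<Longrightarrow>
    list_all (accept lt (trie_of (codes lt))) (gluings 7 [] (start lt))"
  using gluings_3 gluings_4 gluings_5 gluings_6 gluings_7 gluings_8 gluings_9 gluings_10 gluings_11
  by (elim insertE emptyE) (simp_all only: codes_simps)

lemma static_codes:
  assumes w: "(w, d) \<in> set (codes lt)"
  shows "static_check lt w"
proof -
  have "lt \<in> {3, 4, 5, 6, 7, 8, 9, 10, 11}" using w by (intro codes_range) auto
  then have "list_all (\<lambda>(w, d). static_check lt w) (codes lt)"
    using static_3 static_4 static_5 static_6 static_7 static_8 static_9 static_10 static_11
    by (elim insertE emptyE) (simp_all only: codes_simps)
  with w show ?thesis unfolding list_all_iff by fast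
qed

lemma dynamic_codes:
  assumes w: "(w, d) \<in> set (codes lt)"
  shows "dynamic_check code_rank lt (w, d)"
proof (rule dynamic_check_mono[OF rank_in_tables])
  have "(lt, codes lt) \<in> set tables" using w by (intro codes_cases) auto
  then show "dynamic_check (rank_in (map (\<lambda>(lt, ps). (lt, trie_of ps)) tables)) lt (w, d)"
    using check_tablesD[OF check_all] w by blast
qed

section \<open>Band ends, complementary regions and recurrence of an exchange\<close>

lemma count_list_card: "count_list xs e = card {i. i < length xs \<and> xs ! i = e}"
  by (simp only: count_list_eq_length_filter length_filter_conv_card eq_commute[of e])

lemma count_list_rev: "count_list (rev xs) e = count_list xs e"
  by (induction xs) auto

lemma count_ends: "count_list (ends \<tau>) e = count_list (fst \<tau>) e + count_list (snd \<tau>) e"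
  by (simp add: ends_def count_list_rev)

lemma set_ends: "set (ends \<tau>) = bands \<tau>"
  by (simp add: ends_def bands_def)

lemma length_ends: "length (ends \<tau>) = length (fst \<tau>) + length (snd \<tau>)"
  by (simp add: ends_def)

lemma other_end_ex1:
  assumes "interval_exchange \<tau>" "i < length (ends \<tau>)"
  shows "\<exists>!j. j < length (ends \<tau>) \<and> j \<noteq> i \<and> ends \<tau> ! j = ends \<tau> ! i"
proof -
  let ?A = "{j. j < length (ends \<tau>) \<and> ends \<tau> ! j = ends \<tau> ! i}"
  have "ends \<tau> ! i \<in> bands \<tau>" using assms(2) set_ends nth_mem by metis
  then have "card ?A = 2"
    using count_twice[OF assms(1)] by (simp add: count_list_card[symmetric] count_ends)
  moreover have "i \<in> ?A" using assms(2) by simp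
  ultimately have "card (?A - {i}) = 1" by simp
  then obtain j where "?A - {i} = {j}" by (auto simp: card_1_singleton_iff)
  then show ?thesis by (intro ex1I[of _ j]) blast+
qed

lemma other_end:
  assumes "interval_exchange \<tau>" "i < length (ends \<tau>)"
  shows "other_end \<tau> i < length (ends \<tau>)" "other_end \<tau> i \<noteq> i" "ends \<tau> ! other_end \<tau> i = ends \<tau> ! i"
  using theI'[OF other_end_ex1[OF assms]] unfolding other_end_def by blast+

lemma other_end_eqI:
  assumes "interval_exchange \<tau>" "i < length (ends \<tau>)" "j < length (ends \<tau>)" "j \<noteq> i" "ends \<tau> ! j = ends \<tau> ! i"
  shows "other_end \<tau> i = j"
  using other_end_ex1[OF assms(1,2)] other_end[OF assms(1,2)] assms(3-5) by metis

lemma other_end_involution: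
  assumes "interval_exchange \<tau>" "i < length (ends \<tau>)"
  shows "other_end \<tau> (other_end \<tau> i) = i"
  using other_end[OF assms] assms by (intro other_end_eqI) auto

lemma next_gap_permutation:
  assumes ie: "interval_exchange \<tau>"
  shows "finite_permutation {..<length (ends \<tau>)} (next_gap \<tau>)"
proof
  let ?n = "length (ends \<tau>)"
  show "inj_on (next_gap \<tau>) {..<?n}"
  proof (rule inj_onI)
    fix x y assume xy: "x \<in> {..<?n}" "y \<in> {..<?n}" "next_gap \<tau> x = next_gap \<tau> y"
    then have n: "?n > 0" by auto
    have "other_end \<tau> (Suc x mod ?n) = other_end \<tau> (Suc y mod ?n)" using xy(3) by (simp only: next_gap_def)
    then have "Suc x mod ?n = Suc y mod ?n"
      using other_end_involution[OF ie mod_less_divisor[OF n]] by metis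
    moreover have "Suc z mod ?n = (if Suc z = ?n then 0 else Suc z)" if "z \<in> {..<?n}" for z
      using that by (cases "Suc z = ?n") auto
    ultimately show "x = y" using xy(1,2) by (auto split: if_splits)
  qed
  show "next_gap \<tau> x \<in> {..<?n}" if "x \<in> {..<?n}" for x
  proof -
    have "?n > 0" using that by auto
    then show ?thesis using other_end(1)[OF ie mod_less_divisor] by (simp add: next_gap_def)
  qed
qed simp

lemma complementary_regions_orbits:
  "complementary_regions \<tau> = orbit (next_gap \<tau>) ` {..<length (ends \<tau>)}"
  by (simp add: complementary_regions_def orbit_def)

lemma (in finite_permutation) sum_card_orbits:
  "(\<Sum>R\<in>orbit N ` I. card (A \<inter> R)) = card (A \<inter> I)"
proof -
  have "(\<Union>R\<in>orbit N ` I. A \<inter> R) = A \<inter> I"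
    using orbit_I orbit_refl by fastforce
  moreover have "card (\<Union>R\<in>orbit N ` I. A \<inter> R) = (\<Sum>R\<in>orbit N ` I. card (A \<inter> R))"
  proof (rule card_UN_disjoint)
    show "\<forall>R\<in>orbit N ` I. finite (A \<inter> R)" using orbit_I fin finite_subset by blast
    show "\<forall>R\<in>orbit N ` I. \<forall>R'\<in>orbit N ` I. R \<noteq> R' \<longrightarrow> (A \<inter> R) \<inter> (A \<inter> R') = {}"
    proof (intro ballI impI)
      fix R R' assume "R \<in> orbit N ` I" "R' \<in> orbit N ` I" "R \<noteq> R'"
      then obtain x y where "x \<in> I" "y \<in> I" "R = orbit N x" "R' = orbit N y" by blast
      then have "R \<inter> R' = {}" using orbit_eq \<open>R \<noteq> R'\<close> by blast
      then show "(A \<inter> R) \<inter> (A \<inter> R') = {}" by blast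
    qed
  qed (use fin in simp)
  ultimately show ?thesis by simp
qed

lemma length_ends_bands:
  assumes "interval_exchange \<tau>"
  shows "length (ends \<tau>) = 2 * card (bands \<tau>)"
proof -
  have "length (ends \<tau>) = (\<Sum>e\<in>bands \<tau>. count_list (ends \<tau>) e)"
    using sum_count_set[of "ends \<tau>" "bands \<tau>"] by (simp add: set_ends)
  also have "\<dots> = (\<Sum>e\<in>bands \<tau>. 2)"
    using count_twice[OF assms] by (intro sum.cong) (auto simp: count_ends)
  finally show ?thesis by simp
qed

definition ideal :: "exchange \<Rightarrow> nat set" where
  "ideal \<tau> = {i. Suc i \<noteq> length (fst \<tau>) \<and> Suc i \<noteq> length (ends \<tau>)}"

lemma ideal_vertices_eq: "ideal_vertices \<tau> R = ideal \<tau> \<inter> R"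
  by (auto simp: ideal_vertices_def ideal_def)

text \<open>There are as many gaps as band ends. All but the two smooth ones are ideal vertices, and
  the regions share these out in threes.\<close>

lemma count_regions:
  assumes ie: "interval_exchange \<tau>" and ne: "fst \<tau> \<noteq> []" "snd \<tau> \<noteq> []"
    and tri: "\<forall>R\<in>complementary_regions \<tau>. card (ideal_vertices \<tau> R) = 3"
  shows "3 * card (complementary_regions \<tau>) + 2 = length (ends \<tau>)"
proof -
  let ?n = "length (ends \<tau>)"
  interpret finite_permutation "{..<?n}" "next_gap \<tau>" by (rule next_gap_permutation[OF ie])
  have "3 * card (complementary_regions \<tau>) = (\<Sum>R\<in>complementary_regions \<tau>. card (ideal \<tau> \<inter> R))"
    using tri by (simp add: ideal_vertices_eq)
  also have "\<dots> = card (ideal \<tau> \<inter> {..<?n})"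
    unfolding complementary_regions_orbits by (rule sum_card_orbits)
  also have "ideal \<tau> \<inter> {..<?n} = {..<?n} - {length (fst \<tau>) - 1, ?n - 1}"
    using ne by (auto simp: ideal_def length_ends)
  also have "card \<dots> = ?n - 2"
  proof -
    have "{length (fst \<tau>) - 1, ?n - 1} \<subseteq> {..<?n}" "length (fst \<tau>) - 1 \<noteq> ?n - 1"
      using ne by (cases "fst \<tau>"; cases "snd \<tau>"; auto simp: length_ends)+
    then show ?thesis by (simp add: card_Diff_subset)
  qed
  finally show ?thesis using ne by (cases "fst \<tau>"; cases "snd \<tau>") (auto simp: length_ends)
qed

text \<open>A positive weight gives the same total to the top-top and to the bottom-bottom bands, so
  neither kind occurs alone.\<close>

lemma recurrent_sides:
  assumes ie: "interval_exchange \<tau>" and rec: "recurrent \<tau>"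
  shows "side True \<tau> = {} \<longleftrightarrow> side False \<tau> = {}"
proof -
  obtain w where w: "w \<in> weights \<tau>" "\<forall>e\<in>bands \<tau>. w e > 0" using rec by (auto simp: recurrent_def)
  have eq: "sum w (side True \<tau>) = sum w (side False \<tau>)" by (rule weights_side_sum[OF ie w(1)])
  have "sum w (side s \<tau>) > 0" if "side s \<tau> \<noteq> {}" for s
    using that w(2) side_subset[of s \<tau>] by (intro sum_pos) auto
  from this[of True] this[of False] show ?thesis using eq by fastforce
qed

text \<open>Every top-top band gets the number of bottom-bottom bands as its weight, and conversely;
  two-sided bands get weight 1.\<close>

lemma recurrentI:
  assumes ie: "interval_exchange \<tau>" and ne: "side True \<tau> \<noteq> {}" "side False \<tau> \<noteq> {}"
  shows "recurrent \<tau>"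
proof -
  define w where "w = (\<lambda>e\<in>bands \<tau>. if e \<in> side True \<tau> then real (card (side False \<tau>))
    else if e \<in> side False \<tau> then real (card (side True \<tau>)) else 1)"
  have pos: "card (side s \<tau>) > 0" for s using ne by (cases s) (auto simp: card_gt_0_iff)
  have "sum w (side True \<tau>) = (\<Sum>e\<in>side True \<tau>. real (card (side False \<tau>)))"
    using side_subset[of True \<tau>] by (intro sum.cong) (auto simp: w_def)
  moreover have "sum w (side False \<tau>) = (\<Sum>e\<in>side False \<tau>. real (card (side True \<tau>)))"
    using side_subset[of False \<tau>] side_disjoint(1)[of \<tau>] by (intro sum.cong) (auto simp: w_def)
  ultimately have "imbalance \<tau> w = 0" by (simp add: sum_defect_zero[OF ie])
  moreover have w0: "w e > 0" if "e \<in> bands \<tau>" for e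
    using that pos[of True] pos[of False] by (simp add: w_def)
  moreover have "w \<in> extensional (bands \<tau>)" by (simp add: w_def)
  ultimately have "w \<in> weights \<tau>" by (auto simp: weights_iff PiE_iff less_imp_le)
  then show ?thesis using w0 by (auto simp: recurrent_def)
qed

lemma gaps_eq: "gaps = [0..<14]"
  by code_simp

lemma start_properties:
  "chain_ends (start lt) = {..<14}" "distinct (map fst (start lt))"
  "x < 14 \<Longrightarrow> target (start lt) x = Suc x mod 14"
  "x < 14 \<Longrightarrow> weight (start lt) x = (if Suc x = lt \<or> Suc x = 14 then 0 else 1)"
proof -
  have gaps: "set gaps = {..<14}" "distinct gaps" by (auto simp: gaps_eq simp del: upt_Suc upt_rec_numeral)
  have fst_start: "map fst (start lt) = gaps" by (simp add: start_def comp_def)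
  show "chain_ends (start lt) = {..<14}" using arg_cong[OF fst_start, of set] gaps by simp
  show d: "distinct (map fst (start lt))" by (simp add: fst_start gaps)
  assume x: "x < 14"
  have "(x, if x = 13 then 0 else x + 1, if x + 1 = lt \<or> x = 13 then 0 else 1) \<in> set (start lt)"
    using x gaps(1) unfolding start_def by (simp add: image_iff Bex_def)
  then have m: "map_of (start lt) x = Some (if x = 13 then 0 else x + 1, if x + 1 = lt \<or> x = 13 then 0 else 1)"
    using d by (simp add: map_of_is_SomeI)
  show "target (start lt) x = Suc x mod 14" using x by (simp add: target_def m)
  show "weight (start lt) x = (if Suc x = lt \<or> Suc x = 14 then 0 else 1)" using x by (simp add: weight_def m)
qed

lemma chain_system_start:
  assumes ie: "interval_exchange \<tau>" and n: "length (ends \<tau>) = 14"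
  shows "chain_system (other_end \<tau>) (start lt)"
proof -
  interpret finite_permutation "{..<14}" "next_gap \<tau>" using next_gap_permutation[OF ie] by (simp add: n)
  have eq: "other_end \<tau> (target (start lt) x) = next_gap \<tau> x" if "x < 14" for x
    using that by (simp add: start_properties(3) next_gap_def n)
  have "inj_on (\<lambda>x. other_end \<tau> (target (start lt) x)) {..<14} = inj_on (next_gap \<tau>) {..<14}"
    by (intro inj_on_cong) (simp add: eq)
  then have "finite_permutation {..<14} (\<lambda>x. other_end \<tau> (target (start lt) x))"
    using inj closed eq by unfold_locales auto
  moreover have "other_end \<tau> (other_end \<tau> (target (start lt) x)) = target (start lt) x" if "x < 14" for x
    using other_end_involution[OF ie] n that by (simp add: start_properties(3))
  ultimately show ?thesis
    unfolding chain_system_def start_properties(1) using start_properties(2) by auto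
qed

lemma triangular_start:
  assumes ie: "interval_exchange \<tau>" and n: "length (ends \<tau>) = 14"
  shows "triangular (other_end \<tau>) (start (length (fst \<tau>))) \<longleftrightarrow>
    (\<forall>R\<in>complementary_regions \<tau>. card (ideal_vertices \<tau> R) = 3)"
proof -
  let ?st = "start (length (fst \<tau>))"
  interpret finite_permutation "{..<14}" "next_gap \<tau>" using next_gap_permutation[OF ie] by (simp add: n)
  have "triangular (other_end \<tau>) ?st \<longleftrightarrow> all_three {..<14} (next_gap \<tau>) (\<lambda>x. if x \<in> ideal \<tau> then 1 else 0)"
    unfolding triangular_def start_properties(1)
    using closed by (intro all_three_cong) (auto simp: start_properties(3,4) next_gap_def n ideal_def)
  moreover have "(\<Sum>y\<in>orbit (next_gap \<tau>) x. if y \<in> ideal \<tau> then 1 else 0) = card (ideal \<tau> \<inter> orbit (next_gap \<tau>) x)"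
    if "x \<in> {..<14}" for x
  proof -
    have "finite (orbit (next_gap \<tau>) x)" using orbit_I[OF that] fin finite_subset by blast
    then show ?thesis by (simp add: sum.If_cases Int_commute)
  qed
  ultimately show ?thesis
    by (simp add: all_three_def complementary_regions_orbits ideal_vertices_eq n)
qed

lemma first_position_nth:
  assumes ie: "interval_exchange \<tau>" and i: "i < length (ends \<tau>)"
  shows "first_position (ends \<tau>) (ends \<tau> ! i) = min i (other_end \<tau> i)"
proof -
  define m where "m = min i (other_end \<tau> i)"
  note o = other_end[OF ie i]
  have m: "m < length (ends \<tau>)" "ends \<tau> ! m = ends \<tau> ! i" using o i by (auto simp: m_def min_def)
  have "ends \<tau> ! k \<noteq> ends \<tau> ! i" if "k < m" for k
  proof
    assume k: "ends \<tau> ! k = ends \<tau> ! i"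
    have "k \<noteq> i" "k < length (ends \<tau>)" using that m by (auto simp: m_def)
    then have "other_end \<tau> i = k" using k i ie by (intro other_end_eqI) auto
    then show False using that by (simp add: m_def)
  qed
  then have "takeWhile (\<lambda>y. y \<noteq> ends \<tau> ! i) (ends \<tau>) = take m (ends \<tau>)"
    using m by (intro takeWhile_eq_take_P_nth) auto
  then show ?thesis using m by (simp add: first_position_def m_def)
qed

lemma label_pairs:
  assumes "\<forall>(i, j)\<in>set ps. p i = j \<and> p j = i" "x \<in> fst ` set ps \<union> snd ` set ps"
  shows "label ps x = min x (p x)"
  using assms
proof (induction ps)
  case (Cons e ps)
  obtain i j where e: "e = (i, j)" by (cases e)
  have ij: "p i = j" "p j = i" using Cons.prems(1) e by auto
  show ?case
  proof (cases "x = i \<or> x = j")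
    case True
    then show ?thesis using ij e by (auto simp: min_def)
  next
    case False
    then show ?thesis using Cons e by auto
  qed
qed simp

lemma ends_side:
  assumes ie: "interval_exchange \<tau>" and i: "i < length (ends \<tau>)"
  shows "ends \<tau> ! i \<in> side True \<tau> \<longleftrightarrow> i < length (fst \<tau>) \<and> other_end \<tau> i < length (fst \<tau>)"
    and "ends \<tau> ! i \<in> side False \<tau> \<longleftrightarrow> length (fst \<tau>) \<le> i \<and> length (fst \<tau>) \<le> other_end \<tau> i"
proof -
  define e where "e = ends \<tau> ! i"
  note o = other_end[OF ie i]
  have top: "e \<in> set (fst \<tau>) \<longleftrightarrow> (\<exists>k<length (fst \<tau>). ends \<tau> ! k = e)"
    by (auto simp: ends_def in_set_conv_nth nth_append)
  have bot: "e \<in> set (snd \<tau>) \<longleftrightarrow> (\<exists>k. length (fst \<tau>) \<le> k \<and> k < length (ends \<tau>) \<and> ends \<tau> ! k = e)"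
  proof
    assume "e \<in> set (snd \<tau>)"
    then have "e \<in> set (rev (snd \<tau>))" by simp
    then obtain k where "k < length (rev (snd \<tau>))" "rev (snd \<tau>) ! k = e" by (metis in_set_conv_nth)
    then show "\<exists>k. length (fst \<tau>) \<le> k \<and> k < length (ends \<tau>) \<and> ends \<tau> ! k = e"
      by (intro exI[of _ "length (fst \<tau>) + k"]) (simp add: ends_def nth_append)
  next
    assume "\<exists>k. length (fst \<tau>) \<le> k \<and> k < length (ends \<tau>) \<and> ends \<tau> ! k = e"
    then obtain k where k: "length (fst \<tau>) \<le> k" "k < length (ends \<tau>)" "ends \<tau> ! k = e" by blast
    then have "rev (snd \<tau>) ! (k - length (fst \<tau>)) = e" "k - length (fst \<tau>) < length (rev (snd \<tau>))"
      by (auto simp: ends_def nth_append)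
    then show "e \<in> set (snd \<tau>)" by (metis nth_mem set_rev)
  qed
  have pos: "k = i \<or> k = other_end \<tau> i" if "k < length (ends \<tau>)" "ends \<tau> ! k = e" for k
    using other_end_eqI[OF ie i that(1)] that(2) by (auto simp: e_def)
  have le: "length (fst \<tau>) \<le> length (ends \<tau>)" by (simp add: length_ends)
  have T: "e \<in> set (fst \<tau>) \<longleftrightarrow> i < length (fst \<tau>) \<or> other_end \<tau> i < length (fst \<tau>)"
    unfolding top using pos le o(3) i by (metis e_def order_less_le_trans)
  have B: "e \<in> set (snd \<tau>) \<longleftrightarrow> length (fst \<tau>) \<le> i \<or> length (fst \<tau>) \<le> other_end \<tau> i"
    unfolding bot using pos o i by (metis e_def)
  show "ends \<tau> ! i \<in> side True \<tau> \<longleftrightarrow> i < length (fst \<tau>) \<and> other_end \<tau> i < length (fst \<tau>)"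
    "ends \<tau> ! i \<in> side False \<tau> \<longleftrightarrow> length (fst \<tau>) \<le> i \<and> length (fst \<tau>) \<le> other_end \<tau> i"
    using T B by (auto simp: side_def e_def)
qed

lemma side_nonempty_iff:
  assumes ie: "interval_exchange \<tau>"
  shows "side True \<tau> \<noteq> {} \<longleftrightarrow> (\<exists>i<length (ends \<tau>). i < length (fst \<tau>) \<and> other_end \<tau> i < length (fst \<tau>))"
    and "side False \<tau> \<noteq> {} \<longleftrightarrow> (\<exists>i<length (ends \<tau>). length (fst \<tau>) \<le> i \<and> length (fst \<tau>) \<le> other_end \<tau> i)"
proof -
  have "e \<in> side s \<tau> \<Longrightarrow> \<exists>i<length (ends \<tau>). ends \<tau> ! i = e" for e s
    using side_subset[of s \<tau>] set_ends[of \<tau>] by (metis in_set_conv_nth subsetD)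
  then show "side True \<tau> \<noteq> {} \<longleftrightarrow> (\<exists>i<length (ends \<tau>). i < length (fst \<tau>) \<and> other_end \<tau> i < length (fst \<tau>))"
    "side False \<tau> \<noteq> {} \<longleftrightarrow> (\<exists>i<length (ends \<tau>). length (fst \<tau>) \<le> i \<and> length (fst \<tau>) \<le> other_end \<tau> i)"
    using ends_side[OF ie] by (metis ex_in_conv)+
qed

text \<open>For \<open>n\<close> bands and \<open>r\<close> regions the triangles give
  \<open>2 * n = 3 * r + 2\<close>, and genus 2 gives \<open>n = r + 3\<close>. Hence
  \<open>r = 4\<close> and \<open>n = 7\<close>.\<close>

lemma complete_genus2_counts:
  assumes c: "complete_exchange \<tau>" and g: "has_genus \<tau> 2"
  shows "length (ends \<tau>) = 14" "fst \<tau> \<noteq> []" "snd \<tau> \<noteq> []"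
proof -
  have ie: "interval_exchange \<tau>" and rec: "recurrent \<tau>"
    and tri: "\<forall>R\<in>complementary_regions \<tau>. card (ideal_vertices \<tau> R) = 3"
    using c by (auto simp: complete_exchange_def)
  have b: "int (card (bands \<tau>)) = int (card (complementary_regions \<tau>)) + 3"
    using g by (simp add: has_genus_def capped_euler_char_def)
  then have ne: "bands \<tau> \<noteq> {}" by auto
  obtain w where w: "w \<in> weights \<tau>" "\<forall>e\<in>bands \<tau>. w e > 0" using rec by (auto simp: recurrent_def)
  have sum_pos: "sum_list (map w xs) > 0" if "xs \<noteq> []" "set xs \<subseteq> bands \<tau>" for xs
    using that
  proof (induction xs)
    case (Cons x xs)
    then show ?case using w(2) by (cases "xs = []") (auto intro: add_pos_pos)
  qed simp
  show 1: "fst \<tau> \<noteq> []" "snd \<tau> \<noteq> []"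
    using sum_pos[of "fst \<tau>"] sum_pos[of "snd \<tau>"] w(1) ne by (auto simp: weights_def bands_def)
  show "length (ends \<tau>) = 14"
    using count_regions[OF ie 1 tri] length_ends_bands[OF ie] b by linarith
qed

lemma loose_if_unequal_lengths:
  assumes ie: "interval_exchange \<tau>" and s: "side True \<tau> = {}" "side False \<tau> = {}"
  shows "length (fst \<tau>) = length (snd \<tau>)"
proof -
  have "imbalance \<tau> (\<lambda>_. 1) = 0" using s by (simp add: sum_defect_zero[OF ie])
  then show ?thesis by (simp add: imbalance_def sum_list_triv)
qed

text \<open>The tables miss nothing: the pairing of the ends is found by the search, its labels form
  the code of the exchange, and recurrence makes \<open>accept\<close> look this code up.\<close>

theorem code_rank_complete_genus2:
  assumes c: "complete_exchange \<tau>" and g: "has_genus \<tau> 2"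
  shows "code_rank \<tau> \<noteq> None"
proof -
  define lt where "lt = length (fst \<tau>)"
  define p where "p = other_end \<tau>"
  have ie: "interval_exchange \<tau>" and rec: "recurrent \<tau>"
    and tri: "\<forall>R\<in>complementary_regions \<tau>. card (ideal_vertices \<tau> R) = 3"
    using c by (auto simp: complete_exchange_def)
  note cnt = complete_genus2_counts[OF c g]
  have p: "p x < 14" "p x \<noteq> x" "p (p x) = x" if "x < 14" for x
    using other_end[OF ie, of x] other_end_involution[OF ie, of x] that by (auto simp: cnt p_def)
  have st: "chain_system p (start lt)" "triangular p (start lt)"
    using chain_system_start[OF ie cnt(1)] triangular_start[OF ie cnt(1)] tri by (auto simp: p_def lt_def)
  have sides: "side True \<tau> \<noteq> {} \<longleftrightarrow> (\<exists>i<14. i < lt \<and> p i < lt)" "side False \<tau> \<noteq> {} \<longleftrightarrow> (\<exists>i<14. lt \<le> i \<and> lt \<le> p i)"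
    using side_nonempty_iff[OF ie] by (simp_all add: cnt(1) p_def lt_def)
  have lt: "0 < lt" "lt < 14" "length (snd \<tau>) = 14 - lt"
    using cnt by (auto simp: lt_def length_ends simp flip: length_greater_0_conv)
  have both: "side True \<tau> \<noteq> {}" "side False \<tau> \<noteq> {}" if "lt \<noteq> 7"
    using that loose_if_unequal_lengths[OF ie] recurrent_sides[OF ie rec] lt by (auto simp: lt_def)
  \<comment> \<open>Words of different lengths force loose bands of both kinds. A side with fewer
    than three ends then consists of the two ends of one band, which closes up a region too
    early.\<close>
  have lt_range: "lt \<in> {3, 4, 5, 6, 7, 8, 9, 10, 11}"
  proof (rule ccontr)
    assume "lt \<notin> {3, 4, 5, 6, 7, 8, 9, 10, 11}"
    then consider "lt < 3" | "lt > 11" by force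
    then show False
    proof cases
      case 1
      then obtain i where i: "i < 14" "i < lt" "p i < lt" using both sides by auto
      then have "{i, p i} = {0, 1} \<and> lt = 2" using 1 p[OF i(1)] by auto
      then have 2: "p 0 = 1" "p 1 = 0" "lt = 2" using p[OF i(1)] by (auto simp: doubleton_eq_iff)
      then show False
        using pair_up_correct(1)[OF st(1), of 0 1] st(2) no_start_2 by (auto simp: start_properties)
    next
      case 2
      then obtain i where i: "i < 14" "lt \<le> i" "lt \<le> p i" using both sides by auto
      then have "{i, p i} = {12, 13} \<and> lt = 12" using 2 lt p[OF i(1)] by auto
      then have 2: "p 12 = 13" "p 13 = 12" "lt = 12" using p[OF i(1)] by (auto simp: doubleton_eq_iff)
      then show False
        using pair_up_correct(1)[OF st(1), of 12 13] st(2) no_start_12 by (auto simp: start_properties)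
    qed
  qed
  have acc: "\<forall>r\<in>set (gluings 7 [] (start lt)). accept lt (trie_of (codes lt)) r"
    using gluings_codes[OF lt_range] by (simp only: list_all_iff)
  then have none: "None \<notin> set (gluings 7 [] (start lt))" by force
  obtain ps where in_gluings: "Some ps \<in> set (gluings 7 [] (start lt))" and ps: "\<forall>(i, j)\<in>set ps. p i = j \<and> p j = i"
    "fst ` set ps \<union> snd ` set ps = {..<14}"
    using gluings_correct[OF none st] p by (auto simp: start_properties)
  have lab: "label ps x = min x (p x)" if "x < 14" for x
    using label_pairs[OF ps(1), of x] ps(2) that by auto
  have "word_code \<tau> = map (\<lambda>i. first_position (ends \<tau>) (ends \<tau> ! i)) [0..<14]"
    unfolding word_code_def by (subst (2) map_nth[symmetric, of "ends \<tau>"]) (simp add: cnt(1) comp_def del: upt_Suc upt_conv_Cons upt_rec_numeral)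
  also have "\<dots> = map (label ps) [0..<14]"
    using first_position_nth[OF ie] lab by (intro map_cong) (auto simp: cnt(1) p_def)
  also have "[0..<14] = gaps" by (rule gaps_eq[symmetric])
  finally have wc: "word_code \<tau> = map (label ps) gaps" .
  have in_ps: "(x, p x) \<in> set ps \<or> (p x, x) \<in> set ps" if "x < 14" for x
    using ps that by force
  have bd: "i < 14" "j < 14" if "(i, j) \<in> set ps" for i j using ps(2) that by force+
  have "list_ex (\<lambda>(i, j). i < lt \<and> j < lt) ps \<longleftrightarrow> side True \<tau> \<noteq> {}"
    unfolding sides(1) list_ex_iff using in_ps bd ps(1) by fastforce
  moreover have "list_ex (\<lambda>(i, j). lt \<le> i \<and> lt \<le> j) ps \<longleftrightarrow> side False \<tau> \<noteq> {}"
    unfolding sides(2) list_ex_iff using in_ps bd ps(1) by fastforce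
  ultimately have "map_of (codes lt) (word_code \<tau>) \<noteq> None"
    using bspec[OF acc in_gluings] recurrent_sides[OF ie rec] by (auto simp: wc lookup_trie_of split: if_splits)
  then show ?thesis by (simp add: code_rank_def lt_def)
qed

section \<open>The graph of complete genus 2 exchanges\<close>

lemma relabel_simps [simp]:
  "fst (relabel f \<tau>) = map f (fst \<tau>)" "snd (relabel f \<tau>) = map f (snd \<tau>)"
  "bands (relabel f \<tau>) = f ` bands \<tau>" "ends (relabel f \<tau>) = map f (ends \<tau>)"
  "relabel g (relabel f \<tau>) = relabel (g \<circ> f) \<tau>"
  "relabel f (prod.swap \<tau>) = prod.swap (relabel f \<tau>)"
  by (auto simp: relabel_def bands_def ends_def rev_map)

lemma set_word_bands: "set (fst \<tau>) \<subseteq> bands \<tau>" "set (snd \<tau>) \<subseteq> bands \<tau>"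
  by (auto simp: bands_def)

lemma relabel_cong: "(\<And>e. e \<in> bands \<tau> \<Longrightarrow> f e = g e) \<Longrightarrow> relabel f \<tau> = relabel g \<tau>"
  by (auto simp: relabel_def bands_def)

lemma relabel_id [simp]: "relabel (\<lambda>e. e) \<tau> = \<tau>" "relabel id \<tau> = \<tau>"
  by (simp_all add: relabel_def)

lemma count_list_map_inj:
  "inj_on f (insert e (set xs)) \<Longrightarrow> count_list (map f xs) (f e) = count_list xs e"
  by (induction xs) (auto simp: inj_on_def)

lemma interval_exchange_relabel:
  assumes "inj_on f (bands \<tau>)" "interval_exchange \<tau>"
  shows "interval_exchange (relabel f \<tau>)"
  unfolding interval_exchange_def
proof
  fix e assume "e \<in> bands (relabel f \<tau>)"
  then obtain d where d: "d \<in> bands \<tau>" "e = f d" by auto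
  have "inj_on f (insert d (set (fst \<tau> @ snd \<tau>)))"
    using d(1) by (intro inj_on_subset[OF assms(1)]) (auto simp: bands_def)
  then have "count_list (map f (fst \<tau> @ snd \<tau>)) (f d) = count_list (fst \<tau> @ snd \<tau>) d"
    by (rule count_list_map_inj)
  then show "count_list (fst (relabel f \<tau>) @ snd (relabel f \<tau>)) e = 2"
    using assms(2) d by (simp add: interval_exchange_def)
qed

lemma first_position_map:
  "inj_on f (insert x (set xs)) \<Longrightarrow> first_position (map f xs) (f x) = first_position xs x"
proof -
  assume inj: "inj_on f (insert x (set xs))"
  have "takeWhile (\<lambda>y. y \<noteq> f x) (map f xs) = map f (takeWhile (\<lambda>y. y \<noteq> x) xs)"
    using inj by (induction xs) (auto simp: inj_on_def)
  then show ?thesis by (simp add: first_position_def)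
qed

lemma word_code_relabel:
  assumes "inj_on f (bands \<tau>)"
  shows "word_code (relabel f \<tau>) = word_code \<tau>"
proof -
  have "first_position (map f (ends \<tau>)) (f x) = first_position (ends \<tau>) x" if "x \<in> set (ends \<tau>)" for x
    using that assms by (intro first_position_map) (simp add: set_ends insert_absorb)
  then show ?thesis by (simp add: word_code_def)
qed

lemma code_rank_relabel: "inj_on f (bands \<tau>) \<Longrightarrow> code_rank (relabel f \<tau>) = code_rank \<tau>"
  by (simp add: code_rank_def word_code_relabel)

lemma side_relabel:
  assumes "inj_on f (bands \<tau>)"
  shows "side s (relabel f \<tau>) = f ` side s \<tau>"
proof -
  have "f ` A - f ` B = f ` (A - B)" if "A \<subseteq> bands \<tau>" "B \<subseteq> bands \<tau>" for A B
    using inj_on_image_set_diff[OF assms, of A B] that by auto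
  then show ?thesis using set_word_bands[of \<tau>] by (simp add: side_def)
qed

lemma win_relabel: "fst \<tau> \<noteq> [] \<Longrightarrow> snd \<tau> \<noteq> [] \<Longrightarrow> win s (relabel f \<tau>) = f (win s \<tau>)"
  by (simp add: win_def last_map)

lemma unequal_ends_relabel:
  assumes f: "inj_on f (bands \<tau>)" and u: "unequal_ends \<tau>"
  shows "unequal_ends (relabel f \<tau>)"
proof -
  note ne = unequal_ends_nonempty[OF u]
  have w: "win s (relabel f \<tau>) = f (win s \<tau>)" for s using win_relabel ne by blast
  have eq: "f ` side s \<tau> = {f (win s \<tau>)} \<longleftrightarrow> side s \<tau> = {win s \<tau>}" for s
    using inj_on_image_eq_iff[OF f side_subset, of "{win s \<tau>}" s] win_in_bands[OF u, of s] by simp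
  have "f (win True \<tau>) \<noteq> f (win False \<tau>)"
    using inj_onD[OF f, of "win True \<tau>" "win False \<tau>"] win_in_bands[OF u] win_neq_lose[OF u, of True] by auto
  then show ?thesis
    using u interval_exchange_relabel[OF f] by (auto simp: unequal_ends_def side_relabel[OF f] w eq)
qed

lemma feasible_relabel:
  assumes f: "inj_on f (bands \<tau>)" and u: "unequal_ends \<tau>"
  shows "feasible s (relabel f \<tau>) = feasible s \<tau>"
proof -
  note ne = unequal_ends_nonempty[OF u]
  have w: "win s (relabel f \<tau>) = f (win s \<tau>)" for s using win_relabel ne by blast
  have "f ` side (\<not> s) \<tau> = {f (lose s \<tau>)} \<longleftrightarrow> side (\<not> s) \<tau> = {lose s \<tau>}"
    using inj_on_image_eq_iff[OF f side_subset, of "{lose s \<tau>}" "\<not> s"] win_in_bands[OF u, of "\<not> s"] by simp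
  moreover have "f (win s \<tau>) \<in> f ` side s \<tau> \<longleftrightarrow> win s \<tau> \<in> side s \<tau>"
    using inj_on_image_mem_iff[OF f win_in_bands[OF u] side_subset] .
  ultimately show ?thesis by (simp add: feasible_def side_relabel[OF f] w)
qed

lemma insert_right_map: "inj_on f (insert t (set xs)) \<Longrightarrow> insert_right (f t) (f b) (map f xs) = map f (insert_right t b xs)"
  by (induction xs) (auto simp: inj_on_def)

lemma insert_left_map: "inj_on f (insert t (set xs)) \<Longrightarrow> insert_left (f t) (f b) (map f xs) = map f (insert_left t b xs)"
  by (induction xs) (auto simp: inj_on_def)

lemma move_relabel:
  assumes f: "inj_on f (bands \<tau>)" and u: "unequal_ends \<tau>"
  shows "move s (relabel f \<tau>) = relabel f (move s \<tau>)"
proof -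
  have top: "move_top (relabel f \<tau>) = relabel f (move_top \<tau>)" if f: "inj_on f (bands \<tau>)" and u: "unequal_ends \<tau>" for \<tau>
  proof -
    note ne = unequal_ends_nonempty[OF u]
    have t: "last (fst \<tau>) \<in> bands \<tau>" using ne by (simp add: bands_def)
    have mem: "f (last (fst \<tau>)) \<in> f ` set (snd \<tau>) \<longleftrightarrow> last (fst \<tau>) \<in> set (snd \<tau>)"
      using inj_on_image_mem_iff[OF f t set_word_bands(2)] .
    have i: "inj_on f (insert (last (fst \<tau>)) (set (butlast (snd \<tau>))))" "inj_on f (insert (last (fst \<tau>)) (set (fst \<tau>)))"
      by (rule inj_on_subset[OF f]; use t set_word_bands[of \<tau>] in \<open>auto dest: in_set_butlastD\<close>)+
    show ?thesis
      using ne by (simp add: move_top_def last_map mem map_butlast[symmetric] insert_right_map[OF i(1)] insert_left_map[OF i(2)])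
        (simp add: relabel_def)
  qed
  show ?thesis
    using top[OF f u] top[of "prod.swap \<tau>"] f u by (cases s) (auto simp: move_def simp flip: relabel_simps(6))
qed

text \<open>A letter of the code is the position of the first end of a band, so reading off the word
  at this position restores the band.\<close>

lemma relabel_decode:
  assumes "interval_exchange \<tau>"
  defines "g \<equiv> (\<lambda>k. ends \<tau> ! k)" and "\<sigma> \<equiv> decode (length (fst \<tau>)) (word_code \<tau>)"
  shows "\<tau> = relabel g \<sigma>" "inj_on g (bands \<sigma>)"
proof -
  have g: "g (first_position (ends \<tau>) x) = x" if "x \<in> set (ends \<tau>)" for x
  proof -
    have "takeWhile (\<lambda>y. y \<noteq> x) (ends \<tau>) \<noteq> ends \<tau>" using that by (metis set_takeWhileD)
    then have "first_position (ends \<tau>) x < length (ends \<tau>)"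
      unfolding first_position_def by (metis length_takeWhile_le le_neq_implies_less takeWhile_eq_take take_all_iff order_refl)
    then show ?thesis
      using nth_length_takeWhile[of "\<lambda>y. y \<noteq> x" "ends \<tau>"] by (simp add: g_def first_position_def)
  qed
  then have mg: "map g (word_code \<tau>) = ends \<tau>"
    by (simp add: word_code_def map_idI)
  have "relabel g \<sigma> = (take (length (fst \<tau>)) (map g (word_code \<tau>)), rev (drop (length (fst \<tau>)) (map g (word_code \<tau>))))"
    by (simp add: relabel_def \<sigma>_def decode_def take_map drop_map rev_map)
  then show "\<tau> = relabel g \<sigma>" by (simp add: mg ends_def)
  have "bands \<sigma> \<subseteq> first_position (ends \<tau>) ` set (ends \<tau>)"
    by (auto simp: \<sigma>_def decode_def bands_def word_code_def dest!: in_set_takeD in_set_dropD)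
  moreover have "inj_on g (first_position (ends \<tau>) ` set (ends \<tau>))"
    by (rule inj_on_inverseI[of _ "first_position (ends \<tau>)"]) (auto simp: g)
  ultimately show "inj_on g (bands \<sigma>)" by (rule inj_on_subset[rotated])
qed

section \<open>Isomorphism classes and the exchanges in the tables\<close>

lemma equiv_isomorphic: "equiv {\<tau>. interval_exchange \<tau>} isomorphic_exchanges"
proof (rule equivI)
  show "refl_on {\<tau>. interval_exchange \<tau>} isomorphic_exchanges"
    by (auto simp: refl_on_def isomorphic_exchanges_def intro!: exI[of _ id])
  show "isomorphic_exchanges \<subseteq> {\<tau>. interval_exchange \<tau>} \<times> {\<tau>. interval_exchange \<tau>}"
    by (auto simp: isomorphic_exchanges_def)
  show "sym isomorphic_exchanges"
  proof (rule symI)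
    fix \<tau> \<tau>' assume "(\<tau>, \<tau>') \<in> isomorphic_exchanges"
    then obtain f where ie: "interval_exchange \<tau>" "interval_exchange \<tau>'" and f: "inj_on f (bands \<tau>)"
      and eq: "\<tau>' = relabel f \<tau> \<or> \<tau>' = prod.swap (relabel f \<tau>)"
      by (auto simp: isomorphic_exchanges_def)
    define g where "g = inv_into (bands \<tau>) f"
    have gf: "relabel (g \<circ> f) \<tau> = \<tau>"
      using relabel_cong[of \<tau> "g \<circ> f" id] f by (simp add: g_def)
    have "bands \<tau>' = f ` bands \<tau>" using eq by auto
    then have "inj_on g (bands \<tau>')" by (simp add: g_def inj_on_inv_into)
    moreover have "\<tau> = relabel g \<tau>' \<or> \<tau> = prod.swap (relabel g \<tau>')"
      using eq gf by auto
    ultimately show "(\<tau>', \<tau>) \<in> isomorphic_exchanges"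
      using ie by (auto simp: isomorphic_exchanges_def)
  qed
  show "trans isomorphic_exchanges"
  proof (rule transI)
    fix \<tau> \<tau>' \<tau>'' assume "(\<tau>, \<tau>') \<in> isomorphic_exchanges" "(\<tau>', \<tau>'') \<in> isomorphic_exchanges"
    then obtain f g where ie: "interval_exchange \<tau>" "interval_exchange \<tau>''"
      and f: "inj_on f (bands \<tau>)" "\<tau>' = relabel f \<tau> \<or> \<tau>' = prod.swap (relabel f \<tau>)"
      and g: "inj_on g (bands \<tau>')" "\<tau>'' = relabel g \<tau>' \<or> \<tau>'' = prod.swap (relabel g \<tau>')"
      by (auto simp: isomorphic_exchanges_def)
    have "bands \<tau>' = f ` bands \<tau>" using f(2) by auto
    then have "inj_on (g \<circ> f) (bands \<tau>)" using f(1) g(1) by (simp add: comp_inj_on)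
    moreover have "\<tau>'' = relabel (g \<circ> f) \<tau> \<or> \<tau>'' = prod.swap (relabel (g \<circ> f) \<tau>)"
      using f(2) g(2) by auto
    ultimately show "(\<tau>, \<tau>'') \<in> isomorphic_exchanges"
      using ie by (auto simp: isomorphic_exchanges_def)
  qed
qed

lemma iso_class_eq_iff:
  assumes "interval_exchange \<tau>" "interval_exchange \<tau>'"
  shows "iso_class \<tau> = iso_class \<tau>' \<longleftrightarrow> (\<tau>, \<tau>') \<in> isomorphic_exchanges"
  using equiv_class_eq_iff[OF equiv_isomorphic, of \<tau> \<tau>'] assms by (simp add: iso_class_def)

lemma iso_class_self: "interval_exchange \<tau> \<Longrightarrow> \<tau> \<in> iso_class \<tau>"
  using equiv_class_self[OF equiv_isomorphic, of \<tau>] by (simp add: iso_class_def)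

lemma iso_class_mem:
  assumes "\<tau>' \<in> iso_class \<tau>"
  shows "interval_exchange \<tau>" "interval_exchange \<tau>'" "iso_class \<tau>' = iso_class \<tau>"
    "\<exists>f. inj_on f (bands \<tau>) \<and> (\<tau>' = relabel f \<tau> \<or> \<tau>' = prod.swap (relabel f \<tau>))"
  using assms iso_class_eq_iff[of \<tau> \<tau>'] by (auto simp: iso_class_def isomorphic_exchanges_def)

lemma iso_class_relabel:
  assumes "interval_exchange \<tau>" "inj_on f (bands \<tau>)"
  shows "iso_class (relabel f \<tau>) = iso_class \<tau>"
proof -
  have "(\<tau>, relabel f \<tau>) \<in> isomorphic_exchanges"
    using assms interval_exchange_relabel by (auto simp: isomorphic_exchanges_def)
  then show ?thesis using iso_class_eq_iff assms interval_exchange_relabel by metis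
qed

text \<open>A checkable substitute for complete exchanges of genus 2, with which it agrees on the
  level of classes by \<open>genus2_classes_eq\<close>.\<close>

definition good :: "exchange \<Rightarrow> bool" where
  "good \<tau> \<longleftrightarrow> interval_exchange \<tau> \<and> code_rank \<tau> \<noteq> None"

lemma feasible_code_iff:
  assumes "fst \<tau> \<noteq> []" "snd \<tau> \<noteq> []" "side (\<not> s) \<tau> \<noteq> {}"
  shows "feasible_code s \<tau> = feasible s \<tau>"
  using assms by (cases s) (auto simp: feasible_code_def feasible_def side_def win_def Let_def)

lemma take_out_mem: "take_out j st = Some y \<Longrightarrow> j \<in> chain_ends st"
proof (induction st arbitrary: y)
  case (Cons e st)
  then show ?case by (cases e) (auto split: if_splits option.splits)
qed simp

text \<open>The condition is traced back from the empty system of chains, where it is vacuous,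
  through the gluings in reverse order.\<close>

lemma pair_up_all_triangular:
  assumes "pair_up_all ps st" "chain_system p st" "\<And>i j. (i, j) \<in> set ps \<Longrightarrow> i \<noteq> j \<and> p i = j \<and> p j = i"
  shows "triangular p st"
  using assms
proof (induction ps arbitrary: st)
  case Nil
  then show ?case by (simp add: triangular_def all_three_def)
next
  case (Cons e ps)
  obtain i j where e: "e = (i, j)" by (cases e)
  obtain st' where st': "pair_up i j st = Some st'" "pair_up_all ps st'"
    using Cons.prems(1) e by (auto split: option.splits)
  obtain st1 where st1: "bypass j i st = Some st1" "bypass i j st1 = Some st'"
    using st'(1) by (cases "bypass j i st") (auto simp: pair_up_def)
  have ij: "i \<noteq> j" "p i = j" "p j = i" using Cons.prems(3)[of i j] e by auto
  have j: "j \<in> chain_ends st"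
    using st1(1) take_out_mem[of j st] by (cases "take_out j st") (auto simp: bypass_def)
  have "i \<in> chain_ends st1"
    using st1(2) take_out_mem[of i st1] by (cases "take_out i st1") (auto simp: bypass_def)
  then have i: "i \<in> chain_ends st"
    using bypass_correct(2)[OF Cons.prems(2) j ij(2,3) st1(1)] by blast
  note c = pair_up_correct[OF Cons.prems(2) i j ij]
  have "triangular p st'" using Cons.IH[OF st'(2)] c(2)[OF st'(1)] Cons.prems(3) by (auto simp: e)
  then show ?case using c(1) st'(1) by blast
qed

lemma static_complete:
  assumes "static_check lt w"
  defines "\<sigma> \<equiv> decode lt w"
  shows "interval_exchange \<sigma>" "side s \<sigma> \<noteq> {}" "win True \<sigma> \<noteq> win False \<sigma>"
    "complete_exchange \<sigma>" "has_genus \<sigma> 2" "fst \<sigma> \<noteq> []" "snd \<sigma> \<noteq> []" "length (fst \<sigma>) = lt" "word_code \<sigma> = w"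
proof -
  have chk: "length w = 14" "word_code \<sigma> = w" "\<forall>e\<in>set w. count_list w e = 2"
    "\<exists>e\<in>set (fst \<sigma>). e \<notin> set (snd \<sigma>)" "\<exists>e\<in>set (snd \<sigma>). e \<notin> set (fst \<sigma>)"
    "last (fst \<sigma>) \<noteq> last (snd \<sigma>)" "pair_up_all (partners w) (start lt)"
    using assms(1) by (auto simp: static_check_def \<sigma>_def decode_def list_all_iff Let_def)
  have ends: "ends \<sigma> = w" by (simp add: ends_def \<sigma>_def decode_def)
  show ne: "fst \<sigma> \<noteq> []" "snd \<sigma> \<noteq> []" using chk(4,5) by auto
  have "lt < length w" using ne(2) by (auto simp: \<sigma>_def decode_def)
  then show lt: "length (fst \<sigma>) = lt" by (simp add: \<sigma>_def decode_def)
  show ie: "interval_exchange \<sigma>"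
    unfolding interval_exchange_def
    using chk(3) set_ends[of \<sigma>] count_ends[of \<sigma>] by (simp add: ends)
  show side: "side s \<sigma> \<noteq> {}" for s using chk(4,5) by (cases s) (auto simp: side_def)
  show "win True \<sigma> \<noteq> win False \<sigma>" using chk(6) by (simp add: win_def)
  show "word_code \<sigma> = w" by (rule chk(2))
  have n: "length (ends \<sigma>) = 14" by (simp add: ends chk(1))
  have "triangular (other_end \<sigma>) (start lt)"
  proof (rule pair_up_all_triangular[OF chk(7) chain_system_start[OF ie n]])
    fix i j assume "(i, j) \<in> set (partners w)"
    then obtain k where k: "k < 14" "i = w ! k" "j = gaps ! k" "i \<noteq> j"
      using chk(1) by (auto simp: partners_def set_zip gaps_eq)
    have jk: "j = k" using k(1,3) by (simp add: gaps_eq)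
    have "first_position w (w ! k) = w ! k"
      using arg_cong[OF chk(2), of "\<lambda>xs. xs ! k"] k(1) chk(1) by (simp add: word_code_def ends)
    then have "min k (other_end \<sigma> k) = w ! k"
      using first_position_nth[OF ie, of k] k(1) n by (simp add: ends)
    then have o: "other_end \<sigma> j = i" using k(2,4) jk by (auto simp: min_def split: if_splits)
    moreover have "other_end \<sigma> i = j"
      using other_end_involution[OF ie, of j] o k(1) jk n by auto
    ultimately show "i \<noteq> j \<and> other_end \<sigma> i = j \<and> other_end \<sigma> j = i" using k(4) by blast
  qed
  then have tri: "\<forall>R\<in>complementary_regions \<sigma>. card (ideal_vertices \<sigma> R) = 3"
    using triangular_start[OF ie n] lt by simp
  then show "complete_exchange \<sigma>"
    using ie recurrentI[OF ie] side by (simp add: complete_exchange_def)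
  show "has_genus \<sigma> 2"
    using count_regions[OF ie ne tri] length_ends_bands[OF ie] n by (simp add: has_genus_def capped_euler_char_def)
qed

definition base_exchange :: exchange where
  "base_exchange = ([1, 2, 3, 4, 2, 3, 4], [5, 6, 7, 5, 6, 7, 1])"

lemma base_code: "length (fst base_exchange) = 7" "word_code base_exchange = base_word"
  by (simp add: base_exchange_def) code_simp

lemma feasible_code_base: "feasible_code True (decode 7 base_word)"
  by code_simp

lemma dynamic_checkD:
  assumes "dynamic_check code_rank lt (w, d)"
  defines "\<sigma> \<equiv> decode lt w"
  shows "code_rank (prod.swap \<sigma>) \<noteq> None" "feasible_code s \<sigma> \<Longrightarrow> code_rank (move s \<sigma>) \<noteq> None"
    "d = 0 \<Longrightarrow> lt = 7 \<and> w = base_word"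
    "d \<noteq> 0 \<Longrightarrow> \<exists>s d'. feasible_code s \<sigma> \<and> code_rank (move s \<sigma>) = Some d' \<and> d' < d"
proof -
  define R where "R = (\<lambda>s. code_rank (move s \<sigma>)) ` {s. feasible_code s \<sigma>}"
  have R: "set (successor_ranks code_rank \<sigma>) = R"
  proof -
    have "{s \<in> set [True, False]. feasible_code s \<sigma>} = {s. feasible_code s \<sigma>}"
      by (rule Collect_cong) (metis (full_types) list.set_intros(1,2))
    then show ?thesis unfolding R_def successor_ranks_def set_map set_filter image_image by (rule arg_cong)
  qed
  have chk: "code_rank (prod.swap \<sigma>) \<noteq> None \<and> None \<notin> R \<and>
    (if d = 0 then lt = 7 \<and> w = base_word
     else \<exists>r\<in>R. smaller_rank d r)"
    using assms(1) unfolding dynamic_check.simps check_ranks_def list_ex_iff \<sigma>_def[symmetric] R .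
  show "code_rank (prod.swap \<sigma>) \<noteq> None" using chk by (rule conjunct1)
  show "code_rank (move s \<sigma>) \<noteq> None" if "feasible_code s \<sigma>"
    using conjunct1[OF conjunct2[OF chk]] that unfolding R_def by (metis imageI mem_Collect_eq)
  have c3: "if d = 0 then lt = 7 \<and> w = base_word
     else \<exists>r\<in>R. smaller_rank d r"
    using chk by (elim conjE)
  show "d = 0 \<Longrightarrow> lt = 7 \<and> w = base_word" using c3 by (simp only: if_True)
  show "\<exists>s d'. feasible_code s \<sigma> \<and> code_rank (move s \<sigma>) = Some d' \<and> d' < d" if "d \<noteq> 0"
  proof -
    have "\<exists>r\<in>R. smaller_rank d r" using c3 that by (simp only: if_False)
    then obtain s where "feasible_code s \<sigma>" "smaller_rank d (code_rank (move s \<sigma>))"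
      unfolding R_def by blast
    then show ?thesis by (cases "code_rank (move s \<sigma>)") (auto simp: smaller_rank_def)
  qed
qed

lemma good_code:
  assumes "good \<tau>"
  obtains lt w d g where "(w, d) \<in> set (codes lt)" "code_rank \<tau> = Some d" "lt = length (fst \<tau>)" "w = word_code \<tau>"
    "\<tau> = relabel g (decode lt w)" "inj_on g (bands (decode lt w))" "unequal_ends (decode lt w)"
    "static_check lt w" "dynamic_check code_rank lt (w, d)"
proof -
  obtain d where d: "code_rank \<tau> = Some d" using assms by (auto simp: good_def)
  define lt w where "lt = length (fst \<tau>)" and "w = word_code \<tau>"
  have ie: "interval_exchange \<tau>" using assms by (simp add: good_def)
  have mem: "(w, d) \<in> set (codes lt)" using d by (auto simp: code_rank_def lt_def w_def dest: map_of_SomeD)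
  have st: "static_check lt w" by (rule static_codes[OF mem])
  have dy: "dynamic_check code_rank lt (w, d)" by (rule dynamic_codes[OF mem])
  note sc = static_complete[OF st]
  \<comment> \<open>A feasible move excludes the last case in \<open>unequal_ends\<close>, where
    neither competitor can win. At positive rank the move that lowers the rank is at hand; rank 0
    leaves only the base word.\<close>
  have "\<exists>s. feasible_code s (decode lt w)"
  proof (cases "d = 0")
    case True
    then have "lt = 7 \<and> w = base_word" by (rule dynamic_checkD(3)[OF dy])
    then show ?thesis using feasible_code_base by blast
  next
    case False
    then show ?thesis using dynamic_checkD(4)[OF dy] by blast
  qed
  then obtain s where "feasible s (decode lt w)" using feasible_code_iff sc(2,6,7) by blast
  then have "unequal_ends (decode lt w)"
    using sc(1,3) sc(2)[of True] sc(2)[of False] by (cases s) (auto simp: unequal_ends_def feasible_def)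
  then show ?thesis
    by (rule that[OF mem d lt_def w_def relabel_decode[OF ie, folded lt_def w_def] _ st dy])
qed

lemma good_unequal_ends: "good \<tau> \<Longrightarrow> unequal_ends \<tau>"
  by (erule good_code) (metis unequal_ends_relabel)

lemma good_relabel: "good \<tau> \<Longrightarrow> inj_on f (bands \<tau>) \<Longrightarrow> good (relabel f \<tau>)"
  by (simp add: good_def interval_exchange_relabel code_rank_relabel)

lemma good_step:
  assumes "good \<tau>"
  shows "feasible s \<tau> \<Longrightarrow> good (move s \<tau>)" "good (prod.swap \<tau>)"
    "code_rank \<tau> = Some 0 \<Longrightarrow> length (fst \<tau>) = 7 \<and> word_code \<tau> = base_word"
    "code_rank \<tau> = Some d \<Longrightarrow> 0 < d \<Longrightarrow> \<exists>s d'. feasible s \<tau> \<and> code_rank (move s \<tau>) = Some d' \<and> d' < d"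
proof -
  obtain lt w d0 g where c: "(w, d0) \<in> set (codes lt)" "code_rank \<tau> = Some d0" "lt = length (fst \<tau>)" "w = word_code \<tau>"
    "\<tau> = relabel g (decode lt w)" "inj_on g (bands (decode lt w))" "unequal_ends (decode lt w)"
    "static_check lt w" "dynamic_check code_rank lt (w, d0)"
    by (rule good_code[OF assms])
  define \<sigma> where "\<sigma> = decode lt w"
  note sc = static_complete[OF c(8), folded \<sigma>_def]
  note \<sigma> = c(5-7)[folded \<sigma>_def]
  have fc: "feasible_code s \<sigma> = feasible s \<tau>" for s
    using feasible_code_iff[OF sc(6,7) sc(2)] feasible_relabel[OF \<sigma>(2,3)] \<sigma>(1) by metis
  have rk: "code_rank (move s \<tau>) = code_rank (move s \<sigma>)" for s
    unfolding \<sigma>(1) move_relabel[OF \<sigma>(2,3)] using \<sigma> by (intro code_rank_relabel) simp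
  note dy = dynamic_checkD[OF c(9), folded \<sigma>_def, unfolded fc, folded rk]
  have u: "unequal_ends \<tau>" by (rule good_unequal_ends[OF assms])
  show "good (move s \<tau>)" if "feasible s \<tau>"
    using dy(2)[OF that] interval_exchange_move[OF u] by (simp add: good_def)
  have "code_rank (prod.swap \<tau>) = code_rank (prod.swap \<sigma>)"
    unfolding \<sigma>(1) relabel_simps(6)[symmetric] using \<sigma>(2) by (intro code_rank_relabel) simp
  then show "good (prod.swap \<tau>)" using dy(1) assms by (simp add: good_def)
  show "code_rank \<tau> = Some 0 \<Longrightarrow> length (fst \<tau>) = 7 \<and> word_code \<tau> = base_word"
    using dy(3) c(2-4) by simp
  show "code_rank \<tau> = Some d \<Longrightarrow> 0 < d \<Longrightarrow> \<exists>s d'. feasible s \<tau> \<and> code_rank (move s \<tau>) = Some d' \<and> d' < d"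
    using dy(4) c(2) by simp
qed

lemma good_iso_class:
  assumes "good \<tau>" "\<tau>' \<in> iso_class \<tau>"
  shows "good \<tau>'"
  using iso_class_mem(4)[OF assms(2)] good_relabel[OF assms(1)] good_step(2) by blast

text \<open>One inclusion is the completeness of the tables, the other one their soundness.\<close>

lemma genus2_classes_eq: "genus2_classes = iso_class ` {\<tau>. good \<tau>}"
proof (intro equalityI subsetI)
  fix C assume "C \<in> genus2_classes"
  then obtain \<tau> where \<tau>: "complete_exchange \<tau>" "has_genus \<tau> 2" "C = iso_class \<tau>"
    by (auto simp: genus2_classes_def quotient_def iso_class_def)
  then have "good \<tau>" using code_rank_complete_genus2 by (auto simp: good_def complete_exchange_def)
  then show "C \<in> iso_class ` {\<tau>. good \<tau>}" using \<tau>(3) by blast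
next
  fix C assume "C \<in> iso_class ` {\<tau>. good \<tau>}"
  then obtain \<tau> where \<tau>: "good \<tau>" "C = iso_class \<tau>" by blast
  obtain lt w d g where c: "\<tau> = relabel g (decode lt w)" "inj_on g (bands (decode lt w))" "static_check lt w"
    using good_code[OF \<tau>(1)] by metis
  note sc = static_complete[OF c(3)]
  have "C = iso_class (decode lt w)" using \<tau>(2) c(1,2) iso_class_relabel[OF sc(1)] by simp
  then show "C \<in> genus2_classes"
    using sc(4,5) quotientI[of "decode lt w" "{\<tau>. complete_exchange \<tau> \<and> has_genus \<tau> 2}" isomorphic_exchanges]
    by (simp only: genus2_classes_def iso_class_def mem_Collect_eq simp_thms)
qed

lemma finite_genus2_classes: "finite genus2_classes"
proof -
  have "genus2_classes \<subseteq> (\<lambda>(lt, w). iso_class (decode lt w)) ` (\<Union>lt\<in>{3, 4, 5, 6, 7, 8, 9, 10, 11}. Pair lt ` fst ` set (codes lt))"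
  proof
    fix C assume "C \<in> genus2_classes"
    then obtain \<tau> where \<tau>: "good \<tau>" "C = iso_class \<tau>" by (auto simp: genus2_classes_eq)
    obtain lt w d g where c: "(w, d) \<in> set (codes lt)" "\<tau> = relabel g (decode lt w)"
      "inj_on g (bands (decode lt w))" "static_check lt w"
      using good_code[OF \<tau>(1)] by metis
    have "C = iso_class (decode lt w)" using \<tau>(2) c(2,3) iso_class_relabel[OF static_complete(1)[OF c(4)]] by simp
    moreover have "lt \<in> {3, 4, 5, 6, 7, 8, 9, 10, 11}" using c(1) by (intro codes_range) auto
    moreover have "w \<in> fst ` set (codes lt)" using c(1) by force
    ultimately show "C \<in> (\<lambda>(lt, w). iso_class (decode lt w)) ` (\<Union>lt\<in>{3, 4, 5, 6, 7, 8, 9, 10, 11}. Pair lt ` fst ` set (codes lt))"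
      by (intro image_eqI[of _ _ "(lt, w)"]) auto
  qed
  then show ?thesis by (rule finite_subset) auto
qed

text \<open>An edge may be realised by any representatives of the two classes. Moves commute with
  relabelling and, up to exchanging the sides, with the interchange of top and bottom, so all edges
  leaving a class are visible at one representative.\<close>

lemma splits_to_good:
  assumes \<tau>: "good \<tau>"
  shows "splits_to (iso_class \<tau>) C \<and> C \<in> genus2_classes \<longleftrightarrow> (\<exists>s. feasible s \<tau> \<and> C = iso_class (move s \<tau>))"
proof
  assume "\<exists>s. feasible s \<tau> \<and> C = iso_class (move s \<tau>)"
  then obtain s where s: "feasible s \<tau>" "C = iso_class (move s \<tau>)" by blast
  have g: "good (move s \<tau>)" by (rule good_step(1)[OF \<tau> s(1)])
  have ie: "interval_exchange \<tau>" "interval_exchange (move s \<tau>)" using \<tau> g by (auto simp: good_def)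
  obtain w where w: "w \<in> weights \<tau>" "w (lose s \<tau>) < w (win s \<tau>)"
    using feasible_obtain[OF good_unequal_ends[OF \<tau>] s(1)] by blast
  then have "split_step (\<tau>, w) = Some (move s \<tau>, split_weight s \<tau> w)" by (cases s) (auto simp: split_step_eq)
  then have "splits_to (iso_class \<tau>) C"
    unfolding splits_to_def s(2) using w(1) iso_class_self[OF ie(1)] iso_class_self[OF ie(2)] by blast
  then show "splits_to (iso_class \<tau>) C \<and> C \<in> genus2_classes" using g s(2) by (auto simp: genus2_classes_eq)
next
  assume a: "splits_to (iso_class \<tau>) C \<and> C \<in> genus2_classes"
  then obtain \<tau>1 w \<tau>1' w' where t: "\<tau>1 \<in> iso_class \<tau>" "w \<in> weights \<tau>1" "\<tau>1' \<in> C" "split_step (\<tau>1, w) = Some (\<tau>1', w')"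
    unfolding splits_to_def by blast
  obtain s where s: "w (lose s \<tau>1) < w (win s \<tau>1)" "\<tau>1' = move s \<tau>1"
  proof (cases "w (win False \<tau>1) < w (win True \<tau>1)")
    case True then show ?thesis using that[of True] t(4) by (auto simp: split_step_eq)
  next
    case False then show ?thesis using that[of False] t(4) by (auto simp: split_step_eq split: if_splits)
  qed
  have ie: "interval_exchange \<tau>" "interval_exchange \<tau>1" using iso_class_mem[OF t(1)] by auto
  have f1: "feasible s \<tau>1" by (rule feasible_if_greater[OF ie(2) t(2) s(1)])
  have u: "unequal_ends \<tau>" by (rule good_unequal_ends[OF \<tau>])
  obtain f where f: "inj_on f (bands \<tau>)" "\<tau>1 = relabel f \<tau> \<or> \<tau>1 = prod.swap (relabel f \<tau>)"
    using iso_class_mem(4)[OF t(1)] by blast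
  obtain C' \<tau>2 where C: "C = iso_class \<tau>2" "good \<tau>2" using a by (auto simp: genus2_classes_eq)
  have Ceq: "C = iso_class \<tau>1'" using iso_class_mem(3)[of \<tau>1' \<tau>2] t(3) C(1) by simp
  have ex: "\<exists>r. feasible r \<tau> \<and> (\<tau>1' = relabel f (move r \<tau>) \<or> \<tau>1' = prod.swap (relabel f (move r \<tau>)))"
    using f(2)
  proof
    assume e: "\<tau>1 = relabel f \<tau>"
    then show ?thesis using f1 s(2) feasible_relabel[OF f(1) u] move_relabel[OF f(1) u] by (intro exI[of _ s]) simp
  next
    assume e: "\<tau>1 = prod.swap (relabel f \<tau>)"
    then show ?thesis using f1 s(2) feasible_relabel[OF f(1) u] move_relabel[OF f(1) u] by (intro exI[of _ "\<not> s"]) simp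
  qed
  then obtain r where r: "feasible r \<tau>" "\<tau>1' = relabel f (move r \<tau>) \<or> \<tau>1' = prod.swap (relabel f (move r \<tau>))" by blast
  have ie': "interval_exchange (move r \<tau>)" using interval_exchange_move[OF u] .
  have fi: "inj_on f (bands (move r \<tau>))" using f(1) u by simp
  have "(move r \<tau>, \<tau>1') \<in> isomorphic_exchanges"
    using r(2) ie' fi interval_exchange_relabel[OF fi ie'] by (auto simp: isomorphic_exchanges_def)
  then have "iso_class (move r \<tau>) = C"
    unfolding Ceq by (subst iso_class_eq_iff) (auto simp: isomorphic_exchanges_def)
  then show "\<exists>s. feasible s \<tau> \<and> C = iso_class (move s \<tau>)" using r(1) by blast
qed

section \<open>Paths to the base exchange\<close>

lemma path_relabel:
  assumes "good \<tau>" "inj_on f (bands \<tau>)" "feasible_path \<tau> ss"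
  shows "feasible_path (relabel f \<tau>) ss \<and> competitors (relabel f \<tau>) ss = f ` competitors \<tau> ss"
  using assms
proof (induction ss arbitrary: \<tau>)
  case (Cons s ss)
  note f = Cons.prems(2) and u = good_unequal_ends[OF Cons.prems(1)]
  have s: "feasible s \<tau>" "feasible_path (move s \<tau>) ss" using Cons.prems(3) by auto
  have "inj_on f (bands (move s \<tau>))" using f u by simp
  then have "feasible_path (relabel f (move s \<tau>)) ss \<and> competitors (relabel f (move s \<tau>)) ss = f ` competitors (move s \<tau>) ss"
    using s(2) good_step(1)[OF Cons.prems(1) s(1)] by (intro Cons.IH)
  then show ?case
    using s unequal_ends_nonempty[OF u] by (simp add: feasible_relabel[OF f u] move_relabel[OF f u] win_relabel)
qed simp

fun finish :: "exchange \<Rightarrow> bool list \<Rightarrow> exchange" where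
  "finish \<tau> [] = \<tau>"
| "finish \<tau> (s # ss) = finish (move s \<tau>) ss"

lemma path_append:
  "feasible_path \<tau> (ss @ ss') \<longleftrightarrow> feasible_path \<tau> ss \<and> feasible_path (finish \<tau> ss) ss'"
  "competitors \<tau> (ss @ ss') = competitors \<tau> ss \<union> competitors (finish \<tau> ss) ss'"
  by (induction ss arbitrary: \<tau>) auto

lemma good_finish: "good \<tau> \<Longrightarrow> feasible_path \<tau> ss \<Longrightarrow> good (finish \<tau> ss) \<and> bands (finish \<tau> ss) = bands \<tau>"
proof (induction ss arbitrary: \<tau>)
  case (Cons s ss)
  have "good (move s \<tau>)" using Cons.prems good_step(1) by auto
  then show ?case using Cons.IH[of "move s \<tau>"] Cons.prems bands_move[OF good_unequal_ends[OF Cons.prems(1)]] by simp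
qed simp

lemma competitors_subset: "good \<tau> \<Longrightarrow> feasible_path \<tau> ss \<Longrightarrow> competitors \<tau> ss \<subseteq> bands \<tau>"
proof (induction ss arbitrary: \<tau>)
  case (Cons s ss)
  have u: "unequal_ends \<tau>" by (rule good_unequal_ends[OF Cons.prems(1)])
  have "good (move s \<tau>)" using Cons.prems good_step(1) by auto
  then show ?case using Cons.IH[of "move s \<tau>"] Cons.prems bands_move[OF u] win_in_bands[OF u] by simp
qed simp

lemma good_base: "good base_exchange"
proof -
  have "interval_exchange base_exchange" by (simp add: interval_exchange_def base_exchange_def bands_def)
  moreover have "code_rank base_exchange \<noteq> None"
    unfolding code_rank_def base_code by code_simp
  ultimately show ?thesis by (simp add: good_def)
qed

text \<open>Descent on the rank. At rank 0 the code is that of \<open>base_exchange\<close>, and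
  both exchanges are relabellings of the same decoded word.\<close>

lemma path_to_base:
  assumes "good \<tau>"
  obtains ss f where "feasible_path \<tau> ss" "finish \<tau> ss = relabel f base_exchange" "inj_on f (bands base_exchange)"
proof -
  obtain d where "code_rank \<tau> = Some d" using assms by (auto simp: good_def)
  then have "\<exists>ss f. feasible_path \<tau> ss \<and> finish \<tau> ss = relabel f base_exchange \<and> inj_on f (bands base_exchange)"
    using assms
  proof (induction d arbitrary: \<tau> rule: less_induct)
    case (less d)
    show ?case
    proof (cases "d = 0")
      case True
      then have "length (fst \<tau>) = 7 \<and> word_code \<tau> = base_word"
        using good_step(3)[OF less.prems(2)] less.prems(1) by simp
      then have c: "length (fst \<tau>) = length (fst base_exchange)" "word_code \<tau> = word_code base_exchange"
        using base_code by simp_all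
      define \<sigma> where "\<sigma> = decode (length (fst base_exchange)) (word_code base_exchange)"
      have ie: "interval_exchange \<tau>" "interval_exchange base_exchange"
        using less.prems(2) good_base by (auto simp: good_def)
      obtain g where g: "\<tau> = relabel g \<sigma>" "inj_on g (bands \<sigma>)"
        using relabel_decode[OF ie(1)] unfolding c \<sigma>_def[symmetric] by blast
      obtain h where h: "base_exchange = relabel h \<sigma>" "inj_on h (bands \<sigma>)"
        using relabel_decode[OF ie(2)] unfolding \<sigma>_def[symmetric] by blast
      define k where "k = inv_into (bands \<sigma>) h"
      have b: "bands base_exchange = h ` bands \<sigma>" using h(1) by (metis relabel_simps(3))
      have "relabel (g \<circ> k \<circ> h) \<sigma> = relabel g \<sigma>"
        using h(2) by (intro relabel_cong) (simp add: k_def)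
      then have "relabel (g \<circ> k) base_exchange = \<tau>" using g(1) h(1) by (metis relabel_simps(5))
      moreover have "inj_on (g \<circ> k) (bands base_exchange)"
        unfolding b using h(2) g(2) by (intro comp_inj_on) (simp_all add: k_def inj_on_inv_into)
      ultimately show ?thesis
        by (intro exI[of _ "[]"] exI[of _ "g \<circ> k"]) (simp only: feasible_path.simps finish.simps simp_thms)
    next
      case False
      then obtain s d' where s: "feasible s \<tau>" "code_rank (move s \<tau>) = Some d'" "d' < d"
        using good_step(4)[OF less.prems(2,1)] by auto
      then obtain ss f where "feasible_path (move s \<tau>) ss" "finish (move s \<tau>) ss = relabel f base_exchange"
        "inj_on f (bands base_exchange)"
        using less.IH[OF s(3,2) good_step(1)[OF less.prems(2) s(1)]] by blast
      then show ?thesis using s(1) by (intro exI[of _ "s # ss"] exI[of _ f]) simp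
    qed
  qed
  then show ?thesis using that by blast
qed

text \<open>Band 4 beats 1, 7 and 6 from the top; then 5 beats 4, 3 and 2 from the bottom.\<close>

lemma base_path:
  "feasible_path base_exchange [True, True, True, False, False, False]"
  "competitors base_exchange [True, True, True, False, False, False] = bands base_exchange"
  by code_simp+

lemma all_bands_compete:
  assumes "good \<tau>"
  shows "\<exists>ss. feasible_path \<tau> ss \<and> competitors \<tau> ss = bands \<tau>"
proof -
  obtain ss f where p: "feasible_path \<tau> ss" "finish \<tau> ss = relabel f base_exchange" "inj_on f (bands base_exchange)"
    using path_to_base[OF assms] by blast
  define q where "q = [True, True, True, False, False, False]"
  have q: "feasible_path (finish \<tau> ss) q" "competitors (finish \<tau> ss) q = bands (finish \<tau> ss)"
    using path_relabel[OF good_base p(3) base_path(1)] base_path(2) unfolding p(2) q_def[symmetric] by simp_all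
  have b: "bands (finish \<tau> ss) = bands \<tau>" using good_finish[OF assms p(1)] by blast
  have f: "feasible_path \<tau> (ss @ q)" using p(1) q(1) by (simp add: path_append)
  moreover have "bands \<tau> \<subseteq> competitors \<tau> (ss @ q)" using q(2) b by (simp add: path_append)
  ultimately show ?thesis using competitors_subset[OF assms f] by blast
qed

lemma iso_class_finish_base:
  assumes "good \<tau>" "finish \<tau> ss = relabel f base_exchange" "inj_on f (bands base_exchange)"
  shows "iso_class (finish \<tau> ss) = iso_class base_exchange"
  using assms good_base iso_class_relabel by (simp add: good_def)

section \<open>The splitting graph, its sink and normality\<close>

lemma path_graph:
  assumes "good \<tau>" "feasible_path \<tau> ss"
  shows "(iso_class \<tau>, iso_class (finish \<tau> ss)) \<in> splitting_graph\<^sup>*"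
  using assms
proof (induction ss arbitrary: \<tau>)
  case (Cons s ss)
  have s: "feasible s \<tau>" "feasible_path (move s \<tau>) ss" using Cons.prems by auto
  have g: "good (move s \<tau>)" by (rule good_step(1)[OF Cons.prems(1) s(1)])
  have "(iso_class \<tau>, iso_class (move s \<tau>)) \<in> splitting_graph"
    using splits_to_good[OF Cons.prems(1), of "iso_class (move s \<tau>)"] s(1) Cons.prems(1)
    by (auto simp: splitting_graph_def genus2_classes_eq)
  moreover have "(iso_class (move s \<tau>), iso_class (finish (move s \<tau>) ss)) \<in> splitting_graph\<^sup>*"
    by (rule Cons.IH[OF g s(2)])
  ultimately show ?case by simp
qed simp

lemma graph_path:
  assumes "(iso_class \<tau>, C) \<in> splitting_graph\<^sup>*" "good \<tau>"
  shows "\<exists>ss. feasible_path \<tau> ss \<and> iso_class (finish \<tau> ss) = C"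
  using assms
proof (induction "iso_class \<tau>" arbitrary: \<tau> rule: converse_rtrancl_induct)
  case base
  then show ?case by (intro exI[of _ "[]"]) simp
next
  case (step D)
  have "splits_to (iso_class \<tau>) D \<and> D \<in> genus2_classes" using step.hyps(1) by (simp add: splitting_graph_def)
  then obtain s where s: "feasible s \<tau>" "D = iso_class (move s \<tau>)" using splits_to_good[OF step.prems] by blast
  obtain ss where "feasible_path (move s \<tau>) ss" "iso_class (finish (move s \<tau>) ss) = C"
    using step.hyps(3)[OF s(2) good_step(1)[OF step.prems s(1)]] by blast
  then show ?case using s(1) by (intro exI[of _ "s # ss"]) simp
qed

text \<open>Every class reaches that of \<open>base_exchange\<close>, so whatever is reachable from
  there is reachable from everywhere.\<close>

lemma genus2_sink_eq: "genus2_sink = {C. (iso_class base_exchange, C) \<in> splitting_graph\<^sup>*}"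
proof (intro equalityI subsetI)
  fix C assume "C \<in> genus2_sink"
  moreover have "iso_class base_exchange \<in> genus2_classes"
    unfolding genus2_classes_eq using good_base by blast
  ultimately show "C \<in> {C. (iso_class base_exchange, C) \<in> splitting_graph\<^sup>*}"
    unfolding genus2_sink_def by blast
next
  fix C assume "C \<in> {C. (iso_class base_exchange, C) \<in> splitting_graph\<^sup>*}"
  then have C: "(iso_class base_exchange, C) \<in> splitting_graph\<^sup>*" by simp
  have "iso_class base_exchange \<in> genus2_classes"
    unfolding genus2_classes_eq using good_base by blast
  with C have "C \<in> genus2_classes"
    by (induction rule: rtrancl_induct) (simp_all add: splitting_graph_def)
  moreover have "(D, C) \<in> splitting_graph\<^sup>*" if D: "D \<in> genus2_classes" for D
  proof -
    obtain \<tau> where \<tau>: "good \<tau>" "D = iso_class \<tau>" using D unfolding genus2_classes_eq by blast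
    obtain ss f where p: "feasible_path \<tau> ss" "finish \<tau> ss = relabel f base_exchange" "inj_on f (bands base_exchange)"
      using path_to_base[OF \<tau>(1)] by blast
    have "(D, iso_class base_exchange) \<in> splitting_graph\<^sup>*"
      using path_graph[OF \<tau>(1) p(1)] iso_class_finish_base[OF \<tau>(1) p(2,3)] \<tau>(2) by simp
    then show ?thesis using C by (rule rtrancl_trans)
  qed
  ultimately show "C \<in> genus2_sink" by (simp add: genus2_sink_def)
qed

lemma classes_append: "drop (length ss) (classes \<tau> (ss @ ss')) = classes (finish \<tau> ss) ss'"
  by (induction ss arbitrary: \<tau>) auto

text \<open>Lifts a sequence of classes to moves starting at a prescribed representative, edge by
  edge by means of \<open>splits_to_good\<close>.\<close>

lemma classes_follow:
  assumes "\<sigma>s \<noteq> []" "hd \<sigma>s = iso_class \<tau>" "set \<sigma>s \<subseteq> genus2_classes" "successively splits_to \<sigma>s" "good \<tau>"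
  shows "\<exists>ss. feasible_path \<tau> ss \<and> classes \<tau> ss = \<sigma>s"
  using assms
proof (induction \<sigma>s arbitrary: \<tau>)
  case (Cons C \<sigma>s)
  show ?case
  proof (cases \<sigma>s)
    case Nil
    then show ?thesis using Cons.prems(2) by (intro exI[of _ "[]"]) simp
  next
    case (Cons D Ds)
    have "splits_to (iso_class \<tau>) D \<and> D \<in> genus2_classes"
      using Cons.prems(2-4) Cons by simp
    then obtain s where s: "feasible s \<tau>" "D = iso_class (move s \<tau>)"
      using splits_to_good[OF Cons.prems(5)] by blast
    have "\<exists>ss. feasible_path (move s \<tau>) ss \<and> classes (move s \<tau>) ss = \<sigma>s"
      using Cons.prems(3,4) Cons s(2) good_step(1)[OF Cons.prems(5) s(1)] by (intro Cons.IH) (simp_all)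
    then obtain ss where "feasible_path (move s \<tau>) ss" "classes (move s \<tau>) ss = \<sigma>s" by blast
    then show ?thesis using s(1) Cons.prems(2) by (intro exI[of _ "s # ss"]) simp
  qed
qed simp

lemma genus2_sink_move:
  assumes "good \<tau>" "iso_class \<tau> \<in> genus2_sink" "feasible s \<tau>"
  shows "iso_class (move s \<tau>) \<in> genus2_sink"
proof -
  have "(iso_class \<tau>, iso_class (move s \<tau>)) \<in> splitting_graph\<^sup>*"
    using path_graph[OF assms(1), of "[s]"] assms(3) by simp
  then show ?thesis using assms(2) unfolding genus2_sink_eq by (auto intro: rtrancl_trans)
qed

lemma genus2_sink_mem:
  assumes "C \<in> genus2_sink" "\<tau> \<in> C"
  shows "good \<tau>" "iso_class \<tau> = C"
proof -
  obtain \<sigma> where \<sigma>: "good \<sigma>" "C = iso_class \<sigma>"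
    using assms(1) unfolding genus2_sink_def genus2_classes_eq by blast
  show "good \<tau>" using good_iso_class[OF \<sigma>(1)] assms(2) \<sigma>(2) by blast
  show "iso_class \<tau> = C" using iso_class_mem(3) assms(2) \<sigma>(2) by blast
qed

lemma splitting_system_sink:
  assumes \<tau>: "good \<tau>" "iso_class \<tau> \<in> genus2_sink"
  shows "splitting_system (bands \<tau>) {\<tau>'. bands \<tau>' = bands \<tau> \<and> good \<tau>' \<and> iso_class \<tau>' \<in> genus2_sink}"
    (is "splitting_system _ ?X")
proof
  let ?n = "2 * card (bands \<tau>)"
  have "?X \<subseteq> {xs. set xs \<subseteq> bands \<tau> \<and> length xs \<le> ?n} \<times> {xs. set xs \<subseteq> bands \<tau> \<and> length xs \<le> ?n}"
  proof
    fix \<tau>' assume a: "\<tau>' \<in> ?X"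
    then have "length (ends \<tau>') = ?n" using length_ends_bands[of \<tau>'] by (simp add: good_def)
    then show "\<tau>' \<in> {xs. set xs \<subseteq> bands \<tau> \<and> length xs \<le> ?n} \<times> {xs. set xs \<subseteq> bands \<tau> \<and> length xs \<le> ?n}"
      using a set_word_bands[of \<tau>'] by (cases \<tau>') (simp add: ends_def)
  qed
  then show "finite ?X" by (rule finite_subset) (intro finite_cartesian_product finite_lists_length_le finite_bands)
  show "?X \<noteq> {}" using \<tau> by blast
  fix \<tau>' assume a: "\<tau>' \<in> ?X"
  then have g: "good \<tau>'" "bands \<tau>' = bands \<tau>" by blast+
  show u: "unequal_ends \<tau>'" by (rule good_unequal_ends[OF g(1)])
  show "bands \<tau>' = bands \<tau>" by (rule g(2))
  show "\<exists>ss. feasible_path \<tau>' ss \<and> competitors \<tau>' ss = bands \<tau>"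
    using all_bands_compete[OF g(1)] unfolding g(2) .
  show "move s \<tau>' \<in> ?X" if "feasible s \<tau>'" for s
    using a good_step(1)[OF g(1) that] genus2_sink_move[OF g(1) _ that] bands_move[OF u] by simp
qed

text \<open>From every exchange in the sink there is a path that first leads to the class
  \<open>hd \<sigma>s\<close> and then runs through the block; these are the paths that
  \<open>AE_occurs_infinitely_often\<close> requires.\<close>

lemma AE_splitting_sequence:
  assumes \<tau>: "good \<tau>" "iso_class \<tau> \<in> genus2_sink"
    and \<sigma>s: "\<sigma>s \<noteq> []" "set \<sigma>s \<subseteq> genus2_sink" "successively splits_to \<sigma>s"
  shows "AE w in lebesgue_weights \<tau>.
    infinite {k. \<forall>i<length \<sigma>s. splitting_sequence \<tau> w (k + i) = Some (\<sigma>s ! i)}"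
proof -
  let ?X = "{\<tau>'. bands \<tau>' = bands \<tau> \<and> good \<tau>' \<and> iso_class \<tau>' \<in> genus2_sink}"
  have "\<exists>ss m. feasible_path \<tau>' ss \<and> drop m (classes \<tau>' ss) = \<sigma>s" if "\<tau>' \<in> ?X" for \<tau>'
  proof -
    have g: "good \<tau>'" using that by blast
    have "hd \<sigma>s \<in> genus2_sink" using \<sigma>s(1,2) by auto
    moreover have "iso_class \<tau>' \<in> genus2_classes" unfolding genus2_classes_eq using g by blast
    ultimately have "(iso_class \<tau>', hd \<sigma>s) \<in> splitting_graph\<^sup>*" unfolding genus2_sink_def by blast
    then obtain ss where ss: "feasible_path \<tau>' ss" "iso_class (finish \<tau>' ss) = hd \<sigma>s"
      using graph_path[OF _ g] by blast
    have "set \<sigma>s \<subseteq> genus2_classes" using \<sigma>s(2) unfolding genus2_sink_def by blast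
    then obtain ss' where "feasible_path (finish \<tau>' ss) ss'" "classes (finish \<tau>' ss) ss' = \<sigma>s"
      using classes_follow[OF \<sigma>s(1) ss(2)[symmetric] _ \<sigma>s(3)] good_finish[OF g ss(1)] by blast
    then show ?thesis
      using ss(1) by (intro exI[of _ "ss @ ss'"] exI[of _ "length ss"]) (simp add: path_append classes_append)
  qed
  moreover have "\<tau> \<in> ?X" using \<tau> by blast
  ultimately show ?thesis
    using splitting_system.AE_occurs_infinitely_often[OF splitting_system_sink[OF \<tau>], of \<sigma>s \<tau>]
    unfolding occurs_def by blast
qed

theorem theorem10p4:
  fixes rep :: "exchange set \<Rightarrow> exchange"
  assumes rep: "\<And>C. C \<in> genus2_sink \<Longrightarrow> rep C \<in> C"
  shows "finite genus2_classes \<and>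
    iso_class ([1, 2, 3, 4, 2, 3, 4], [5, 6, 7, 5, 6, 7, 1]) \<in> genus2_sink \<and>
    (\<forall>\<sigma>s. \<sigma>s \<noteq> [] \<and> set \<sigma>s \<subseteq> genus2_sink \<and> successively splits_to \<sigma>s \<longrightarrow>
      (AE (C, w) in X_S rep.
        infinite {k. \<forall>i<length \<sigma>s. splitting_sequence (rep C) w (k + i) = Some (\<sigma>s ! i)}))"
proof (intro conjI allI impI)
  show "finite genus2_classes" by (rule finite_genus2_classes)
  show "iso_class ([1, 2, 3, 4, 2, 3, 4], [5, 6, 7, 5, 6, 7, 1]) \<in> genus2_sink"
    unfolding base_exchange_def[symmetric] genus2_sink_eq by simp
next
  fix \<sigma>s assume \<sigma>s: "\<sigma>s \<noteq> [] \<and> set \<sigma>s \<subseteq> genus2_sink \<and> successively splits_to \<sigma>s"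
  show "AE (C, w) in X_S rep.
    infinite {k. \<forall>i<length \<sigma>s. splitting_sequence (rep C) w (k + i) = Some (\<sigma>s ! i)}"
    unfolding X_S_def AE_coproduct_measure prod.case
  proof
    fix C assume C: "C \<in> genus2_sink"
    show "AE w in lebesgue_weights (rep C).
      infinite {k. \<forall>i<length \<sigma>s. splitting_sequence (rep C) w (k + i) = Some (\<sigma>s ! i)}"
      using \<sigma>s genus2_sink_mem[OF C rep[OF C]] C by (intro AE_splitting_sequence) simp_all
  qed
qed

end
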